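(* Let $\Phi$ satisfy Assumption (A), $\omega\in A^{\mathrm{loc}}_{\infty}(\mathbb{R}^n)$, $q_\omega$ its critical index, $q\in(q_\omega,\infty)$ and let the integer $N\ge N_{\Phi,\omega}$. Then $h^\Phi_{\omega,N}(\mathbb{R}^n)\cap L^q_\omega(\mathbb{R}^n)$ is dense in $h^\Phi_{\omega,N}(\mathbb{R}^n)$.
   Context: Cubes are closed with sides parallel to the axes; $\omega(E)=\int_E\omega\,dx$; $\mathbb{Z}_+=\{0,1,2,\dots\}$; $\lfloor r\rfloor$ is the largest integer not exceeding $r$. Weights. For $p\in(1,\infty)$, $A^{\mathrm{loc}}_p(\mathbb{R}^n)$ is the set of nonnegative locally integrable $\omega$ with $\sup_{|Q|\le1}|Q|^{-p}\int_Q\omega\,dx\,(\int_Q\omega^{-p'/p}dx)^{p/p'}<\infty$ ($1/p+1/p'=1$); $A^{\mathrm{loc}}_1$: $\sup_{|Q|\le1}|Q|^{-1}\int_Q\omega\,dx\cdot\mathrm{ess\,sup}_Q\,\omega^{-1}<\infty$; $A^{\mathrm{loc}}_\infty$: for every $\alpha\in(0,1)$, $\sup_{|Q|\le1}\sup\{\omega(Q)/\omega(F):F\subset Q\text{ measurable},|F|\ge\alpha|Q|\}<\infty$. $q_\omega=\inf\{p\in[1,\infty):\omega\in A^{\mathrm{loc}}_p\}$. $\|g\|_{L^q_\omega}=(\int|g|^q\omega)^{1/q}$. Assumption (A) on $\Phi:(0,\infty)\to(0,\infty)$: $\Phi$ is continuous, strictly increasing, subadditive, concave, and of strictly lower type (for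 some $p>0$, $\Phi(st)\le t^p\Phi(s)$ for all $t\in(0,1)$, $s>0$), with $p_\Phi=\sup\{p>0:\Phi(st)\le t^p\Phi(s)\ \forall t\in(0,1),s>0\}\in(0,1]$. $\Phi(0)=0$. $L^\Phi_\omega$ is the set of measurable $g$ with $\int\Phi(|g|)\omega<\infty$; $\|g\|_{L^\Phi_\omega}=\inf\{\lambda>0:\int\Phi(|g|/\lambda)\omega\,dx\le1\}$. Hardy space. $\mathcal{D}=C_c^\infty(\mathbb{R}^n)$, $\mathcal{D}'$ its dual; $\psi_t(x)=t^{-n}\psi(x/t)$. $\mathcal{G}_N(f)(x)=\sup|\psi_t*f(x)|$ over $t\in(0,1)$ and $\psi\in\mathcal{D}$ with $\mathrm{supp}\,\psi\subset B(0,2^{3(10+n)})$ and $\sup_x\sup_{|\alpha|\le N}|\partial^\alpha\psi(x)|\le1$. For integer $N\ge\widetilde N_{\Phi,\omega}:=\lfloor n(q_\omega/p_\Phi-1)\rfloor+2$, $h^\Phi_{\omega,N}=\{f\in\mathcal{D}':\mathcal{G}_N(f)\in L^\Phi_\omega\}$, $\|f\|_{h^\Phi_{\omega,N}}=\|\mathcal{G}_N(f)\|_{L^\Phi_\omega}$. The integer $N_{\Phi,\omega}$. Fix $\psi_0\in\mathcal{D}$ with $\int\psi_0\neq0$; $(\psi_0)_j(x)=2^{jn}\psi_0(2^jx)$ ($j\in\mathbb{Z}_+$), $m_{j,A,B}(y)=(1+2^j|y|)^A2^{B|y|}$, $M^{\mathrm{loc}}g(x)=\sup_{Q\ni x,|Q|\le1}|Q|^{-1}\int_Q|g|$,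 $K_Bg(x)=\int|g(y)|2^{-B|x-y|}dy$. $A_0$ is a positive constant depending only on $\mathrm{supp}\,\psi_0$ (such a constant exists) such that for every $r>0$, $A>\max\{A_0,n/r\}$, $B\ge0$ there is $C=C(n,r,\psi_0,A,B)$ with $[\sup_y|(\psi_0)_j*f(x-y)|/m_{j,A,B}(y)]^r\le C\sum_{k\ge j}2^{(j-k)(Ar-n)}\{M^{\mathrm{loc}}(|(\psi_0)_k*f|^r)(x)+K_{Br}(|(\psi_0)_k*f|^r)(x)\}$ for all $f\in\mathcal{D}'$, $x\in\mathbb{R}^n$, $j\in\mathbb{Z}_+$. $A_1=\max\{A_0,nq_\omega/p_\Phi\}$, $N_0=\lfloor2A_1\rfloor+1$, $N_{\Phi,\omega}=\max\{\widetilde N_{\Phi,\omega},N_0\}$. *)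

theory Defs
  imports "HOL-Probability.Essential_Supremum"
begin

section \<open>Powers of extended nonnegative reals\<close>

text \<open>Only used with positive exponents; a negative power of \<open>u\<close> is written as a positive power
  of \<open>inverse u\<close>, where \<open>inverse 0 = \<infinity>\<close>.\<close>

definition epowr :: "ennreal \<Rightarrow> real \<Rightarrow> ennreal" where
  "epowr u r = (if u = top then top else ennreal (enn2real u powr r))"

section \<open>Local Muckenhoupt weights\<close>

definition cubes :: "(real^'n) set set" where
  "cubes = {cbox a (a + (\<chi> i. l)) | a l. 0 < l}"

definition small_cubes :: "(real^'n) set set" where
  "small_cubes = {Q \<in> cubes. emeasure lebesgue Q \<le> 1}"

definition locally_integrable :: "(real^'n \<Rightarrow> 'b::{banach, second_countable_topology}) \<Rightarrow> bool" where
  "locally_integrable g \<longleftrightarrow>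
     g \<in> borel_measurable lebesgue \<and> (\<forall>K. compact K \<longrightarrow> set_integrable lebesgue K g)"

definition weights :: "(real^'n \<Rightarrow> real) set" where
  "weights = {\<omega>. (\<forall>x. 0 \<le> \<omega> x) \<and> locally_integrable \<omega>}"

definition weight_of :: "(real^'n \<Rightarrow> real) \<Rightarrow> (real^'n) set \<Rightarrow> ennreal" where
  "weight_of \<omega> E = (\<integral>\<^sup>+x\<in>E. ennreal (\<omega> x) \<partial>lebesgue)"

definition Ap_const :: "real \<Rightarrow> (real^'n \<Rightarrow> real) \<Rightarrow> ennreal" where
  "Ap_const p \<omega> = (let p' = p / (p - 1) in
     SUP Q\<in>small_cubes.
       ennreal (measure lebesgue Q powr (- p)) * weight_of \<omega> Q *
       epowr (\<integral>\<^sup>+x\<in>Q. epowr (inverse (ennreal (\<omega> x))) (p' / p) \<partial>lebesgue) (p / p'))"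

definition A1_const :: "(real^'n \<Rightarrow> real) \<Rightarrow> ennreal" where
  "A1_const \<omega> =
     (SUP Q\<in>small_cubes.
       weight_of \<omega> Q / emeasure lebesgue Q *
       esssup (lebesgue_on Q) (\<lambda>x. inverse (ennreal (\<omega> x))))"

definition Ap_loc :: "real \<Rightarrow> (real^'n \<Rightarrow> real) set" where
  "Ap_loc p = {\<omega> \<in> weights. if p = 1 then A1_const \<omega> < top else 1 < p \<and> Ap_const p \<omega> < top}"

definition Ainfty_loc :: "(real^'n \<Rightarrow> real) set" where
  "Ainfty_loc = {\<omega> \<in> weights. \<forall>\<alpha>\<in>{0<..<1}.
     (SUP Q\<in>small_cubes.
       SUP F\<in>{F. F \<subseteq> Q \<and> F \<in> sets lebesgue \<and> emeasure lebesgue F \<ge> ennreal \<alpha> * emeasure lebesgue Q}.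
         weight_of \<omega> Q / weight_of \<omega> F) < top}"

definition critical_index :: "(real^'n \<Rightarrow> real) \<Rightarrow> real" where
  "critical_index \<omega> = Inf {p. 1 \<le> p \<and> \<omega> \<in> Ap_loc p}"

definition Lq_weighted :: "real \<Rightarrow> (real^'n \<Rightarrow> real) \<Rightarrow> (real^'n \<Rightarrow> complex) set" where
  "Lq_weighted q \<omega> =
     {g \<in> borel_measurable lebesgue. (\<integral>\<^sup>+x. ennreal (norm (g x) powr q * \<omega> x) \<partial>lebesgue) < top}"

section \<open>Orlicz functions and weighted Orlicz spaces\<close>

definition lower_type_exponents :: "(real \<Rightarrow> real) \<Rightarrow> real set" where
  "lower_type_exponents \<Phi> =
     {p. 0 < p \<and> (\<forall>t\<in>{0<..<1}. \<forall>s>0. \<Phi> (s * t) \<le> t powr p * \<Phi> s)}"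

definition lower_type_index :: "(real \<Rightarrow> real) \<Rightarrow> real" where
  "lower_type_index \<Phi> = Sup (lower_type_exponents \<Phi>)"

text \<open>Assumption (A), together with the convention \<open>\<Phi>(0) = 0\<close>; the values of \<open>\<Phi>\<close> on negative
  numbers are irrelevant.\<close>

definition assumption_A :: "(real \<Rightarrow> real) \<Rightarrow> bool" where
  "assumption_A \<Phi> \<longleftrightarrow>
     \<Phi> 0 = 0 \<and> (\<forall>t>0. 0 < \<Phi> t) \<and>
     continuous_on {0<..} \<Phi> \<and> strict_mono_on {0<..} \<Phi> \<and>
     (\<forall>s>0. \<forall>t>0. \<Phi> (s + t) \<le> \<Phi> s + \<Phi> t) \<and>
     concave_on {0<..} \<Phi> \<and>
     lower_type_exponents \<Phi> \<noteq> {} \<and> lower_type_index \<Phi> \<in> {0<..1}"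

text \<open>The maximal functions below take values in \<open>[0,\<infinity>]\<close>. A function of strictly lower type is
  unbounded, so \<open>\<Phi>(\<infinity>) = \<infinity>\<close> is its continuous extension.\<close>

definition extend_Phi :: "(real \<Rightarrow> real) \<Rightarrow> ennreal \<Rightarrow> ennreal" where
  "extend_Phi \<Phi> u = (if u = top then top else ennreal (\<Phi> (enn2real u)))"

definition modular :: "(real \<Rightarrow> real) \<Rightarrow> (real^'n \<Rightarrow> real) \<Rightarrow> (real^'n \<Rightarrow> ennreal) \<Rightarrow> ennreal" where
  "modular \<Phi> \<omega> g = (\<integral>\<^sup>+x. extend_Phi \<Phi> (g x) * ennreal (\<omega> x) \<partial>lebesgue)"

definition LPhi :: "(real \<Rightarrow> real) \<Rightarrow> (real^'n \<Rightarrow> real) \<Rightarrow> (real^'n \<Rightarrow> ennreal) set" where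
  "LPhi \<Phi> \<omega> = {g \<in> borel_measurable lebesgue. modular \<Phi> \<omega> g < top}"

definition LPhi_norm :: "(real \<Rightarrow> real) \<Rightarrow> (real^'n \<Rightarrow> real) \<Rightarrow> (real^'n \<Rightarrow> ennreal) \<Rightarrow> ennreal" where
  "LPhi_norm \<Phi> \<omega> g =
     Inf {ennreal c | c. 0 < c \<and> modular \<Phi> \<omega> (\<lambda>x. g x / ennreal c) \<le> 1}"

section \<open>Test functions and distributions\<close>

definition partial_deriv :: "'n \<Rightarrow> (real^'n \<Rightarrow> complex) \<Rightarrow> real^'n \<Rightarrow> complex" where
  "partial_deriv i \<phi> x = frechet_derivative \<phi> (at x) (axis i 1)"

text \<open>For smooth \<open>\<phi>\<close> the order of the directions in the list is irrelevant, so the lists of length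
  \<open>k\<close> produce exactly the derivatives of multi-index order \<open>k\<close>.\<close>

definition partial_derivs :: "'n list \<Rightarrow> (real^'n \<Rightarrow> complex) \<Rightarrow> real^'n \<Rightarrow> complex" where
  "partial_derivs ds \<phi> = foldr partial_deriv ds \<phi>"

definition smooth :: "(real^'n \<Rightarrow> complex) \<Rightarrow> bool" where
  "smooth \<phi> \<longleftrightarrow> (\<forall>ds. partial_derivs ds \<phi> differentiable_on UNIV)"

definition supp :: "(real^'n \<Rightarrow> complex) \<Rightarrow> (real^'n) set" where
  "supp \<phi> = closure {x. \<phi> x \<noteq> 0}"

definition test_functions :: "(real^'n \<Rightarrow> complex) set" where
  "test_functions = {\<phi>. smooth \<phi> \<and> compact (supp \<phi>)}"

definition Ck_norm :: "nat \<Rightarrow> (real^'n \<Rightarrow> complex) \<Rightarrow> ennreal" where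
  "Ck_norm k \<phi> = (SUP x. SUP ds\<in>{ds. length ds \<le> k}. ennreal (norm (partial_derivs ds \<phi> x)))"

text \<open>A distribution is represented as a functional that vanishes outside the test functions, so
  that equality of representatives is equality of distributions. Continuity is expressed by the
  usual seminorm estimates on each compact set.\<close>

definition distributions :: "((real^'n \<Rightarrow> complex) \<Rightarrow> complex) set" where
  "distributions = {f.
     (\<forall>\<phi>. \<phi> \<notin> test_functions \<longrightarrow> f \<phi> = 0) \<and>
     (\<forall>\<phi>\<in>test_functions. \<forall>\<psi>\<in>test_functions. f (\<lambda>x. \<phi> x + \<psi> x) = f \<phi> + f \<psi>) \<and>
     (\<forall>\<phi>\<in>test_functions. \<forall>c. f (\<lambda>x. c * \<phi> x) = c * f \<phi>) \<and>
     (\<forall>K. compact K \<longrightarrow> (\<exists>(C::real) k. \<forall>\<phi>\<in>test_functions. supp \<phi> \<subseteq> K \<longrightarrow>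
        ennreal (norm (f \<phi>)) \<le> ennreal C * Ck_norm k \<phi>))}"

definition distribution_of :: "(real^'n \<Rightarrow> complex) \<Rightarrow> (real^'n \<Rightarrow> complex) \<Rightarrow> complex" where
  "distribution_of g = (\<lambda>\<phi>. if \<phi> \<in> test_functions then (LINT x|lebesgue. g x * \<phi> x) else 0)"

definition convolve ::
    "(real^'n \<Rightarrow> complex) \<Rightarrow> ((real^'n \<Rightarrow> complex) \<Rightarrow> complex) \<Rightarrow> real^'n \<Rightarrow> complex" where
  "convolve \<psi> f x = f (\<lambda>y. \<psi> (x - y))"

definition dilate :: "real \<Rightarrow> (real^'n \<Rightarrow> complex) \<Rightarrow> real^'n \<Rightarrow> complex" where
  "dilate t \<psi> = (\<lambda>x. (1 / t ^ CARD('n)) *\<^sub>R \<psi> ((1 / t) *\<^sub>R x))"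

section \<open>The weighted local Orlicz--Hardy space\<close>

definition grand_test_functions :: "nat \<Rightarrow> (real^'n \<Rightarrow> complex) set" where
  "grand_test_functions N =
     {\<psi> \<in> test_functions. supp \<psi> \<subseteq> ball 0 (2 ^ (3 * (10 + CARD('n)))) \<and> Ck_norm N \<psi> \<le> 1}"

definition grand_maximal ::
    "nat \<Rightarrow> ((real^'n \<Rightarrow> complex) \<Rightarrow> complex) \<Rightarrow> real^'n \<Rightarrow> ennreal" where
  "grand_maximal N f x =
     (SUP t\<in>{0<..<1}. SUP \<psi>\<in>grand_test_functions N. ennreal (norm (convolve (dilate t \<psi>) f x)))"

definition hardy ::
    "(real \<Rightarrow> real) \<Rightarrow> (real^'n \<Rightarrow> real) \<Rightarrow> nat \<Rightarrow> ((real^'n \<Rightarrow> complex) \<Rightarrow> complex) set" where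
  "hardy \<Phi> \<omega> N = {f \<in> distributions. grand_maximal N f \<in> LPhi \<Phi> \<omega>}"

definition hardy_norm ::
    "(real \<Rightarrow> real) \<Rightarrow> (real^'n \<Rightarrow> real) \<Rightarrow> nat \<Rightarrow> ((real^'n \<Rightarrow> complex) \<Rightarrow> complex) \<Rightarrow> ennreal" where
  "hardy_norm \<Phi> \<omega> N f = LPhi_norm \<Phi> \<omega> (grand_maximal N f)"

text \<open>\<open>L\<^sup>q\<^sub>\<omega>\<close> as a space of distributions. Local integrability is automatic for
  \<open>g \<in> L\<^sup>q\<^sub>\<omega>\<close> when \<open>q\<close> exceeds the critical index of \<open>\<omega>\<close> (unless \<open>\<omega> = 0\<close> a.e.).\<close>

definition Lq_distributions ::
    "real \<Rightarrow> (real^'n \<Rightarrow> real) \<Rightarrow> ((real^'n \<Rightarrow> complex) \<Rightarrow> complex) set" where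
  "Lq_distributions q \<omega> = {distribution_of g | g. g \<in> Lq_weighted q \<omega> \<and> locally_integrable g}"

definition dense_in_hardy ::
    "(real \<Rightarrow> real) \<Rightarrow> (real^'n \<Rightarrow> real) \<Rightarrow> nat \<Rightarrow> ((real^'n \<Rightarrow> complex) \<Rightarrow> complex) set \<Rightarrow> bool" where
  "dense_in_hardy \<Phi> \<omega> N S \<longleftrightarrow>
     S \<subseteq> hardy \<Phi> \<omega> N \<and>
     (\<forall>f\<in>hardy \<Phi> \<omega> N. \<forall>\<epsilon>>0. \<exists>g\<in>S. hardy_norm \<Phi> \<omega> N (\<lambda>\<phi>. f \<phi> - g \<phi>) < ennreal \<epsilon>)"

section \<open>The integer \<open>N\<^sub>\<Phi>\<^sub>,\<^sub>\<omega>\<close>\<close>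

definition dyadic :: "nat \<Rightarrow> (real^'n \<Rightarrow> complex) \<Rightarrow> real^'n \<Rightarrow> complex" where
  "dyadic j \<psi> = (\<lambda>x. (2 ^ (j * CARD('n))) *\<^sub>R \<psi> ((2 ^ j) *\<^sub>R x))"

definition peetre_weight :: "nat \<Rightarrow> real \<Rightarrow> real \<Rightarrow> real^'n \<Rightarrow> real" where
  "peetre_weight j A B y = (1 + 2 ^ j * norm y) powr A * 2 powr (B * norm y)"

definition local_maximal :: "(real^'n \<Rightarrow> real) \<Rightarrow> real^'n \<Rightarrow> ennreal" where
  "local_maximal g x =
     (SUP Q\<in>{Q \<in> small_cubes. x \<in> Q}.
       (\<integral>\<^sup>+y\<in>Q. ennreal \<bar>g y\<bar> \<partial>lebesgue) / emeasure lebesgue Q)"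

definition exp_average :: "real \<Rightarrow> (real^'n \<Rightarrow> real) \<Rightarrow> real^'n \<Rightarrow> ennreal" where
  "exp_average B g x = (\<integral>\<^sup>+y. ennreal (\<bar>g y\<bar> * 2 powr (- B * norm (x - y))) \<partial>lebesgue)"

definition peetre_estimate :: "(real^'n \<Rightarrow> complex) \<Rightarrow> real \<Rightarrow> bool" where
  "peetre_estimate \<psi> A\<^sub>0 \<longleftrightarrow>
     (\<forall>r>0. \<forall>A>max A\<^sub>0 (real CARD('n) / r). \<forall>B\<ge>0. \<exists>C::real.
       \<forall>f\<in>distributions. \<forall>x j.
         epowr (SUP y. ennreal (norm (convolve (dyadic j \<psi>) f (x - y)) / peetre_weight j A B y)) r
         \<le> ennreal C *
           (\<Sum>k. if k < j then 0 else
              ennreal (2 powr ((real j - real k) * (A * r - real CARD('n)))) *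
              (local_maximal (\<lambda>y. norm (convolve (dyadic k \<psi>) f y) powr r) x +
               exp_average (B * r) (\<lambda>y. norm (convolve (dyadic k \<psi>) f y) powr r) x)))"

text \<open>\<open>A\<^sub>0\<close> is an admissible constant for the support \<open>S\<close>: it depends on the kernel only through
  its support, i.e. it serves every kernel with support \<open>S\<close> and nonvanishing integral.\<close>

definition admissible_A0 :: "(real^'n) set \<Rightarrow> real \<Rightarrow> bool" where
  "admissible_A0 S A\<^sub>0 \<longleftrightarrow>
     0 < A\<^sub>0 \<and>
     (\<forall>\<psi>\<in>test_functions. (LINT x|lebesgue. \<psi> x) \<noteq> 0 \<longrightarrow> supp \<psi> = S \<longrightarrow> peetre_estimate \<psi> A\<^sub>0)"

definition N_tilde :: "(real \<Rightarrow> real) \<Rightarrow> (real^'n \<Rightarrow> real) \<Rightarrow> int" where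
  "N_tilde \<Phi> \<omega> = \<lfloor>real CARD('n) * (critical_index \<omega> / lower_type_index \<Phi> - 1)\<rfloor> + 2"

definition A_one :: "(real \<Rightarrow> real) \<Rightarrow> (real^'n \<Rightarrow> real) \<Rightarrow> real \<Rightarrow> real" where
  "A_one \<Phi> \<omega> A\<^sub>0 = max A\<^sub>0 (real CARD('n) * critical_index \<omega> / lower_type_index \<Phi>)"

definition N_crit :: "(real \<Rightarrow> real) \<Rightarrow> (real^'n \<Rightarrow> real) \<Rightarrow> real \<Rightarrow> int" where
  "N_crit \<Phi> \<omega> A\<^sub>0 = max (N_tilde \<Phi> \<omega>) (\<lfloor>2 * A_one \<Phi> \<omega> A\<^sub>0\<rfloor> + 1)"

end

theory Submission
  imports Defs 
begin

text \<open>Every distribution in the Hardy space is approximated by bounded functions with bounded support;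
such functions lie in every weighted Lebesgue space. The approximation is a Calderon-Zygmund
decomposition at a high level \<open>\<kappa>\<close>, arranged so that no moment conditions on bad pieces are needed.

Let \<open>\<Gamma>\<close> be (a multiple of) the grand maximal function of \<open>f\<close>, which is first cut off far out
(\<open>cutoff_error\<close>), and let \<open>F\<close> be the set where \<open>\<Gamma> \<le> \<kappa>\<close>. A test function concentrated at scale
\<open>s\<close> near a point \<open>z\<close> satisfies \<open>|f h| \<le> s\<^sup>n M \<Gamma> z\<close> if its scaled derivatives are bounded by \<open>M\<close>
(\<open>grand_maximal_bound\<close>). Cut the complement of \<open>F\<close> into layers at distance about \<open>l = 2\<^sup>-\<^sup>k\<close> from
\<open>F\<close>, with smooth cut-offs \<open>\<eta>\<^sub>k\<close>, and each layer into cells of side \<open>l\<close>; points of \<open>F\<close> are then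
within reach of each cell, so \<open>f\<close> is of size \<open>\<kappa>\<close> on every piece (\<open>piece_bound\<close>). On the layer of
scale \<open>l\<close> split \<open>h = T\<^sub>k h + A\<^sub>k h\<close>, where \<open>A\<^sub>k\<close> is the \<open>N\<close>-th power of identity minus mollification
at scale \<open>l\<close>. Two facts carry the argument: the derivatives of \<open>T\<^sub>k h\<close> cost only means of \<open>|h|\<close>
(\<open>smoothing_jet\<close>), and \<open>A\<^sub>k h\<close> gains a factor \<open>l\<^sup>N\<close> against \<open>N\<close> derivatives of \<open>h\<close>
(\<open>resid_pow_jet\<close>).

Removing all \<open>b\<^sub>k(h) = f (\<eta>\<^sub>k A\<^sub>k h)\<close> from \<open>f\<close> leaves a functional bounded by a multiple of
\<open>\<kappa> \<integral>|h|\<close> over a ball (\<open>good_bound\<close>), hence a bounded function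
(\<open>bounded_functional_representation\<close>). The removed part, tested against a kernel of scale \<open>t\<close> at
\<open>x\<close>, is at most a multiple of \<open>\<Gamma> x\<close> off \<open>F\<close> plus \<open>\<kappa>\<close> times tails
\<open>(l / (l + |x - x\<^sub>i|))\<^bsup>n + N\<^esup>\<close> of the cells (\<open>grand_maximal_bad\<close>). As \<open>N\<close> is large compared with
\<open>n (q\<^sub>\<omega> / p\<^sub>\<Phi> - 1)\<close>, one can choose an exponent \<open>p\<^sub>1\<close> with \<open>\<omega>\<close> in the \<open>p\<^sub>1\<close>-class and a lower
type \<open>p\<close> of \<open>\<Phi>\<close> with \<open>n p\<^sub>1 < (n + N) p\<close> (\<open>exponents_gap\<close>); then the tails are integrable
(\<open>cell_tail\<close>) and, the cells overlapping boundedly, the modular of the error is at most a constant,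
which depends neither on \<open>\<kappa>\<close> nor on \<open>F\<close>, times the integral of \<open>\<Phi>(\<Gamma>) \<omega>\<close> over the set where
\<open>\<Gamma> > \<kappa>\<close> (\<open>bad_bound_integral\<close>). That integral tends to zero as \<open>\<kappa>\<close> grows.

The weight enters through the inequality between the weights of a small cube and of its parts
(\<open>part_bound\<close>), which follows from the Muckenhoupt condition. That the set of exponents defining the
critical index is not empty is a reverse Hoelder argument for the density of Lebesgue measure with
respect to the weight (\<open>Ainfty_in_some_Ap\<close>).\<close>

section \<open>Calculus of smooth functions\<close>

lemma partial_derivs_Nil [simp]: "partial_derivs [] \<phi> = \<phi>"
  and partial_derivs_Cons [simp]: "partial_derivs (d # ds) \<phi> = partial_deriv d (partial_derivs ds \<phi>)"
  and partial_derivs_append: "partial_derivs (ds @ es) \<phi> = partial_derivs ds (partial_derivs es \<phi>)"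
  by (simp_all add: partial_derivs_def)

lemma smooth_differentiable: "smooth \<phi> ==> \<phi> differentiable (at x)"
  unfolding smooth_def differentiable_on_def by (metis partial_derivs_Nil UNIV_I)

lemma smooth_partial_derivs: "smooth \<phi> ==> smooth (partial_derivs ds \<phi>)"
  unfolding smooth_def by (metis partial_derivs_append)

lemma smooth_partial_deriv: "smooth \<phi> ==> smooth (partial_deriv i \<phi>)"
  using smooth_partial_derivs[of \<phi> "[i]"] by simp

text \<open>Smoothness is the largest property that implies differentiability and passes to partial
derivatives, so any invariant of this kind proves it.\<close>

lemma smooth_coinduct:
  assumes "P \<phi>"
    and "\<And>\<phi> x. P \<phi> ==> \<phi> differentiable (at x)"
    and "\<And>\<phi> i. P \<phi> ==> P (partial_deriv i \<phi>)"
  shows "smooth \<phi>"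
proof -
  have "P (partial_derivs ds \<phi>)" for ds by (induction ds) (auto intro: assms)
  then show ?thesis unfolding smooth_def differentiable_on_def using assms(2) by blast
qed

lemma partial_deriv_eqI: "(\<phi> has_derivative D) (at x) ==> partial_deriv i \<phi> x = D (axis i 1)"
  unfolding partial_deriv_def using frechet_derivative_at by (metis)

lemma has_derivative_partial:
  assumes "\<phi> differentiable (at x)"
  shows "(\<phi> has_derivative (\<lambda>v. \<Sum>i\<in>UNIV. (v $ i) *\<^sub>R partial_deriv i \<phi> x)) (at x)"
proof -
  let ?D = "frechet_derivative \<phi> (at x)"
  have D: "(\<phi> has_derivative ?D) (at x)" using assms frechet_derivative_works by blast
  then have lin: "linear ?D" by (rule has_derivative_linear)
  have "?D v = (\<Sum>i\<in>UNIV. (v $ i) *\<^sub>R partial_deriv i \<phi> x)" for v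
  proof -
    have "?D v = ?D (\<Sum>i\<in>UNIV. (v $ i) *\<^sub>R axis i 1)"
      by (simp add: basis_expansion flip: scalar_mult_eq_scaleR)
    also have "... = (\<Sum>i\<in>UNIV. (v $ i) *\<^sub>R ?D (axis i 1))"
      using lin by (simp add: linear_sum linear_cmul)
    finally show ?thesis by (simp add: partial_deriv_def)
  qed
  with D show ?thesis by (metis (no_types, lifting) ext)
qed

lemma smooth_continuous_on: "smooth \<phi> ==> continuous_on S \<phi>"
  by (meson continuous_at_imp_continuous_on differentiable_imp_continuous_within smooth_differentiable)

lemma partial_deriv_const: "partial_deriv i (\<lambda>x. c) = (\<lambda>x. 0)"
  by (rule ext, rule partial_deriv_eqI) (rule has_derivative_const)

lemma partial_derivs_zero: "partial_derivs ds (\<lambda>x. 0) = (\<lambda>x. 0)"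
  by (induction ds) (auto simp: partial_deriv_const)

lemma smooth_const: "smooth (\<lambda>x. c)"
  by (rule smooth_coinduct[where P = "\<lambda>\<phi>. \<exists>c. \<phi> = (\<lambda>x. c)"]) (auto simp: partial_deriv_const)

lemma partial_deriv_add_at:
  assumes "\<phi> differentiable (at x)" "\<psi> differentiable (at x)"
  shows "partial_deriv i (\<lambda>x. \<phi> x + \<psi> x) x = partial_deriv i \<phi> x + partial_deriv i \<psi> x"
proof -
  have "((\<lambda>x. \<phi> x + \<psi> x) has_derivative
      (\<lambda>v. frechet_derivative \<phi> (at x) v + frechet_derivative \<psi> (at x) v)) (at x)"
    using assms by (intro has_derivative_add) (auto simp: frechet_derivative_works[symmetric])
  from partial_deriv_eqI[OF this] show ?thesis by (simp add: partial_deriv_def)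
qed

lemma partial_deriv_add:
  assumes "smooth \<phi>" "smooth \<psi>"
  shows "partial_deriv i (\<lambda>x. \<phi> x + \<psi> x) = (\<lambda>x. partial_deriv i \<phi> x + partial_deriv i \<psi> x)"
  using assms by (intro ext) (simp add: partial_deriv_add_at smooth_differentiable)

lemma partial_deriv_cmult:
  assumes "smooth \<phi>"
  shows "partial_deriv i (\<lambda>x. c * \<phi> x) = (\<lambda>x. c * partial_deriv i \<phi> x)" using assms
  by (intro ext partial_deriv_eqI[where D = "\<lambda>v. c * frechet_derivative \<phi> (at x) v" for x, THEN trans])
    (auto intro!: derivative_eq_intros simp: partial_deriv_def
      smooth_differentiable frechet_derivative_works[symmetric])

lemma partial_deriv_mult:
  assumes "smooth \<phi>" "smooth \<psi>"
  shows "partial_deriv i (\<lambda>x. \<phi> x * \<psi> x) = (\<lambda>x. partial_deriv i \<phi> x * \<psi> x + \<phi> x * partial_deriv i \<psi> x)"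
proof
  fix x
  have "((\<lambda>x. \<phi> x * \<psi> x) has_derivative
      (\<lambda>v. \<phi> x * frechet_derivative \<psi> (at x) v + frechet_derivative \<phi> (at x) v * \<psi> x)) (at x)"
    using assms by (intro has_derivative_mult) (auto simp: smooth_differentiable frechet_derivative_works[symmetric])
  from partial_deriv_eqI[OF this]
  show "partial_deriv i (\<lambda>x. \<phi> x * \<psi> x) x = partial_deriv i \<phi> x * \<psi> x + \<phi> x * partial_deriv i \<psi> x"
    by (simp add: partial_deriv_def)
qed

lemma smooth_add:
  assumes "smooth \<phi>" "smooth \<psi>" shows "smooth (\<lambda>x. \<phi> x + \<psi> x)"
proof (rule smooth_coinduct[where P = "\<lambda>\<xi>. \<exists>\<phi> \<psi>. smooth \<phi> \<and> smooth \<psi> \<and> \<xi> = (\<lambda>x. \<phi> x + \<psi> x)"])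
  show "\<exists>\<phi>' \<psi>'. smooth \<phi>' \<and> smooth \<psi>' \<and> (\<lambda>x. \<phi> x + \<psi> x) = (\<lambda>x. \<phi>' x + \<psi>' x)"
    using assms by blast
next
  fix \<xi> :: "real^'a => complex" and x
  assume "\<exists>\<phi> \<psi>. smooth \<phi> \<and> smooth \<psi> \<and> \<xi> = (\<lambda>x. \<phi> x + \<psi> x)"
  then show "\<xi> differentiable at x" by (auto intro!: differentiable_add dest: smooth_differentiable)
next
  fix \<xi> :: "real^'a => complex" and i
  assume "\<exists>\<phi> \<psi>. smooth \<phi> \<and> smooth \<psi> \<and> \<xi> = (\<lambda>x. \<phi> x + \<psi> x)"
  then obtain \<phi> \<psi> where *: "smooth \<phi>" "smooth \<psi>" "\<xi> = (\<lambda>x. \<phi> x + \<psi> x)"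
    by blast
  then show "\<exists>\<phi> \<psi>. smooth \<phi> \<and> smooth \<psi> \<and> partial_deriv i \<xi> = (\<lambda>x. \<phi> x + \<psi> x)"
    using smooth_partial_deriv[OF *(1)] smooth_partial_deriv[OF *(2)] partial_deriv_add[OF *(1,2)] by blast
qed

lemma smooth_cmult:
  assumes "smooth \<phi>" shows "smooth (\<lambda>x. c * \<phi> x)"
  by (rule smooth_coinduct[where P = "\<lambda>\<xi>. \<exists>\<phi>. smooth \<phi> \<and> \<xi> = (\<lambda>x. c * \<phi> x)"])
    (use assms in \<open>auto simp: partial_deriv_cmult smooth_differentiable intro: smooth_partial_deriv\<close>)

lemma smooth_sum:
  assumes "\<And>a. a \<in> I ==> smooth (\<phi> a)" shows "smooth (\<lambda>x. \<Sum>a\<in>I. \<phi> a x)"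
  using assms by (induction I rule: infinite_finite_induct) (auto intro: smooth_const smooth_add)

inductive product_sum :: "(real^'n => complex) => bool" where
  prod: "smooth \<phi> ==> smooth \<psi> ==> product_sum (\<lambda>x. \<phi> x * \<psi> x)"
| plus: "product_sum \<phi> ==> product_sum \<psi> ==> product_sum (\<lambda>x. \<phi> x + \<psi> x)"

text \<open>Products of smooth functions are not closed under partial derivatives, but finite sums of
products are; this is the invariant that makes products smooth.\<close>

lemma product_sum_differentiable: "product_sum \<phi> ==> \<phi> differentiable (at x)"
  by (induction rule: product_sum.induct) (auto intro: differentiable_mult differentiable_add dest: smooth_differentiable)

lemma product_sum_partial_deriv: "product_sum \<phi> ==> product_sum (partial_deriv i \<phi>)"
proof (induction rule: product_sum.induct)
  case (prod \<phi> \<psi>)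
  then show ?case by (simp add: partial_deriv_mult)
      (intro product_sum.intros smooth_partial_deriv)
next
  case (plus \<phi> \<psi>)
  have "partial_deriv i (\<lambda>x. \<phi> x + \<psi> x) = (\<lambda>x. partial_deriv i \<phi> x + partial_deriv i \<psi> x)"
    using plus by (intro ext) (simp add: partial_deriv_add_at product_sum_differentiable)
  then show ?case using plus by (simp add: product_sum.plus)
qed

lemma smooth_mult:
  assumes "smooth \<phi>" "smooth \<psi>" shows "smooth (\<lambda>x. \<phi> x * \<psi> x)"
  by (rule smooth_coinduct[where P = product_sum])
    (use assms in \<open>auto intro: product_sum.prod product_sum_differentiable product_sum_partial_deriv\<close>)

lemma partial_derivs_add:
  assumes "smooth \<phi>" "smooth \<psi>"
  shows "partial_derivs ds (\<lambda>x. \<phi> x + \<psi> x) = (\<lambda>x. partial_derivs ds \<phi> x + partial_derivs ds \<psi> x)"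
  using assms by (induction ds) (auto simp: partial_deriv_add smooth_partial_derivs)

lemma partial_derivs_cmult:
  assumes "smooth \<phi>"
  shows "partial_derivs ds (\<lambda>x. c * \<phi> x) = (\<lambda>x. c * partial_derivs ds \<phi> x)"
  using assms by (induction ds) (auto simp: partial_deriv_cmult smooth_partial_derivs)

lemma smooth_diff:
  assumes "smooth \<phi>" "smooth \<psi>" shows "smooth (\<lambda>x. \<phi> x - \<psi> x)"
  using smooth_add[OF assms(1) smooth_cmult[OF assms(2), of "-1"]] by simp

lemma partial_derivs_diff:
  assumes "smooth \<phi>" "smooth \<psi>"
  shows "partial_derivs ds (\<lambda>x. \<phi> x - \<psi> x) = (\<lambda>x. partial_derivs ds \<phi> x - partial_derivs ds \<psi> x)"
  using partial_derivs_add[OF assms(1) smooth_cmult[OF assms(2), of "-1"], of ds]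
    partial_derivs_cmult[OF assms(2), of ds "-1"] by simp

lemma partial_derivs_sum:
  assumes "finite I" "\<And>a. a \<in> I ==> smooth (\<phi> a)"
  shows "partial_derivs ds (\<lambda>x. \<Sum>a\<in>I. \<phi> a x) = (\<lambda>x. \<Sum>a\<in>I. partial_derivs ds (\<phi> a) x)"
  using assms
  by (induction I rule: finite_induct) (auto simp: partial_derivs_zero partial_derivs_add smooth_sum)

lemma partial_deriv_affine:
  assumes "smooth \<phi>"
  shows "partial_deriv i (\<lambda>w. \<phi> (z + c *\<^sub>R w)) = (\<lambda>w. complex_of_real c * partial_deriv i \<phi> (z + c *\<^sub>R w))"
proof
  fix w
  have D: "(\<phi> has_derivative frechet_derivative \<phi> (at (z + c *\<^sub>R w))) (at (z + c *\<^sub>R w))"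
    using assms by (simp add: smooth_differentiable frechet_derivative_works[symmetric])
  have "((\<lambda>w. \<phi> (z + c *\<^sub>R w)) has_derivative (\<lambda>v. frechet_derivative \<phi> (at (z + c *\<^sub>R w)) (c *\<^sub>R v))) (at w)"
    by (rule has_derivative_compose[where f = "\<lambda>w. z + c *\<^sub>R w" and g = \<phi>, OF _ D]) (auto intro!: derivative_eq_intros)
  from partial_deriv_eqI[OF this]
  show "partial_deriv i (\<lambda>w. \<phi> (z + c *\<^sub>R w)) w = complex_of_real c * partial_deriv i \<phi> (z + c *\<^sub>R w)"
    using has_derivative_linear[OF D] by (simp add: partial_deriv_def linear_cmul) (simp add: scaleR_conv_of_real)
qed

lemma smooth_affine_aux:
  fixes \<xi> :: "real^'n => complex"
  shows "(\<exists>a \<psi>. smooth \<psi> \<and> \<xi> = (\<lambda>w. a * \<psi> (z + c *\<^sub>R w))) ==> \<xi> differentiable (at x)"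
proof (elim exE conjE)
  fix a \<psi> assume "smooth \<psi>" and \<xi>: "\<xi> = (\<lambda>w. a * \<psi> (z + c *\<^sub>R w))"
  then have D: "(\<psi> has_derivative frechet_derivative \<psi> (at (z + c *\<^sub>R x))) (at (z + c *\<^sub>R x))"
    by (simp add: smooth_differentiable frechet_derivative_works[symmetric])
  have "((\<lambda>w. \<psi> (z + c *\<^sub>R w)) has_derivative (\<lambda>v. frechet_derivative \<psi> (at (z + c *\<^sub>R x)) (c *\<^sub>R v))) (at x)"
    by (rule has_derivative_compose[where f = "\<lambda>w. z + c *\<^sub>R w" and g = \<psi>, OF _ D]) (auto intro!: derivative_eq_intros)
  then have "(\<lambda>w. \<psi> (z + c *\<^sub>R w)) differentiable (at x)" by (rule differentiableI)
  then show "\<xi> differentiable (at x)" unfolding \<xi> by (intro differentiable_mult) auto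
qed

lemma smooth_affine:
  fixes \<phi> :: "real^'n => complex"
  assumes "smooth \<phi>" shows "smooth (\<lambda>w. \<phi> (z + c *\<^sub>R w))"
proof (rule smooth_coinduct[where P = "\<lambda>\<xi>. \<exists>a \<psi>. smooth \<psi> \<and> \<xi> = (\<lambda>w. a * \<psi> (z + c *\<^sub>R w))"])
  show "\<exists>a \<psi>. smooth \<psi> \<and> (\<lambda>w. \<phi> (z + c *\<^sub>R w)) = (\<lambda>w. a * \<psi> (z + c *\<^sub>R w))"
    using assms by (intro exI[of _ 1] exI[of _ \<phi>]) auto
  fix \<xi> :: "real^'n => complex" and i
  assume "\<exists>a \<psi>. smooth \<psi> \<and> \<xi> = (\<lambda>w. a * \<psi> (z + c *\<^sub>R w))"
  then obtain a \<psi> where *: "smooth \<psi>" "\<xi> = (\<lambda>w. a * \<psi> (z + c *\<^sub>R w))" by blast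
  have "partial_deriv i \<xi> = (\<lambda>w. complex_of_real c * partial_deriv i (\<lambda>x. a * \<psi> x) (z + c *\<^sub>R w))"
    using partial_deriv_affine[OF smooth_cmult[OF *(1)], of i a z c] * by simp
  also have "... = (\<lambda>w. (c * a) * partial_deriv i \<psi> (z + c *\<^sub>R w))"
    using * by (simp add: partial_deriv_cmult mult.assoc)
  finally show "\<exists>a \<psi>. smooth \<psi> \<and> partial_deriv i \<xi> = (\<lambda>w. a * \<psi> (z + c *\<^sub>R w))"
    using * smooth_partial_deriv by blast
qed (rule smooth_affine_aux)

lemma partial_derivs_affine:
  assumes "smooth \<phi>"
  shows "partial_derivs ds (\<lambda>w. \<phi> (z + c *\<^sub>R w)) =
    (\<lambda>w. complex_of_real c ^ length ds * partial_derivs ds \<phi> (z + c *\<^sub>R w))"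
proof (induction ds)
  case (Cons d ds)
  show ?case using assms unfolding partial_derivs_Cons Cons.IH by (subst partial_deriv_cmult)
       (simp_all add: partial_deriv_affine smooth_partial_derivs smooth_affine algebra_simps)
qed simp

text \<open>The factor \<open>s\<close> per derivative makes the bound invariant under dilation, so that one estimate
  serves all scales.\<close>

definition jet_le :: "nat => real => real => (real^'n => complex) => real^'n => bool" where
  "jet_le N s M \<phi> x \<longleftrightarrow> (\<forall>ds. length ds \<le> N --> s ^ length ds * norm (partial_derivs ds \<phi> x) \<le> M)"

lemma jet_leD: "jet_le N s M \<phi> x ==> length ds \<le> N ==> s ^ length ds * norm (partial_derivs ds \<phi> x) \<le> M"
  by (simp add: jet_le_def)

lemma jet_le_norm: "jet_le N s M \<phi> x ==> norm (\<phi> x) \<le> M"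
  using jet_leD[of N s M \<phi> x "[]"] by simp

lemma jet_le_nonneg: "jet_le N s M \<phi> x ==> 0 \<le> M" using jet_le_norm norm_ge_zero order_trans by blast

lemma jet_le_mono:
  assumes "jet_le N s M \<phi> x" "0 \<le> s'" "s' \<le> s" "M \<le> M'"
  shows "jet_le N s' M' \<phi> x" unfolding jet_le_def
proof (intro allI impI)
  fix ds :: "'a list" assume ds: "length ds \<le> N"
  have "s' ^ length ds * norm (partial_derivs ds \<phi> x) \<le> s ^ length ds * norm (partial_derivs ds \<phi> x)"
    using assms by (intro mult_right_mono power_mono) auto
  also have "... \<le> M" using assms ds by (simp add: jet_leD)
  finally show "s' ^ length ds * norm (partial_derivs ds \<phi> x) \<le> M'" using assms by simp
qed

lemma jet_le_rescale:
  assumes "jet_le N s M \<phi> x" "0 \<le> s" "1 \<le> c"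
  shows "jet_le N (c * s) (c ^ N * M) \<phi> x" unfolding jet_le_def
proof (intro allI impI)
  fix ds :: "'a list" assume ds: "length ds \<le> N"
  have "(c * s) ^ length ds * norm (partial_derivs ds \<phi> x) =
      c ^ length ds * (s ^ length ds * norm (partial_derivs ds \<phi> x))" by (simp add: power_mult_distrib)
  also have "... \<le> c ^ N * M" using assms ds by (intro mult_mono power_increasing jet_leD) auto
  finally show "(c * s) ^ length ds * norm (partial_derivs ds \<phi> x) \<le> c ^ N * M" .
qed

lemma jet_le_add:
  assumes "smooth \<phi>" "smooth \<psi>" "jet_le N s A \<phi> x" "jet_le N s B \<psi> x" "0 \<le> s"
  shows "jet_le N s (A + B) (\<lambda>x. \<phi> x + \<psi> x) x" unfolding jet_le_def
proof (intro allI impI)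
  fix ds :: "'a list" assume ds: "length ds \<le> N"
  have "s ^ length ds * norm (partial_derivs ds \<phi> x + partial_derivs ds \<psi> x)
    \<le> s ^ length ds * (norm (partial_derivs ds \<phi> x) + norm (partial_derivs ds \<psi> x))"
    using assms by (intro mult_left_mono norm_triangle_ineq) auto
  also have "... \<le> A + B" using assms ds by (simp add: distrib_left add_mono jet_leD)
  finally show "s ^ length ds * norm (partial_derivs ds (\<lambda>x. \<phi> x + \<psi> x) x) \<le> A + B"
    using assms by (simp add: partial_derivs_add)
qed

lemma jet_le_cmult:
  assumes "smooth \<phi>" "jet_le N s A \<phi> x"
  shows "jet_le N s (norm c * A) (\<lambda>x. c * \<phi> x) x" unfolding jet_le_def
proof (intro allI impI)
  fix ds :: "'a list" assume ds: "length ds \<le> N"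
  have "norm c * (s ^ length ds * norm (partial_derivs ds \<phi> x)) \<le> norm c * A"
    using assms ds by (intro mult_left_mono jet_leD) auto
  then show "s ^ length ds * norm (partial_derivs ds (\<lambda>x. c * \<phi> x) x) \<le> norm c * A"
    using assms by (simp add: partial_derivs_cmult norm_mult algebra_simps)
qed

lemma jet_le_diff:
  assumes "smooth \<phi>" "smooth \<psi>" "jet_le N s A \<phi> x" "jet_le N s B \<psi> x" "0 \<le> s"
  shows "jet_le N s (A + B) (\<lambda>x. \<phi> x - \<psi> x) x"
  using jet_le_add[OF assms(1) smooth_cmult[OF assms(2), of "-1"] assms(3) jet_le_cmult[OF assms(2,4), of "-1"]] assms(5)
  by simp

lemma jet_le_Suc_iff:
  assumes "0 \<le> s" "smooth \<phi>"
  shows "jet_le (Suc N) s M \<phi> x \<longleftrightarrow>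
    norm (\<phi> x) \<le> M \<and> (\<forall>i. jet_le N s M (\<lambda>x. complex_of_real s * partial_deriv i \<phi> x) x)"
    (is "?L \<longleftrightarrow> ?R")
proof -
  have eq: "s ^ length ds * norm (partial_derivs ds (\<lambda>x. complex_of_real s * partial_deriv i \<phi> x) x)
    = s ^ length (ds @ [i]) * norm (partial_derivs (ds @ [i]) \<phi> x)" for ds i
    using assms by (simp add: partial_derivs_cmult smooth_partial_deriv partial_derivs_append norm_mult)
  show ?thesis
  proof
    assume L: ?L
    then show ?R using jet_le_norm[OF L] unfolding jet_le_def eq by (metis Suc_le_mono length_append_singleton)
  next
    assume R: ?R
    show ?L unfolding jet_le_def
    proof (intro allI impI)
      fix ds :: "'a list" assume "length ds \<le> Suc N"
      then show "s ^ length ds * norm (partial_derivs ds \<phi> x) \<le> M"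
        using R by (cases ds rule: rev_cases) (auto simp only: jet_le_def eq list.size partial_derivs_Nil
            power_0 mult_1 length_append_singleton Suc_le_mono)
    qed
  qed
qed

text \<open>By the product rule every derivative falls on one of the two factors, which doubles the number
of terms with each order.\<close>

lemma jet_le_mult:
  assumes "smooth \<phi>" "smooth \<psi>" "jet_le N s A \<phi> x" "jet_le N s B \<psi> x" "0 \<le> s"
  shows "jet_le N s (2 ^ N * A * B) (\<lambda>x. \<phi> x * \<psi> x) x" using assms
proof (induction N arbitrary: \<phi> \<psi> A B)
  case 0
  have "norm (\<phi> x) * norm (\<psi> x) \<le> A * B"
    using jet_le_norm[OF 0(3)] jet_le_norm[OF 0(4)] jet_le_nonneg[OF 0(3)] by (intro mult_mono) auto
  then show ?case by (simp add: jet_le_def norm_mult)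
next
  case (Suc N)
  let ?d = "\<lambda>i \<phi> x. complex_of_real s * partial_deriv i \<phi> x"
  have A: "0 \<le> A" and B: "0 \<le> B" using Suc.prems jet_le_nonneg by blast+
  have \<phi>N: "jet_le N s A \<phi> x" and \<psi>N: "jet_le N s B \<psi> x"
    using Suc.prems(3,4) unfolding jet_le_def by auto
  have "norm (\<phi> x) * norm (\<psi> x) \<le> A * B"
    using jet_le_norm[OF Suc.prems(3)] jet_le_norm[OF Suc.prems(4)] A by (intro mult_mono) auto
  moreover have "A * B \<le> 2 ^ Suc N * (A * B)"
    using A B mult_right_mono[of 1 "2 ^ Suc N" "A * B"] one_le_power[of "2::real" "Suc N"] by simp
  ultimately have 1: "norm (\<phi> x * \<psi> x) \<le> 2 ^ Suc N * A * B" by (simp only: norm_mult mult.assoc)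
  have 2: "jet_le N s (2 ^ Suc N * A * B) (?d i (\<lambda>x. \<phi> x * \<psi> x)) x" for i
  proof -
    have sm: "smooth (?d i \<phi>)" "smooth (?d i \<psi>)"
      using Suc.prems by (auto intro: smooth_cmult smooth_partial_deriv)
    have j1: "jet_le N s A (?d i \<phi>) x" and j2: "jet_le N s B (?d i \<psi>) x"
      using Suc.prems by (auto simp: jet_le_Suc_iff)
    have "jet_le N s (2 ^ N * A * B + 2 ^ N * A * B) (\<lambda>x. ?d i \<phi> x * \<psi> x + \<phi> x * ?d i \<psi> x) x"
      using Suc.prems(1,2,5) sm
      by (intro jet_le_add smooth_mult[OF sm(1) Suc.prems(2)] smooth_mult[OF Suc.prems(1) sm(2)]
          Suc.IH[OF sm(1) Suc.prems(2) j1 \<psi>N] Suc.IH[OF Suc.prems(1) sm(2) \<phi>N j2])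
    moreover have "(\<lambda>x. ?d i \<phi> x * \<psi> x + \<phi> x * ?d i \<psi> x) = ?d i (\<lambda>x. \<phi> x * \<psi> x)"
      using Suc.prems by (simp add: partial_deriv_mult algebra_simps)
    ultimately show ?thesis by (simp add: algebra_simps)
  qed
  show ?case using Suc.prems 1 2 by (subst jet_le_Suc_iff) (auto intro: smooth_mult)
qed

section \<open>Test functions\<close>

lemma test_functions_iff:
  "\<phi> \<in> test_functions \<longleftrightarrow> smooth \<phi> \<and> (\<exists>r. \<forall>x. r < norm x --> \<phi> x = 0)"
proof -
  have "compact (supp \<phi>) \<longleftrightarrow> bounded {x. \<phi> x \<noteq> 0}" by (simp add: supp_def)
  also have "... \<longleftrightarrow> (\<exists>r. \<forall>x. r < norm x --> \<phi> x = 0)"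
    unfolding bounded_iff by (auto simp: not_le[symmetric])
  finally show ?thesis by (simp add: test_functions_def)
qed

lemma test_smooth: "\<phi> \<in> test_functions ==> smooth \<phi>" by (simp add: test_functions_def)

lemma test_add: "\<phi> \<in> test_functions ==> \<psi> \<in> test_functions ==> (\<lambda>x. \<phi> x + \<psi> x) \<in> test_functions"
  unfolding test_functions_iff by (auto intro!: smooth_add) (metis add.right_neutral max.strict_boundedE)

lemma test_mult: "smooth \<phi> ==> \<psi> \<in> test_functions ==> (\<lambda>x. \<phi> x * \<psi> x) \<in> test_functions"
  unfolding test_functions_iff by (auto intro!: smooth_mult)

lemma test_cmult: "\<psi> \<in> test_functions ==> (\<lambda>x. c * \<psi> x) \<in> test_functions"
  by (rule test_mult[OF smooth_const])

lemma test_diff: "\<phi> \<in> test_functions ==> \<psi> \<in> test_functions ==> (\<lambda>x. \<phi> x - \<psi> x) \<in> test_functions"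
  using test_add[OF _ test_cmult[of \<psi> "-1"], of \<phi>] by simp

lemma test_zero: "(\<lambda>x. 0) \<in> test_functions" by (auto simp: test_functions_iff smooth_const)

lemma test_sum:
  assumes "\<And>a. a \<in> I ==> \<phi> a \<in> test_functions"
  shows "(\<lambda>x. \<Sum>a\<in>I. \<phi> a x) \<in> test_functions"
  using assms by (induction I rule: infinite_finite_induct) (auto intro: test_zero test_add)

lemma test_affine:
  assumes "\<phi> \<in> test_functions" "c \<noteq> 0"
  shows "(\<lambda>w. \<phi> (z + c *\<^sub>R w)) \<in> test_functions"
proof -
  obtain r where sm: "smooth \<phi>" and r: "\<And>x. r < norm x ==> \<phi> x = 0"
    using assms by (auto simp: test_functions_iff)
  have "\<phi> (z + c *\<^sub>R w) = 0" if "(r + norm z) / \<bar>c\<bar> < norm w" for w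
  proof (rule r)
    have "r + norm z < \<bar>c\<bar> * norm w" using that assms(2) by (simp add: field_simps)
    also have "... = norm ((z + c *\<^sub>R w) - z)" by simp
    also have "... \<le> norm (z + c *\<^sub>R w) + norm z" by (rule norm_triangle_ineq4)
    finally show "r < norm (z + c *\<^sub>R w)" by simp
  qed
  then show ?thesis using sm smooth_affine by (auto simp: test_functions_iff)
qed

lemma partial_deriv_cong_open:
  assumes "open U" "x \<in> U" "\<And>y. y \<in> U ==> \<phi> y = \<psi> y"
  shows "partial_deriv i \<phi> x = partial_deriv i \<psi> x"
proof -
  have "(\<phi> has_derivative D) (at x) \<longleftrightarrow> (\<psi> has_derivative D) (at x)" for D
    using has_derivative_transform_within_open[of \<phi> D x UNIV U \<psi>]
      has_derivative_transform_within_open[of \<psi> D x UNIV U \<phi>] assms by auto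
  then show ?thesis unfolding partial_deriv_def frechet_derivative_def by simp
qed

lemma partial_derivs_cong_open:
  assumes "open U" "x \<in> U" "\<And>y. y \<in> U ==> \<phi> y = \<psi> y"
  shows "partial_derivs ds \<phi> x = partial_derivs ds \<psi> x" using assms(2)
proof (induction ds arbitrary: x)
  case (Cons d ds)
  show ?case unfolding partial_derivs_Cons by (rule partial_deriv_cong_open[OF assms(1) Cons.prems Cons.IH])
qed (use assms in simp)

lemma partial_derivs_eq_0_open:
  assumes "open U" "x \<in> U" "\<And>y. y \<in> U ==> \<phi> y = 0"
  shows "partial_derivs ds \<phi> x = 0"
proof -
  have "partial_derivs ds \<phi> x = partial_derivs ds (\<lambda>x. 0) x"
    by (rule partial_derivs_cong_open[OF assms(1,2)]) (rule assms(3))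
  then show ?thesis by (simp add: partial_derivs_zero)
qed

lemma partial_derivs_eq_0_norm:
  assumes "\<And>x. r < norm x ==> \<phi> x = 0" "r < norm x"
  shows "partial_derivs ds \<phi> x = 0" by (rule partial_derivs_eq_0_open[of "{x. r < norm x}"])
    (use assms in \<open>auto intro: open_Collect_less continuous_intros\<close>)

lemma test_partial_derivs: "\<phi> \<in> test_functions ==> partial_derivs ds \<phi> \<in> test_functions"
  unfolding test_functions_iff
proof (elim conjE exE, intro conjI)
  fix r assume sm: "smooth \<phi>" and r: "\<forall>x. r < norm x --> \<phi> x = 0"
  show "smooth (partial_derivs ds \<phi>)" using sm by (rule smooth_partial_derivs)
  have "partial_derivs ds \<phi> x = 0" if "r < norm x" for x
    using r that by (intro partial_derivs_eq_0_norm[of r]) auto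
  then show "\<exists>r. \<forall>x. r < norm x --> partial_derivs ds \<phi> x = 0" by blast
qed

lemma test_partial_deriv: "\<phi> \<in> test_functions ==> partial_deriv i \<phi> \<in> test_functions"
  using test_partial_derivs[of \<phi> "[i]"] by simp

lemma test_bounded:
  assumes "\<phi> \<in> test_functions"
  obtains B where "0 \<le> B" "\<And>x. norm (\<phi> x) \<le> B"
proof -
  obtain r where r: "\<And>x. r < norm x ==> \<phi> x = 0" using assms by (auto simp: test_functions_iff)
  have "compact (\<phi> ` cball 0 r)"
    using assms by (intro compact_continuous_image smooth_continuous_on test_smooth) auto
  then obtain B where B: "\<And>x. norm x \<le> r ==> norm (\<phi> x) \<le> B"
    using compact_imp_bounded bounded_iff by (metis imageI mem_cball_0)
  show ?thesis
  proof (rule that[of "max 0 B"])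
    show "norm (\<phi> x) \<le> max 0 B" for x using r[of x] B[of x] by (cases "r < norm x") auto
  qed auto
qed

lemma test_jet_bounded:
  fixes \<phi> :: "real^'n => complex"
  assumes "\<phi> \<in> test_functions"
  obtains M where "0 \<le> M" "\<And>x. jet_le N 1 M \<phi> x"
proof -
  have "\<exists>B. 0 \<le> B \<and> (\<forall>x. norm (partial_derivs ds \<phi> x) \<le> B)" for ds
    using test_bounded[OF test_partial_derivs[OF assms]] by metis
  then obtain B where B: "\<And>ds. 0 \<le> B ds" "\<And>ds x. norm (partial_derivs ds \<phi> x) \<le> B ds"
    by metis
  let ?L = "{ds :: 'n list. length ds \<le> N}"
  have fin: "finite ?L" using finite_lists_length_le[of "UNIV :: 'n set" N] by simp
  have "norm (partial_derivs ds \<phi> x) \<le> (\<Sum>ds\<in>?L. B ds)" if "length ds \<le> N" for ds x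
  proof -
    have "B ds \<le> (\<Sum>ds\<in>?L. B ds)" using fin that B(1) by (intro member_le_sum) auto
    with B(2)[of ds x] show ?thesis by linarith
  qed
  then show ?thesis by (intro that[of "\<Sum>ds\<in>?L. B ds"]) (auto simp: jet_le_def B sum_nonneg)
qed

lemma test_Lipschitz:
  fixes \<phi> :: "real^'n => complex"
  assumes "\<phi> \<in> test_functions"
  obtains L where "0 \<le> L" "\<And>x y. norm (\<phi> x - \<phi> y) \<le> L * norm (x - y)"
proof -
  have "\<exists>B. 0 \<le> B \<and> (\<forall>x. norm (partial_deriv i \<phi> x) \<le> B)" for i
    by (rule test_bounded[OF test_partial_deriv[OF assms, of i]]) blast
  then obtain B where B: "\<And>i. 0 \<le> B i" "\<And>i x. norm (partial_deriv i \<phi> x) \<le> B i" by metis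
  have "norm (\<phi> x - \<phi> y) \<le> sum B UNIV * norm (x - y)" for x y
  proof (rule differentiable_bound[where S = UNIV
        and f' = "\<lambda>x v. \<Sum>i\<in>UNIV. (v $ i) *\<^sub>R partial_deriv i \<phi> x"])
    show "(\<phi> has_derivative (\<lambda>v. \<Sum>i\<in>UNIV. (v $ i) *\<^sub>R partial_deriv i \<phi> x)) (at x within UNIV)" for x
      using assms by (simp add: has_derivative_partial smooth_differentiable test_smooth)
    show "onorm (\<lambda>v. \<Sum>i\<in>UNIV. (v $ i) *\<^sub>R partial_deriv i \<phi> x) \<le> sum B UNIV" for x
    proof (rule onorm_le)
      fix v :: "real^'n"
      have "norm (\<Sum>i\<in>UNIV. (v $ i) *\<^sub>R partial_deriv i \<phi> x) \<le> (\<Sum>i\<in>UNIV. B i * norm v)"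
        using B component_le_norm_cart[of v]
        by (intro sum_norm_le) (auto simp: mult.commute[of "B _"] intro!: mult_mono)
      then show "norm (\<Sum>i\<in>UNIV. (v $ i) *\<^sub>R partial_deriv i \<phi> x) \<le> sum B UNIV * norm v"
        by (simp add: sum_distrib_right)
    qed
  qed auto
  then show ?thesis using that[of "sum B UNIV"] B by (simp add: sum_nonneg)
qed

text \<open>A first-order Taylor bound that is uniform in the base point, as needed to differentiate under the
convolution integral.\<close>

lemma test_Taylor1:
  fixes \<phi> :: "real^'n => complex"
  assumes "\<phi> \<in> test_functions"
  obtains L where "0 \<le> L"
    "\<And>z v. norm (\<phi> (z + v) - \<phi> z - (\<Sum>i\<in>UNIV. (v $ i) *\<^sub>R partial_deriv i \<phi> z)) \<le> L * (norm v)\<^sup>2"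
proof -
  have "\<exists>B. 0 \<le> B \<and> (\<forall>x y. norm (partial_deriv i \<phi> x - partial_deriv i \<phi> y) \<le> B * norm (x - y))" for i
    by (rule test_Lipschitz[OF test_partial_deriv[OF assms, of i]]) blast
  then obtain B where B: "\<And>i. 0 \<le> B i"
      "\<And>i x y. norm (partial_deriv i \<phi> x - partial_deriv i \<phi> y) \<le> B i * norm (x - y)"
    by metis
  have "norm (\<phi> (z + v) - \<phi> z - (\<Sum>i\<in>UNIV. (v $ i) *\<^sub>R partial_deriv i \<phi> z)) \<le> sum B UNIV * (norm v)\<^sup>2" for z v
  proof -
    let ?r = "\<lambda>w. \<phi> (z + w) - (\<Sum>i\<in>UNIV. (w $ i) *\<^sub>R partial_deriv i \<phi> z)"
    let ?r' = "\<lambda>w u. \<Sum>i\<in>UNIV. (u $ i) *\<^sub>R (partial_deriv i \<phi> (z + w) - partial_deriv i \<phi> z)"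
    have "norm (?r v - ?r 0) \<le> (sum B UNIV * norm v) * norm (v - 0)"
    proof (rule differentiable_bound[where S = "cball 0 (norm v)" and f' = ?r'])
      fix w :: "real^'n" assume w: "w \<in> cball 0 (norm v)"
      have D: "(\<phi> has_derivative (\<lambda>u. \<Sum>i\<in>UNIV. (u $ i) *\<^sub>R partial_deriv i \<phi> (z + w))) (at (z + w))"
        using assms by (simp add: has_derivative_partial smooth_differentiable test_smooth)
      have "((\<lambda>w. \<phi> (z + w)) has_derivative (\<lambda>u. \<Sum>i\<in>UNIV. (u $ i) *\<^sub>R partial_deriv i \<phi> (z + w))) (at w)"
        by (rule has_derivative_compose[where f = "\<lambda>w. z + w" and g = \<phi>, OF _ D])
          (auto intro!: derivative_eq_intros)
      then have "(?r has_derivative ?r' w) (at w)"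
        by (rule derivative_eq_intros) (auto intro!: derivative_eq_intros bounded_linear.has_derivative[OF bounded_linear_vec_nth]
            simp: scaleR_diff_right sum_subtractf)
      then show "(?r has_derivative ?r' w) (at w within cball 0 (norm v))" by (rule has_derivative_at_withinI)
      show "onorm (?r' w) \<le> sum B UNIV * norm v"
      proof (rule onorm_le)
        fix u :: "real^'n"
        have "norm (?r' w u) \<le> (\<Sum>i\<in>UNIV. norm u * (B i * norm v))"
        proof (rule sum_norm_le)
          fix i
          have "norm (partial_deriv i \<phi> (z + w) - partial_deriv i \<phi> z) \<le> B i * norm w"
            using B(2)[of i "z + w" z] by simp
          also have "... \<le> B i * norm v" using w B(1) by (intro mult_left_mono) auto
          finally show "norm ((u $ i) *\<^sub>R (partial_deriv i \<phi> (z + w) - partial_deriv i \<phi> z)) \<le> norm u * (B i * norm v)"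
            using component_le_norm_cart[of u i] by (auto intro!: mult_mono)
        qed
        then show "norm (?r' w u) \<le> sum B UNIV * norm v * norm u"
          by (simp add: sum_distrib_left sum_distrib_right algebra_simps)
      qed
    qed auto
    then show ?thesis by (simp add: power2_eq_square algebra_simps)
  qed
  then show ?thesis using that[of "sum B UNIV"] B by (simp add: sum_nonneg)
qed

lemma borel_measurable_lebesgueI:
  "f \<in> borel_measurable borel ==> f \<in> borel_measurable lebesgue" by (simp add: measurable_completion)

lemma test_borel: "\<phi> \<in> test_functions ==> \<phi> \<in> borel_measurable borel"
  by (intro borel_measurable_continuous_onI smooth_continuous_on test_smooth)

lemma test_integrable:
  assumes "\<phi> \<in> test_functions" shows "integrable lebesgue \<phi>"
proof -
  obtain r where r: "\<And>x. r < norm x ==> \<phi> x = 0" using assms by (auto simp: test_functions_iff)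
  have "integrable lborel (\<lambda>x. indicator (cball 0 r) x *\<^sub>R \<phi> x)"
    using assms by (intro borel_integrable_compact smooth_continuous_on test_smooth) auto
  moreover have "(\<lambda>x. indicator (cball 0 r) x *\<^sub>R \<phi> x) = \<phi>"
    using r by (auto simp: indicator_def fun_eq_iff not_le)
  ultimately show ?thesis using test_borel[OF assms] by (simp add: integrable_completion)
qed

lemma lebesgue_integral_affine:
  fixes f :: "'a::euclidean_space => 'b::{banach, second_countable_topology}"
  assumes "f \<in> borel_measurable borel" "c \<noteq> 0"
  shows "(LINT x|lebesgue. f x) = \<bar>c\<bar> ^ DIM('a) *\<^sub>R (LINT x|lebesgue. f (t + c *\<^sub>R x))"
proof -
  have "(LINT x|lborel. f x) = \<bar>c\<bar> ^ DIM('a) *\<^sub>R (LINT x|lborel. f (t + c *\<^sub>R x))"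
    by (subst lborel_affine[OF assms(2), of t], subst integral_density)
      (use assms in \<open>auto simp: integral_distr\<close>)
  then show ?thesis using assms by (simp add: integral_completion)
qed

section \<open>Convolution with a test function\<close>

definition cv :: "(real^'n => complex) => (real^'n => complex) => real^'n => complex" where
  "cv k h x = (LINT y|lebesgue. k (x - y) * h y)"

lemma test_shift: "k \<in> test_functions ==> (\<lambda>y. k (x - y)) \<in> test_functions"
  using test_affine[of k "-1" x] by simp

lemma integrable_test_mult:
  assumes "k \<in> test_functions" "integrable lebesgue h"
  shows "integrable lebesgue (\<lambda>y. k y * h y)"
proof -
  obtain B where B: "0 \<le> B" "\<And>x. norm (k x) \<le> B" using test_bounded[OF assms(1)] by blast
  show ?thesis
  proof (rule Bochner_Integration.integrable_bound)
    show "integrable lebesgue (\<lambda>y. B * norm (h y))" using assms(2) by simp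
    show "(\<lambda>y. k y * h y) \<in> borel_measurable lebesgue"
      using assms(2) borel_measurable_lebesgueI[OF test_borel[OF assms(1)]] by (intro borel_measurable_times) auto
    show "AE y in lebesgue. norm (k y * h y) \<le> norm (B * norm (h y))"
      using B by (intro AE_I2) (auto simp: norm_mult intro!: mult_right_mono)
  qed
qed

lemma cv_integrable:
  assumes "k \<in> test_functions" "integrable lebesgue h"
  shows "integrable lebesgue (\<lambda>y. k (x - y) * h y)"
  by (rule integrable_test_mult[OF test_shift]) (use assms in auto)

lemma cv_has_derivative:
  fixes k :: "real^'n => complex"
  assumes k: "k \<in> test_functions" and h: "integrable lebesgue h"
  shows "(cv k h has_derivative (\<lambda>v. \<Sum>i\<in>UNIV. (v $ i) *\<^sub>R cv (partial_deriv i k) h x)) (at x)"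
proof -
  obtain L where L: "0 \<le> L"
    "\<And>z v. norm (k (z + v) - k z - (\<Sum>i\<in>UNIV. (v $ i) *\<^sub>R partial_deriv i k z)) \<le> L * (norm v)\<^sup>2"
    using test_Taylor1[OF k] by blast
  let ?D = "\<lambda>v. \<Sum>i\<in>UNIV. (v $ i) *\<^sub>R cv (partial_deriv i k) h x"
  let ?H = "LINT y|lebesgue. norm (h y)"
  have rem: "norm (cv k h (x + v) - cv k h x - ?D v) \<le> L * ?H * (norm v)\<^sup>2" for v
  proof -
    have int: "integrable lebesgue (\<lambda>y. k (x + v - y) * h y)" "integrable lebesgue (\<lambda>y. k (x - y) * h y)"
       "integrable lebesgue (\<lambda>y. partial_deriv i k (x - y) * h y)" for i
      using assms by (auto intro!: cv_integrable test_partial_deriv)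
    have eq: "cv k h (x + v) - cv k h x - ?D v =
      (LINT y|lebesgue. k (x + v - y) * h y - k (x - y) * h y - (\<Sum>i\<in>UNIV. (v $ i) *\<^sub>R (partial_deriv i k (x - y) * h y)))"
      unfolding cv_def using int by simp
    have "norm (cv k h (x + v) - cv k h x - ?D v) \<le> (LINT y|lebesgue. norm (k (x + v - y) * h y - k (x - y) * h y - (\<Sum>i\<in>UNIV. (v $ i) *\<^sub>R (partial_deriv i k (x - y) * h y))))"
      unfolding eq by (rule integral_norm_bound)
    also have "... \<le> (LINT y|lebesgue. L * (norm v)\<^sup>2 * norm (h y))"
    proof (rule integral_mono)
      fix y
      have gen: "a * c - b * c - (\<Sum>i\<in>UNIV. (v $ i) *\<^sub>R (p i * c)) = (a - b - (\<Sum>i\<in>UNIV. (v $ i) *\<^sub>R p i)) * c"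
        for a b c :: complex and p by (simp add: left_diff_distrib sum_distrib_right)
      have xv: "x - y + v = x + v - y" by simp
      have "k (x + v - y) * h y - k (x - y) * h y - (\<Sum>i\<in>UNIV. (v $ i) *\<^sub>R (partial_deriv i k (x - y) * h y))
        = (k ((x - y) + v) - k (x - y) - (\<Sum>i\<in>UNIV. (v $ i) *\<^sub>R partial_deriv i k (x - y))) * h y"
        unfolding xv by (rule gen)
      then show "norm (k (x + v - y) * h y - k (x - y) * h y - (\<Sum>i\<in>UNIV. (v $ i) *\<^sub>R (partial_deriv i k (x - y) * h y))) \<le> L * (norm v)\<^sup>2 * norm (h y)"
        using mult_right_mono[OF L(2)[of "x - y" v] norm_ge_zero[of "h y"]] by (simp only: norm_mult)
    qed (use int h in auto)
    also have "... = L * ?H * (norm v)\<^sup>2" using h by simp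
    finally show ?thesis .
  qed
  have H: "0 \<le> ?H" by simp
  have bl: "bounded_linear ?D" by (intro bounded_linear_sum bounded_linear_scaleR_const bounded_linear_vec_nth)
  show ?thesis unfolding has_derivative_at_alt
  proof (intro conjI bl allI impI)
    fix e :: real assume e: "0 < e"
    define d where "d = e / (L * ?H + 1)"
    have LH: "0 < L * ?H + 1" using L H by (simp add: add_nonneg_pos)
    have d: "0 < d" using e LH by (simp add: d_def)
    have "norm (cv k h y - cv k h x - ?D (y - x)) \<le> e * norm (y - x)" if "norm (y - x) < d" for y
    proof -
      have "norm (cv k h y - cv k h x - ?D (y - x)) \<le> L * ?H * (norm (y - x))\<^sup>2"
        using rem[of "y - x"] by simp
      also have "... = (L * ?H * norm (y - x)) * norm (y - x)" by (simp add: power2_eq_square)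
      also have "... \<le> e * norm (y - x)"
      proof (rule mult_right_mono)
        have "L * ?H * norm (y - x) \<le> (L * ?H + 1) * d"
          using that L H by (intro mult_mono) (auto intro!: mult_nonneg_nonneg)
        also have "... = e" using LH by (simp add: d_def)
        finally show "L * ?H * norm (y - x) \<le> e" .
      qed auto
      finally show ?thesis .
    qed
    then show "\<exists>d>0. \<forall>y. norm (y - x) < d --> norm (cv k h y - cv k h x - ?D (y - x)) \<le> e * norm (y - x)"
      using d by blast
  qed
qed

lemma partial_deriv_cv:
  fixes k :: "real^'n => complex"
  assumes "k \<in> test_functions" "integrable lebesgue h"
  shows "partial_deriv i (cv k h) = cv (partial_deriv i k) h"
proof
  fix x
  have "partial_deriv i (cv k h) x = (\<Sum>j\<in>UNIV. ((axis i 1 :: real^'n) $ j) *\<^sub>R cv (partial_deriv j k) h x)"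
    by (rule partial_deriv_eqI) (rule cv_has_derivative[OF assms])
  also have "... = (\<Sum>j\<in>UNIV. if j = i then cv (partial_deriv j k) h x else 0)"
    by (intro sum.cong) (auto simp: axis_def)
  finally show "partial_deriv i (cv k h) x = cv (partial_deriv i k) h x" by simp
qed

lemma partial_derivs_cv:
  assumes "k \<in> test_functions" "integrable lebesgue h"
  shows "partial_derivs ds (cv k h) = cv (partial_derivs ds k) h"
  using assms by (induction ds) (auto simp: partial_deriv_cv test_partial_derivs)

lemma smooth_cv:
  assumes "k \<in> test_functions" "integrable lebesgue h"
  shows "smooth (cv k h)" unfolding smooth_def
proof (intro allI)
  fix ds
  show "partial_derivs ds (cv k h) differentiable_on UNIV"
    unfolding partial_derivs_cv[OF assms] differentiable_on_def
    using cv_has_derivative[OF test_partial_derivs[OF assms(1)] assms(2)] differentiableI by blast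
qed

lemma cv_commute:
  assumes "k \<in> test_functions" "h \<in> test_functions"
  shows "cv k h x = cv h k x"
proof -
  have "(\<lambda>y. k (x - y) * h y) \<in> borel_measurable borel"
    using assms by (intro borel_measurable_times test_borel test_shift)
  from lebesgue_integral_affine[OF this, of "-1" x] show ?thesis by (simp add: cv_def mult.commute)
qed

lemma test_cv:
  assumes "k \<in> test_functions" "h \<in> test_functions"
  shows "cv k h \<in> test_functions"
proof -
  obtain r where r: "\<And>x. r < norm x ==> k x = 0" using assms by (auto simp: test_functions_iff)
  obtain r' where r': "\<And>x. r' < norm x ==> h x = 0" using assms by (auto simp: test_functions_iff)
  have "cv k h x = 0" if "r + r' < norm x" for x
  proof -
    have "k (x - y) * h y = 0" for y
    proof (cases "r' < norm y")
      case False
      then have "r < norm (x - y)" using that norm_triangle_ineq2[of x y] by linarith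
      then show ?thesis by (simp add: r)
    qed (simp add: r')
    then have "(\<lambda>y. k (x - y) * h y) = (\<lambda>_. 0)" by (rule ext)
    then show ?thesis by (simp only: cv_def integral_zero)
  qed
  then show ?thesis
    using assms smooth_cv[OF assms(1) test_integrable[OF assms(2)]] by (auto simp: test_functions_iff)
qed

lemma test_cv_integrable:
  assumes "k \<in> test_functions" "integrable lebesgue h" "\<And>x. r' < norm x ==> h x = 0"
  shows "cv k h \<in> test_functions"
proof -
  obtain r where r: "\<And>x. r < norm x ==> k x = 0" using assms by (auto simp: test_functions_iff)
  have "cv k h x = 0" if "r + r' < norm x" for x
  proof -
    have "k (x - y) * h y = 0" for y
    proof (cases "r' < norm y")
      case False
      then have "r < norm (x - y)" using that norm_triangle_ineq2[of x y] by linarith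
      then show ?thesis by (simp add: r)
    qed (simp add: assms(3))
    then have "(\<lambda>y. k (x - y) * h y) = (\<lambda>_. 0)" by (rule ext)
    then show ?thesis by (simp only: cv_def integral_zero)
  qed
  then show ?thesis using smooth_cv[OF assms(1,2)] by (auto simp: test_functions_iff)
qed

section \<open>A smooth bump\<close>

text \<open>The derivatives of \<open>exp (- 1 / t)\<close> are polynomials in \<open>1 / t\<close> times this function itself; the
recursion is the product rule.\<close>

primrec flat_poly :: "nat => real poly" where
  "flat_poly 0 = [:1:]"
| "flat_poly (Suc m) = [:0, 0, 1:] * (flat_poly m - pderiv (flat_poly m))"

definition flat_exp :: "nat => real => real" where
  "flat_exp m t = (if t \<le> 0 then 0 else poly (flat_poly m) (1 / t) * exp (- (1 / t)))"

lemma poly_exp_tendsto_0: "((\<lambda>s::real. poly p s * exp (- s)) \<longlongrightarrow> 0) at_top"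
proof -
  have "((\<lambda>s::real. \<Sum>i\<le>degree p. coeff p i * (s ^ i / exp s)) \<longlongrightarrow> (\<Sum>i\<le>degree p. coeff p i * 0)) at_top"
    by (intro tendsto_sum tendsto_mult tendsto_const tendsto_power_div_exp_0)
  then show ?thesis by (simp add: poly_altdef sum_distrib_right exp_minus divide_inverse mult.assoc)
qed

lemma flat_exp_has_derivative: "(flat_exp m has_real_derivative flat_exp (Suc m) t) (at t)"
proof (cases t "0::real" rule: linorder_cases)
  case less
  have "((\<lambda>_. 0) has_real_derivative 0) (at t)" by simp
  then have "(flat_exp m has_real_derivative 0) (at t)"
    by (rule DERIV_cong_ev[OF refl _ refl, THEN iffD1, rotated])
      (use less in \<open>auto simp: eventually_nhds flat_exp_def intro!: exI[of _ "{..<0}"]\<close>)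
  then show ?thesis using less by (simp add: flat_exp_def)
next
  case greater
  have "((\<lambda>t. poly (flat_poly m) (1 / t) * exp (- (1 / t))) has_real_derivative
      flat_exp (Suc m) t) (at t)" using greater by (auto intro!: derivative_eq_intros simp: flat_exp_def)
       (simp add: field_simps power2_eq_square)
  then show ?thesis by (rule DERIV_cong_ev[OF refl _ refl, THEN iffD1, rotated])
      (use greater in \<open>auto simp: eventually_nhds flat_exp_def intro!: exI[of _ "{0<..}"]\<close>)
next
  case equal
  have "((\<lambda>h. flat_exp m h / h) \<longlongrightarrow> 0) (at_right 0)"
  proof -
    have "((\<lambda>h. poly ([:0, 1:] * flat_poly m) (inverse h) * exp (- inverse h)) \<longlongrightarrow> 0) (at_right (0::real))"
      by (rule filterlim_compose[OF poly_exp_tendsto_0 filterlim_inverse_at_top_right])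
    then show ?thesis by (rule Lim_transform_eventually)
        (auto simp: eventually_at_right_field flat_exp_def divide_inverse intro!: exI[of _ 1])
  qed
  moreover have "((\<lambda>h. flat_exp m h / h) \<longlongrightarrow> 0) (at_left 0)"
    by (rule Lim_transform_eventually[OF tendsto_const])
      (auto simp: eventually_at_left_field flat_exp_def intro!: exI[of _ "-1"])
  ultimately have "((\<lambda>h. flat_exp m h / h) \<longlongrightarrow> 0) (at 0)"
    by (rule filterlim_split_at_real[rotated])
  then show ?thesis using equal by (simp add: has_field_derivative_iff flat_exp_def)
qed

definition corner_bump :: "('n => nat) => real^'n => complex" where
  "corner_bump m x = complex_of_real (\<Prod>i\<in>UNIV. flat_exp (m i) (x $ i))"

lemma corner_bump_has_derivative:
  "(corner_bump m has_derivative (\<lambda>y. complex_of_real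
     (\<Sum>i\<in>UNIV. (y $ i * flat_exp (Suc (m i)) (x $ i)) * (\<Prod>j\<in>UNIV - {i}. flat_exp (m j) (x $ j))))) (at x)"
proof -
  have *: "((\<lambda>x. flat_exp (m i) (x $ i)) has_derivative (\<lambda>y. y $ i * flat_exp (Suc (m i)) (x $ i))) (at x)" for i
    by (rule has_derivative_compose[where f = "\<lambda>x. x $ i" and g = "flat_exp (m i)",
          OF bounded_linear.has_derivative[OF bounded_linear_vec_nth has_derivative_ident]])
      (use flat_exp_has_derivative[of "m i" "x $ i"] in \<open>simp add: has_field_derivative_def mult_commute_abs\<close>)
  show ?thesis unfolding corner_bump_def by (intro has_derivative_of_real has_derivative_prod *)
qed

lemma partial_deriv_corner_bump: "partial_deriv k (corner_bump m) = corner_bump (m(k := Suc (m k)))"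
proof
  fix x
  let ?t = "\<lambda>i. flat_exp (Suc (m i)) (x $ i) * (\<Prod>j\<in>UNIV - {i}. flat_exp (m j) (x $ j))"
  have "partial_deriv k (corner_bump m) x = complex_of_real
     (\<Sum>i\<in>UNIV. ((axis k 1 :: real^'a) $ i * flat_exp (Suc (m i)) (x $ i)) * (\<Prod>j\<in>UNIV - {i}. flat_exp (m j) (x $ j)))"
    by (rule partial_deriv_eqI) (rule corner_bump_has_derivative)
  also have "(\<Sum>i\<in>UNIV. ((axis k 1 :: real^'a) $ i * flat_exp (Suc (m i)) (x $ i)) * (\<Prod>j\<in>UNIV - {i}. flat_exp (m j) (x $ j)))
    = (\<Sum>i\<in>UNIV. if i = k then ?t i else 0)" by (intro sum.cong) (auto simp: axis_def)
  also have "... = ?t k" by simp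
  also have "... = (\<Prod>i\<in>UNIV. flat_exp ((m(k := Suc (m k))) i) (x $ i))"
    by (subst prod.remove[of UNIV k]) (auto intro!: prod.cong)
  finally show "partial_deriv k (corner_bump m) x = corner_bump (m(k := Suc (m k))) x"
    by (simp only: corner_bump_def[of "m(k := Suc (m k))"])
qed

lemma smooth_corner_bump: "smooth (corner_bump m)"
  by (rule smooth_coinduct[where P = "\<lambda>\<phi>. \<exists>m. \<phi> = corner_bump m"])
    (auto simp: partial_deriv_corner_bump intro: differentiableI corner_bump_has_derivative)

lemma mollifier_exists:
  "\<exists>\<kappa> :: real^'n => real. (\<lambda>x. complex_of_real (\<kappa> x)) \<in> test_functions \<and> (\<forall>x. 0 \<le> \<kappa> x) \<and>
     (\<forall>x. 1 \<le> norm x --> \<kappa> x = 0) \<and> (LINT x|lebesgue. \<kappa> x) = 1"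
proof -
  define n where "n = real CARD('n)"
  have n: "0 < n" by (simp add: n_def)
  define p where "p c x = (\<Prod>i\<in>UNIV. flat_exp 0 (((\<chi> i. 1) + c *\<^sub>R x :: real^'n) $ i))" for c and x :: "real^'n"
  define \<kappa> where "\<kappa> x = p n x * p (- n) x" for x
  have pb: "complex_of_real (p c x) = corner_bump (\<lambda>_. 0) ((\<chi> i. 1) + c *\<^sub>R x)" for c x
    by (simp add: p_def corner_bump_def)
  have flat0: "0 \<le> flat_exp 0 t" for t by (simp add: flat_exp_def)
  have pos: "0 \<le> \<kappa> x" for x
    unfolding \<kappa>_def p_def by (intro mult_nonneg_nonneg prod_nonneg flat0)
  have zero: "\<kappa> x = 0" if "1 \<le> norm x" for x
  proof -
    have "\<exists>i. 1 \<le> n * \<bar>x $ i\<bar>"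
    proof (rule ccontr)
      assume "\<not> ?thesis"
      then have "\<bar>x $ i\<bar> < 1 / n" for i using n by (simp add: field_simps not_le)
      then have "(\<Sum>i\<in>UNIV. \<bar>x $ i\<bar>) < (\<Sum>i\<in>(UNIV::'n set). 1 / n)"
        by (intro sum_strict_mono) auto
      then show False using norm_le_l1_cart[of x] that by (simp add: n_def)
    qed
    then obtain i where "1 \<le> n * \<bar>x $ i\<bar>" by blast
    then have "flat_exp 0 (1 + n * x $ i) = 0 \<or> flat_exp 0 (1 - n * x $ i) = 0"
      by (auto simp: flat_exp_def abs_if split: if_splits)
    then show ?thesis unfolding \<kappa>_def p_def by (auto simp: prod_zero_iff)
  qed
  have sm: "smooth (\<lambda>x. complex_of_real (\<kappa> x))"
    unfolding \<kappa>_def of_real_mult pb by (intro smooth_mult smooth_affine smooth_corner_bump)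
  have test: "(\<lambda>x. complex_of_real (\<kappa> x)) \<in> test_functions"
    unfolding test_functions_iff using sm zero by (auto intro!: exI[of _ 1])
  have int: "integrable lebesgue \<kappa>" using integrable_Re[OF test_integrable[OF test]] by simp
  have cont: "continuous_on UNIV \<kappa>"
    using continuous_on_Re[OF smooth_continuous_on[OF sm, of UNIV]] by simp
  have "(LINT x|lebesgue. \<kappa> x) \<noteq> 0"
  proof
    assume "(LINT x|lebesgue. \<kappa> x) = 0"
    then have "AE x in lebesgue. \<kappa> x = 0" using int pos by (subst (asm) integral_nonneg_eq_0_iff_AE) auto
    then have "negligible {x. \<kappa> x \<noteq> 0}"
      by (simp add: negligible_iff_null_sets AE_iff_null_sets[symmetric] completion.AE_iff_null_sets) 
    moreover have "open {x. \<kappa> x \<noteq> 0}"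
      using open_Collect_neq[OF cont continuous_on_const[of UNIV 0]] by simp
    moreover have "\<kappa> 0 \<noteq> 0" by (auto simp: \<kappa>_def p_def flat_exp_def)
    ultimately show False using open_not_negligible by blast
  qed
  moreover have "0 \<le> (LINT x|lebesgue. \<kappa> x)" using pos by simp
  ultimately have c: "0 < (LINT x|lebesgue. \<kappa> x)" by simp
  define c where "c = (LINT x|lebesgue. \<kappa> x)"
  show ?thesis
  proof (intro exI[of _ "\<lambda>x. inverse c * \<kappa> x"] conjI allI impI)
    show "(\<lambda>x. complex_of_real (inverse c * \<kappa> x)) \<in> test_functions"
      unfolding of_real_mult using test by (rule test_cmult)
  qed (use pos zero c int in \<open>auto simp: c_def\<close>)
qed

definition mollifier :: "real^'n => real" where
  "mollifier = (SOME \<kappa>. (\<lambda>x. complex_of_real (\<kappa> x)) \<in> test_functions \<and> (\<forall>x. 0 \<le> \<kappa> x) \<and>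
     (\<forall>x. 1 \<le> norm x --> \<kappa> x = 0) \<and> (LINT x|lebesgue. \<kappa> x) = 1)"

lemma mollifier_test: "(\<lambda>x. complex_of_real (mollifier x)) \<in> test_functions"
  and mollifier_nonneg: "0 \<le> mollifier x"
  and mollifier_zero: "1 \<le> norm x ==> mollifier x = 0"
  and mollifier_integral: "(LINT x|lebesgue. mollifier x) = 1"
  using someI_ex[OF mollifier_exists] unfolding mollifier_def by blast+

definition moll :: "real => real^'n => complex" where
  "moll a x = complex_of_real (mollifier ((1 / a) *\<^sub>R x) / a ^ CARD('n))"

lemma moll_eq:
  "moll a = (\<lambda>x. complex_of_real (1 / a ^ CARD('n)) * complex_of_real (mollifier (0 + (1 / a) *\<^sub>R (x :: real^'n))))"
  by (auto simp: moll_def fun_eq_iff)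

lemma moll_test: "0 < a ==> moll a \<in> test_functions"
  unfolding moll_eq by (intro test_cmult test_affine[OF mollifier_test]) auto

lemma moll_zero: "0 < a ==> a \<le> norm x ==> moll a x = 0" by (simp add: moll_def mollifier_zero)

lemma moll_norm: "0 < a ==> norm (moll a x) = Re (moll a x)"
  unfolding moll_def norm_of_real Re_complex_of_real by (simp add: mollifier_nonneg)

lemma integral_moll:
  assumes "0 < a" shows "(LINT x|lebesgue. moll a (x :: real^'n)) = 1"
proof -
  have "(LINT x|lebesgue. complex_of_real (mollifier (x :: real^'n))) =
      \<bar>1 / a\<bar> ^ CARD('n) *\<^sub>R (LINT x|lebesgue. complex_of_real (mollifier (0 + (1 / a) *\<^sub>R (x :: real^'n))))"
    using lebesgue_integral_affine[OF test_borel[OF mollifier_test], of "1 / a" 0] assms by simp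
  also have "... = (LINT x|lebesgue. moll a (x :: real^'n))"
    using assms unfolding moll_eq by (simp add: scaleR_conv_of_real power_one_over)
  finally show ?thesis by (simp add: mollifier_integral)
qed

lemma integral_norm_moll:
  assumes "0 < a" shows "(LINT x|lebesgue. norm (moll a (x :: real^'n))) = 1"
proof -
  have "(LINT x|lebesgue. norm (moll a (x :: real^'n))) = Re (LINT x|lebesgue. moll a (x :: real^'n))"
    using assms by (simp add: moll_norm test_integrable moll_test)
  then show ?thesis using assms by (simp add: integral_moll)
qed

lemma jet_le_affine:
  assumes "smooth \<phi>" "jet_le N s M \<phi> (z + c *\<^sub>R w)" "0 \<le> t" "t * \<bar>c\<bar> \<le> s"
  shows "jet_le N t M (\<lambda>w. \<phi> (z + c *\<^sub>R w)) w" unfolding jet_le_def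
proof (intro allI impI)
  fix ds :: "'a list" assume "length ds \<le> N"
  then have "s ^ length ds * norm (partial_derivs ds \<phi> (z + c *\<^sub>R w)) \<le> M"
    using assms by (simp add: jet_leD)
  moreover have "t ^ length ds * norm (partial_derivs ds (\<lambda>w. \<phi> (z + c *\<^sub>R w)) w) =
      (t * \<bar>c\<bar>) ^ length ds * norm (partial_derivs ds \<phi> (z + c *\<^sub>R w))"
    using assms by (simp add: partial_derivs_affine norm_mult norm_power power_mult_distrib)
  moreover have "(t * \<bar>c\<bar>) ^ length ds * norm (partial_derivs ds \<phi> (z + c *\<^sub>R w)) \<le>
      s ^ length ds * norm (partial_derivs ds \<phi> (z + c *\<^sub>R w))"
    using assms by (intro mult_right_mono power_mono) auto
  ultimately show "t ^ length ds * norm (partial_derivs ds (\<lambda>w. \<phi> (z + c *\<^sub>R w)) w) \<le> M"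
    by simp
qed

lemma moll_jet:
  obtains C where "0 \<le> C"
    "\<And>a (x :: real^'n). 0 < a ==> jet_le N a (C / a ^ CARD('n)) (moll a) x"
proof -
  obtain C where C: "0 \<le> C" "\<And>x :: real^'n. jet_le N 1 C (\<lambda>x. complex_of_real (mollifier x)) x"
    using test_jet_bounded[OF mollifier_test] by blast
  have "jet_le N a (C / a ^ CARD('n)) (moll a) x" if a: "0 < a" for a and x :: "real^'n"
  proof -
    have sm: "smooth (\<lambda>x :: real^'n. complex_of_real (mollifier x))"
      by (rule test_smooth[OF mollifier_test])
    have "jet_le N a (norm (complex_of_real (1 / a ^ CARD('n))) * C) (moll a) x" unfolding moll_eq
      by (intro jet_le_cmult jet_le_affine[OF sm C(2)] smooth_affine[OF sm]) (use a in auto)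
    then show ?thesis using a by (simp add: norm_divide norm_power)
  qed
  with C that show ?thesis by blast
qed

section \<open>Mollification and its iterated residual\<close>

lemma measure_cball_le:
  assumes "0 \<le> a"
  shows "measure lebesgue (cball (x :: real^'n) a) \<le> (2 * a) ^ CARD('n)"
proof -
  have sub: "cball x a \<subseteq> cbox (x - (\<chi> i. a)) (x + (\<chi> i. a))"
  proof
    fix y assume "y \<in> cball x a"
    then have "\<bar>(y - x) $ i\<bar> \<le> a" for i
      using component_le_norm_cart[of "y - x" i] by (simp add: dist_norm norm_minus_commute)
    then show "y \<in> cbox (x - (\<chi> i. a)) (x + (\<chi> i. a))"
      by (auto simp: mem_box_cart abs_le_iff algebra_simps)
  qed
  have "measure lebesgue (cball x a) \<le> measure lebesgue (cbox (x - (\<chi> i. a)) (x + (\<chi> i. a)))"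
    using sub by (intro measure_mono_fmeasurable) auto
  also have "... = (2 * a) ^ CARD('n)" using assms by (simp add: content_cbox_if_cart interval_eq_empty_cart)
  finally show ?thesis .
qed

lemma cv_moll_norm_le:
  fixes h :: "real^'n => complex"
  assumes k: "k \<in> test_functions" and h: "integrable lebesgue h"
    and kz: "\<And>y. a < norm y ==> k y = 0" and kB: "\<And>y. norm (k y) \<le> B"
  shows "norm (cv k h x) \<le> B * (LINT y|lebesgue. indicator (cball x a) y * norm (h y))"
proof -
  have i: "integrable lebesgue (\<lambda>y. indicator (cball x a) y * norm (h y))"
    using integrable_real_mult_indicator[of "cball x a" lebesgue "\<lambda>y. norm (h y)"] h by (simp add: mult.commute)
  have "norm (cv k h x) \<le> (LINT y|lebesgue. norm (k (x - y) * h y))"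
    unfolding cv_def by (rule integral_norm_bound)
  also have "... \<le> (LINT y|lebesgue. B * (indicator (cball x a) y * norm (h y)))"
  proof (rule integral_mono)
    fix y
    show "norm (k (x - y) * h y) \<le> B * (indicator (cball x a) y * norm (h y))"
    proof (cases "y \<in> cball x a")
      case True
      then show ?thesis using mult_right_mono[OF kB[of "x - y"] norm_ge_zero[of "h y"]] by (simp add: norm_mult)
    next
      case False
      then have "k (x - y) = 0" by (intro kz) (simp add: dist_norm)
      then show ?thesis using False by simp
    qed
  qed (use i cv_integrable[OF k h] in auto)
  finally show ?thesis by simp
qed

text \<open>All derivatives fall on the mollifier, so that they cost powers of its scale and the mean of the
function only.\<close>

lemma jet_le_cv_moll:
  obtains C where "1 \<le> C"
    "\<And>a (h :: real^'n => complex) x. 0 < a ==> integrable lebesgue h ==>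
      jet_le N a (C / a ^ CARD('n) * (LINT y|lebesgue. indicator (cball x a) y * norm (h y))) (cv (moll a) h) x"
proof -
  obtain C where C: "0 \<le> C" "\<And>a (x :: real^'n). 0 < a ==> jet_le N a (C / a ^ CARD('n)) (moll a) x"
    using moll_jet by blast
  let ?C = "max 1 C"
  have "jet_le N a (?C / a ^ CARD('n) * (LINT y|lebesgue. indicator (cball x a) y * norm (h y))) (cv (moll a) h) x"
    if a: "0 < a" and h: "integrable lebesgue h" for a and h :: "real^'n => complex" and x unfolding jet_le_def
  proof (intro allI impI)
    fix ds :: "'n list" assume ds: "length ds \<le> N"
    let ?I = "LINT y|lebesgue. indicator (cball x a) y * norm (h y)"
    have I: "0 \<le> ?I" by (intro integral_nonneg_AE) auto
    have "norm (cv (partial_derivs ds (moll a)) h x) \<le> (C / a ^ CARD('n) / a ^ length ds) * ?I"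
    proof (rule cv_moll_norm_le[OF test_partial_derivs[OF moll_test[OF a]] h])
      show "partial_derivs ds (moll a) y = 0" if "a < norm y" for y
        by (rule partial_derivs_eq_0_norm[OF moll_zero[OF a less_imp_le] that])
      show "norm (partial_derivs ds (moll a) y) \<le> C / a ^ CARD('n) / a ^ length ds" for y
        using jet_leD[OF C(2)[OF a] ds, of y] a by (simp add: field_simps)
    qed
    then have "a ^ length ds * norm (partial_derivs ds (cv (moll a) h) x) \<le>
       a ^ length ds * ((C / a ^ CARD('n) / a ^ length ds) * ?I)"
      using a h by (intro mult_left_mono) (auto simp: partial_derivs_cv moll_test)
    also have "... = C / a ^ CARD('n) * ?I" using a by simp
    also have "... \<le> ?C / a ^ CARD('n) * ?I" using a I by (intro mult_right_mono divide_right_mono) auto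
    finally show "a ^ length ds * norm (partial_derivs ds (cv (moll a) h) x) \<le> ?C / a ^ CARD('n) * ?I" .
  qed
  then show ?thesis using that[of ?C] by simp
qed

definition mollify :: "real => (real^'n => complex) => real^'n => complex" where
  "mollify a h = cv h (moll a)"

definition resid :: "real => (real^'n => complex) => real^'n => complex" where
  "resid a h x = h x - mollify a h x"

lemma resid_pow_Suc:
  "(resid a ^^ Suc j) h x = (resid a ^^ j) h x - mollify a ((resid a ^^ j) h) x"
  by (simp only: funpow.simps o_apply resid_def)

context
  fixes a :: real
  assumes a: "0 < a"
begin

lemma mollify_eq: "h \<in> test_functions ==> mollify a h = cv (moll a) h"
  unfolding mollify_def using cv_commute[OF _ moll_test[OF a]] by blast

lemma test_mollify: "h \<in> test_functions ==> mollify a h \<in> test_functions"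
  unfolding mollify_def using moll_test[OF a] by (intro test_cv)

lemma test_resid: "h \<in> test_functions ==> resid a h \<in> test_functions"
  using test_diff[OF _ test_mollify, of h h] unfolding resid_def[abs_def] by simp

lemma test_resid_pow: "h \<in> test_functions ==> (resid a ^^ j) h \<in> test_functions"
  by (induction j) (auto intro: test_resid)

lemma partial_derivs_mollify:
  "h \<in> test_functions ==> partial_derivs ds (mollify a h) = mollify a (partial_derivs ds h)"
  unfolding mollify_def by (rule partial_derivs_cv[OF _ test_integrable[OF moll_test[OF a]]])

lemma partial_derivs_resid:
  assumes "h \<in> test_functions"
  shows "partial_derivs ds (resid a h) = resid a (partial_derivs ds h)"
  using partial_derivs_diff[OF test_smooth[OF assms] test_smooth[OF test_mollify[OF assms]], of ds]
    partial_derivs_mollify[OF assms, of ds] by (simp add: resid_def[abs_def])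

lemma partial_derivs_resid_pow:
  assumes "h \<in> test_functions"
  shows "partial_derivs ds ((resid a ^^ j) h) = (resid a ^^ j) (partial_derivs ds h)"
  by (induction j) (simp_all add: partial_derivs_resid test_resid_pow assms)

lemma mollify_diff:
  assumes "g \<in> test_functions" "h \<in> test_functions"
  shows "mollify a (\<lambda>x. g x - h x) = (\<lambda>x. mollify a g x - mollify a h x)"
proof
  fix x
  have "integrable lebesgue (\<lambda>y. g (x - y) * moll a y)" "integrable lebesgue (\<lambda>y. h (x - y) * moll a y)"
    using assms by (auto intro: cv_integrable test_integrable[OF moll_test[OF a]])
  then show "mollify a (\<lambda>x. g x - h x) x = mollify a g x - mollify a h x"
    unfolding mollify_def cv_def left_diff_distrib by (rule Bochner_Integration.integral_diff)
qed

lemma mollify_add: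
  assumes "g \<in> test_functions" "h \<in> test_functions"
  shows "mollify a (\<lambda>x. g x + h x) = (\<lambda>x. mollify a g x + mollify a h x)"
proof
  fix x
  have "integrable lebesgue (\<lambda>y. g (x - y) * moll a y)" "integrable lebesgue (\<lambda>y. h (x - y) * moll a y)"
    using assms by (auto intro: cv_integrable test_integrable[OF moll_test[OF a]])
  then show "mollify a (\<lambda>x. g x + h x) x = mollify a g x + mollify a h x"
    unfolding mollify_def cv_def distrib_right by (rule Bochner_Integration.integral_add)
qed

lemma mollify_cmult: "mollify a (\<lambda>x. c * h x) = (\<lambda>x. c * mollify a h x)"
  unfolding mollify_def cv_def by (simp add: mult.assoc)

lemma resid_pow_add:
  assumes "g \<in> test_functions" "h \<in> test_functions"
  shows "(resid a ^^ j) (\<lambda>x. g x + h x) = (\<lambda>x. (resid a ^^ j) g x + (resid a ^^ j) h x)"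
proof (induction j)
  case (Suc j)
  show ?case by (rule ext) (simp add: Suc resid_pow_Suc mollify_add test_resid_pow assms del: funpow.simps)
qed simp

lemma resid_pow_cmult: "(resid a ^^ j) (\<lambda>x. c * h x) = (\<lambda>x. c * (resid a ^^ j) h x)"
proof (induction j)
  case (Suc j)
  show ?case by (rule ext) (simp add: Suc resid_pow_Suc mollify_cmult right_diff_distrib del: funpow.simps)
qed simp

lemma mollify_resid_pow:
  assumes "h \<in> test_functions"
  shows "mollify a ((resid a ^^ j) h) = (resid a ^^ j) (mollify a h)"
proof (induction j)
  case (Suc j)
  have "mollify a ((resid a ^^ Suc j) h) = (\<lambda>x. mollify a ((resid a ^^ j) h) x - mollify a (mollify a ((resid a ^^ j) h)) x)"
  proof -
    have "resid a ((resid a ^^ j) h) = (\<lambda>x. (resid a ^^ j) h x - mollify a ((resid a ^^ j) h) x)"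
      by (rule ext) (simp add: resid_def)
    then show ?thesis
      using mollify_diff[OF test_resid_pow[OF assms] test_mollify[OF test_resid_pow[OF assms]], of j j] by simp
  qed
  moreover have "(resid a ^^ Suc j) (mollify a h) = (\<lambda>x. mollify a ((resid a ^^ j) h) x - mollify a (mollify a ((resid a ^^ j) h)) x)"
    by (rule ext) (simp only: resid_pow_Suc Suc)
  ultimately show ?case by (simp only:)
qed simp

lemma cv_moll_approx:
  fixes h :: "real^'n => complex"
  assumes h: "integrable lebesgue h" and K: "\<And>y. y \<in> cball x a ==> norm (h y - c) \<le> K"
  shows "norm (cv (moll a) h x - c) \<le> K"
proof -
  let ?m = "\<lambda>y :: real^'n. moll a (x - y)"
  have mi: "integrable lebesgue ?m" by (rule test_integrable[OF test_shift[OF moll_test[OF a]]])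
  have sub: "(LINT y|lebesgue. g (x - y)) = (LINT y|lebesgue. g y)" if "g \<in> borel_measurable borel"
    for g :: "real^'n => 'b::{banach, second_countable_topology}"
    using lebesgue_integral_affine[OF that, of "-1" x] by simp
  have mb: "moll a \<in> borel_measurable (borel :: (real^'n) measure)" by (rule test_borel[OF moll_test[OF a]])
  have m1: "(LINT y|lebesgue. ?m y) = 1" using sub[OF mb] by (simp add: integral_moll[OF a])
  have m2: "(LINT y|lebesgue. norm (?m y)) = 1"
    using sub[of "\<lambda>y. norm (moll a y)"] mb by (simp add: integral_norm_moll[OF a])
  have i: "integrable lebesgue (\<lambda>y. ?m y * h y)" by (rule cv_integrable[OF moll_test[OF a] h])
  have "cv (moll a) h x - c = (LINT y|lebesgue. ?m y * h y) - (LINT y|lebesgue. ?m y * c)"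
    using m1 by (simp add: cv_def)
  also have "... = (LINT y|lebesgue. ?m y * h y - ?m y * c)" using i mi by simp
  finally have eq: "cv (moll a) h x - c = (LINT y|lebesgue. ?m y * h y - ?m y * c)" .
  have "norm (cv (moll a) h x - c) \<le> (LINT y|lebesgue. norm (?m y * h y - ?m y * c))"
    unfolding eq by (rule integral_norm_bound)
  also have "... \<le> (LINT y|lebesgue. K * norm (?m y))"
  proof (rule integral_mono)
    fix y
    show "norm (?m y * h y - ?m y * c) \<le> K * norm (?m y)"
    proof (cases "norm (x - y) < a")
      case True
      then have "norm (h y - c) \<le> K" by (intro K) (simp add: dist_norm)
      then show ?thesis
        by (simp only: right_diff_distrib[symmetric] norm_mult mult.commute[of "norm (?m y)"] mult_right_mono norm_ge_zero)
    next
      case False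
      then have "?m y = 0" by (intro moll_zero[OF a]) simp
      then show ?thesis by simp
    qed
  qed (use i mi in auto)
  also have "... = K" using m2 by simp
  finally show ?thesis .
qed

lemma resid_norm_le:
  assumes h: "h \<in> test_functions" and K: "\<And>y. y \<in> cball x a ==> norm (h x - h y) \<le> K"
  shows "norm (resid a h x) \<le> K" using cv_moll_approx[OF test_integrable[OF h], of x "h x" K] K
  by (simp add: resid_def mollify_eq[OF h] norm_minus_commute)

lemma resid_pow_local:
  assumes "h \<in> test_functions" "\<And>y. y \<in> cball x (real j * a) ==> norm (h y) \<le> M"
  shows "norm ((resid a ^^ j) h x) \<le> 2 ^ j * M" using assms(2)
proof (induction j arbitrary: x)
  case 0
  then show ?case using a by simp
next
  case (Suc j)
  have *: "norm ((resid a ^^ j) h y) \<le> 2 ^ j * M" if y: "y \<in> cball x a" for y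
  proof (rule Suc.IH)
    fix z assume "z \<in> cball y (real j * a)"
    then have "dist x z \<le> a + real j * a" using y dist_triangle[of x z y] by simp
    then show "norm (h z) \<le> M" by (intro Suc.prems) (simp add: algebra_simps)
  qed
  have "norm (resid a ((resid a ^^ j) h) x) \<le> 2 ^ j * M + 2 ^ j * M"
  proof (rule resid_norm_le[OF test_resid_pow[OF assms(1)]])
    fix y assume "y \<in> cball x a"
    then have "norm ((resid a ^^ j) h x) \<le> 2 ^ j * M" "norm ((resid a ^^ j) h y) \<le> 2 ^ j * M"
      using a by (auto intro!: *)
    then show "norm ((resid a ^^ j) h x - (resid a ^^ j) h y) \<le> 2 ^ j * M + 2 ^ j * M"
      using norm_triangle_ineq4[of "(resid a ^^ j) h x" "(resid a ^^ j) h y"] by linarith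
  qed
  then show ?case by (simp add: mult.commute mult.left_commute)
qed

lemma resid_gain:
  fixes h :: "real^'n => complex"
  assumes h: "h \<in> test_functions" and M: "\<And>i x. norm (partial_deriv i h x) \<le> M"
  shows "norm (resid a h x) \<le> real CARD('n) * a * M"
proof (rule resid_norm_le[OF h])
  have M0: "0 \<le> M" using M order_trans[OF norm_ge_zero] by blast
  fix y assume y: "y \<in> cball x a"
  have "norm (h x - h y) \<le> (real CARD('n) * M) * norm (x - y)"
  proof (rule differentiable_bound[where S = UNIV
        and f' = "\<lambda>x v. \<Sum>i\<in>UNIV. (v $ i) *\<^sub>R partial_deriv i h x"])
    show "(h has_derivative (\<lambda>v. \<Sum>i\<in>UNIV. (v $ i) *\<^sub>R partial_deriv i h x)) (at x within UNIV)" for x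
      using h by (simp add: has_derivative_partial smooth_differentiable test_smooth)
    show "onorm (\<lambda>v. \<Sum>i\<in>UNIV. (v $ i) *\<^sub>R partial_deriv i h x) \<le> real CARD('n) * M" for x
    proof (rule onorm_le)
      fix v :: "real^'n"
      have "norm (\<Sum>i\<in>UNIV. (v $ i) *\<^sub>R partial_deriv i h x) \<le> (\<Sum>i\<in>(UNIV::'n set). M * norm v)"
        using M component_le_norm_cart[of v] M0
        by (intro sum_norm_le) (auto simp: mult.commute[of M] intro!: mult_mono)
      then show "norm (\<Sum>i\<in>UNIV. (v $ i) *\<^sub>R partial_deriv i h x) \<le> real CARD('n) * M * norm v"
        by simp
    qed
  qed auto
  also have "... \<le> (real CARD('n) * M) * a" using y M0 by (intro mult_left_mono) (auto simp: dist_norm)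
  finally show "norm (h x - h y) \<le> real CARD('n) * a * M" by (simp add: algebra_simps)
qed

lemma resid_pow_gain:
  fixes h :: "real^'n => complex"
  assumes "h \<in> test_functions" "\<And>ds x. length ds = j ==> norm (partial_derivs ds h x) \<le> M"
  shows "norm ((resid a ^^ j) h x) \<le> (real CARD('n) * a) ^ j * M" using assms
proof (induction j arbitrary: h x)
  case 0
  then show ?case by (metis funpow_0 list.size(3) mult_1 partial_derivs_Nil power_0)
next
  case (Suc j)
  have "norm (resid a ((resid a ^^ j) h) x) \<le> real CARD('n) * a * ((real CARD('n) * a) ^ j * M)"
  proof (rule resid_gain[OF test_resid_pow[OF Suc.prems(1)]])
    fix i x
    have "partial_deriv i ((resid a ^^ j) h) = (resid a ^^ j) (partial_deriv i h)"
      using partial_derivs_resid_pow[OF Suc.prems(1), of "[i]" j] by simp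
    moreover have "norm ((resid a ^^ j) (partial_deriv i h) x) \<le> (real CARD('n) * a) ^ j * M"
    proof (rule Suc.IH[OF test_partial_deriv[OF Suc.prems(1)]])
      fix ds :: "'n list" and x assume "length ds = j"
      then show "norm (partial_derivs ds (partial_deriv i h) x) \<le> M"
        using Suc.prems(2)[of "ds @ [i]" x] by (simp add: partial_derivs_append)
    qed
    ultimately show "norm (partial_deriv i ((resid a ^^ j) h) x) \<le> (real CARD('n) * a) ^ j * M" by simp
  qed
  then show ?case by (simp add: algebra_simps)
qed

text \<open>Each of the \<open>N\<close> residuals turns one derivative of \<open>h\<close> into a factor \<open>a\<close>. A derivative of order
\<open>j\<close> of the result uses up \<open>j\<close> of the \<open>N\<close> available derivatives, and the remaining residuals gain
\<open>N - j\<close> factors.\<close>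

lemma resid_pow_jet:
  fixes h :: "real^'n => complex"
  assumes h: "h \<in> test_functions" and M: "\<And>ds x. length ds = N ==> norm (partial_derivs ds h x) \<le> M"
    and l: "a \<le> l"
  shows "jet_le N l ((2 * real CARD('n)) ^ N * l ^ N * M) ((resid a ^^ N) h) x" unfolding jet_le_def
proof (intro allI impI)
  fix ds :: "'n list" assume ds: "length ds \<le> N"
  define m where "m = length ds"
  define n where "n = real CARD('n)"
  have n: "1 \<le> n" by (simp add: n_def Suc_leI)
  obtain es :: "'n list" where "length es = N" using Ex_list_of_length by blast
  then have M0: "0 \<le> M" using M[of es 0] order_trans[OF norm_ge_zero] by blast
  have "norm ((resid a ^^ m) ((resid a ^^ (N - m)) (partial_derivs ds h)) x) \<le> 2 ^ m * ((n * a) ^ (N - m) * M)"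
  proof (rule resid_pow_local[OF test_resid_pow[OF test_partial_derivs[OF h]]])
    show "norm ((resid a ^^ (N - m)) (partial_derivs ds h) y) \<le> (n * a) ^ (N - m) * M" for y unfolding n_def
      by (rule resid_pow_gain[OF test_partial_derivs[OF h]])
        (use ds in \<open>auto simp: partial_derivs_append[symmetric] m_def intro!: M\<close>)
  qed
  moreover have "(resid a ^^ m) ((resid a ^^ (N - m)) (partial_derivs ds h)) = partial_derivs ds ((resid a ^^ N) h)"
  proof -
    have "(resid a ^^ N) g = (resid a ^^ m) ((resid a ^^ (N - m)) g)" for g :: "real^'n => complex"
      using ds funpow_add[of m "N - m" "resid a :: (real^'n => complex) => _"] unfolding m_def by (simp only: le_add_diff_inverse o_apply)
    from this[of "partial_derivs ds h"] show ?thesis using partial_derivs_resid_pow[OF h, of ds N] by simp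
  qed
  ultimately have "l ^ m * norm (partial_derivs ds ((resid a ^^ N) h) x) \<le> l ^ m * (2 ^ m * ((n * a) ^ (N - m) * M))"
    using l a by (intro mult_left_mono) auto
  also have "... \<le> l ^ m * (2 ^ m * ((n * l) ^ (N - m) * M))"
    using l a n M0 by (intro mult_left_mono mult_right_mono power_mono) auto
  also have "... = (2 ^ m * n ^ (N - m)) * (l ^ m * l ^ (N - m)) * M" by (simp add: power_mult_distrib)
  also have "l ^ m * l ^ (N - m) = l ^ N" using ds by (simp add: m_def flip: power_add)
  also have "(2 ^ m * n ^ (N - m)) * l ^ N * M \<le> ((2 * n) ^ m * (2 * n) ^ (N - m)) * l ^ N * M"
    using l a n M0 by (intro mult_right_mono mult_mono power_mono) auto
  also have "(2 * n) ^ m * (2 * n) ^ (N - m) = (2 * n) ^ N"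
    using ds unfolding m_def by (metis le_add_diff_inverse power_add)
  finally show "l ^ length ds * norm (partial_derivs ds ((resid a ^^ N) h) x) \<le> (2 * real CARD('n)) ^ N * l ^ N * M"
    by (simp add: m_def n_def)
qed

lemma resid_pow_telescope:
  assumes h: "h \<in> test_functions"
  shows "h x - (resid a ^^ N) h x = (\<Sum>j<N. (resid a ^^ j) (mollify a h) x)"
proof (induction N)
  case (Suc N)
  have "(resid a ^^ Suc N) h x = (resid a ^^ N) h x - (resid a ^^ N) (mollify a h) x"
    by (simp only: resid_pow_Suc mollify_resid_pow[OF h])
  with Suc show ?case by simp
qed simp

end

text \<open>The difference telescopes into residuals of a mollification of \<open>h\<close>; its derivatives therefore fall
on a mollifier. The step \<open>l / (N + 1)\<close> keeps the \<open>N\<close> convolutions inside the ball of radius \<open>l\<close>.\<close>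

lemma smoothing_jet:
  obtains C where "1 \<le> C"
    "\<And>l (h :: real^'n => complex) x. 0 < l ==> h \<in> test_functions ==>
      jet_le N l (C / l ^ CARD('n) * (LINT y|lebesgue. indicator (cball x l) y * norm (h y)))
        (\<lambda>x. h x - (resid (l / real (N + 1)) ^^ N) h x) x"
proof -
  obtain C where C: "1 \<le> C"
    "\<And>a (h :: real^'n => complex) x. 0 < a ==> integrable lebesgue h ==>
      jet_le N a (C / a ^ CARD('n) * (LINT y|lebesgue. indicator (cball x a) y * norm (h y))) (cv (moll a) h) x"
    using jet_le_cv_moll by blast
  define q where "q = real (N + 1)"
  have q: "1 \<le> q" by (simp add: q_def)
  define D where "D = q ^ N * (\<Sum>j<N. 2 ^ j * (C * q ^ CARD('n)))"
  have "jet_le N l (D / l ^ CARD('n) * (LINT y|lebesgue. indicator (cball x l) y * norm (h y)))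
        (\<lambda>x. h x - (resid (l / q) ^^ N) h x) x"
    if l: "0 < l" and h: "h \<in> test_functions" for l and h :: "real^'n => complex" and x
  proof -
    define a where "a = l / q"
    have a: "0 < a" using l q by (simp add: a_def)
    define I where "I = (LINT y|lebesgue. indicator (cball x l) y * norm (h y))"
    have hi: "integrable lebesgue (\<lambda>y. indicator S y * norm (h y))" if "S \<in> sets lebesgue" for S
      using integrable_real_mult_indicator[of S lebesgue "\<lambda>y. norm (h y)"] test_integrable[OF h] that
      by (simp add: mult.commute)
    have I0: "0 \<le> I" unfolding I_def by (intro integral_nonneg_AE) auto
    have mol: "jet_le N a (C / a ^ CARD('n) * I) (mollify a h) y" if y: "dist x y + a \<le> l" for y
    proof -
      have "(LINT z|lebesgue. indicator (cball y a) z * norm (h z)) \<le> I" unfolding I_def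
      proof (rule integral_mono)
        fix z
        have "z \<in> cball x l" if "z \<in> cball y a" using that y dist_triangle[of x z y] by simp
        then show "indicator (cball y a) z * norm (h z) \<le> indicator (cball x l) z * norm (h z)"
          by (auto simp: indicator_def)
      qed (auto intro!: hi)
      then have "C / a ^ CARD('n) * (LINT z|lebesgue. indicator (cball y a) z * norm (h z)) \<le> C / a ^ CARD('n) * I"
        using C(1) a by (intro mult_left_mono) auto
      then show ?thesis
        using jet_le_mono[OF C(2)[OF a test_integrable[OF h], of y], of a] a by (simp add: mollify_eq[OF a h])
    qed
    have "jet_le N a (\<Sum>j<N. 2 ^ j * (C / a ^ CARD('n) * I)) (\<lambda>x. h x - (resid a ^^ N) h x) x"
      unfolding jet_le_def
    proof (intro allI impI)
      fix ds :: "'n list" assume ds: "length ds \<le> N"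
      have "partial_derivs ds (\<lambda>x. h x - (resid a ^^ N) h x) x =
          (\<Sum>j<N. (resid a ^^ j) (partial_derivs ds (mollify a h)) x)" unfolding resid_pow_telescope[OF a h]
        by (subst partial_derivs_sum)
          (auto simp: partial_derivs_resid_pow[OF a test_mollify[OF a h]] intro!: test_smooth test_resid_pow[OF a] test_mollify[OF a] h)
      also have "norm ... \<le> (\<Sum>j<N. 2 ^ j * (C / a ^ CARD('n) * I / a ^ length ds))"
      proof (intro sum_norm_le resid_pow_local[OF a test_partial_derivs[OF test_mollify[OF a h]]])
        fix j y assume j: "j \<in> {..<N}" and y: "y \<in> cball x (real j * a)"
        have "real j * a + a \<le> q * a" using j a by (simp add: q_def algebra_simps)
        also have "... = l" using q by (simp add: a_def)
        finally have "dist x y + a \<le> l" using y by simp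
        from jet_leD[OF mol[OF this] ds]
        show "norm (partial_derivs ds (mollify a h) y) \<le> C / a ^ CARD('n) * I / a ^ length ds"
          using a by (simp add: field_simps)
      qed
      finally have "a ^ length ds * norm (partial_derivs ds (\<lambda>x. h x - (resid a ^^ N) h x) x) \<le>
          a ^ length ds * (\<Sum>j<N. 2 ^ j * (C / a ^ CARD('n) * I / a ^ length ds))"
        using a by (intro mult_left_mono) auto
      also have "... = (\<Sum>j<N. 2 ^ j * (C / a ^ CARD('n) * I))" using a by (simp add: sum_distrib_left)
      finally show "a ^ length ds * norm (partial_derivs ds (\<lambda>x. h x - (resid a ^^ N) h x) x) \<le> ..." .
    qed
    then have "jet_le N (q * a) (q ^ N * (\<Sum>j<N. 2 ^ j * (C / a ^ CARD('n) * I))) (\<lambda>x. h x - (resid a ^^ N) h x) x"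
      using a q by (intro jet_le_rescale) auto
    moreover have "q * a = l" using q by (simp add: a_def)
    moreover have "C / a ^ CARD('n) * I = C * q ^ CARD('n) * I / l ^ CARD('n)" by (simp add: a_def power_divide)
    then have "q ^ N * (\<Sum>j<N. 2 ^ j * (C / a ^ CARD('n) * I)) = D / l ^ CARD('n) * I"
      by (simp add: D_def sum_distrib_left sum_distrib_right sum_divide_distrib mult.assoc)
    ultimately show ?thesis by (simp add: I_def a_def)
  qed
  note jet = this
  show ?thesis
  proof (rule that[of "max 1 D"])
    fix l :: real and h :: "real^'n => complex" and x
    assume l: "0 < l" and h: "h \<in> test_functions"
    have "0 \<le> (LINT y|lebesgue. indicator (cball x l) y * norm (h y))" by (intro integral_nonneg_AE) auto
    then have "D / l ^ CARD('n) * (LINT y|lebesgue. indicator (cball x l) y * norm (h y))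
        \<le> max 1 D / l ^ CARD('n) * (LINT y|lebesgue. indicator (cball x l) y * norm (h y))"
      using l by (intro mult_right_mono divide_right_mono) auto
    from jet_le_mono[OF jet[OF l h] _ _ this]
    show "jet_le N l (max 1 D / l ^ CARD('n) * (LINT y|lebesgue. indicator (cball x l) y * norm (h y)))
        (\<lambda>x. h x - (resid (l / real (N + 1)) ^^ N) h x) x" using l by (simp add: q_def)
  qed simp
qed

section \<open>Functionals bounded in the mean are bounded functions\<close>

lemma test_lebesgue_measurable: "h \<in> test_functions ==> h \<in> borel_measurable lebesgue"
  by (intro borel_measurable_lebesgueI test_borel)

context
  fixes u :: "(real^'n => complex) => complex" and M \<rho> :: real
  assumes u_add: "\<And>g h. g \<in> test_functions ==> h \<in> test_functions ==> u (\<lambda>x. g x + h x) = u g + u h"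
    and u_cmult: "\<And>c h. h \<in> test_functions ==> u (\<lambda>x. c * h x) = c * u h"
    and u_bound: "\<And>h. h \<in> test_functions ==>
      norm (u h) \<le> M * (LINT x|lebesgue. indicator (cball 0 \<rho>) x * norm (h x))"
    and M: "0 \<le> M"
begin

abbreviation "\<B> \<equiv> cball (0 :: real^'n) \<rho>"

text \<open>The minimiser of this quadratic functional over the test functions represents \<open>u\<close>, as in the proof
of the Riesz theorem; working with minimising sequences avoids setting up a Hilbert space.\<close>

definition energy :: "(real^'n => complex) => real" where
  "energy h = (LINT x|lebesgue. indicator \<B> x * (norm (h x))\<^sup>2) - 2 * Re (u h)"

lemma indicator_ball_integrable: "integrable lebesgue (indicator \<B> :: _ => real)"
  using lmeasurable_cball by (simp add: lmeasurable_iff_integrable)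

lemma test_ball_integrable:
  fixes g :: "real^'n => 'b::{banach, second_countable_topology}"
  assumes "g \<in> borel_measurable lebesgue" "\<And>x. norm (g x) \<le> K"
  shows "integrable lebesgue (\<lambda>x. indicator \<B> x *\<^sub>R g x)"
proof (rule Bochner_Integration.integrable_bound)
  show "integrable lebesgue (\<lambda>x. indicator \<B> x * K)"
    by (intro integrable_mult_left impI indicator_ball_integrable)
  have "0 \<le> K" using assms(2)[of 0] norm_ge_zero order_trans by blast
  then show "AE x in lebesgue. norm (indicator \<B> x *\<^sub>R g x) \<le> norm (indicator \<B> x * K)"
    using assms(2) by (intro AE_I2) (simp add: indicator_def)
  show "(\<lambda>x. indicator \<B> x *\<^sub>R g x) \<in> borel_measurable lebesgue"
    using assms(1) borel_measurable_integrable[OF indicator_ball_integrable] by (intro borel_measurable_scaleR)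
qed

lemma test_cnj_measurable: "h \<in> test_functions ==> (\<lambda>x. cnj (h x)) \<in> borel_measurable lebesgue"
  by (intro borel_measurable_lebesgueI borel_measurable_continuous_onI continuous_on_cnj
      smooth_continuous_on test_smooth)

lemma int1: assumes h: "h \<in> test_functions" shows "integrable lebesgue (\<lambda>x. indicator \<B> x * norm (h x))"
proof -
  obtain B where "0 \<le> B" "\<And>x. norm (h x) \<le> B" by (rule test_bounded[OF h]) blast
  then show ?thesis
    using test_ball_integrable[of "\<lambda>x. norm (h x)" B] test_lebesgue_measurable[OF h] by simp
qed

lemma int2: assumes h: "h \<in> test_functions" shows "integrable lebesgue (\<lambda>x. indicator \<B> x * (norm (h x))\<^sup>2)"
proof -
  obtain B where B: "0 \<le> B" "\<And>x. norm (h x) \<le> B" by (rule test_bounded[OF h]) blast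
  have "norm ((norm (h x))\<^sup>2) \<le> B\<^sup>2" for x using B by (simp add: power_mono)
  then show ?thesis
    using test_ball_integrable[of "\<lambda>x. (norm (h x))\<^sup>2" "B\<^sup>2"] test_lebesgue_measurable[OF h] by simp
qed

lemma int3:
  assumes g: "g \<in> test_functions" and h: "h \<in> test_functions"
  shows "integrable lebesgue (\<lambda>x. indicator \<B> x * (cnj (g x) * h x))"
proof -
  obtain B where B: "0 \<le> B" "\<And>x. norm (h x) \<le> B" by (rule test_bounded[OF h]) blast
  obtain C where C: "0 \<le> C" "\<And>x. norm (g x) \<le> C" by (rule test_bounded[OF g]) blast
  have "norm (cnj (g x) * h x) \<le> C * B" for x using B C by (simp add: norm_mult mult_mono)
  then have "integrable lebesgue (\<lambda>x. indicator \<B> x *\<^sub>R (cnj (g x) * h x))"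
    using test_lebesgue_measurable[OF h] test_cnj_measurable[OF g]
    by (intro test_ball_integrable[of _ "C * B"] borel_measurable_times)
  moreover have "(\<lambda>x. indicator \<B> x *\<^sub>R (cnj (g x) * h x)) = (\<lambda>x. indicator \<B> x * (cnj (g x) * h x))"
    by (rule ext) (simp add: indicator_def)
  ultimately show ?thesis by (simp only:)
qed

definition "vol = measure lebesgue \<B>"

lemma vol_eq: "(LINT x|lebesgue. indicator \<B> x) = vol" "integrable lebesgue (\<lambda>x. indicator \<B> x :: real)"
  using indicator_ball_integrable by (auto simp: vol_def)

lemma energy_lower: "h \<in> test_functions ==> - M\<^sup>2 * vol \<le> energy h"
proof -
  assume h: "h \<in> test_functions"
  have "2 * Re (u h) \<le> 2 * (M * (LINT x|lebesgue. indicator \<B> x * norm (h x)))"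
    using u_bound[OF h] complex_Re_le_cmod[of "u h"] by linarith
  also have "... = (LINT x|lebesgue. 2 * M * (indicator \<B> x * norm (h x)))" by simp
  also have "... \<le> (LINT x|lebesgue. indicator \<B> x * (norm (h x))\<^sup>2 + M\<^sup>2 * indicator \<B> x)"
  proof (rule integral_mono)
    show "2 * M * (indicator \<B> x * norm (h x)) \<le> indicator \<B> x * (norm (h x))\<^sup>2 + M\<^sup>2 * indicator \<B> x" for x
      using sum_squares_bound[of M "norm (h x)"] by (auto simp: indicator_def)
  qed (use int1[OF h] int2[OF h] vol_eq in auto)
  also have "... = (LINT x|lebesgue. indicator \<B> x * (norm (h x))\<^sup>2) + M\<^sup>2 * vol"
    using int2[OF h] vol_eq by simp
  finally show ?thesis by (simp add: energy_def)
qed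

lemma energy_parallelogram:
  assumes g: "g \<in> test_functions" and h: "h \<in> test_functions"
  shows "(LINT x|lebesgue. indicator \<B> x * (norm (g x - h x))\<^sup>2) =
    2 * energy g + 2 * energy h - 4 * energy (\<lambda>x. (1 / 2) * (g x + h x))"
proof -
  have gh: "(\<lambda>x. g x + h x) \<in> test_functions" "(\<lambda>x. g x - h x) \<in> test_functions"
      "(\<lambda>x. (1 / 2) * (g x + h x)) \<in> test_functions"
    by (rule test_add[OF g h], rule test_diff[OF g h], rule test_cmult[OF test_add[OF g h]])
  have "(LINT x|lebesgue. indicator \<B> x * (norm (g x - h x))\<^sup>2) =
    (LINT x|lebesgue. 2 * (indicator \<B> x * (norm (g x))\<^sup>2) + 2 * (indicator \<B> x * (norm (h x))\<^sup>2)
       - 4 * (indicator \<B> x * (norm ((1 / 2) * (g x + h x)))\<^sup>2))"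
  proof (rule Bochner_Integration.integral_cong[OF refl])
    fix x
    have "(norm (g x - h x))\<^sup>2 = 2 * (norm (g x))\<^sup>2 + 2 * (norm (h x))\<^sup>2 - 4 * (norm ((1 / 2) * (g x + h x)))\<^sup>2"
    proof -
      have "norm ((1 / 2) * (g x + h x)) = norm (g x + h x) / 2" by (simp add: norm_mult)
      moreover have "(norm (g x - h x))\<^sup>2 = 2 * (norm (g x))\<^sup>2 + 2 * (norm (h x))\<^sup>2 - (norm (g x + h x))\<^sup>2"
        by (simp only: cmod_power2 plus_complex.sel minus_complex.sel) (simp add: power2_eq_square algebra_simps)
      ultimately show ?thesis by (simp add: power_divide)
    qed
    then show "indicator \<B> x * (norm (g x - h x))\<^sup>2 = 2 * (indicator \<B> x * (norm (g x))\<^sup>2) + 2 * (indicator \<B> x * (norm (h x))\<^sup>2)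
       - 4 * (indicator \<B> x * (norm ((1 / 2) * (g x + h x)))\<^sup>2)"
      unfolding indicator_def by (simp del: norm_mult)
  qed
  also have "... = 2 * (LINT x|lebesgue. indicator \<B> x * (norm (g x))\<^sup>2) + 2 * (LINT x|lebesgue. indicator \<B> x * (norm (h x))\<^sup>2)
     - 4 * (LINT x|lebesgue. indicator \<B> x * (norm ((1 / 2) * (g x + h x)))\<^sup>2)"
    using int2[OF g] int2[OF h] int2[OF gh(3)] by simp
  also have "... = 2 * energy g + 2 * energy h - 4 * energy (\<lambda>x. (1 / 2) * (g x + h x))"
  proof -
    have "Re (u (\<lambda>x. (1 / 2) * (g x + h x))) = (Re (u g) + Re (u h)) / 2"
      unfolding u_cmult[OF gh(1)] u_add[OF g h] by simp
    then show ?thesis by (simp add: energy_def)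
  qed
  finally show ?thesis .
qed

lemma energy_variation:
  assumes g: "g \<in> test_functions" and h: "h \<in> test_functions"
  shows "energy (\<lambda>x. g x + c * h x) = energy g + (norm c)\<^sup>2 * (LINT x|lebesgue. indicator \<B> x * (norm (h x))\<^sup>2)
    + 2 * Re (c * ((LINT x|lebesgue. indicator \<B> x * (cnj (g x) * h x)) - u h))"
proof -
  have "(LINT x|lebesgue. indicator \<B> x * (norm (g x + c * h x))\<^sup>2) =
    (LINT x|lebesgue. indicator \<B> x * (norm (g x))\<^sup>2 + (norm c)\<^sup>2 * (indicator \<B> x * (norm (h x))\<^sup>2)
       + 2 * Re (c * (indicator \<B> x * (cnj (g x) * h x))))"
  proof (rule Bochner_Integration.integral_cong[OF refl])
    fix x
    have "(norm (g x + c * h x))\<^sup>2 = (norm (g x))\<^sup>2 + (norm c)\<^sup>2 * (norm (h x))\<^sup>2 + 2 * Re (c * (cnj (g x) * h x))"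
      by (simp add: cmod_power2) (simp add: power2_eq_square algebra_simps)
    then show "indicator \<B> x * (norm (g x + c * h x))\<^sup>2 = indicator \<B> x * (norm (g x))\<^sup>2 + (norm c)\<^sup>2 * (indicator \<B> x * (norm (h x))\<^sup>2)
       + 2 * Re (c * (indicator \<B> x * (cnj (g x) * h x)))" by (simp add: indicator_def)
  qed
  also have "... = (LINT x|lebesgue. indicator \<B> x * (norm (g x))\<^sup>2) + (norm c)\<^sup>2 * (LINT x|lebesgue. indicator \<B> x * (norm (h x))\<^sup>2)
       + 2 * Re (c * (LINT x|lebesgue. indicator \<B> x * (cnj (g x) * h x)))"
  proof -
    have *: "integrable lebesgue (\<lambda>x. Re (c * (indicator \<B> x * (cnj (g x) * h x))))"
      by (intro integrable_Re integrable_mult_right int3 g h)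
    have "(LINT x|lebesgue. Re (c * (indicator \<B> x * (cnj (g x) * h x)))) = Re (c * (LINT x|lebesgue. indicator \<B> x * (cnj (g x) * h x)))"
      using integral_Re[OF integrable_mult_right[OF int3[OF g h], of c]] by simp
    moreover have "(LINT x|lebesgue. p x + s * q x + 2 * r x) = (LINT x|lebesgue. p x) + s * (LINT x|lebesgue. q x) + 2 * (LINT x|lebesgue. r x)"
      if "integrable lebesgue p" "integrable lebesgue q" "integrable lebesgue r"
      for p q r :: "real^'n => real" and s using that by simp
    from this[OF int2[OF g] int2[OF h] *] show ?thesis unfolding calculation .
  qed
  finally show ?thesis using u_add[OF g test_cmult[OF h, of c]] u_cmult[OF h, of c]
    by (simp add: energy_def algebra_simps)
qed

lemma minimising_sequence:
  obtains h where "\<And>j. h j \<in> test_functions"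
    "\<And>j. (LINT x|lebesgue. indicator \<B> x * (norm (h (Suc j) x - h j x))\<^sup>2) \<le> 4 * (1 / 4) ^ j"
    "\<And>j g. g \<in> test_functions ==> energy (h j) \<le> energy g + (1 / 4) ^ j"
proof -
  define m where "m = Inf (energy ` test_functions)"
  have bdd: "bdd_below (energy ` test_functions)"
    using energy_lower by (intro bdd_belowI[of _ "- M\<^sup>2 * vol"]) auto
  have ne: "energy ` test_functions \<noteq> {}" using test_zero by blast
  have m: "m \<le> energy g" if "g \<in> test_functions" for g
    unfolding m_def using bdd that by (intro cInf_lower) auto
  have "\<exists>g\<in>test_functions. energy g < m + (1 / 4) ^ j" for j
    using cInf_lessD[OF ne, of "m + (1 / 4) ^ j"] by (auto simp: m_def)
  then obtain h where h: "\<And>j. h j \<in> test_functions" "\<And>j. energy (h j) < m + (1 / 4) ^ j" by metis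
  show ?thesis
  proof (rule that[of h])
    fix j
    have "m \<le> energy (\<lambda>x. (1 / 2) * (h (Suc j) x + h j x))" by (intro m test_cmult test_add h)
    then have "(LINT x|lebesgue. indicator \<B> x * (norm (h (Suc j) x - h j x))\<^sup>2) \<le> 2 * (1 / 4) ^ Suc j + 2 * (1 / 4) ^ j"
      using energy_parallelogram[OF h(1)[of "Suc j"] h(1)[of j]] h(2)[of j] h(2)[of "Suc j"] by linarith
    also have "... \<le> 4 * (1 / 4) ^ j" by simp
    finally show "(LINT x|lebesgue. indicator \<B> x * (norm (h (Suc j) x - h j x))\<^sup>2) \<le> 4 * (1 / 4) ^ j" .
  next
    show "energy (h j) \<le> energy g + (1 / 4) ^ j" if "g \<in> test_functions" for j g
      using m[OF that] h(2)[of j] by linarith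
  qed (rule h)
qed

lemma near_minimiser:
  assumes g: "g \<in> test_functions" and h: "h \<in> test_functions"
    and min: "\<And>f. f \<in> test_functions ==> energy g \<le> energy f + e"
  shows "(norm ((LINT x|lebesgue. indicator \<B> x * (cnj (g x) * h x)) - u h))\<^sup>2
    \<le> ((LINT x|lebesgue. indicator \<B> x * (norm (h x))\<^sup>2) + 1) * e"
proof -
  define n2 where "n2 = (LINT x|lebesgue. indicator \<B> x * (norm (h x))\<^sup>2)"
  define z where "z = (LINT x|lebesgue. indicator \<B> x * (cnj (g x) * h x)) - u h"
  have n2: "0 \<le> n2" unfolding n2_def by (intro integral_nonneg_AE) auto
  define t where "t = 1 / (n2 + 1)"
  have t: "0 < t" "t * n2 \<le> 1" using n2 by (auto simp: t_def field_simps)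
  define c where "c = - complex_of_real t * cnj z"
  have "energy g \<le> energy (\<lambda>x. g x + c * h x) + e" by (intro min test_add g test_cmult h)
  also have "energy (\<lambda>x. g x + c * h x) = energy g + (norm c)\<^sup>2 * n2 + 2 * Re (c * z)"
    unfolding n2_def z_def by (rule energy_variation[OF g h])
  finally have "0 \<le> (norm c)\<^sup>2 * n2 + 2 * Re (c * z) + e" by simp
  also have "(norm c)\<^sup>2 = t * t * (norm z)\<^sup>2"
    using t by (simp add: c_def norm_mult power_mult_distrib power2_eq_square)
  also have "Re (c * z) = - t * (norm z)\<^sup>2"
    by (simp add: c_def cmod_power2) (simp add: power2_eq_square algebra_simps)
  finally have "t * (norm z)\<^sup>2 * (2 - t * n2) \<le> e" by (simp add: algebra_simps)
  moreover have "t * (norm z)\<^sup>2 * 1 \<le> t * (norm z)\<^sup>2 * (2 - t * n2)"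
    using t by (intro mult_left_mono) auto
  ultimately have "t * (norm z)\<^sup>2 \<le> e" by linarith
  then have "(norm z)\<^sup>2 \<le> (n2 + 1) * e" using n2 by (simp add: t_def field_simps)
  then show ?thesis by (simp add: z_def n2_def)
qed

text \<open>By the parallelogram identity a minimising sequence is Cauchy in the square mean, and chosen to
converge fast enough that it converges almost everywhere. The first variation vanishes at the limit.\<close>

lemma energy_representation:
  obtains v where "integrable lebesgue v" "\<And>x. x \<notin> \<B> ==> v x = 0"
    "\<And>h. h \<in> test_functions ==> u h = (LINT x|lebesgue. v x * h x)"
proof -
  obtain h where h: "\<And>j. h j \<in> test_functions"
    "\<And>j. (LINT x|lebesgue. indicator \<B> x * (norm (h (Suc j) x - h j x))\<^sup>2) \<le> 4 * (1 / 4) ^ j"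
    "\<And>j g. g \<in> test_functions ==> energy (h j) \<le> energy g + (1 / 4) ^ j"
    using minimising_sequence by blast
  define e where "e j x = indicator \<B> x *\<^sub>R cnj (h j x)" for j x
  have e_meas: "e j \<in> borel_measurable lebesgue" for j
    unfolding e_def using test_cnj_measurable[OF h(1)[of j]] borel_measurable_integrable[OF indicator_ball_integrable]
    by (intro borel_measurable_scaleR)
  have e_int: "integrable lebesgue (e j)" for j
  proof -
    obtain B where B: "0 \<le> B" "\<And>x. norm (h j x) \<le> B" by (rule test_bounded[OF h(1)]) blast
    then show ?thesis unfolding e_def using test_cnj_measurable[OF h(1)[of j]]
      by (intro test_ball_integrable[of _ B]) auto
  qed
  define d where "d j x = e (Suc j) x - e j x" for j x
  have d_int: "integrable lebesgue (d j)" for j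
    unfolding d_def by (intro Bochner_Integration.integrable_diff e_int)
  have d_le: "(LINT x|lebesgue. norm (d j x)) \<le> (1 / 2) ^ j * (vol / 2 + 2)" for j
  proof -
    have dn: "norm (d j x) = indicator \<B> x * norm (h (Suc j) x - h j x)" for x
      by (simp add: d_def e_def indicator_def) (metis complex_cnj_diff complex_mod_cnj)
    have hd: "(\<lambda>x. h (Suc j) x - h j x) \<in> test_functions" by (intro test_diff h)
    have "(LINT x|lebesgue. norm (d j x)) \<le>
        (LINT x|lebesgue. (1 / 2) ^ j / 2 * indicator \<B> x + 2 ^ j / 2 * (indicator \<B> x * (norm (h (Suc j) x - h j x))\<^sup>2))"
    proof (rule integral_mono)
      fix x
      have "2 * ((1 / 2) ^ j * 2 ^ j) * y \<le> (1 / 2) ^ j * (1 + (2 ^ j * y)\<^sup>2)" for y :: real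
        using mult_left_mono[OF sum_squares_bound[of 1 "2 ^ j * y"], of "(1 / 2) ^ j"] by (simp add: mult_ac)
      then have "y \<le> (1 / 2) ^ j / 2 + 2 ^ j / 2 * y\<^sup>2" for y :: real
        by (simp add: power_one_over power_mult_distrib field_simps power2_eq_square)
      then show "norm (d j x) \<le> (1 / 2) ^ j / 2 * indicator \<B> x + 2 ^ j / 2 * (indicator \<B> x * (norm (h (Suc j) x - h j x))\<^sup>2)"
        unfolding dn by (auto simp: indicator_def)
    qed (use d_int int2[OF hd] vol_eq in auto)
    also have "... = (1 / 2) ^ j / 2 * vol + 2 ^ j / 2 * (LINT x|lebesgue. indicator \<B> x * (norm (h (Suc j) x - h j x))\<^sup>2)"
      using int2[OF hd] vol_eq by simp
    also have "... \<le> (1 / 2) ^ j / 2 * vol + 2 ^ j / 2 * (4 * (1 / 4) ^ j)"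
      using h(2)[of j] by (intro add_left_mono mult_left_mono) auto
    also have "... = (1 / 2) ^ j * (vol / 2 + 2)"
    proof -
      have "(2::real) ^ j * (1 / 4) ^ j = (1 / 2) ^ j" by (simp flip: power_mult_distrib)
      then show ?thesis by (simp add: algebra_simps)
    qed
    finally show ?thesis .
  qed
  have summ: "summable (\<lambda>j. LINT x|lebesgue. norm (d j x))"
    by (rule summable_comparison_test'[of "\<lambda>j. (1 / 2) ^ j * (vol / 2 + 2)" 0])
      (use d_le in \<open>auto intro!: summable_mult2 summable_geometric integral_nonneg_AE\<close>)
  have AE_summ: "AE x in lebesgue. summable (\<lambda>j. norm (d j x))"
  proof -
    have "(\<integral>\<^sup>+x. (\<Sum>j. ennreal (norm (d j x))) \<partial>lebesgue) = (\<Sum>j. \<integral>\<^sup>+x. ennreal (norm (d j x)) \<partial>lebesgue)"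
      using borel_measurable_integrable[OF d_int] by (intro nn_integral_suminf) auto
    also have "... = (\<Sum>j. ennreal (LINT x|lebesgue. norm (d j x)))"
      using d_int by (intro suminf_cong nn_integral_eq_integral) auto
    also have "... = ennreal (\<Sum>j. LINT x|lebesgue. norm (d j x))"
      using summ by (intro suminf_ennreal2) (auto intro!: integral_nonneg_AE)
    finally have "(\<integral>\<^sup>+x. (\<Sum>j. ennreal (norm (d j x))) \<partial>lebesgue) \<noteq> \<infinity>" by simp
    then have "AE x in lebesgue. (\<Sum>j. ennreal (norm (d j x))) \<noteq> \<infinity>"
      using borel_measurable_integrable[OF d_int] by (intro nn_integral_PInf_AE) auto
    then show ?thesis by (rule eventually_mono) (rule summable_suminf_not_top, simp_all)
  qed
  define G where "G x = norm (e 0 x) + (\<Sum>j. norm (d j x))" for x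
  have G_int: "integrable lebesgue G"
    unfolding G_def using integrable_suminf[of lebesgue "\<lambda>j x. norm (d j x)"] d_int AE_summ summ e_int
    by (intro Bochner_Integration.integrable_add) auto
  define w where "w x = e 0 x + (\<Sum>j. d j x)" for x
  have tel: "e 0 x + (\<Sum>j<k. d j x) = e k x" for k x
    unfolding d_def using sum_lessThan_telescope[of "\<lambda>j. e j x" k] by simp
  have lim: "AE x in lebesgue. (\<lambda>k. e k x) \<longlonglongrightarrow> w x" using AE_summ
  proof (rule eventually_mono)
    fix x assume "summable (\<lambda>j. norm (d j x))"
    then have "(\<lambda>k. \<Sum>j<k. d j x) \<longlonglongrightarrow> (\<Sum>j. d j x)"
      by (rule summable_LIMSEQ[OF summable_norm_cancel])
    then have "(\<lambda>k. e 0 x + (\<Sum>j<k. d j x)) \<longlonglongrightarrow> w x"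
      unfolding w_def by (intro tendsto_intros)
    then show "(\<lambda>k. e k x) \<longlonglongrightarrow> w x" unfolding tel .
  qed
  have dom: "AE x in lebesgue. norm (e k x) \<le> G x" for k using AE_summ
  proof (rule eventually_mono)
    fix x assume s: "summable (\<lambda>j. norm (d j x))"
    have "norm (e k x) \<le> norm (e 0 x) + norm (\<Sum>j<k. d j x)"
      unfolding tel[symmetric, of k] by (rule norm_triangle_ineq)
    also have "norm (\<Sum>j<k. d j x) \<le> (\<Sum>j<k. norm (d j x))" by (rule norm_sum)
    also have "... \<le> (\<Sum>j. norm (d j x))" using s by (intro sum_le_suminf) auto
    finally show "norm (e k x) \<le> G x" by (simp add: G_def)
  qed
  have w_int: "integrable lebesgue w"
    unfolding w_def using integrable_suminf[of lebesgue d] d_int AE_summ summ e_int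
    by (intro Bochner_Integration.integrable_add) auto
  have w0: "w x = 0" if "x \<notin> \<B>" for x using that by (simp add: w_def d_def e_def)
  have rep: "u g = (LINT x|lebesgue. w x * g x)" if g: "g \<in> test_functions" for g
  proof -
    obtain B where B: "0 \<le> B" "\<And>x. norm (g x) \<le> B" by (rule test_bounded[OF g]) blast
    have "(\<lambda>k. LINT x|lebesgue. e k x * g x) \<longlonglongrightarrow> (LINT x|lebesgue. w x * g x)"
    proof (rule integral_dominated_convergence[where w = "\<lambda>x. G x * B"])
      show "(\<lambda>x. w x * g x) \<in> borel_measurable lebesgue" "(\<lambda>x. e k x * g x) \<in> borel_measurable lebesgue" for k
        using borel_measurable_integrable[OF w_int] e_meas test_lebesgue_measurable[OF g] by auto
      show "integrable lebesgue (\<lambda>x. G x * B)" using G_int by simp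
      show "AE x in lebesgue. (\<lambda>k. e k x * g x) \<longlonglongrightarrow> w x * g x"
        using lim by (rule eventually_mono) (rule tendsto_mult_right)
      show "AE x in lebesgue. norm (e k x * g x) \<le> G x * B" for k using dom[of k] by (rule eventually_mono)
            (simp add: norm_mult mult_mono B order_trans[OF norm_ge_zero])
    qed
    moreover have "(\<lambda>k. LINT x|lebesgue. e k x * g x) \<longlonglongrightarrow> u g"
    proof -
      let ?n = "(LINT x|lebesgue. indicator \<B> x * (norm (g x))\<^sup>2) + 1"
      have "(norm ((LINT x|lebesgue. e k x * g x) - u g))\<^sup>2 \<le> ?n * (1 / 4) ^ k" for k
      proof -
        have "(\<lambda>x. e k x * g x) = (\<lambda>x. indicator \<B> x * (cnj (h k x) * g x))"
          by (auto simp: e_def indicator_def fun_eq_iff)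
        then show ?thesis using near_minimiser[OF h(1) g h(3)] by simp
      qed
      then have bd: "norm ((norm ((LINT x|lebesgue. e k x * g x) - u g))\<^sup>2) \<le> ?n * (1 / 4) ^ k" for k
        by simp
      have "(\<lambda>k. ?n * (1 / 4) ^ k) \<longlonglongrightarrow> 0"
        by (intro tendsto_mult_right_zero LIMSEQ_realpow_zero) auto
      then have "(\<lambda>k. (norm ((LINT x|lebesgue. e k x * g x) - u g))\<^sup>2) \<longlonglongrightarrow> 0"
        by (rule Lim_null_comparison[OF always_eventually, rotated]) (use bd in blast)
      then have "(\<lambda>k. norm ((LINT x|lebesgue. e k x * g x) - u g)) \<longlonglongrightarrow> 0"
        using tendsto_real_sqrt[of "\<lambda>k. (norm ((LINT x|lebesgue. e k x * g x) - u g))\<^sup>2" 0] by simp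
      then show ?thesis by (simp add: LIM_zero_iff tendsto_norm_zero_iff)
    qed
    ultimately show ?thesis using LIMSEQ_unique by blast
  qed
  show ?thesis using that[OF w_int w0 rep] .
qed

lemma approximate_continuous_by_test:
  fixes p :: "real^'n => complex"
  assumes p: "continuous_on UNIV p" "\<And>x. norm (p x) \<le> 1" and e: "0 < e"
  obtains h where "h \<in> test_functions" "\<And>x. norm (h x) \<le> 1" "\<And>x. x \<in> \<B> ==> norm (h x - p x) \<le> e"
proof -
  let ?B' = "cball (0 :: real^'n) (\<rho> + 1)"
  have "uniformly_continuous_on ?B' p"
    by (intro compact_uniformly_continuous continuous_on_subset[OF p(1)]) auto
  then obtain d where d: "0 < d" "\<And>x y. x \<in> ?B' ==> y \<in> ?B' ==> dist y x < d ==> dist (p y) (p x) < e"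
    unfolding uniformly_continuous_on_def using e by metis
  define a where "a = min 1 (d / 2)"
  have a: "0 < a" "a \<le> 1" "a < d" using d by (auto simp: a_def)
  define f where "f x = indicator ?B' x *\<^sub>R p x" for x
  have f_int: "integrable lebesgue f"
  proof -
    have "integrable lborel f"
      unfolding f_def by (intro borel_integrable_compact continuous_on_subset[OF p(1)]) auto
    then show ?thesis by (simp add: integrable_completion borel_measurable_integrable)
  qed
  show ?thesis
  proof (rule that[of "cv (moll a) f"])
    show "cv (moll a) f \<in> test_functions"
      by (rule test_cv_integrable[OF moll_test[OF a(1)] f_int, of "\<rho> + 1"]) (simp add: f_def)
    show "norm (cv (moll a) f x) \<le> 1" for x
      using cv_moll_approx[OF a(1) f_int, of x 0 1] p(2) by (simp add: f_def indicator_def)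
    show "norm (cv (moll a) f x - p x) \<le> e" if x: "x \<in> \<B>" for x
    proof (rule cv_moll_approx[OF a(1) f_int])
      fix y assume y: "y \<in> cball x a"
      have "norm y \<le> \<rho> + 1"
        using x y a norm_triangle_ineq[of x "y - x"] by (simp add: dist_norm norm_minus_commute)
      moreover have "norm x \<le> \<rho> + 1" using x by simp
      moreover have "dist y x < d" using y a by (simp add: dist_commute)
      ultimately show "norm (f y - p x) \<le> e" using d(2)[of x y] by (simp add: f_def dist_norm)
    qed
  qed
qed

text \<open>Where the representing function exceeds \<open>M\<close> in modulus, testing with smooth approximations of its
conjugate phase, restricted to that set, contradicts the bound on \<open>u\<close> unless the set is null.\<close>

theorem bounded_functional_representation:
  obtains v where "v \<in> borel_measurable lebesgue" "\<And>x. norm (v x) \<le> M" "\<And>x. x \<notin> \<B> ==> v x = 0"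
    "\<And>h. h \<in> test_functions ==> u h = (LINT x|lebesgue. v x * h x)"
proof -
  obtain v where v: "integrable lebesgue v" "\<And>x. x \<notin> \<B> ==> v x = 0"
    "\<And>h. h \<in> test_functions ==> u h = (LINT x|lebesgue. v x * h x)"
    by (rule energy_representation) blast
  have vm: "v \<in> borel_measurable lebesgue" by (rule borel_measurable_integrable[OF v(1)])
  define E where "E = {x. M < norm (v x)}"
  have E: "E \<in> sets lebesgue"
  proof -
    have "{x \<in> space lebesgue. M < norm (v x)} \<in> sets lebesgue"
      using vm by (intro borel_measurable_less) auto
    then show ?thesis by (simp add: E_def)
  qed
  have EB: "x \<in> \<B>" "v x \<noteq> 0" if "x \<in> E" for x
    using that v(2)[of x] M by (auto simp: E_def intro: ccontr)
  define g where "g x = indicator E x *\<^sub>R ((1 / norm (v x)) *\<^sub>R cnj (v x))" for x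
  have cm: "(\<lambda>x. cnj (v x)) \<in> borel_measurable lebesgue"
    by (rule measurable_compose[OF vm]) (intro borel_measurable_continuous_onI continuous_intros)
  have gm: "g \<in> borel_measurable lebesgue"
    unfolding g_def using vm cm E by (intro borel_measurable_scaleR borel_measurable_divide) auto
  have g1: "norm (g x) \<le> 1" for x by (simp add: g_def indicator_def)
  obtain N G where N: "negligible N" and G: "\<And>n. continuous_on UNIV (G n)"
    and GN: "\<And>x. x \<notin> N ==> (\<lambda>n. G n x) \<longlonglongrightarrow> g x"
    using lebesgue_measurable_imp_measurable_on[OF gm, of UNIV] unfolding measurable_on_def by fastforce
  define p where "p n x = closest_point (cball 0 1) (G n x)" for n x
  have cp: "continuous_on UNIV (closest_point (cball (0::complex) 1))"
    by (intro continuous_on_closest_point) auto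
  have p: "continuous_on UNIV (p n)" "\<And>x. norm (p n x) \<le> 1" for n unfolding p_def
    using continuous_on_compose2[OF cp G[of n]] closest_point_in_set[of "cball (0::complex) 1"] by auto
  have pN: "(\<lambda>n. p n x) \<longlonglongrightarrow> g x" if "x \<notin> N" for x
  proof -
    have "(\<lambda>n. p n x) \<longlonglongrightarrow> closest_point (cball 0 1) (g x)"
      unfolding p_def using continuous_on_tendsto_compose[OF cp GN[OF that]] by simp
    then show ?thesis using g1[of x] by (simp add: closest_point_self)
  qed
  have "\<exists>h. h \<in> test_functions \<and> (\<forall>x. norm (h x) \<le> 1) \<and> (\<forall>x\<in>\<B>. norm (h x - p n x) \<le> inverse (real (Suc n)))" for n
    by (rule approximate_continuous_by_test[OF p(1)[of n] p(2)[of n], of "inverse (real (Suc n))"]) auto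
  then obtain h where h: "\<And>n. h n \<in> test_functions" "\<And>n x. norm (h n x) \<le> 1"
    "\<And>n x. x \<in> \<B> ==> norm (h n x - p n x) \<le> inverse (real (Suc n))" by metis
  have hN: "(\<lambda>n. h n x) \<longlonglongrightarrow> g x" if "x \<in> \<B>" "x \<notin> N" for x
  proof -
    have "(\<lambda>n. h n x - p n x) \<longlonglongrightarrow> 0"
      using h(3)[OF that(1)] by (intro Lim_null_comparison[OF _ LIMSEQ_inverse_real_of_nat]) auto
    from tendsto_add[OF this pN[OF that(2)]] show ?thesis by simp
  qed
  have AEN: "AE x in lebesgue. x \<notin> N" using N by (intro AE_not_in) (simp add: negligible_iff_null_sets)
  have l1: "(\<lambda>n. LINT x|lebesgue. v x * h n x) \<longlonglongrightarrow> (LINT x|lebesgue. v x * g x)"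
  proof (rule integral_dominated_convergence[where w = "\<lambda>x. norm (v x)"])
    show "(\<lambda>x. v x * g x) \<in> borel_measurable lebesgue" "(\<lambda>x. v x * h n x) \<in> borel_measurable lebesgue" for n
      using vm gm test_lebesgue_measurable[OF h(1)[of n]] by auto
    show "AE x in lebesgue. (\<lambda>n. v x * h n x) \<longlonglongrightarrow> v x * g x" using AEN
    proof (rule eventually_mono)
      fix x assume "x \<notin> N"
      then show "(\<lambda>n. v x * h n x) \<longlonglongrightarrow> v x * g x"
        using hN[of x] v(2)[of x] by (cases "x \<in> \<B>") (auto intro: tendsto_mult_left)
    qed
    show "AE x in lebesgue. norm (v x * h n x) \<le> norm (v x)" for n
      using h(2)[of n] by (intro AE_I2) (simp add: norm_mult mult_left_le)
  qed (use v in auto)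
  have l2: "(\<lambda>n. LINT x|lebesgue. indicator \<B> x * norm (h n x)) \<longlonglongrightarrow> (LINT x|lebesgue. indicator \<B> x * norm (g x))"
  proof (rule integral_dominated_convergence[where w = "indicator \<B>"])
    show "(\<lambda>x. indicator \<B> x * norm (g x)) \<in> borel_measurable lebesgue"
      using gm borel_measurable_integrable[OF indicator_ball_integrable] by auto
    show "(\<lambda>x. indicator \<B> x * norm (h n x)) \<in> borel_measurable lebesgue" for n
      using int1[OF h(1)] by (rule borel_measurable_integrable)
    show "AE x in lebesgue. (\<lambda>n. indicator \<B> x * norm (h n x)) \<longlonglongrightarrow> indicator \<B> x * norm (g x)"
      using AEN
    proof (rule eventually_mono)
      fix x assume "x \<notin> N"
      then show "(\<lambda>n. indicator \<B> x * norm (h n x)) \<longlonglongrightarrow> indicator \<B> x * norm (g x)"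
        using hN[of x] by (cases "x \<in> \<B>") (auto intro: tendsto_norm)
    qed
    show "AE x in lebesgue. norm (indicator \<B> x * norm (h n x)) \<le> indicator \<B> x" for n
      using h(2)[of n] by (intro AE_I2) (simp add: indicator_def)
  qed (rule indicator_ball_integrable)
  have "norm (LINT x|lebesgue. v x * h n x) \<le> M * (LINT x|lebesgue. indicator \<B> x * norm (h n x))" for n
    using u_bound[OF h(1)[of n]] v(3)[OF h(1)[of n]] by simp
  then have le: "norm (LINT x|lebesgue. v x * g x) \<le> M * (LINT x|lebesgue. indicator \<B> x * norm (g x))"
    by (intro LIMSEQ_le[OF tendsto_norm[OF l1] tendsto_mult_left[OF l2]]) auto
  have E_int: "integrable lebesgue (indicator E :: _ => real)"
    by (rule Bochner_Integration.integrable_bound[OF indicator_ball_integrable])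
      (use E EB in \<open>auto simp: indicator_def\<close>)
  have vE_int: "integrable lebesgue (\<lambda>x. indicator E x * norm (v x))"
    by (rule Bochner_Integration.integrable_bound[OF integrable_norm[OF v(1)]])
      (use E vm in \<open>auto simp: indicator_def\<close>)
  have "v x * g x = complex_of_real (indicator E x * norm (v x))" for x
  proof -
    have "v x * cnj (v x) = complex_of_real (norm (v x)) * complex_of_real (norm (v x))"
      by (simp add: complex_mult_cnj cmod_power2 flip: power2_eq_square of_real_power)
    then have "v x * ((1 / norm (v x)) *\<^sub>R cnj (v x)) = norm (v x)"
      by (cases "v x = 0") (simp_all add: scaleR_conv_of_real)
    then show ?thesis by (simp add: g_def indicator_def)
  qed
  then have "(LINT x|lebesgue. v x * g x) = complex_of_real (LINT x|lebesgue. indicator E x * norm (v x))"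
    by (simp only: integral_complex_of_real)
  moreover have "0 \<le> (LINT x|lebesgue. indicator E x * norm (v x))" by (intro integral_nonneg_AE) auto
  moreover have "indicator \<B> x * norm (g x) = indicator E x" for x
    using EB[of x] by (auto simp: g_def indicator_def)
  ultimately have "(LINT x|lebesgue. indicator E x * norm (v x)) \<le> M * (LINT x|lebesgue. indicator E x)"
    using le by simp
  then have "(LINT x|lebesgue. indicator E x * norm (v x) - M * indicator E x) \<le> 0"
    using E_int vE_int by simp
  moreover have nn: "0 \<le> indicator E x * norm (v x) - M * indicator E x" for x
    by (auto simp: indicator_def E_def)
  ultimately have "(LINT x|lebesgue. indicator E x * norm (v x) - M * indicator E x) = 0"
    by (intro antisym integral_nonneg_AE) auto
  then have "AE x in lebesgue. indicator E x * norm (v x) - M * indicator E x = 0"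
    using E_int vE_int nn by (subst (asm) integral_nonneg_eq_0_iff_AE) auto
  then have AE_E: "AE x in lebesgue. x \<notin> E" by (rule eventually_mono) (auto simp: indicator_def E_def)
  define v' where "v' x = (if x \<in> E then 0 else v x)" for x
  have v'm: "v' \<in> borel_measurable lebesgue" unfolding v'_def using vm E by (intro measurable_If_set) auto
  show ?thesis
  proof (rule that[of v'])
    show "norm (v' x) \<le> M" for x using M by (simp add: v'_def E_def)
    show "v' x = 0" if "x \<notin> \<B>" for x using v(2)[OF that] by (simp add: v'_def)
    fix h :: "real^'n => complex" assume h: "h \<in> test_functions"
    have "(LINT x|lebesgue. v x * h x) = (LINT x|lebesgue. v' x * h x)"
    proof (intro integral_cong_AE borel_measurable_times vm v'm test_lebesgue_measurable h)
      show "AE x in lebesgue. v x * h x = v' x * h x" using AE_E by (rule eventually_mono) (simp add: v'_def)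
    qed
    then show "u h = (LINT x|lebesgue. v' x * h x)" using v(3)[OF h] by simp
  qed (rule v'm)
qed

end

section \<open>Local weights\<close>

definition wmeas :: "(real^'n => real) => (real^'n) measure" where
  "wmeas \<omega> = density lebesgue (\<lambda>x. ennreal (\<omega> x))"

lemma sets_wmeas [simp, measurable_cong]: "sets (wmeas \<omega>) = sets lebesgue"
  and space_wmeas [simp]: "space (wmeas \<omega>) = UNIV" by (simp_all add: wmeas_def)

definition cube :: "real^'n => real => (real^'n) set" where
  "cube x l = cbox x (x + (\<chi> i. l))"

lemma mem_cube: "y \<in> cube x l \<longleftrightarrow> (\<forall>i. x $ i \<le> y $ i \<and> y $ i \<le> x $ i + l)"
  by (simp add: cube_def mem_box_cart)

lemma cube_sets [simp]: "cube x l \<in> sets lebesgue" "cube x l \<in> sets borel" by (simp_all add: cube_def)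

lemma emeasure_cube: "0 \<le> l ==> emeasure lebesgue (cube (x :: real^'n) l) = ennreal (l ^ CARD('n))"
  and measure_cube: "0 \<le> l ==> measure lebesgue (cube (x :: real^'n) l) = l ^ CARD('n)"
proof -
  assume l: "0 \<le> l"
  have m: "measure lborel (cbox x (x + (\<chi> i. l))) = l ^ CARD('n)"
    using l content_cbox_if_cart[of x "x + (\<chi> i. l)"] by (auto simp: interval_eq_empty_cart not_less[symmetric])
  then show "measure lebesgue (cube x l) = l ^ CARD('n)" by (simp add: cube_def)
  show "emeasure lebesgue (cube x l) = ennreal (l ^ CARD('n))"
    using m emeasure_eq_ennreal_measure[of lborel "cbox x (x + (\<chi> i. l))"]
      emeasure_lborel_cbox_finite[of x "x + (\<chi> i. l)"] by (simp add: cube_def)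
qed

lemma lborel_cube:
  assumes "0 \<le> l"
  shows "emeasure lborel (cube (x :: real^'n) l) = ennreal (l ^ CARD('n))"
    "measure lborel (cube x l) = l ^ CARD('n)"
  using emeasure_cube[OF assms, of x] measure_cube[OF assms, of x] by simp_all

lemma small_cubes_eq: "(small_cubes :: (real^'n) set set) = {cube x l | x l. 0 < l \<and> l \<le> 1}"
proof -
  have "ennreal (l ^ CARD('n)) \<le> 1 \<longleftrightarrow> l \<le> 1" if "0 < l" for l :: real
    using that power_le_one_iff[of l "CARD('n)"] by simp
  then show ?thesis unfolding small_cubes_def cubes_def using emeasure_cube[where 'n = 'n]
    by (auto simp: cube_def) (metis less_imp_le)+
qed

lemma cube_bounded: "bounded (cube x l)" by (simp add: cube_def)

context
  fixes \<omega> :: "real^'n => real"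
  assumes weight: "\<omega> \<in> weights"
begin

lemma weight_nonneg: "0 \<le> \<omega> x" using weight by (simp add: weights_def)

lemma weight_measurable: "\<omega> \<in> borel_measurable lebesgue"
  using weight by (simp add: weights_def locally_integrable_def)

lemma weight_of_eq: "E \<in> sets lebesgue ==> weight_of \<omega> E = emeasure (wmeas \<omega>) E"
  unfolding weight_of_def wmeas_def using weight_measurable by (subst emeasure_density) auto

lemma wmeas_finite:
  assumes "bounded E"
  shows "emeasure (wmeas \<omega>) E < top"
proof -
  have "set_integrable lebesgue (closure E) \<omega>"
    using weight assms by (simp add: weights_def locally_integrable_def)
  then have "integrable lebesgue (\<lambda>x. indicator (closure E) x *\<^sub>R \<omega> x)"
    by (simp add: set_integrable_def)
  then have "(\<integral>\<^sup>+x. ennreal (norm (indicator (closure E) x *\<^sub>R \<omega> x)) \<partial>lebesgue) < top"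
    by (simp add: integrable_iff_bounded)
  also have "(\<integral>\<^sup>+x. ennreal (norm (indicator (closure E) x *\<^sub>R \<omega> x)) \<partial>lebesgue) = emeasure (wmeas \<omega>) (closure E)"
    unfolding wmeas_def using weight_measurable
    by (subst emeasure_density) (auto simp: weight_nonneg indicator_def intro!: nn_integral_cong)
  finally have "emeasure (wmeas \<omega>) (closure E) < top" .
  then show ?thesis
    using emeasure_mono[of E "closure E" "wmeas \<omega>"] closure_subset by (auto intro: le_less_trans)
qed

lemma wmeas_null: "E \<in> sets lebesgue ==> emeasure lebesgue E = 0 ==> emeasure (wmeas \<omega>) E = 0"
  unfolding wmeas_def using absolutely_continuousI_density[of "\<lambda>x. ennreal (\<omega> x)" lebesgue] weight_measurable
  by (fastforce simp: absolutely_continuous_def null_sets_def)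

subsection \<open>The local Muckenhoupt condition bounds the weight of parts of a cube from below\<close>

text \<open>\<open>C\<close> witnesses that the weight satisfies the \<open>p\<close>-th power lower bound on parts of small cubes.\<close>

definition part_bound :: "real => real => bool" where
  "part_bound p C \<longleftrightarrow> 0 < C \<and> (\<forall>x l F. 0 < l --> l \<le> 1 --> F \<subseteq> cube x l --> F \<in> sets lebesgue -->
     (measure lebesgue F) powr p * measure (wmeas \<omega>) (cube x l) \<le> C * (l ^ CARD('n)) powr p * measure (wmeas \<omega>) F)"

lemma wmeas_measure: "bounded E ==> emeasure (wmeas \<omega>) E = ennreal (measure (wmeas \<omega>) E)"
  using wmeas_finite[of E] by (intro emeasure_eq_ennreal_measure) auto

lemma wmeas_mono:
  assumes "A \<subseteq> B" "bounded B" "B \<in> sets lebesgue"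
  shows "measure (wmeas \<omega>) A \<le> measure (wmeas \<omega>) B"
proof (cases "A \<in> sets lebesgue")
  case True
  then show ?thesis
    using assms wmeas_finite[of B] by (intro measure_mono_fmeasurable) (auto simp: fmeasurable_def)
qed (simp add: measure_notin_sets)

end

text \<open>Optimising the parameter in Young's inequality gives Hoelder's inequality. The factors are first
enlarged to be positive, since a parameter that optimises exists only then.\<close>

lemma Hoelder_from_Young:
  fixes b X m p :: real
  assumes p: "1 < p" and nn: "0 \<le> b" "0 \<le> X" "0 \<le> m"
    and le: "\<And>s. 0 < s ==> m \<le> s / p * b + (p - 1) / p * s powr (- 1 / (p - 1)) * X"
  shows "m powr p \<le> b * X powr (p - 1)"
proof -
  have main: "m powr p \<le> b' * X' powr (p - 1)" if b': "b \<le> b'" "0 < b'" and X': "X \<le> X'" "0 < X'" for b' X'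
  proof -
    define s where "s = (X' / b') powr ((p - 1) / p)"
    have s: "0 < s" using that by (simp add: s_def)
    define t where "t = b' powr (1 / p) * X' powr ((p - 1) / p)"
    have "s * b' = t"
    proof -
      have "b' = b' powr (1 / p + (p - 1) / p)" using b' p by (simp add: field_simps)
      then have "b' = b' powr (1 / p) * b' powr ((p - 1) / p)" using b' by (simp add: powr_add)
      then show ?thesis using b' X' unfolding s_def t_def by (simp add: powr_divide field_simps)
    qed
    moreover have "s powr (- 1 / (p - 1)) * X' = t"
    proof -
      have "(p - 1) / p * (- 1 / (p - 1)) = - (1 / p)" using p by (simp add: field_simps)
      then have "s powr (- 1 / (p - 1)) = (X' / b') powr (- (1 / p))" by (simp only: s_def powr_powr)
      also have "... = b' powr (1 / p) / X' powr (1 / p)"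
        using b' X' by (simp add: powr_divide powr_minus field_simps)
      finally have 1: "s powr (- 1 / (p - 1)) = b' powr (1 / p) / X' powr (1 / p)" .
      have "X' = X' powr (1 / p + (p - 1) / p)" using X' p by (simp add: field_simps)
      then have "X' = X' powr (1 / p) * X' powr ((p - 1) / p)" using X' by (simp add: powr_add)
      then show ?thesis unfolding 1 t_def using X' by (simp add: field_simps)
    qed
    moreover have "m \<le> s / p * b' + (p - 1) / p * s powr (- 1 / (p - 1)) * X'"
      using le[OF s] b' X' s p by (intro order_trans[OF le[OF s]] add_mono mult_left_mono) auto
    ultimately have "m \<le> t / p + (p - 1) / p * t" by (simp add: mult.assoc)
    also have "... = t" using p by (simp add: field_simps)
    finally have "m powr p \<le> t powr p" using nn p by (intro powr_mono2) auto
    also have "... = b' * X' powr (p - 1)" using b' X' p by (simp add: t_def powr_mult powr_powr)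
    finally show ?thesis .
  qed
  have "(\<lambda>n. (b + inverse (real (Suc n))) * (X + inverse (real (Suc n))) powr (p - 1)) \<longlonglongrightarrow> (b + 0) * (X + 0) powr (p - 1)"
    using nn p by (intro tendsto_mult tendsto_add tendsto_const LIMSEQ_inverse_real_of_nat tendsto_powr') (auto intro!: always_eventually)
  then show ?thesis using nn by (intro LIMSEQ_le_const) (auto intro!: main exI[of _ 0] add_nonneg_pos)
qed

text \<open>Write the measure of the part \<open>F\<close> as the integral of \<open>\<omega>\<^bsup>1/p\<^esup> \<omega>\<^bsup>-1/p\<^esup>\<close> and apply Hoelder's
inequality: the first factor gives the weight of \<open>F\<close>, the second is controlled on the whole cube.\<close>

lemma Ap_part_bound:
  fixes \<omega> :: "real^'n => real"
  assumes \<omega>: "\<omega> \<in> Ap_loc p" and p: "1 < p"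
  shows "\<exists>C. part_bound \<omega> p C"
proof -
  have w: "\<omega> \<in> weights" and Ap: "Ap_const p \<omega> < top" using assms by (auto simp: Ap_loc_def)
  note [measurable] = weight_measurable[OF w]
  define A where "A = enn2real (Ap_const p \<omega>)"
  have A: "Ap_const p \<omega> = ennreal A" "0 \<le> A" using Ap by (auto simp: A_def)
  have e1: "p / (p - 1) / p = 1 / (p - 1)" "p / (p / (p - 1)) = p - 1" using p by auto
  have "measure lebesgue F powr p * measure (wmeas \<omega>) (cube x l) \<le> (A + 1) * (l ^ CARD('n)) powr p * measure (wmeas \<omega>) F"
    if l: "0 < l" "l \<le> 1" and F: "F \<subseteq> cube x l" "F \<in> sets lebesgue" for x l F
  proof -
    let ?Q = "cube x l"
    define \<sigma> where "\<sigma> y = epowr (inverse (ennreal (\<omega> y))) (1 / (p - 1))" for y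
    have \<sigma>_meas [measurable]: "\<sigma> \<in> borel_measurable lebesgue"
      unfolding \<sigma>_def epowr_def by measurable
    define b where "b = measure (wmeas \<omega>) F"
    define a where "a = measure (wmeas \<omega>) ?Q"
    define m where "m = measure lebesgue F"
    have bF: "bounded F" using F(1) cube_bounded bounded_subset by blast
    have fin: "emeasure lebesgue F < top"
      using fmeasurableD2[OF bounded_set_imp_lmeasurable[OF bF F(2)]] by (simp add: top.not_eq_extremum)
    have m_eq: "emeasure lebesgue F = ennreal m"
      unfolding m_def using fin by (intro emeasure_eq_ennreal_measure) auto
    have m_le: "m \<le> l ^ CARD('n)"
      unfolding m_def using measure_cube[of l x] l F measure_mono_fmeasurable[of F ?Q lebesgue] by (auto simp: cube_def)
    have nn: "0 \<le> a" "0 \<le> b" "0 \<le> m" by (simp_all add: a_def b_def m_def)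
    show ?thesis
    proof (cases "a = 0")
      case False
      then have a: "0 < a" using nn by simp
      define X where "X = (\<integral>\<^sup>+y\<in>?Q. \<sigma> y \<partial>lebesgue)"
      have "ennreal ((l ^ CARD('n)) powr (- p)) * ennreal a * epowr X (p - 1) \<le> Ap_const p \<omega>"
      proof -
        have "?Q \<in> small_cubes" using l by (auto simp: small_cubes_eq)
        then have "ennreal (measure lebesgue ?Q powr (- p)) * weight_of \<omega> ?Q *
            epowr (\<integral>\<^sup>+x\<in>?Q. epowr (inverse (ennreal (\<omega> x))) (1 / (p - 1)) \<partial>lebesgue) (p - 1) \<le> Ap_const p \<omega>"
          unfolding Ap_const_def Let_def e1 by (rule SUP_upper)
        then show ?thesis using wmeas_measure[OF w cube_bounded, of x l] weight_of_eq[OF w, of ?Q] l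
          by (simp add: lborel_cube X_def \<sigma>_def a_def)
      qed
      then have Xb: "ennreal ((l ^ CARD('n)) powr (- p) * a) * epowr X (p - 1) \<le> ennreal A"
        using nn by (simp add: A ennreal_mult)
      have pos: "0 < (l ^ CARD('n)) powr (- p) * a" using a l by simp
      have "X \<noteq> top"
      proof
        assume "X = top"
        then have "ennreal ((l ^ CARD('n)) powr (- p) * a) * epowr X (p - 1) = top"
          using pos a l by (simp add: epowr_def ennreal_mult_top)
        with Xb show False by (simp add: top_unique)
      qed
      define Y where "Y = enn2real X"
      have Y: "X = ennreal Y" "0 \<le> Y" using \<open>X \<noteq> top\<close> by (auto simp: Y_def top.not_eq_extremum)
      have YA: "(l ^ CARD('n)) powr (- p) * a * Y powr (p - 1) \<le> A"
        using Xb pos Y A(2) by (simp add: epowr_def Y ennreal_mult[symmetric] less_imp_le)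
      have "m powr p \<le> b * Y powr (p - 1)"
      proof (rule Hoelder_from_Young[OF p nn(2) Y(2) nn(3)])
        fix s :: real assume s: "0 < s"
        define c where "c = (p - 1) / p * s powr (- 1 / (p - 1))"
        have c: "0 < c" using s p by (simp add: c_def)
        have young: "1 \<le> ennreal (s / p) * ennreal (\<omega> y) + ennreal c * \<sigma> y" for y
        proof (cases "\<omega> y = 0")
          case True
          then show ?thesis using c by (simp add: \<sigma>_def epowr_def ennreal_mult_top)
        next
          case False
          then have o: "0 < \<omega> y" using weight_nonneg[OF w, of y] by simp
          have i: "inverse (ennreal (\<omega> y)) = ennreal (inverse (\<omega> y))"
            using o by (rule inverse_ennreal)
          have \<sigma>y: "\<sigma> y = ennreal (inverse (\<omega> y) powr (1 / (p - 1)))"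
            using o by (simp add: \<sigma>_def epowr_def i)
          have "(s * \<omega> y) powr (1 / p) * (s powr (- 1 / (p - 1)) * inverse (\<omega> y) powr (1 / (p - 1))) powr ((p - 1) / p)
            \<le> 1 / p * (s * \<omega> y) + (p - 1) / p * (s powr (- 1 / (p - 1)) * inverse (\<omega> y) powr (1 / (p - 1)))"
            using p s o by (intro Youngs_inequality_0) (auto simp: field_simps)
          also have "(s * \<omega> y) powr (1 / p) * (s powr (- 1 / (p - 1)) * inverse (\<omega> y) powr (1 / (p - 1))) powr ((p - 1) / p) = 1"
          proof -
            have "s powr (- 1 / (p - 1)) * inverse (\<omega> y) powr (1 / (p - 1)) = (s * \<omega> y) powr (- 1 / (p - 1))"
              using s o by (simp add: powr_mult powr_minus inverse_powr minus_divide_left[symmetric])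
            moreover have "- 1 / (p - 1) * ((p - 1) / p) = - (1 / p)" using p by (simp add: field_simps)
            ultimately have "(s powr (- 1 / (p - 1)) * inverse (\<omega> y) powr (1 / (p - 1))) powr ((p - 1) / p) = (s * \<omega> y) powr (- (1 / p))"
              by (simp only: powr_powr)
            then show ?thesis using s o by (simp flip: powr_add)
          qed
          finally have "1 \<le> s / p * \<omega> y + c * inverse (\<omega> y) powr (1 / (p - 1))"
            by (simp add: c_def mult.assoc)
          then have "ennreal 1 \<le> ennreal (s / p * \<omega> y + c * inverse (\<omega> y) powr (1 / (p - 1)))"
            by (rule ennreal_leI)
          then show ?thesis
            using s o c p by (simp add: \<sigma>y ennreal_mult[symmetric] ennreal_plus[symmetric] del: ennreal_plus)
        qed
        have "ennreal m = (\<integral>\<^sup>+y. indicator F y \<partial>lebesgue)" using F m_eq by simp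
        also have "... \<le> (\<integral>\<^sup>+y. ennreal (s / p) * (ennreal (\<omega> y) * indicator F y) + ennreal c * (\<sigma> y * indicator ?Q y) \<partial>lebesgue)"
        proof (rule nn_integral_mono)
          fix y
          show "indicator F y \<le> ennreal (s / p) * (ennreal (\<omega> y) * indicator F y) + ennreal c * (\<sigma> y * indicator ?Q y)"
            using young[of y] F(1) by (cases "y \<in> F") (auto simp: indicator_def)
        qed
        also have "... = ennreal (s / p) * (\<integral>\<^sup>+y. ennreal (\<omega> y) * indicator F y \<partial>lebesgue) + ennreal c * X"
        proof -
          have m: "(\<lambda>y. ennreal (\<omega> y) * indicator F y) \<in> borel_measurable lebesgue"
              "(\<lambda>y. \<sigma> y * indicator ?Q y) \<in> borel_measurable lebesgue"
            using F(2) by (auto intro!: borel_measurable_times_ennreal \<sigma>_meas borel_measurable_indicator cube_sets(1))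
          then show ?thesis
            unfolding X_def using m by (simp add: nn_integral_add nn_integral_cmult borel_measurable_times)
        qed
        also have "(\<integral>\<^sup>+y. ennreal (\<omega> y) * indicator F y \<partial>lebesgue) = ennreal b"
          using weight_of_eq[OF w F(2)] wmeas_measure[OF w bF] by (simp add: weight_of_def b_def)
        finally have "ennreal m \<le> ennreal (s / p * b + c * Y)"
          using s p c nn Y by (simp add: ennreal_mult[symmetric] ennreal_plus[symmetric] del: ennreal_plus)
        then show "m \<le> s / p * b + (p - 1) / p * s powr (- 1 / (p - 1)) * Y"
          using s p c nn Y by (subst (asm) ennreal_le_iff) (auto simp: c_def intro!: add_nonneg_nonneg mult_nonneg_nonneg)
      qed
      then have "m powr p * a \<le> b * Y powr (p - 1) * a" using nn by (intro mult_right_mono)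
      also have "... = b * (l ^ CARD('n)) powr p * ((l ^ CARD('n)) powr (- p) * a * Y powr (p - 1))"
        using l by (simp add: powr_minus field_simps)
      also have "... \<le> b * (l ^ CARD('n)) powr p * A" using YA nn by (intro mult_left_mono) auto
      also have "... \<le> b * (l ^ CARD('n)) powr p * (A + 1)" using nn by (intro mult_left_mono) auto
      finally show ?thesis by (simp add: a_def b_def m_def mult.commute mult.left_commute)
    qed (use nn A l in \<open>simp add: a_def\<close>)
  qed
  then show ?thesis using A by (intro exI[of _ "A + 1"]) (auto simp: part_bound_def[OF w] )
qed

lemma A1_part_bound:
  fixes \<omega> :: "real^'n => real"
  assumes \<omega>: "\<omega> \<in> Ap_loc 1"
  shows "\<exists>C. part_bound \<omega> 1 C"
proof -
  have w: "\<omega> \<in> weights" and A1: "A1_const \<omega> < top" using assms by (auto simp: Ap_loc_def)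
  note [measurable] = weight_measurable[OF w]
  define A where "A = enn2real (A1_const \<omega>)"
  have A: "A1_const \<omega> = ennreal A" "0 \<le> A" using A1 by (auto simp: A_def)
  have "measure lebesgue F * measure (wmeas \<omega>) (cube x l) \<le> (A + 1) * (l ^ CARD('n)) * measure (wmeas \<omega>) F"
    if l: "0 < l" "l \<le> 1" and F: "F \<subseteq> cube x l" "F \<in> sets lebesgue" for x l F
  proof -
    let ?Q = "cube x l"
    define b where "b = measure (wmeas \<omega>) F"
    define a where "a = measure (wmeas \<omega>) ?Q"
    define m where "m = measure lebesgue F"
    define v where "v = l ^ CARD('n)"
    have v: "0 < v" using l by (simp add: v_def)
    have bF: "bounded F" using F(1) cube_bounded bounded_subset by blast
    have fin: "emeasure lebesgue F < top"
      using fmeasurableD2[OF bounded_set_imp_lmeasurable[OF bF F(2)]] by (simp add: top.not_eq_extremum)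
    have m_eq: "emeasure lebesgue F = ennreal m"
      unfolding m_def using fin by (intro emeasure_eq_ennreal_measure) auto
    have nn: "0 \<le> a" "0 \<le> b" "0 \<le> m" by (simp_all add: a_def b_def m_def)
    show ?thesis
    proof (cases "a = 0")
      case False
      then have a: "0 < a" using nn by simp
      define S where "S = esssup (lebesgue_on ?Q) (\<lambda>x. inverse (ennreal (\<omega> x)))"
      have Sb: "ennreal (a / v) * S \<le> ennreal A"
      proof -
        have "?Q \<in> small_cubes" using l by (auto simp: small_cubes_eq)
        then have "weight_of \<omega> ?Q / emeasure lebesgue ?Q * S \<le> A1_const \<omega>"
          unfolding A1_const_def S_def by (rule SUP_upper)
        then show ?thesis using wmeas_measure[OF w cube_bounded, of x l] weight_of_eq[OF w, of ?Q] l v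
          by (simp add: lborel_cube a_def A divide_ennreal v_def)
      qed
      have "S \<noteq> top"
      proof
        assume "S = top"
        then have "ennreal (a / v) * S = top" using a v by (simp add: ennreal_mult_top)
        with Sb show False by (simp add: top_unique)
      qed
      then obtain r where r: "S = ennreal r" "0 \<le> r" by (cases S) auto
      have rA: "a / v * r \<le> A" using Sb r A a v by (simp add: ennreal_mult[symmetric])
      have "AE y in lebesgue_on ?Q. inverse (ennreal (\<omega> y)) \<le> S" unfolding S_def by (rule esssup_AE)
      then have ae: "AE y in lebesgue. y \<in> ?Q --> inverse (ennreal (\<omega> y)) \<le> S"
        by (subst (asm) AE_restrict_space_iff) auto
      have "ennreal m = (\<integral>\<^sup>+y. indicator F y \<partial>lebesgue)" using F m_eq by simp
      also have "... \<le> (\<integral>\<^sup>+y. ennreal r * (ennreal (\<omega> y) * indicator F y) \<partial>lebesgue)"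
      proof (rule nn_integral_mono_AE)
        show "AE y in lebesgue. indicator F y \<le> ennreal r * (ennreal (\<omega> y) * indicator F y)" using ae
        proof (rule eventually_mono)
          fix y assume y: "y \<in> ?Q --> inverse (ennreal (\<omega> y)) \<le> S"
          show "indicator F y \<le> ennreal r * (ennreal (\<omega> y) * indicator F y)"
          proof (cases "y \<in> F")
            case True
            then have le: "inverse (ennreal (\<omega> y)) \<le> ennreal r" using y F(1) r by auto
            then have "\<omega> y \<noteq> 0" by (auto simp: top_unique)
            then have o: "0 < \<omega> y" using weight_nonneg[OF w, of y] by simp
            then have "inverse (\<omega> y) \<le> r" using le r by (simp add: inverse_ennreal)
            then have "1 \<le> r * \<omega> y" using o by (simp add: field_simps)
            then have "ennreal 1 \<le> ennreal (r * \<omega> y)" by (rule ennreal_leI)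
            then show ?thesis using True r o by (simp add: ennreal_mult)
          qed simp
        qed
      qed
      also have "... = ennreal r * (\<integral>\<^sup>+y. ennreal (\<omega> y) * indicator F y \<partial>lebesgue)"
        using F(2) by (intro nn_integral_cmult borel_measurable_times) auto
      also have "(\<integral>\<^sup>+y. ennreal (\<omega> y) * indicator F y \<partial>lebesgue) = ennreal b"
        using weight_of_eq[OF w F(2)] wmeas_measure[OF w bF] by (simp add: weight_of_def b_def)
      finally have mrb: "m \<le> r * b" using r nn by (simp add: ennreal_mult[symmetric])
      have "m * a \<le> r * b * a" using mrb nn by (intro mult_right_mono)
      also have "... = (a / v * r) * v * b" using v by simp
      also have "... \<le> (A + 1) * v * b" using rA v nn by (intro mult_right_mono) auto
      finally show ?thesis by (simp add: a_def b_def m_def v_def)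
    qed (use A l in \<open>simp add: a_def\<close>)
  qed
  then show ?thesis using A by (intro exI[of _ "A + 1"]) (auto simp: part_bound_def[OF w])
qed

lemma Ap_loc_part_bound: "\<omega> \<in> Ap_loc p ==> \<exists>C. part_bound \<omega> p C"
  using Ap_part_bound[of \<omega> p] A1_part_bound[of \<omega>] by (auto simp: Ap_loc_def split: if_splits)

subsection \<open>Positivity and doubling\<close>

lemma cube_subset_iff:
  assumes "0 \<le> k"
  shows "cube x k \<subseteq> cube (y :: real^'n) l \<longleftrightarrow> (\<forall>i. y $ i \<le> x $ i \<and> x $ i + k \<le> y $ i + l)"
proof
  assume sub: "cube x k \<subseteq> cube y l"
  have "x \<in> cube x k" "x + (\<chi> i. k) \<in> cube x k" using assms by (auto simp: mem_cube)
  with sub have "x \<in> cube y l" "x + (\<chi> i. k) \<in> cube y l" by blast+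
  then show "\<forall>i. y $ i \<le> x $ i \<and> x $ i + k \<le> y $ i + l" by (simp add: mem_cube)
qed (auto simp: mem_cube; smt (verit, best))

lemma ball_subset_cube: "ball (x :: real^'n) r \<subseteq> cube (x - (\<chi> i. r)) (2 * r)"
proof
  fix y assume "y \<in> ball x r"
  then have "\<bar>(y - x) $ i\<bar> \<le> r" for i
    using component_le_norm_cart[of "y - x" i] by (simp add: dist_norm norm_minus_commute)
  then have "x $ i - r \<le> y $ i \<and> y $ i \<le> x $ i + r" for i by (simp add: abs_le_iff algebra_simps)
  then show "y \<in> cube (x - (\<chi> i. r)) (2 * r)" by (simp add: mem_cube add.commute)
qed

lemma part_bound_cubes:
  fixes \<omega> :: "real^'n => real"
  assumes w: "\<omega> \<in> weights" and pb: "part_bound \<omega> p C" and k: "0 < k" "0 < l" "l \<le> 1"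
    and sub: "cube x k \<subseteq> cube y l"
  shows "measure (wmeas \<omega>) (cube y l) \<le> C * (l / k) powr (real CARD('n) * p) * measure (wmeas \<omega>) (cube x k)"
proof -
  have "(k ^ CARD('n)) powr p * measure (wmeas \<omega>) (cube y l) \<le> C * (l ^ CARD('n)) powr p * measure (wmeas \<omega>) (cube x k)"
    using pb k sub measure_cube[of k x] unfolding part_bound_def[OF w] by (metis cube_sets(1) less_imp_le)
  moreover have pw: "(t ^ CARD('n)) powr p = t powr (real CARD('n) * p)" if "0 < t" for t :: real
    using that by (simp add: powr_powr flip: powr_realpow)
  ultimately have "k powr (real CARD('n) * p) * measure (wmeas \<omega>) (cube y l) \<le> C * l powr (real CARD('n) * p) * measure (wmeas \<omega>) (cube x k)"
    using k by simp
  then show ?thesis using k by (simp add: powr_divide field_simps)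
qed

text \<open>A weight that gives no mass to one cube of side one half gives none to any neighbour, hence
  none to any cube at all, because space is connected.\<close>

lemma weight_zero_or_positive:
  fixes \<omega> :: "real^'n => real"
  assumes w: "\<omega> \<in> weights"
    and zero: "\<And>x k y l. 0 < k ==> 0 < l ==> l \<le> 1 ==> cube x k \<subseteq> cube y l ==>
      measure (wmeas \<omega>) (cube x k) = 0 ==> measure (wmeas \<omega>) (cube y l) \<le> 0"
  shows "(AE x in lebesgue. \<omega> x = 0) \<or> (\<forall>x l. 0 < l --> 0 < measure (wmeas \<omega>) (cube x l))"
proof -
  let ?W = "measure (wmeas \<omega>)"
  define Z where "Z = {x. ?W (cube x (1/2)) = 0}"
  have nb: "y \<in> Z" if x: "x \<in> Z" and near: "norm (x - y) < 1 / 2" for x y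
  proof -
    define z :: "real^'n" where "z = (\<chi> i. min (x $ i) (y $ i))"
    have c: "\<bar>x $ i - y $ i\<bar> \<le> 1 / 2" for i
      using component_le_norm_cart[of "x - y" i] near by simp
    have "z $ i \<le> x $ i \<and> x $ i + 1 / 2 \<le> z $ i + 1 \<and> z $ i \<le> y $ i \<and> y $ i + 1 / 2 \<le> z $ i + 1" for i
      using c[of i] unfolding z_def by (auto simp: min_def abs_le_iff)
    then have s: "cube x (1/2) \<subseteq> cube z 1" "cube y (1/2) \<subseteq> cube z 1"
      by (auto simp: cube_subset_iff)
    have "?W (cube z 1) \<le> 0" using zero[OF _ _ _ s(1)] x by (simp add: Z_def)
    then have "?W (cube y (1/2)) \<le> 0" using wmeas_mono[OF w s(2) cube_bounded] by simp
    then show ?thesis using measure_nonneg[of "wmeas \<omega>" "cube y (1/2)"] by (simp add: Z_def)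
  qed
  have "open Z" unfolding open_dist
  proof (intro ballI exI[of _ "1/2"] conjI allI impI)
    fix x y assume "x \<in> Z" "dist y x < 1 / 2"
    then show "y \<in> Z" using nb[of x y] by (simp add: dist_norm norm_minus_commute)
  qed simp
  moreover have "open (- Z)" unfolding open_dist
  proof (intro ballI exI[of _ "1/2"] conjI allI impI)
    fix x y assume "x \<in> - Z" "dist y x < 1 / 2"
    then show "y \<in> - Z" using nb[of y x] by (auto simp: dist_norm)
  qed simp
  ultimately consider "Z = {}" | "Z = UNIV" using clopen[of Z] by (auto simp: closed_def)
  then show ?thesis
  proof cases
    case 1
    have "0 < ?W (cube x l)" if l: "0 < l" for x l
    proof (rule ccontr)
      assume "\<not> ?thesis"
      then have z: "?W (cube x l) = 0" using measure_nonneg[of "wmeas \<omega>" "cube x l"] by simp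
      define k where "k = min l (1/2)"
      have k: "0 < k" "k \<le> 1/2" "k \<le> l" using l by (auto simp: k_def)
      have "?W (cube x k) \<le> 0"
        using wmeas_mono[OF w _ cube_bounded, of "cube x k" x l] k z by (simp add: cube_subset_iff)
      then have "?W (cube x k) = 0" using measure_nonneg[of "wmeas \<omega>" "cube x k"] by simp
      then have "?W (cube x (1/2)) \<le> 0" using zero[OF k(1), of "1/2" x x] k by (simp add: cube_subset_iff)
      then have "x \<in> Z" using measure_nonneg[of "wmeas \<omega>" "cube x (1/2)"] by (simp add: Z_def)
      with 1 show False by simp
    qed
    then show ?thesis by blast
  next
    case 2
    define G :: "(real^'n) set" where "G = {z. \<forall>i. z $ i \<in> \<rat>}"
    have cG: "countable G"
    proof -
      have "G \<subseteq> (\<lambda>f. \<chi> i. f i) ` (UNIV \<rightarrow>\<^sub>E \<rat>)"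
      proof
        fix z assume "z \<in> G"
        then show "z \<in> (\<lambda>f. \<chi> i. f i) ` (UNIV \<rightarrow>\<^sub>E \<rat>)"
          by (intro image_eqI[of _ _ "\<lambda>i. z $ i"]) (auto simp: G_def)
      qed
      moreover have "countable (UNIV \<rightarrow>\<^sub>E (\<rat> :: real set) :: ('n => real) set)"
        by (intro countable_PiE) (auto simp: countable_rat)
      ultimately show ?thesis by (meson countable_image countable_subset)
    qed
    have cov: "(\<Union>z\<in>G. cube z (1/2)) = UNIV"
    proof (intro equalityI subset_UNIV subsetI)
      fix x :: "real^'n"
      have "\<exists>q\<in>\<rat>. x $ i - 1/2 < q \<and> q < x $ i" for i
        using Rats_dense_in_real[of "x $ i - 1/2" "x $ i"] by auto
      then obtain q where q: "\<And>i. q i \<in> \<rat>" "\<And>i. x $ i - 1/2 < q i" "\<And>i. q i < x $ i" by metis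
      then have "(\<chi> i. q i) \<in> G" "x \<in> cube (\<chi> i. q i) (1/2)"
        by (auto simp: G_def mem_cube intro: less_imp_le) (metis add.commute diff_less_eq less_imp_le)
      then show "x \<in> (\<Union>z\<in>G. cube z (1/2))" by blast
    qed
    have "emeasure (wmeas \<omega>) (cube z (1/2)) = 0" for z
      using 2 wmeas_measure[OF w cube_bounded, of z "1/2"] by (auto simp: Z_def)
    then have "(\<Union>z\<in>G. cube z (1/2)) \<in> null_sets (wmeas \<omega>)"
      using cG by (intro null_sets_UN') (auto simp: null_sets_def)
    then have "emeasure (wmeas \<omega>) UNIV = 0" unfolding cov by (simp add: null_sets_def)
    then have "(\<integral>\<^sup>+x. ennreal (\<omega> x) \<partial>lebesgue) = 0"
      using weight_of_eq[OF w, of UNIV] by (simp add: weight_of_def)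
    then have "AE x in lebesgue. ennreal (\<omega> x) = 0"
      using weight_measurable[OF w] by (subst (asm) nn_integral_0_iff_AE) auto
    then have "AE x in lebesgue. \<omega> x = 0"
      by (rule eventually_mono) (use weight_nonneg[OF w] in \<open>auto simp: ennreal_eq_0_iff intro: antisym\<close>)
    then show ?thesis ..
  qed
qed

text \<open>A finite number of cubes, given by compactness, is enough: each cube with corner in the bounded set
contains one of them.\<close>

lemma cube_mass_lower_bound:
  fixes \<omega> :: "real^'n => real"
  assumes w: "\<omega> \<in> weights" and pos: "\<And>x l. 0 < l ==> 0 < measure (wmeas \<omega>) (cube x l)"
    and B: "bounded B" and l: "0 < l"
  obtains c where "0 < c" "\<And>x. x \<in> B ==> c \<le> measure (wmeas \<omega>) (cube x l)"
proof (cases "B = {}")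
  case False
  let ?W = "measure (wmeas \<omega>)"
  have "compact (closure B)" using B by simp
  then obtain T where T: "T \<subseteq> closure B" "finite T" "closure B \<subseteq> (\<Union>z\<in>T. ball z (l / 4))"
    by (rule compactE_image[of "closure B" "closure B" "\<lambda>z. ball z (l / 4)"]) (use l in auto)
  have ne: "T \<noteq> {}" using T(3) False closure_subset[of B] by auto
  define c where "c = Min ((\<lambda>z. ?W (cube (z + (\<chi> i. l / 4)) (l / 2))) ` T)"
  have "0 < c" unfolding c_def using T(2) ne pos l by (subst Min_gr_iff) auto
  moreover have "c \<le> ?W (cube x l)" if "x \<in> B" for x
  proof -
    have "x \<in> (\<Union>z\<in>T. ball z (l / 4))" using T(3) that closure_subset[of B] by blast
    then obtain z where z: "z \<in> T" "dist z x < l / 4" by auto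
    have "x $ i \<le> z $ i + l / 4 \<and> z $ i + l / 4 + l / 2 \<le> x $ i + l" for i
    proof -
      have "\<bar>z $ i - x $ i\<bar> \<le> l / 4"
        using component_le_norm_cart[of "z - x" i] z(2) by (simp add: dist_norm)
      then show ?thesis by linarith
    qed
    then have "cube (z + (\<chi> i. l / 4)) (l / 2) \<subseteq> cube x l" using l by (simp add: cube_subset_iff)
    then have "?W (cube (z + (\<chi> i. l / 4)) (l / 2)) \<le> ?W (cube x l)"
      by (intro wmeas_mono[OF w]) (auto simp: cube_bounded)
    moreover have "c \<le> ?W (cube (z + (\<chi> i. l / 4)) (l / 2))"
      unfolding c_def using z T(2) by (intro Min_le) auto
    ultimately show ?thesis by simp
  qed
  ultimately show ?thesis using that by blast
qed (use that[of 1] in simp)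

text \<open>As long as the ball lies in a cube of side at most one, the lower bound on parts applies. A larger
ball has at most the weight of the whole bounded region, which is comparable to that of a cube of side
one at \<open>x\<close>.\<close>

lemma local_doubling:
  fixes \<omega> :: "real^'n => real"
  assumes w: "\<omega> \<in> weights" and pos: "\<And>x l. 0 < l ==> 0 < measure (wmeas \<omega>) (cube x l)"
    and pb: "part_bound \<omega> p C" and B: "bounded B" and B': "bounded B'" "B' \<in> sets lebesgue" and p: "0 \<le> p"
  obtains K where "0 < K" "\<And>x l j. x \<in> B ==> 0 < l ==> l \<le> 1 ==>
    measure (wmeas \<omega>) (ball x (2 ^ j * D * l) \<inter> B') \<le> K * (2 ^ j) powr (real CARD('n) * p) * measure (wmeas \<omega>) (cube x l)"
proof -
  let ?W = "measure (wmeas \<omega>)"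
  let ?e = "real CARD('n) * p"
  obtain c where c: "0 < c" "\<And>x. x \<in> B ==> c \<le> ?W (cube x 1)"
    by (rule cube_mass_lower_bound[OF w pos B, of 1]) auto
  define d where "d = max D 1"
  have d: "1 \<le> d" "D \<le> d" by (auto simp: d_def)
  have C: "0 < C" using pb by (simp add: part_bound_def[OF w])
  define K where "K = C * (2 * d) powr ?e * (1 + ?W B' / c)"
  have WB: "0 \<le> ?W B' / c" using c by simp
  have K0: "0 < K" unfolding K_def using C d WB by (intro mult_pos_pos) (auto intro: add_pos_nonneg)
  have main: "?W (ball x (2 ^ j * D * l) \<inter> B') \<le> K * (2 ^ j) powr ?e * ?W (cube x l)"
    if x: "x \<in> B" and l: "0 < l" "l \<le> 1" for x l j
  proof -
    define r where "r = 2 ^ j * d * l"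
    have r: "l \<le> r" "0 < r"
      using l d mult_mono[of 1 "2 ^ j" 1 d] by (auto simp: r_def intro: order_trans[of _ "1 * l"] mult_right_mono)
    have b0: "ball x (2 ^ j * D * l) \<subseteq> ball x r"
      unfolding r_def using d l by (intro subset_ball mult_right_mono mult_left_mono) auto
    have e: "((2 * r) / l) powr ?e = (2 * d) powr ?e * (2 ^ j) powr ?e"
      using l d by (simp add: r_def powr_mult[symmetric] mult_ac)
    have main: "?W (ball x (2 ^ j * D * l) \<inter> B') \<le> C * ((2 * d) powr ?e * (2 ^ j) powr ?e) * (1 + ?W B' / c) * ?W (cube x l)"
    proof (cases "2 * r \<le> 1")
      case True
      have "?W (ball x (2 ^ j * D * l) \<inter> B') \<le> ?W (cube (x - (\<chi> i. r)) (2 * r))"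
        using b0 ball_subset_cube[of x r] by (intro wmeas_mono[OF w]) (auto simp: cube_bounded)
      also have "... \<le> C * ((2 * r) / l) powr ?e * ?W (cube x l)"
        using True r l by (intro part_bound_cubes[OF w pb]) (auto simp: cube_subset_iff)
      also have "... \<le> C * ((2 * r) / l) powr ?e * ?W (cube x l) * (1 + ?W B' / c)"
        using C WB by (intro mult_le_cancel_left1[THEN iffD2]) (auto simp: mult_less_0_iff)
      finally show ?thesis unfolding e by (simp add: mult_ac)
    next
      case False
      have "?W (ball x (2 ^ j * D * l) \<inter> B') \<le> ?W B'" using B' by (intro wmeas_mono[OF w]) auto
      also have "... \<le> ?W B' / c * ?W (cube x 1)"
        using c(1) c(2)[OF x] mult_left_mono[OF c(2)[OF x], of "?W B' / c"] by simp
      also have "... \<le> ?W B' / c * (C * (1 / l) powr ?e * ?W (cube x l))"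
        using WB l by (intro mult_left_mono part_bound_cubes[OF w pb]) (auto simp: cube_subset_iff)
      also have "... \<le> ?W B' / c * (C * ((2 * r) / l) powr ?e * ?W (cube x l))"
        using WB l C p False by (intro mult_left_mono mult_right_mono powr_mono2 divide_right_mono) auto
      also have "... \<le> (1 + ?W B' / c) * (C * ((2 * r) / l) powr ?e * ?W (cube x l))"
        using C by (intro mult_right_mono) auto
      finally show ?thesis unfolding e by (simp add: mult_ac)
    qed
    then show ?thesis by (simp add: K_def mult_ac)
  qed
  show ?thesis using that[OF K0 main] .
qed

section \<open>Every local \<open>A\<^sub>\<infinity>\<close> weight is a local \<open>A\<^sub>p\<close> weight\<close>

definition hcube :: "real^'n => real => (real^'n) set" where
  "hcube x l = {y. \<forall>i. x $ i \<le> y $ i \<and> y $ i < x $ i + l}"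

lemma hcube_sets: "hcube x l \<in> sets borel"
proof -
  have "hcube x l = (\<Inter>i\<in>UNIV. {y. x $ i \<le> y $ i} \<inter> {y. y $ i < x $ i + l})"
    by (auto simp: hcube_def)
  also have "... \<in> sets borel"
    by (intro sets.finite_INT sets.Int borel_closed borel_open closed_Collect_le open_Collect_less continuous_intros) auto
  finally show ?thesis .
qed

lemma hcube_lebesgue [simp]: "hcube x l \<in> sets lebesgue"
  by (intro sets_completionI_sets) (simp add: hcube_sets)

lemma hcube_subset_cube: "hcube x l \<subseteq> cube x l" by (auto simp: hcube_def mem_cube less_imp_le)

lemma emeasure_hcube:
  assumes "0 \<le> l" shows "emeasure lebesgue (hcube (x :: real^'n) l) = ennreal (l ^ CARD('n))"
proof (rule antisym)
  show "emeasure lebesgue (hcube x l) \<le> ennreal (l ^ CARD('n))"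
    unfolding emeasure_cube[OF assms, of x, symmetric] by (intro emeasure_mono hcube_subset_cube) simp
  have "box x (x + (\<chi> i. l)) \<subseteq> hcube x l" by (auto simp: hcube_def mem_box_cart less_imp_le)
  then have "emeasure lebesgue (box x (x + (\<chi> i. l))) \<le> emeasure lebesgue (hcube x l)"
    by (intro emeasure_mono) auto
  moreover have "emeasure lebesgue (box x (x + (\<chi> i. l))) = emeasure lebesgue (cube x l)"
    unfolding cube_def by (simp add: emeasure_lborel_box_eq emeasure_lborel_cbox_eq)
  ultimately show "ennreal (l ^ CARD('n)) \<le> emeasure lebesgue (hcube x l)"
    using emeasure_cube[OF assms, of x] by simp
qed

lemma cube_minus_hcube_null:
  assumes "0 \<le> l" shows "emeasure lebesgue (cube (x :: real^'n) l - hcube x l) = 0"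
  using emeasure_Diff[of lebesgue "hcube x l" "cube x l"] hcube_subset_cube[of x l]
    emeasure_cube[OF assms, of x] emeasure_hcube[OF assms, of x] by simp

lemma wmeas_hcube:
  assumes w: "\<omega> \<in> weights" and l: "0 \<le> l"
  shows "emeasure (wmeas \<omega>) (hcube x l) = emeasure (wmeas \<omega>) (cube x l)"
proof -
  have "emeasure (wmeas \<omega>) (cube x l) = emeasure (wmeas \<omega>) (hcube x l) + emeasure (wmeas \<omega>) (cube x l - hcube x l)"
    using hcube_subset_cube[of x l] by (subst plus_emeasure) (auto simp: Un_absorb1)
  moreover have "emeasure (wmeas \<omega>) (cube x l - hcube x l) = 0"
    by (rule wmeas_null[OF w _ cube_minus_hcube_null[OF l]]) auto
  ultimately show ?thesis by simp
qed

lemma emeasure_disjoint_family_le: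
  assumes "countable \<S>" "disjoint \<S>" "\<S> \<subseteq> sets M" "sets M = sets N"
    and "\<And>S. S \<in> \<S> ==> emeasure M S \<le> c * emeasure N S"
  shows "emeasure M (\<Union>\<S>) \<le> c * emeasure N (\<Union>\<S>)"
proof -
  have d: "disjoint_family_on (\<lambda>S. S) \<S>"
    using assms(2) by (auto simp: disjoint_family_on_def disjoint_def)
  have "emeasure M (\<Union>\<S>) = (\<integral>\<^sup>+S. emeasure M S \<partial>count_space \<S>)"
    using emeasure_UN_countable[of \<S> "\<lambda>S. S" M] assms d by auto
  also have "... \<le> (\<integral>\<^sup>+S. c * emeasure N S \<partial>count_space \<S>)"
    using assms(5) by (intro nn_integral_mono) auto
  also have "... = c * (\<integral>\<^sup>+S. emeasure N S \<partial>count_space \<S>)"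
    by (intro nn_integral_cmult) auto
  also have "(\<integral>\<^sup>+S. emeasure N S \<partial>count_space \<S>) = emeasure N (\<Union>\<S>)"
  proof -
    have "S \<in> sets N" if "S \<in> \<S>" for S using that assms(3,4) by auto
    from emeasure_UN_countable[OF this assms(1) d] show ?thesis by simp
  qed
  finally show ?thesis .
qed

lemma wmeas_outer:
  fixes \<omega> :: "real^'n => real"
  assumes w: "\<omega> \<in> weights" and E: "E \<in> sets lebesgue" "bounded E"
  obtains V where "\<And>k :: nat. open (V k)" "\<And>k. E \<subseteq> V k"
    "(\<lambda>k. emeasure (wmeas \<omega>) (V k)) \<longlonglongrightarrow> emeasure (wmeas \<omega>) E"
proof -
  have "\<exists>T. open T \<and> E \<subseteq> T \<and> emeasure lebesgue (T - E) < ennreal ((1 / 2) ^ k)" for k :: nat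
    by (rule sets_lebesgue_outer_open[OF E(1), of "(1 / 2) ^ k"]) auto
  then obtain T where T: "\<And>k. open (T k)" "\<And>k. E \<subseteq> T k" "\<And>k :: nat. emeasure lebesgue (T k - E) < ennreal ((1 / 2) ^ k)"
    by metis
  obtain r where r: "E \<subseteq> ball 0 r" using E(2) bounded_subset_ballD by blast
  define V where "V k = ball 0 r \<inter> (\<Inter>j\<le>k. T j)" for k
  have V: "open (V k)" "E \<subseteq> V k" "bounded (V k)" for k
    unfolding V_def using T r by (auto intro!: open_INT)
  have dec: "decseq V" unfolding V_def decseq_def by fastforce
  have "(\<lambda>k. emeasure (wmeas \<omega>) (V k)) \<longlonglongrightarrow> emeasure (wmeas \<omega>) (\<Inter>k. V k)"
    using V wmeas_finite[OF w V(3)] dec by (intro Lim_emeasure_decseq) (auto simp: less_top)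
  moreover have "emeasure (wmeas \<omega>) (\<Inter>k. V k) = emeasure (wmeas \<omega>) E"
  proof -
    have Vs: "(\<Inter>k. V k) \<in> sets lebesgue" using V by (intro sets.countable_INT) auto
    have le: "emeasure lebesgue ((\<Inter>k. V k) - E) \<le> ennreal ((1 / 2) ^ k)" for k
    proof -
      have "emeasure lebesgue ((\<Inter>k. V k) - E) \<le> emeasure lebesgue (T k - E)"
        using T E(1) by (intro emeasure_mono) (auto simp: V_def)
      then show ?thesis using T(3)[of k] by simp
    qed
    have "(\<lambda>k. ennreal ((1 / 2) ^ k)) \<longlonglongrightarrow> ennreal 0"
      by (intro tendsto_ennrealI LIMSEQ_realpow_zero) auto
    then have "emeasure lebesgue ((\<Inter>k. V k) - E) \<le> ennreal 0"
      by (rule LIMSEQ_le_const) (use le in auto)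
    then have "emeasure (wmeas \<omega>) ((\<Inter>k. V k) - E) = 0"
      using Vs E(1) by (intro wmeas_null[OF w]) auto
    moreover have "emeasure (wmeas \<omega>) (\<Inter>k. V k) = emeasure (wmeas \<omega>) E + emeasure (wmeas \<omega>) ((\<Inter>k. V k) - E)"
      using V(2) Vs E(1) by (subst plus_emeasure) (auto intro: arg_cong[where f = "emeasure (wmeas \<omega>)"])
    ultimately show ?thesis by simp
  qed
  ultimately show ?thesis using that[of V] V by simp
qed

subsection \<open>Dyadic cells\<close>

context
  fixes x\<^sub>0 :: "real^'n" and L :: real
  assumes L: "0 < L"
begin

definition cell_index :: "nat => real^'n => 'n => int" where
  "cell_index m y i = \<lfloor>2 ^ m * ((y $ i - x\<^sub>0 $ i) / L)\<rfloor>"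

definition cell :: "nat => real^'n => (real^'n) set" where
  "cell m y = {z. cell_index m z = cell_index m y}"

definition side :: "nat => real" where "side m = L / 2 ^ m"

lemma side: "0 < side m" "side m \<le> L" "side (Suc m) = side m / 2"
  using L by (auto simp: side_def field_simps)

lemma cell_self: "y \<in> cell m y" by (simp add: cell_def)

lemma cell_eq: "z \<in> cell m y ==> cell m z = cell m y" by (simp add: cell_def)

lemma cell_eq_hcube: "\<exists>c. cell m y = hcube c (side m)"
proof
  have "cell_index m z i = k \<longleftrightarrow> x\<^sub>0 $ i + side m * k \<le> z $ i \<and> z $ i < x\<^sub>0 $ i + side m * k + side m" for z i k
  proof -
    have "cell_index m z i = k \<longleftrightarrow> of_int k \<le> 2 ^ m * ((z $ i - x\<^sub>0 $ i) / L) \<and> 2 ^ m * ((z $ i - x\<^sub>0 $ i) / L) < of_int k + 1"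
      unfolding cell_index_def by (rule floor_eq_iff)
    also have "... \<longleftrightarrow> x\<^sub>0 $ i + side m * k \<le> z $ i \<and> z $ i < x\<^sub>0 $ i + side m * k + side m"
      using L by (simp add: side_def field_simps)
    finally show ?thesis .
  qed
  then show "cell m y = hcube (\<chi> i. x\<^sub>0 $ i + side m * cell_index m y i) (side m)"
    by (auto simp: cell_def hcube_def fun_eq_iff)
qed

lemma cell_Suc: "cell (Suc m) y \<subseteq> cell m y"
proof -
  have half: "\<lfloor>u\<rfloor> = \<lfloor>2 * u\<rfloor> div 2" for u :: real
  proof -
    have "2 * \<lfloor>u\<rfloor> \<le> \<lfloor>2 * u\<rfloor>" by (simp add: le_floor_iff)
    moreover have "\<lfloor>2 * u\<rfloor> < 2 * \<lfloor>u\<rfloor> + 2" by (simp add: floor_less_iff) linarith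
    ultimately show ?thesis by presburger
  qed
  have "cell_index m z i = cell_index (Suc m) z i div 2" for z i
    unfolding cell_index_def using half[of "2 ^ m * ((z $ i - x\<^sub>0 $ i) / L)"] by (simp only: power_Suc mult.assoc)
  then show ?thesis by (auto simp: cell_def fun_eq_iff)
qed

lemma cell_antimono: "m \<le> m' ==> cell m' y \<subseteq> cell m y"
  by (induction m' rule: dec_induct) (use cell_Suc in blast)+

lemma cell_sets [simp]: "cell m y \<in> sets lebesgue" using cell_eq_hcube[of m y] by auto

lemma emeasure_cell: "emeasure lebesgue (cell m y) = ennreal (side m ^ CARD('n))"
  using cell_eq_hcube[of m y] emeasure_hcube[OF less_imp_le[OF side(1)[of m]]] by metis

lemma cell_bounded: "bounded (cell m y)"
  using cell_eq_hcube[of m y] hcube_subset_cube cube_bounded bounded_subset by metis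

lemma countable_cells: "countable {cell m y | m y. True}"
proof -
  let ?F = "\<lambda>(m, k). {z. cell_index m z = k}"
  have "{cell m y | m y. True} \<subseteq> range ?F" by (auto simp: cell_def)
  moreover have "countable (range ?F)" by (intro countable_image countableI_type)
  ultimately show ?thesis by (rule countable_subset)
qed

lemma cell_small:
  assumes "open U" "y \<in> U" obtains m where "cell m y \<subseteq> U"
proof -
  obtain e where e: "0 < e" "ball y e \<subseteq> U" using assms by (auto simp: open_contains_ball)
  have "(\<lambda>m. real CARD('n) * (L * (1 / 2) ^ m)) \<longlonglongrightarrow> 0"
    by (intro tendsto_mult_right_zero LIMSEQ_realpow_zero) auto
  then have "\<forall>\<^sub>F m in sequentially. real CARD('n) * (L * (1 / 2) ^ m) < e"
    using e by (intro order_tendstoD) auto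
  then obtain m where m: "real CARD('n) * side m < e"
    by (auto simp: eventually_sequentially side_def power_one_over)
  have "cell m y \<subseteq> ball y e"
  proof
    fix z assume z: "z \<in> cell m y"
    obtain c where c: "cell m y = hcube c (side m)" using cell_eq_hcube by blast
    have "\<bar>(y - z) $ i\<bar> \<le> side m" for i
    proof -
      have "c $ i \<le> y $ i \<and> y $ i < c $ i + side m" "c $ i \<le> z $ i \<and> z $ i < c $ i + side m"
        using cell_self[of y m] z c by (auto simp: hcube_def)
      then show ?thesis unfolding vector_minus_component by linarith
    qed
    then have "norm (y - z) \<le> (\<Sum>i\<in>(UNIV :: 'n set). side m)"
      using norm_le_l1_cart[of "y - z"] by (intro order_trans[OF norm_le_l1_cart] sum_mono) auto
    then show "z \<in> ball y e" using m by (simp add: dist_norm)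
  qed
  then show ?thesis using e that by blast
qed

text \<open>For a property \<open>P\<close> of dyadic cells, the selected cells are the maximal cells that have it: the
usual stopping-time construction.\<close>

definition level :: "(nat => real^'n => bool) => real^'n => nat" where
  "level P y = (LEAST m. P m y)"

definition selected :: "(nat => real^'n => bool) => (real^'n) set set" where
  "selected P = {cell (level P y) y | y. \<exists>m. P m y}"

definition on_cells :: "(nat => real^'n => bool) => bool" where
  "on_cells P \<longleftrightarrow> (\<forall>m y z. z \<in> cell m y --> P m y --> P m z)"

lemma level: "\<exists>m. P m y ==> P (level P y) y" and level_le: "P m y ==> level P y \<le> m"
  unfolding level_def by (auto intro: LeastI_ex Least_le)

lemma level_eq:
  assumes P: "on_cells P" and y: "\<exists>m. P m y" and z: "z \<in> cell (level P y) y"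
  shows "level P z = level P y" "\<exists>m. P m z"
proof -
  have Pz: "P (level P y) z" using P level[where P = P, OF y] z unfolding on_cells_def by blast
  then show ex: "\<exists>m. P m z" by blast
  have le: "level P z \<le> level P y" using level_le[of P, OF Pz] .
  have "y \<in> cell (level P z) z" using z cell_antimono[OF le, of y] by (auto simp: cell_def)
  then have "P (level P z) y" using P level[where P = P, OF ex] unfolding on_cells_def by blast
  then show "level P z = level P y" using le level_le[of P] by (simp add: antisym)
qed

lemma selected_countable: "countable (selected P)"
  by (rule countable_subset[OF _ countable_cells]) (auto simp: selected_def)

lemma selected_sets: "selected P \<subseteq> sets lebesgue" by (auto simp: selected_def)

lemma selected_disjoint:
  assumes P: "on_cells P" shows "disjoint (selected P)"
proof (rule disjointI)
  fix A B assume "A \<in> selected P" "B \<in> selected P" and ne: "A \<noteq> B"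
  then obtain y y' where y: "A = cell (level P y) y" "\<exists>m. P m y" and y': "B = cell (level P y') y'" "\<exists>m. P m y'"
    by (auto simp: selected_def)
  show "A \<inter> B = {}"
  proof (rule ccontr)
    assume "A \<inter> B \<noteq> {}"
    then obtain z where "z \<in> A" "z \<in> B" by blast
    then have "cell (level P y) z = A" "cell (level P y') z = B" unfolding y(1) y'(1) by (intro cell_eq; simp)+
    moreover have "level P z = level P y" "level P z = level P y'"
      using level_eq(1)[OF P y(2), of z] level_eq(1)[OF P y'(2), of z] \<open>z \<in> A\<close> \<open>z \<in> B\<close> y(1) y'(1) by auto
    ultimately have "A = B" by simp
    with ne show False by simp
  qed
qed

lemma selected_Union:
  assumes P: "on_cells P" shows "\<Union>(selected P) = {y. \<exists>m. P m y}"
proof (intro equalityI subsetI)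
  fix z assume "z \<in> \<Union>(selected P)"
  then show "z \<in> {y. \<exists>m. P m y}" using level_eq(2)[OF P] by (auto simp: selected_def)
next
  fix z assume "z \<in> {y. \<exists>m. P m y}"
  then show "z \<in> \<Union>(selected P)" using cell_self[of z] by (auto simp: selected_def)
qed

end

text \<open>A part with a fixed share of the volume of a small cube has a fixed share of its weight. Where the
part has weight zero, the quotient is infinite unless the cube has weight zero too.\<close>

lemma Ainfty_bound:
  fixes \<omega> :: "real^'n => real"
  assumes \<omega>: "\<omega> \<in> Ainfty_loc" and \<alpha>: "0 < \<alpha>" "\<alpha> < 1"
  obtains C where "1 \<le> C" "\<And>x l F. 0 < l ==> l \<le> 1 ==> F \<subseteq> cube x l ==> F \<in> sets lebesgue ==>
    ennreal (\<alpha> * l ^ CARD('n)) \<le> emeasure lebesgue F ==>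
    measure (wmeas \<omega>) (cube x l) \<le> C * measure (wmeas \<omega>) F"
proof -
  have w: "\<omega> \<in> weights" using \<omega> by (simp add: Ainfty_loc_def)
  define S where "S = (SUP Q\<in>small_cubes.
       SUP F\<in>{F. F \<subseteq> Q \<and> F \<in> sets lebesgue \<and> emeasure lebesgue F \<ge> ennreal \<alpha> * emeasure lebesgue Q}.
         weight_of \<omega> Q / weight_of \<omega> F)"
  have "S < top" using \<omega> \<alpha> by (simp add: Ainfty_loc_def S_def)
  then obtain s where s: "S = ennreal s" "0 \<le> s" by (cases S) auto
  have "measure (wmeas \<omega>) (cube x l) \<le> max 1 s * measure (wmeas \<omega>) F"
    if l: "0 < l" "l \<le> 1" and F: "F \<subseteq> cube x l" "F \<in> sets lebesgue"
      and big: "ennreal (\<alpha> * l ^ CARD('n)) \<le> emeasure lebesgue F" for x l F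
  proof -
    let ?Q = "cube x l"
    define q where "q = measure (wmeas \<omega>) ?Q"
    define f where "f = measure (wmeas \<omega>) F"
    have nn: "0 \<le> q" "0 \<le> f" by (simp_all add: q_def f_def)
    have bF: "bounded F" using F(1) cube_bounded bounded_subset by blast
    have wq: "weight_of \<omega> ?Q = ennreal q" "weight_of \<omega> F = ennreal f"
      using weight_of_eq[OF w, of ?Q] weight_of_eq[OF w F(2)] wmeas_measure[OF w bF] wmeas_measure[OF w cube_bounded, of x l]
      by (simp_all add: q_def f_def)
    have "ennreal \<alpha> * emeasure lebesgue ?Q \<le> emeasure lebesgue F"
      unfolding emeasure_cube[OF less_imp_le[OF l(1)]] using big \<alpha> l by (simp add: ennreal_mult)
    then have "weight_of \<omega> ?Q / weight_of \<omega> F \<le> S"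
      unfolding S_def using F l by (intro SUP_upper2[of ?Q] SUP_upper) (auto simp: small_cubes_eq)
    then have le: "ennreal q / ennreal f \<le> ennreal s" by (simp only: wq s)
    show ?thesis
    proof (cases "f = 0")
      case True
      have "q = 0"
      proof (rule ccontr)
        assume "q \<noteq> 0"
        then have "ennreal q / ennreal f = top" using True nn by (simp add: divide_ennreal_def ennreal_mult_top)
        with le show False by (simp add: top_unique)
      qed
      then show ?thesis by (simp add: q_def)
    next
      case False
      then have f: "0 < f" using nn by simp
      then have "q / f \<le> s" using le nn s by (simp add: divide_ennreal)
      then have "q \<le> s * f" using f by (simp add: field_simps)
      also have "... \<le> max 1 s * f" using nn by (intro mult_right_mono) auto
      finally show ?thesis by (simp add: q_def f_def)
    qed
  qed
  then show ?thesis using that[of "max 1 s"] by simp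
qed

context
  fixes \<omega> :: "real^'n => real" and C\<^sub>1 C\<^sub>2 :: real and x\<^sub>0 :: "real^'n" and L :: real
  assumes w: "\<omega> \<in> weights"
    and pos: "\<And>x l. 0 < l ==> 0 < measure (wmeas \<omega>) (cube x l)"
    and C1: "1 \<le> C\<^sub>1" "\<And>x l F. 0 < l ==> l \<le> 1 ==> F \<subseteq> cube x l ==> F \<in> sets lebesgue ==>
      ennreal ((1 / 2) ^ CARD('n) * l ^ CARD('n)) \<le> emeasure lebesgue F ==>
      measure (wmeas \<omega>) (cube x l) \<le> C\<^sub>1 * measure (wmeas \<omega>) F"
    and C2: "1 \<le> C\<^sub>2" "\<And>x l F. 0 < l ==> l \<le> 1 ==> F \<subseteq> cube x l ==> F \<in> sets lebesgue ==>
      ennreal (1 / 2 * l ^ CARD('n)) \<le> emeasure lebesgue F ==>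
      measure (wmeas \<omega>) (cube x l) \<le> C\<^sub>2 * measure (wmeas \<omega>) F"
    and L: "0 < L" "L \<le> 1"
begin

abbreviation "cl \<equiv> cell x\<^sub>0 L"
abbreviation "Q\<^sub>0 \<equiv> hcube x\<^sub>0 L"
abbreviation "W \<equiv> measure (wmeas \<omega>)"

lemma sel_countable: "countable (selected x\<^sub>0 L P)" by (rule selected_countable[OF L(1)])

lemma sel_sets: "S \<in> selected x\<^sub>0 L P ==> S \<in> sets lebesgue"
  using selected_sets[OF L(1)] by (rule subsetD)

lemma sel_Union_sets: "\<Union>(selected x\<^sub>0 L P) \<in> sets lebesgue"
  by (intro sets.countable_Union sel_countable subsetI sel_sets)

lemma cl_0: "cl 0 x\<^sub>0 = Q\<^sub>0"
  using L by (auto simp: cell_def[OF L(1)] cell_index_def[OF L(1)] hcube_def fun_eq_iff floor_eq_iff field_simps)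

lemma V_pos: "0 < (side L m ^ CARD('n))" using side(1)[OF L(1)] by simp

lemma V_0: "(side L 0 ^ CARD('n)) = L ^ CARD('n)" by (simp add: side_def[OF L(1)])

lemma W_cl: "emeasure (wmeas \<omega>) (cl m y) = ennreal (W (cl m y))"
  by (rule wmeas_measure[OF w cell_bounded[OF L(1)]])

lemma cl_cube: obtains c where "cl m y \<subseteq> cube c (side L m)" "W (cl m y) = W (cube c (side L m))"
proof -
  obtain c where c: "cl m y = hcube c (side L m)" using cell_eq_hcube[OF L(1)] by blast
  moreover have "W (hcube c (side L m)) = W (cube c (side L m))"
    using wmeas_hcube[OF w, of "side L m" c] side(1)[OF L(1), of m] by (simp add: measure_def)
  ultimately show ?thesis using that hcube_subset_cube by metis
qed

lemma W_cl_pos: "0 < W (cl m y)" by (rule cl_cube[of m y]) (use pos side(1)[OF L(1)] in simp)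

lemma side_le_1: "side L m \<le> 1" using side(2)[OF L(1), of m] L by simp

lemma W_parent: "W (cl m y) \<le> C\<^sub>1 * W (cl (Suc m) y)"
proof -
  obtain c where c: "cl m y \<subseteq> cube c (side L m)" "W (cl m y) = W (cube c (side L m))" by (rule cl_cube)
  show ?thesis unfolding c(2)
  proof (rule C1(2))
    show "ennreal ((1 / 2) ^ CARD('n) * side L m ^ CARD('n)) \<le> emeasure lebesgue (cl (Suc m) y)"
      unfolding emeasure_cell[OF L(1)] side(3)[OF L(1)] by (simp add: power_divide)
    show "cl (Suc m) y \<subseteq> cube c (side L m)" by (rule order_trans[OF cell_Suc[OF L(1)] c(1)])
  qed (use side(1)[OF L(1), of m] side_le_1[of m] in \<open>auto simp: cell_sets[OF L(1)]\<close>)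
qed

lemma W_half:
  assumes "D \<in> sets lebesgue" "W (cl m y) > C\<^sub>2 * W (D \<inter> cl m y)"
  shows "emeasure lebesgue (D \<inter> cl m y) \<le> ennreal (1 / 2) * emeasure lebesgue (cl m y)"
proof (rule ccontr)
  assume "\<not> ?thesis"
  then have big: "ennreal (1 / 2 * (side L m ^ CARD('n))) \<le> emeasure lebesgue (D \<inter> cl m y)"
    using V_pos[of m] by (simp only: emeasure_cell[OF L(1)] ennreal_mult[symmetric] not_le)
  obtain c where c: "cl m y \<subseteq> cube c (side L m)" "W (cl m y) = W (cube c (side L m))" by (rule cl_cube)
  have "W (cube c (side L m)) \<le> C\<^sub>2 * W (D \<inter> cl m y)"
    using c assms(1) big side(1)[OF L(1)] side_le_1 by (intro C2(2)) (auto simp: cell_sets[OF L(1)])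
  then show False using assms(2) c(2) by simp
qed

text \<open>A cell is heavy for \<open>\<tau>\<close> if its volume exceeds \<open>\<tau>\<close> times its weight; the heavy set is thus a level
set of the dyadic maximal function, with respect to the weight, of the density \<open>1 / \<omega>\<close> of Lebesgue
measure.\<close>

definition heavy :: "real => nat => real^'n => bool" where
  "heavy \<tau> m y \<longleftrightarrow> y \<in> Q\<^sub>0 \<and> (side L m ^ CARD('n)) > \<tau> * W (cl m y)"

lemma cl_in_Q0: "y \<in> Q\<^sub>0 ==> z \<in> cl m y ==> z \<in> Q\<^sub>0"
proof -
  assume y: "y \<in> Q\<^sub>0" and z: "z \<in> cl m y"
  have "cl 0 y = cl 0 x\<^sub>0" by (rule cell_eq[OF L(1)]) (use y in \<open>simp only: cl_0\<close>)
  moreover have "z \<in> cl 0 y" by (rule subsetD[OF cell_antimono[OF L(1)] z]) simp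
  ultimately show ?thesis by (simp only: cl_0)
qed

lemma heavy_on_cells: "on_cells x\<^sub>0 L (heavy \<tau>)" unfolding on_cells_def[OF L(1)]
proof (intro allI impI)
  fix m y z assume z: "z \<in> cl m y" and h: "heavy \<tau> m y"
  have "cl m z = cl m y" by (rule cell_eq[OF L(1) z])
  moreover have "z \<in> Q\<^sub>0" using h by (intro cl_in_Q0[OF _ z]) (simp add: heavy_def)
  ultimately show "heavy \<tau> m z" using h by (simp add: heavy_def)
qed

definition heavy_set :: "real => (real^'n) set" where "heavy_set \<tau> = {y. \<exists>m. heavy \<tau> m y}"

lemma heavy_set_Union: "\<Union>(selected x\<^sub>0 L (heavy \<tau>)) = heavy_set \<tau>"
  unfolding heavy_set_def by (rule selected_Union[OF L(1) heavy_on_cells])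

lemma heavy_set_sets: "heavy_set \<tau> \<in> sets lebesgue"
  unfolding heavy_set_Union[symmetric] by (rule sel_Union_sets)

lemma heavy_set_subset: "heavy_set \<tau> \<subseteq> Q\<^sub>0" by (auto simp: heavy_set_def heavy_def)

definition "mean = (side L 0 ^ CARD('n)) / W Q\<^sub>0"

lemma mean_pos: "0 < mean" using V_pos[of 0] W_cl_pos[of 0 x\<^sub>0] by (simp add: mean_def cl_0)

lemma selected_light:
  assumes \<tau>: "mean \<le> \<tau>" and y: "y \<in> heavy_set \<tau>"
  shows "(side L (level (heavy \<tau>) y) ^ CARD('n)) \<le> C\<^sub>1 * \<tau> * W (cl (level (heavy \<tau>) y) y)"
proof -
  define m where "m = level (heavy \<tau>) y"
  have hm: "heavy \<tau> m y"
    unfolding m_def by (rule level[OF L(1), where P = "heavy \<tau>"]) (use y in \<open>simp add: heavy_set_def\<close>)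
  have yQ: "y \<in> Q\<^sub>0" using hm by (simp add: heavy_def)
  have c0: "cl 0 y = Q\<^sub>0"
    unfolding cl_0[symmetric] by (rule cell_eq[OF L(1)]) (use yQ in \<open>simp only: cl_0\<close>)
  have WQ: "0 < W Q\<^sub>0" using W_cl_pos[of 0 x\<^sub>0] by (simp add: cl_0)
  have "m \<noteq> 0"
  proof
    assume "m = 0"
    then have "(side L 0 ^ CARD('n)) > \<tau> * W Q\<^sub>0" using hm c0 by (simp add: heavy_def)
    moreover have "(side L 0 ^ CARD('n)) = mean * W Q\<^sub>0" using WQ by (simp add: mean_def)
    ultimately show False using \<tau> WQ by simp
  qed
  then obtain m' where m': "m = Suc m'" by (cases m) auto
  have "\<not> heavy \<tau> m' y" using level_le[OF L(1), of "heavy \<tau>" m' y] m' unfolding m_def by fastforce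
  then have "(side L m' ^ CARD('n)) \<le> \<tau> * W (cl m' y)" using yQ by (simp add: heavy_def)
  also have "... \<le> \<tau> * (C\<^sub>1 * W (cl m y))"
    unfolding m' using W_parent mean_pos \<tau> by (intro mult_left_mono) auto
  finally have "(side L m' ^ CARD('n)) \<le> C\<^sub>1 * \<tau> * W (cl m y)" by (simp add: mult_ac)
  moreover have "(side L m ^ CARD('n)) \<le> (side L m' ^ CARD('n))"
    unfolding m' using side[OF L(1), of m'] by (intro power_mono) auto
  ultimately show ?thesis by (simp add: m_def)
qed

lemma heavy_mono:
  assumes "\<tau> \<le> \<tau>'" "heavy \<tau>' m y" shows "heavy \<tau> m y"
proof -
  have "\<tau> * W (cl m y) \<le> \<tau>' * W (cl m y)" using assms(1) by (intro mult_right_mono) auto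
  then show ?thesis using assms(2) by (simp add: heavy_def)
qed

lemma heavy_set_antimono: "\<tau> \<le> \<tau>' ==> heavy_set \<tau>' \<subseteq> heavy_set \<tau>"
  unfolding heavy_set_def using heavy_mono by blast

definition "ratio = 3 * C\<^sub>1 * C\<^sub>2"

lemma ratio: "3 \<le> ratio" unfolding ratio_def using C1(1) C2(1) mult_mono[of 1 C\<^sub>1 1 C\<^sub>2] by simp

text \<open>In a maximal cell that is heavy for \<open>\<tau>\<close> the volume is at most \<open>C\<^sub>1 \<tau>\<close> times the weight, since the
parent is not heavy. The set where the level \<open>ratio * \<tau>\<close> is exceeded has at least \<open>ratio * \<tau>\<close> times
its weight as volume, so it takes less than the \<open>C\<^sub>2\<close>-th part of the weight of the cell; by the choice
of \<open>C\<^sub>2\<close> it then has at most half of the volume.\<close>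

lemma heavy_set_halves:
  assumes \<tau>: "mean \<le> \<tau>"
  shows "emeasure lebesgue (heavy_set (ratio * \<tau>)) \<le> ennreal (1 / 2) * emeasure lebesgue (heavy_set \<tau>)"
proof -
  define D where "D = heavy_set (ratio * \<tau>)"
  have \<tau>0: "0 < \<tau>" using mean_pos \<tau> by simp
  have \<tau>': "\<tau> \<le> ratio * \<tau>" using ratio \<tau>0 by simp
  have D: "D \<in> sets lebesgue" "D \<subseteq> heavy_set \<tau>"
    unfolding D_def using heavy_set_sets heavy_set_antimono[OF \<tau>'] by auto
  have part: "emeasure lebesgue (D \<inter> S) \<le> ennreal (1 / 2) * emeasure lebesgue S"
    if sel: "S \<in> selected x\<^sub>0 L (heavy \<tau>)" for S
  proof -
    obtain y where y: "S = cl (level (heavy \<tau>) y) y" "\<exists>m. heavy \<tau> m y"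
      using sel by (auto simp: selected_def[OF L(1)])
    define m where "m = level (heavy \<tau>) y"
    have S: "S = cl m y" using y by (simp add: m_def)
    let ?F = "{S' \<in> selected x\<^sub>0 L (heavy (ratio * \<tau>)). S' \<subseteq> S}"
    have U: "\<Union>?F = D \<inter> S"
    proof (intro equalityI subsetI)
      fix z assume "z \<in> \<Union>?F"
      then show "z \<in> D \<inter> S" using heavy_set_Union[of "ratio * \<tau>"] by (auto simp: D_def)
    next
      fix z assume z: "z \<in> D \<inter> S"
      define m2 where "m2 = level (heavy (ratio * \<tau>)) z"
      have h2: "heavy (ratio * \<tau>) m2 z"
        unfolding m2_def by (rule level[OF L(1), where P = "heavy (ratio * \<tau>)"]) (use z in \<open>simp add: D_def heavy_set_def\<close>)
      then have "heavy \<tau> m2 z" by (rule heavy_mono[OF \<tau>'])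
      then have "level (heavy \<tau>) z \<le> m2" by (rule level_le[OF L(1), where P = "heavy \<tau>"])
      moreover have "level (heavy \<tau>) z = m"
        unfolding m_def by (rule level_eq(1)[OF L(1) heavy_on_cells y(2)]) (use z S in \<open>simp add: m_def\<close>)
      ultimately have "cl m2 z \<subseteq> cl m z" by (intro cell_antimono[OF L(1)]) simp
      also have "cl m z = S" unfolding S using z by (intro cell_eq[OF L(1)]) (simp add: S)
      finally have "cl m2 z \<in> ?F" using h2 by (auto simp: selected_def[OF L(1)] m2_def)
      then show "z \<in> \<Union>?F" using cell_self[OF L(1), of z] by blast
    qed
    have "emeasure (wmeas \<omega>) (\<Union>?F) \<le> ennreal (1 / (ratio * \<tau>)) * emeasure lebesgue (\<Union>?F)"
    proof (rule emeasure_disjoint_family_le)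
      show "countable ?F" using sel_countable by (rule countable_subset[rotated]) auto
      show "disjoint ?F" using selected_disjoint[OF L(1) heavy_on_cells] unfolding disjoint_def by blast
      show "?F \<subseteq> sets (wmeas \<omega>)" using sel_sets by auto
      fix S' assume "S' \<in> ?F"
      then obtain z where z: "S' = cl (level (heavy (ratio * \<tau>)) z) z" "\<exists>m. heavy (ratio * \<tau>) m z"
        by (auto simp: selected_def[OF L(1)])
      have "heavy (ratio * \<tau>) (level (heavy (ratio * \<tau>)) z) z" by (rule level[OF L(1), where P = "heavy (ratio * \<tau>)", OF z(2)])
      then have "W S' \<le> 1 / (ratio * \<tau>) * (side L (level (heavy (ratio * \<tau>)) z) ^ CARD('n))"
        using \<tau>0 ratio by (simp add: heavy_def z(1) field_simps)
      then have "ennreal (W S') \<le> ennreal (1 / (ratio * \<tau>) * (side L (level (heavy (ratio * \<tau>)) z) ^ CARD('n)))"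
        by (rule ennreal_leI)
      then show "emeasure (wmeas \<omega>) S' \<le> ennreal (1 / (ratio * \<tau>)) * emeasure lebesgue S'"
        unfolding z(1) W_cl emeasure_cell[OF L(1)] using \<tau>0 ratio V_pos
        by (subst ennreal_mult[symmetric]) (auto simp: less_imp_le)
    qed simp
    also have "emeasure lebesgue (\<Union>?F) \<le> emeasure lebesgue (cl m y)"
      unfolding U unfolding S by (intro emeasure_mono cell_sets[OF L(1)] Int_lower2)
    also have "emeasure lebesgue (cl m y) = ennreal (side L m ^ CARD('n))" by (rule emeasure_cell[OF L(1)])
    finally have le: "emeasure (wmeas \<omega>) (D \<inter> S) \<le> ennreal (1 / (ratio * \<tau>)) * ennreal (side L m ^ CARD('n))"
      unfolding U by (simp add: mult_left_mono)
    have "bounded (D \<inter> S)" unfolding S using cell_bounded[OF L(1), of x\<^sub>0 m y] by (rule bounded_subset) simp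
    then have "emeasure (wmeas \<omega>) (D \<inter> S) = ennreal (W (D \<inter> S))" by (rule wmeas_measure[OF w])
    with le have "ennreal (W (D \<inter> S)) \<le> ennreal (1 / (ratio * \<tau>) * (side L m ^ CARD('n)))"
      using \<tau>0 ratio V_pos[of m] by (subst ennreal_mult) (auto simp: less_imp_le)
    then have "W (D \<inter> S) \<le> 1 / (ratio * \<tau>) * (side L m ^ CARD('n))"
      using \<tau>0 ratio V_pos[of m] by (simp add: less_imp_le)
    also have "... \<le> 1 / (ratio * \<tau>) * (C\<^sub>1 * \<tau> * W S)"
      using selected_light[OF \<tau>, of y] y \<tau>0 ratio by (intro mult_left_mono) (auto simp: heavy_set_def m_def S)
    also have "... = W S / (3 * C\<^sub>2)" using \<tau>0 C1(1) C2(1) by (simp add: ratio_def field_simps)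
    finally have "C\<^sub>2 * W (D \<inter> S) \<le> W S / 3" using C2(1) by (simp add: field_simps)
    also have "... < W S" using W_cl_pos[of m y] by (simp add: S)
    finally show ?thesis unfolding S by (intro W_half D) (simp add: S)
  qed
  have "emeasure (density lebesgue (indicator D)) (\<Union>(selected x\<^sub>0 L (heavy \<tau>)))
      \<le> ennreal (1 / 2) * emeasure lebesgue (\<Union>(selected x\<^sub>0 L (heavy \<tau>)))"
  proof (rule emeasure_disjoint_family_le)
    fix S assume "S \<in> selected x\<^sub>0 L (heavy \<tau>)"
    then show "emeasure (density lebesgue (indicator D)) S \<le> ennreal (1 / 2) * emeasure lebesgue S"
      using part[of S] sel_sets D(1) by (subst emeasure_restricted) auto
  qed (auto intro: sel_countable selected_disjoint[OF L(1) heavy_on_cells] sel_sets)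
  then have "emeasure lebesgue (D \<inter> heavy_set \<tau>) \<le> ennreal (1 / 2) * emeasure lebesgue (heavy_set \<tau>)"
    unfolding heavy_set_Union using D(1) heavy_set_sets by (subst (asm) emeasure_restricted) auto
  moreover have "D \<inter> heavy_set \<tau> = D" using D by blast
  ultimately show ?thesis by (simp add: D_def)
qed

lemma emeasure_heavy_set: "emeasure lebesgue (heavy_set (ratio ^ k * mean)) \<le> ennreal ((1 / 2) ^ k * (side L 0 ^ CARD('n)))"
proof (induction k)
  case 0
  have "emeasure lebesgue (heavy_set mean) \<le> emeasure lebesgue Q\<^sub>0"
    by (rule emeasure_mono[OF heavy_set_subset hcube_lebesgue])
  then show ?case using emeasure_hcube[of L x\<^sub>0] L by (simp add: V_0)
next
  case (Suc k)
  have "mean \<le> ratio ^ k * mean" using ratio mean_pos one_le_power[of ratio k] by simp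
  from heavy_set_halves[OF this]
  have "emeasure lebesgue (heavy_set (ratio ^ Suc k * mean)) \<le> ennreal (1 / 2) * emeasure lebesgue (heavy_set (ratio ^ k * mean))"
    by (simp add: mult.assoc)
  also have "... \<le> ennreal (1 / 2) * ennreal ((1 / 2) ^ k * (side L 0 ^ CARD('n)))"
    by (intro mult_left_mono Suc) auto
  also have "... = ennreal (1 / 2 * ((1 / 2) ^ k * (side L 0 ^ CARD('n))))"
    using V_pos[of 0] by (intro ennreal_mult[symmetric]) auto
  finally show ?case by (simp add: mult.assoc)
qed

text \<open>A set of positive measure off the heavy set where \<open>\<omega> < 1 / \<tau>\<close> could be covered by small cells of
almost the same total weight, none of them heavy; comparing volumes and weights gives a
contradiction.\<close>

lemma weight_bound_off_heavy_set:
  assumes \<tau>: "0 < \<tau>"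
  shows "AE y in lebesgue. y \<in> Q\<^sub>0 - heavy_set \<tau> --> 1 / \<tau> \<le> \<omega> y"
proof -
  have null: "emeasure lebesgue {y \<in> Q\<^sub>0 - heavy_set \<tau>. \<omega> y \<le> c} = 0" if c: "0 \<le> c" "c < 1 / \<tau>" for c
  proof -
    define E where "E = {y \<in> Q\<^sub>0 - heavy_set \<tau>. \<omega> y \<le> c}"
    have E: "E \<in> sets lebesgue"
    proof -
      have "{y \<in> space lebesgue. \<omega> y \<le> c} \<in> sets lebesgue"
        using weight_measurable[OF w] by measurable
      moreover have "E = (Q\<^sub>0 - heavy_set \<tau>) \<inter> {y \<in> space lebesgue. \<omega> y \<le> c}" by (auto simp: E_def)
      ultimately show ?thesis by (simp only:) (intro sets.Int sets.Diff hcube_lebesgue heavy_set_sets)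
    qed
    have bE: "bounded E"
    proof (rule bounded_subset[OF cell_bounded[OF L(1), of x\<^sub>0 0 x\<^sub>0]])
      show "E \<subseteq> cl 0 x\<^sub>0" unfolding cl_0 by (auto simp: E_def)
    qed
    have open_bound: "emeasure lebesgue E \<le> ennreal \<tau> * emeasure (wmeas \<omega>) U" if U: "open U" "E \<subseteq> U" for U
    proof -
      define P where "P m y \<longleftrightarrow> cl m y \<subseteq> U \<and> (side L m ^ CARD('n)) \<le> \<tau> * W (cl m y)" for m y
      have P: "on_cells x\<^sub>0 L P" unfolding on_cells_def[OF L(1)]
      proof (intro allI impI)
        fix m y z assume z: "z \<in> cl m y" and h: "P m y"
        have "cl m z = cl m y" by (rule cell_eq[OF L(1) z])
        then show "P m z" using h by (simp add: P_def)
      qed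
      have "E \<subseteq> \<Union>(selected x\<^sub>0 L P)"
      proof
        fix y assume y: "y \<in> E"
        then have "y \<in> U" using U(2) by blast
        then obtain m where "cl m y \<subseteq> U" by (rule cell_small[OF L(1) U(1)]) blast
        moreover have "(side L m ^ CARD('n)) \<le> \<tau> * W (cl m y)"
          using y by (auto simp: E_def heavy_set_def heavy_def not_less)
        ultimately show "y \<in> \<Union>(selected x\<^sub>0 L P)"
          unfolding selected_Union[OF L(1) P] P_def by blast
      qed
      then have "emeasure lebesgue E \<le> emeasure lebesgue (\<Union>(selected x\<^sub>0 L P))"
        by (intro emeasure_mono sel_Union_sets)
      also have "... \<le> ennreal \<tau> * emeasure (wmeas \<omega>) (\<Union>(selected x\<^sub>0 L P))"
      proof (rule emeasure_disjoint_family_le)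
        fix S assume "S \<in> selected x\<^sub>0 L P"
        then obtain y where y: "S = cl (level P y) y" "\<exists>m. P m y" by (auto simp: selected_def[OF L(1)])
        have "P (level P y) y" by (rule level[OF L(1), where P = P, OF y(2)])
        then have "(side L (level P y) ^ CARD('n)) \<le> \<tau> * W S" by (simp add: P_def y(1))
        then have "ennreal ((side L (level P y) ^ CARD('n))) \<le> ennreal (\<tau> * W S)" by (rule ennreal_leI)
        then show "emeasure lebesgue S \<le> ennreal \<tau> * emeasure (wmeas \<omega>) S"
          unfolding y(1) W_cl emeasure_cell[OF L(1)] using \<tau> by (simp add: ennreal_mult)
      qed (auto intro: sel_countable selected_disjoint[OF L(1) P] sel_sets)
      also have "... \<le> ennreal \<tau> * emeasure (wmeas \<omega>) U"
      proof (intro mult_left_mono emeasure_mono)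
        show "\<Union>(selected x\<^sub>0 L P) \<subseteq> U"
        proof
          fix z assume "z \<in> \<Union>(selected x\<^sub>0 L P)"
          then obtain m where "P m z" unfolding selected_Union[OF L(1) P] by blast
          then show "z \<in> U" using cell_self[OF L(1), of z] by (auto simp: P_def)
        qed
      qed (use U in auto)
      finally show ?thesis .
    qed
    obtain T where T: "\<And>k :: nat. open (T k)" "\<And>k. E \<subseteq> T k"
      "(\<lambda>k. emeasure (wmeas \<omega>) (T k)) \<longlonglongrightarrow> emeasure (wmeas \<omega>) E"
      by (rule wmeas_outer[OF w E bE]) blast
    have "(\<lambda>k. ennreal \<tau> * emeasure (wmeas \<omega>) (T k)) \<longlonglongrightarrow> ennreal \<tau> * emeasure (wmeas \<omega>) E"
      by (intro ennreal_tendsto_cmult T) auto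
    then have "emeasure lebesgue E \<le> ennreal \<tau> * emeasure (wmeas \<omega>) E"
      by (rule LIMSEQ_le_const) (use open_bound T in auto)
    also have "emeasure (wmeas \<omega>) E \<le> ennreal c * emeasure lebesgue E"
    proof -
      have "emeasure (wmeas \<omega>) E = (\<integral>\<^sup>+y\<in>E. ennreal (\<omega> y) \<partial>lebesgue)"
        using weight_of_eq[OF w E] by (simp add: weight_of_def)
      also have "... \<le> (\<integral>\<^sup>+y. ennreal c * indicator E y \<partial>lebesgue)"
        by (intro nn_integral_mono) (auto simp: E_def indicator_def intro: ennreal_leI)
      also have "... = ennreal c * emeasure lebesgue E" using E by (rule nn_integral_cmult_indicator)
      finally show ?thesis .
    qed
    finally have le: "emeasure lebesgue E \<le> ennreal (\<tau> * c) * emeasure lebesgue E"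
      using \<tau> c by (simp add: ennreal_mult mult.assoc mult_left_mono)
    have "emeasure lebesgue E < top"
      using fmeasurableD2[OF bounded_set_imp_lmeasurable[OF bE E]] by (simp add: top.not_eq_extremum)
    then obtain e where e: "emeasure lebesgue E = ennreal e" "0 \<le> e" by (cases "emeasure lebesgue E") auto
    have "e \<le> \<tau> * c * e" using le \<tau> c e by (simp add: ennreal_mult[symmetric])
    moreover have "\<tau> * c < 1" using c \<tau> by (simp add: field_simps)
    ultimately have "e = 0" using e(2) by (smt (verit) mult_less_cancel_right2)
    then show ?thesis using e by (simp add: E_def)
  qed
  define c where "c j = (1 - inverse (real (Suc j))) / \<tau>" for j
  have c: "0 \<le> c j" "c j < 1 / \<tau>" for j
  proof -
    have "inverse (real (Suc j)) \<le> 1" by (simp add: inverse_le_1_iff)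
    then show "0 \<le> c j" unfolding c_def using \<tau> by (intro divide_nonneg_pos) auto
    show "c j < 1 / \<tau>" unfolding c_def by (rule divide_strict_right_mono[OF _ \<tau>]) simp
  qed
  have meas: "{y \<in> Q\<^sub>0 - heavy_set \<tau>. \<omega> y \<le> t} \<in> sets lebesgue" for t
  proof -
    have "{y \<in> space lebesgue. \<omega> y \<le> t} \<in> sets lebesgue"
      using weight_measurable[OF w] by measurable
    moreover have "{y \<in> Q\<^sub>0 - heavy_set \<tau>. \<omega> y \<le> t} = (Q\<^sub>0 - heavy_set \<tau>) \<inter> {y \<in> space lebesgue. \<omega> y \<le> t}" by auto
    ultimately show ?thesis by (simp only:) (intro sets.Int sets.Diff hcube_lebesgue heavy_set_sets)
  qed
  have "AE y in lebesgue. y \<notin> {y \<in> Q\<^sub>0 - heavy_set \<tau>. \<omega> y \<le> c j}" for j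
    using null[OF c] meas by (intro AE_not_in) (auto simp: null_sets_def)
  then have "AE y in lebesgue. \<forall>j. y \<notin> {y \<in> Q\<^sub>0 - heavy_set \<tau>. \<omega> y \<le> c j}"
    unfolding AE_all_countable by blast
  then show ?thesis
  proof (rule eventually_mono, intro impI)
    fix y assume y: "\<forall>j. y \<notin> {y \<in> Q\<^sub>0 - heavy_set \<tau>. \<omega> y \<le> c j}" "y \<in> Q\<^sub>0 - heavy_set \<tau>"
    then have "\<not> \<omega> y \<le> c j" for j by blast
    then have "c j \<le> \<omega> y" for j by (meson linear)
    moreover have "c \<longlonglongrightarrow> (1 - 0) / \<tau>"
      unfolding c_def using \<tau> by (intro tendsto_intros LIMSEQ_inverse_real_of_nat) auto
    ultimately show "1 / \<tau> \<le> \<omega> y" by (intro LIMSEQ_le_const2[of c]) auto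
  qed
qed

text \<open>Summing over the nested level sets bounds a small negative power of the weight.\<close>

lemma negative_power_mean:
  assumes d: "0 < d" "ratio powr d = 3 / 2"
  shows "(\<integral>\<^sup>+y\<in>cube x\<^sub>0 L. epowr (inverse (ennreal (\<omega> y))) d \<partial>lebesgue) \<le> ennreal (7 * mean powr d * (side L 0 ^ CARD('n)))"
proof -
  define D where "D k = heavy_set (ratio ^ k * mean)" for k
  define \<sigma> where "\<sigma> y = epowr (inverse (ennreal (\<omega> y))) d" for y
  define t where "t k = (ratio ^ k * mean) powr d" for k
  have t: "t k = (3 / 2) ^ k * mean powr d" for k
  proof -
    have "(ratio ^ k) powr d = (3 / 2) ^ k" using ratio d by (induction k) (simp_all add: powr_mult)
    then show ?thesis using ratio mean_pos by (simp add: t_def powr_mult)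
  qed
  have t0: "0 \<le> t k" for k by (simp add: t_def)
  have D: "D k \<in> sets lebesgue" for k unfolding D_def by (rule heavy_set_sets)
  have Dn: "emeasure lebesgue (\<Inter>k. D k) = 0"
  proof -
    have "emeasure lebesgue (\<Inter>k. D k) \<le> ennreal ((1 / 2) ^ k * (side L 0 ^ CARD('n)))" for k
    proof -
      have "emeasure lebesgue (\<Inter>k. D k) \<le> emeasure lebesgue (D k)" using D by (intro emeasure_mono) auto
      also have "... \<le> ennreal ((1 / 2) ^ k * (side L 0 ^ CARD('n)))" unfolding D_def by (rule emeasure_heavy_set)
      finally show ?thesis .
    qed
    moreover have "(\<lambda>k. ennreal ((1 / 2) ^ k * (side L 0 ^ CARD('n)))) \<longlonglongrightarrow> ennreal 0"
      by (intro tendsto_ennrealI tendsto_mult_left_zero LIMSEQ_realpow_zero) auto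
    ultimately have "emeasure lebesgue (\<Inter>k. D k) \<le> ennreal 0" by (intro LIMSEQ_le_const) auto
    then show ?thesis by simp
  qed
  have ae1: "AE y in lebesgue. \<forall>k. y \<in> Q\<^sub>0 - D k --> 1 / (ratio ^ k * mean) \<le> \<omega> y"
    unfolding AE_all_countable D_def using ratio mean_pos by (intro allI weight_bound_off_heavy_set) auto
  have ae2: "AE y in lebesgue. y \<notin> (\<Inter>k. D k)"
    using Dn D by (intro AE_not_in) (auto simp: null_sets_def intro!: sets.countable_INT)
  have ae3: "AE y in lebesgue. y \<notin> cube x\<^sub>0 L - Q\<^sub>0"
    using cube_minus_hcube_null[of L x\<^sub>0] L by (intro AE_not_in) (auto simp: null_sets_def)
  have \<sigma>_le: "\<sigma> y \<le> ennreal (t k)" if "1 / (ratio ^ k * mean) \<le> \<omega> y" for y k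
  proof -
    have p: "0 < ratio ^ k * mean" using ratio mean_pos by simp
    then have "0 < 1 / (ratio ^ k * mean)" by simp
    with that have o: "0 < \<omega> y" by linarith
    then have "inverse (\<omega> y) \<le> ratio ^ k * mean" using that p by (simp add: field_simps)
    then have "inverse (\<omega> y) powr d \<le> t k" unfolding t_def using d o by (intro powr_mono2) auto
    then show ?thesis using o by (simp add: \<sigma>_def inverse_ennreal epowr_def ennreal_leI)
  qed
  have "(\<integral>\<^sup>+y. \<sigma> y * indicator (cube x\<^sub>0 L) y \<partial>lebesgue) \<le>
     (\<integral>\<^sup>+y. ennreal (t 0) * indicator Q\<^sub>0 y + (\<Sum>k. ennreal (t (Suc k)) * indicator (D k) y) \<partial>lebesgue)"
  proof (rule nn_integral_mono_AE)
    show "AE y in lebesgue. \<sigma> y * indicator (cube x\<^sub>0 L) y \<le> ennreal (t 0) * indicator Q\<^sub>0 y + (\<Sum>k. ennreal (t (Suc k)) * indicator (D k) y)"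
      using ae1 ae2 ae3
    proof eventually_elim
      case (elim y)
      show ?case
      proof (cases "y \<in> cube x\<^sub>0 L")
        case True
        then have yQ: "y \<in> Q\<^sub>0" using elim by auto
        obtain k where k: "y \<notin> D k" using elim by auto
        define k0 where "k0 = (LEAST k. y \<notin> D k)"
        have k0: "y \<notin> D k0" unfolding k0_def using k by (rule LeastI)
        then have \<sigma>k: "\<sigma> y \<le> ennreal (t k0)" using elim yQ by (intro \<sigma>_le) auto
        show ?thesis
        proof (cases k0)
          case 0
          then show ?thesis using \<sigma>k yQ True by (auto intro: order_trans add_increasing2)
        next
          case (Suc j)
          then have "y \<in> D j" using not_less_Least[of j "\<lambda>k. y \<notin> D k"] by (auto simp: k0_def)
          then have "\<sigma> y \<le> ennreal (t (Suc j)) * indicator (D j) y" using \<sigma>k Suc by simp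
          also have "... \<le> (\<Sum>k. ennreal (t (Suc k)) * indicator (D k) y)"
          proof -
            have "g j \<le> (\<Sum>k. g k)" for g :: "nat => ennreal" using sum_le_suminf[of g "{j}"] by simp
            then show ?thesis .
          qed
          finally show ?thesis using True by (auto intro: add_increasing)
        qed
      qed simp
    qed
  qed
  also have "... = ennreal (t 0) * emeasure lebesgue Q\<^sub>0 + (\<Sum>k. ennreal (t (Suc k)) * emeasure lebesgue (D k))"
    using D by (subst nn_integral_add)
      (auto simp: nn_integral_suminf nn_integral_cmult_indicator
        intro!: borel_measurable_times_ennreal borel_measurable_indicator hcube_lebesgue)
  also have "... \<le> ennreal (t 0) * ennreal ((side L 0 ^ CARD('n))) + (\<Sum>k. ennreal (t (Suc k)) * ennreal ((1 / 2) ^ k * (side L 0 ^ CARD('n))))"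
  proof (intro add_mono mult_left_mono suminf_le)
    show "emeasure lebesgue Q\<^sub>0 \<le> ennreal ((side L 0 ^ CARD('n)))" using emeasure_hcube[of L x\<^sub>0] L by (simp add: V_0)
    show "emeasure lebesgue (D k) \<le> ennreal ((1 / 2) ^ k * (side L 0 ^ CARD('n)))" for k unfolding D_def by (rule emeasure_heavy_set)
  qed auto
  also have "(\<Sum>k. ennreal (t (Suc k)) * ennreal ((1 / 2) ^ k * (side L 0 ^ CARD('n)))) = (\<Sum>k. ennreal (3 / 2 * (mean powr d * (side L 0 ^ CARD('n))) * (3 / 4) ^ k))"
  proof (rule suminf_cong)
    fix k
    have "t (Suc k) * ((1 / 2) ^ k * (side L 0 ^ CARD('n))) = 3 / 2 * (mean powr d * (side L 0 ^ CARD('n))) * ((3 / 2) ^ k * (1 / 2) ^ k)"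
      by (simp add: t)
    also have "(3 / 2 :: real) ^ k * (1 / 2) ^ k = (3 / 4) ^ k" by (simp flip: power_mult_distrib)
    finally show "ennreal (t (Suc k)) * ennreal ((1 / 2) ^ k * (side L 0 ^ CARD('n))) = ennreal (3 / 2 * (mean powr d * (side L 0 ^ CARD('n))) * (3 / 4) ^ k)"
      using t0 V_pos[of 0] by (simp add: ennreal_mult[symmetric] less_imp_le)
  qed
  also have "... = ennreal (\<Sum>k. 3 / 2 * (mean powr d * (side L 0 ^ CARD('n))) * (3 / 4) ^ k)"
    using V_pos[of 0] by (intro suminf_ennreal2) (auto intro!: summable_mult summable_geometric)
  also have "(\<Sum>k. 3 / 2 * (mean powr d * (side L 0 ^ CARD('n))) * (3 / 4 :: real) ^ k) = 6 * (mean powr d * (side L 0 ^ CARD('n)))"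
    by (subst suminf_mult) (auto simp: suminf_geometric)
  also have "ennreal (t 0) * ennreal ((side L 0 ^ CARD('n))) + ennreal (6 * (mean powr d * (side L 0 ^ CARD('n)))) = ennreal (7 * mean powr d * (side L 0 ^ CARD('n)))"
    using V_pos[of 0] by (simp add: t ennreal_mult[symmetric] ennreal_plus[symmetric] less_imp_le del: ennreal_plus)
  finally show ?thesis by (simp add: \<sigma>_def)
qed

text \<open>With \<open>d = 1 / (p - 1)\<close> this is the product in the definition of the class of exponent \<open>p\<close>. The power
of the mean on the right of the preceding estimate cancels against the weight of the cube.\<close>

lemma Ap_product_bound:
  assumes d: "0 < d" "ratio powr d = 3 / 2"
  shows "ennreal ((side L 0 ^ CARD('n)) powr (- (1 + 1 / d))) * ennreal (W (cube x\<^sub>0 L)) *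
    epowr (\<integral>\<^sup>+y\<in>cube x\<^sub>0 L. epowr (inverse (ennreal (\<omega> y))) d \<partial>lebesgue) (1 / d) \<le> ennreal (7 powr (1 / d))"
proof -
  define X where "X = (\<integral>\<^sup>+y\<in>cube x\<^sub>0 L. epowr (inverse (ennreal (\<omega> y))) d \<partial>lebesgue)"
  define v where "v = (side L 0 ^ CARD('n))"
  have v: "0 < v" unfolding v_def by (rule V_pos)
  have X: "X \<le> ennreal (7 * mean powr d * v)" unfolding X_def v_def by (rule negative_power_mean[OF d])
  then have "X \<noteq> top" by (auto simp: top_unique)
  then obtain x where x: "X = ennreal x" "0 \<le> x" by (cases X) auto
  have x_le: "x \<le> 7 * mean powr d * v" using X x v mean_pos by simp
  have WW: "W (cube x\<^sub>0 L) = W Q\<^sub>0"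
    using wmeas_hcube[OF w, of L x\<^sub>0] L by (simp add: measure_def)
  have WQ: "0 < W Q\<^sub>0" using W_cl_pos[of 0 x\<^sub>0] by (simp add: cl_0)
  have "x powr (1 / d) \<le> (7 * mean powr d * v) powr (1 / d)" using x_le x d by (intro powr_mono2) auto
  also have "... = 7 powr (1 / d) * mean * v powr (1 / d)" using mean_pos v d by (simp add: powr_mult powr_powr)
  finally have le: "x powr (1 / d) \<le> 7 powr (1 / d) * mean * v powr (1 / d)" .
  have "v powr (- (1 + 1 / d)) * W Q\<^sub>0 * x powr (1 / d) \<le> v powr (- (1 + 1 / d)) * W Q\<^sub>0 * (7 powr (1 / d) * mean * v powr (1 / d))"
    using le WQ by (intro mult_left_mono) auto
  also have "... = 7 powr (1 / d) * (W Q\<^sub>0 * mean) * (v powr (- (1 + 1 / d)) * v powr (1 / d))" by (simp add: mult_ac)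
  also have "W Q\<^sub>0 * mean = v" using WQ by (simp add: mean_def v_def)
  also have "v powr (- (1 + 1 / d)) * v powr (1 / d) = 1 / v"
    using v by (simp add: powr_add[symmetric] powr_minus_divide)
  finally have fin: "v powr (- (1 + 1 / d)) * W Q\<^sub>0 * x powr (1 / d) \<le> 7 powr (1 / d)" using v by simp
  show ?thesis
  proof -
    have "epowr X (1 / d) = ennreal (x powr (1 / d))" using x by (simp add: epowr_def)
    then show ?thesis unfolding X_def[symmetric] WW v_def[symmetric] using fin WQ
      by (simp only: ennreal_mult[symmetric] powr_ge_zero less_imp_le mult_nonneg_nonneg ennreal_leI)
  qed
qed

end

text \<open>The constants of the level-set argument do not depend on the cube, so neither does the power \<open>d\<close>.\<close>

theorem Ainfty_in_some_Ap:
  fixes \<omega> :: "real^'n => real"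
  assumes \<omega>: "\<omega> \<in> Ainfty_loc"
  shows "\<exists>p>1. \<omega> \<in> Ap_loc p"
proof -
  have w: "\<omega> \<in> weights" using \<omega> by (simp add: Ainfty_loc_def)
  have zero: "measure (wmeas \<omega>) (cube y l) \<le> 0"
    if k: "0 < k" "0 < l" "l \<le> 1" and sub: "cube x k \<subseteq> cube y l" and z: "measure (wmeas \<omega>) (cube x k) = 0" for x y k l
  proof -
    have kl: "k \<le> l" using sub k cube_subset_iff[of k x y l] by (smt (verit))
    define \<alpha> where "\<alpha> = (k / l) ^ CARD('n) / 2"
    have "(k / l) ^ CARD('n) \<le> 1" using k kl by (intro power_le_one) auto
    then have \<alpha>: "0 < \<alpha>" "\<alpha> < 1" using k by (auto simp: \<alpha>_def)
    obtain C where C: "1 \<le> C" "\<And>x l F. 0 < l ==> l \<le> 1 ==> F \<subseteq> cube x l ==> F \<in> sets lebesgue ==>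
      ennreal (\<alpha> * l ^ CARD('n)) \<le> emeasure lebesgue F ==>
      measure (wmeas \<omega>) (cube x l) \<le> C * measure (wmeas \<omega>) F"
      by (rule Ainfty_bound[OF \<omega> \<alpha>]) blast
    have "measure (wmeas \<omega>) (cube y l) \<le> C * measure (wmeas \<omega>) (cube x k)"
    proof (rule C(2))
      have "\<alpha> * l ^ CARD('n) \<le> k ^ CARD('n)" using k by (simp add: \<alpha>_def power_divide)
      then show "ennreal (\<alpha> * l ^ CARD('n)) \<le> emeasure lebesgue (cube x k)"
        unfolding emeasure_cube[OF less_imp_le[OF k(1)]] by (rule ennreal_leI)
    qed (use k sub in auto)
    with z show ?thesis by simp
  qed
  have "(AE x in lebesgue. \<omega> x = 0) \<or> (\<forall>x l. 0 < l --> 0 < measure (wmeas \<omega>) (cube x l))"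
    by (rule weight_zero_or_positive[OF w]) (blast intro: zero)
  then consider "AE x in lebesgue. \<omega> x = 0" | "\<And>x l. 0 < l ==> 0 < measure (wmeas \<omega>) (cube x l)" by blast
  then show ?thesis
  proof cases
    case 1
    have "weight_of \<omega> Q = 0" for Q
    proof -
      have "weight_of \<omega> Q = (\<integral>\<^sup>+x. 0 \<partial>(lebesgue :: (real^'n) measure))"
        unfolding weight_of_def using 1 by (intro nn_integral_cong_AE) (auto elim!: eventually_mono)
      then show ?thesis by simp
    qed
    then have "Ap_const 2 \<omega> = (SUP Q\<in>(small_cubes :: (real^'n) set set). 0)" by (simp add: Ap_const_def)
    also have "... = 0" by (auto simp: small_cubes_eq intro!: antisym SUP_least)
    finally show ?thesis using w by (intro exI[of _ 2]) (simp add: Ap_loc_def)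
  next
    case 2
    have h: "(0::real) < (1 / 2) ^ CARD('n)" "(1 / 2) ^ CARD('n) < (1::real)" by (auto simp: power_less_one_iff)
    obtain C1 where C1: "1 \<le> C1" "\<And>x l F. 0 < l ==> l \<le> 1 ==> F \<subseteq> cube x l ==> F \<in> sets lebesgue ==>
      ennreal ((1 / 2) ^ CARD('n) * l ^ CARD('n)) \<le> emeasure lebesgue F ==>
      measure (wmeas \<omega>) (cube x l) \<le> C1 * measure (wmeas \<omega>) F"
      by (rule Ainfty_bound[OF \<omega> h]) blast
    obtain C2 where C2: "1 \<le> C2" "\<And>x l F. 0 < l ==> l \<le> 1 ==> F \<subseteq> cube x l ==> F \<in> sets lebesgue ==>
      ennreal (1 / 2 * l ^ CARD('n)) \<le> emeasure lebesgue F ==>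
      measure (wmeas \<omega>) (cube x l) \<le> C2 * measure (wmeas \<omega>) F"
      by (rule Ainfty_bound[OF \<omega>, of "1 / 2"]) auto
    define b where "b = 3 * C1 * C2"
    have b: "3 \<le> b" unfolding b_def using C1(1) C2(1) mult_mono[of 1 C1 1 C2] by simp
    define d where "d = ln (3 / 2) / ln b"
    have d: "0 < d" "b powr d = 3 / 2" using b by (auto simp: d_def powr_def)
    define p where "p = 1 + 1 / d"
    have "1 < p" "p - 1 = 1 / d" using d by (auto simp: p_def)
    then have p: "1 < p" "p / (p - 1) / p = d" "p / (p / (p - 1)) = 1 / d" by simp_all
    have "ennreal (measure lebesgue Q powr (- p)) * weight_of \<omega> Q *
       epowr (\<integral>\<^sup>+x\<in>Q. epowr (inverse (ennreal (\<omega> x))) d \<partial>lebesgue) (1 / d) \<le> ennreal (7 powr (1 / d))"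
      if Q: "Q \<in> small_cubes" for Q :: "(real^'n) set"
    proof -
      obtain x l where l: "Q = cube x l" "0 < l" "l \<le> 1" using Q by (auto simp: small_cubes_eq)
      have rb: "ratio C1 C2 = b" unfolding b_def by (rule ratio_def[OF w 2 C1 C2 l(2,3)])
      have s0: "side l 0 = l" by (simp add: side_def[OF l(2)])
      have mQ: "measure lebesgue Q = l ^ CARD('n)" using l measure_cube[of l x] by simp
      have wQ: "weight_of \<omega> Q = ennreal (measure (wmeas \<omega>) (cube x l))"
        using l weight_of_eq[OF w, of Q] wmeas_measure[OF w cube_bounded, of x l] by simp
      have "ratio C1 C2 powr d = 3 / 2" unfolding rb by (rule d(2))
      from Ap_product_bound[OF w 2 C1 C2 l(2,3) d(1) this, of x]
      show ?thesis unfolding mQ wQ unfolding s0 l(1) p_def .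
    qed
    then have "Ap_const p \<omega> \<le> ennreal (7 powr (1 / d))"
      unfolding Ap_const_def Let_def p(2,3) by (intro SUP_least) auto
    then have "Ap_const p \<omega> < top" by (rule le_less_trans) simp
    then show ?thesis using w p by (intro exI[of _ p]) (simp add: Ap_loc_def)
  qed
qed

section \<open>Orlicz functions\<close>

context
  fixes \<Phi> :: "real => real"
  assumes A: "assumption_A \<Phi>"
begin

lemma Phi_zero: "\<Phi> 0 = 0" and Phi_pos: "0 < t ==> 0 < \<Phi> t" using A by (auto simp: assumption_A_def)

lemma Phi_nonneg: "0 \<le> t ==> 0 \<le> \<Phi> t" using Phi_zero Phi_pos[of t] by (cases "t = 0") auto

lemma Phi_mono: "0 \<le> s ==> s \<le> t ==> \<Phi> s \<le> \<Phi> t"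
proof -
  assume st: "0 \<le> s" "s \<le> t"
  have "strict_mono_on {0<..} \<Phi>" using A by (simp add: assumption_A_def)
  then show ?thesis
    using st Phi_zero Phi_nonneg[of t] by (cases "s = 0"; cases "s = t") (auto simp: strict_mono_on_def less_imp_le)
qed

lemma Phi_add: "0 \<le> s ==> 0 \<le> t ==> \<Phi> (s + t) \<le> \<Phi> s + \<Phi> t"
proof -
  assume st: "0 \<le> s" "0 \<le> t"
  have "\<forall>s>0. \<forall>t>0. \<Phi> (s + t) \<le> \<Phi> s + \<Phi> t" using A by (simp add: assumption_A_def)
  then show ?thesis using st Phi_zero by (cases "s = 0"; cases "t = 0") auto
qed

lemma Phi_nat_mult: "0 \<le> t ==> \<Phi> (real k * t) \<le> real k * \<Phi> t"
proof (induction k)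
  case (Suc k)
  have "\<Phi> (real (Suc k) * t) = \<Phi> (real k * t + t)" by (simp add: algebra_simps)
  also have "... \<le> \<Phi> (real k * t) + \<Phi> t" using Suc.prems by (intro Phi_add) auto
  also have "... \<le> real (Suc k) * \<Phi> t" using Suc by (simp add: algebra_simps)
  finally show ?case .
qed (simp add: Phi_zero)

lemma Phi_mult: "0 \<le> K ==> 0 \<le> t ==> \<Phi> (K * t) \<le> (K + 1) * \<Phi> t"
proof -
  assume K: "0 \<le> K" and t: "0 \<le> t"
  have "\<Phi> (K * t) \<le> \<Phi> (real (nat \<lceil>K\<rceil>) * t)"
    using K t by (intro Phi_mono mult_right_mono) (auto simp: real_nat_ceiling_ge)
  also have "... \<le> real (nat \<lceil>K\<rceil>) * \<Phi> t" by (rule Phi_nat_mult[OF t])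
  also have "... \<le> (K + 1) * \<Phi> t" using K Phi_nonneg[OF t] by (intro mult_right_mono) linarith+
  finally show ?thesis .
qed

lemma Phi_lower_type:
  assumes "p \<in> lower_type_exponents \<Phi>" "0 \<le> t" "t \<le> 1" "0 \<le> s"
  shows "\<Phi> (s * t) \<le> t powr p * \<Phi> s"
  using assms Phi_zero by (cases "t = 0"; cases "t = 1"; cases "s = 0") (auto simp: lower_type_exponents_def)

lemma Phi_unbounded:
  obtains t where "0 < t" "r < \<Phi> t"
proof -
  obtain p where p: "p \<in> lower_type_exponents \<Phi>" using A by (auto simp: assumption_A_def)
  then have p0: "0 < p" by (simp add: lower_type_exponents_def)
  define c where "c = \<Phi> 1"
  have c: "0 < c" using Phi_pos[of 1] by (simp add: c_def)
  define t where "t = (max 1 ((\<bar>r\<bar> + 1) / c)) powr (1 / p)"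
  have t: "1 \<le> t" unfolding t_def using p0 by (intro ge_one_powr_ge_zero) auto
  have tp: "t powr p = max 1 ((\<bar>r\<bar> + 1) / c)" unfolding t_def using p0 by (simp add: powr_powr)
  have "c \<le> (1 / t) powr p * \<Phi> t" using Phi_lower_type[OF p, of "1 / t" t] t by (simp add: c_def)
  then have "c * t powr p \<le> \<Phi> t" using t by (simp add: powr_divide field_simps)
  moreover have "\<bar>r\<bar> + 1 \<le> c * t powr p" unfolding tp using c by (simp add: max_def field_simps)
  ultimately show ?thesis using that[of t] t by linarith
qed

abbreviation "E \<equiv> extend_Phi \<Phi>"

lemma extend_real: "0 \<le> t ==> E (ennreal t) = ennreal (\<Phi> t)" by (simp add: extend_Phi_def)

lemma extend_zero: "E 0 = 0" using extend_real[of 0] Phi_zero by simp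

lemma extend_mono: "u \<le> v ==> E u \<le> E v"
  by (cases u; cases v) (auto simp: extend_Phi_def top_unique intro!: ennreal_leI Phi_mono)

lemma extend_add: "E (u + v) \<le> E u + E v"
proof (cases u; cases v)
  fix a b assume ab: "u = ennreal a" "0 \<le> a" "v = ennreal b" "0 \<le> b"
  have "E (u + v) = ennreal (\<Phi> (a + b))" using ab by (simp add: extend_real flip: ennreal_plus)
  also have "... \<le> ennreal (\<Phi> a + \<Phi> b)" using ab by (intro ennreal_leI Phi_add)
  also have "... = E u + E v" using ab by (simp add: extend_real Phi_nonneg)
  finally show ?thesis .
qed (auto simp: extend_Phi_def)

lemma extend_sum: "E (\<Sum>i\<in>I. u i) \<le> (\<Sum>i\<in>I. E (u i))"
proof (induction I rule: infinite_finite_induct)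
  case (insert i I)
  then show ?case using extend_add[of "u i" "sum u I"] by (auto intro: order_trans add_left_mono)
qed (auto simp: extend_zero)

lemma extend_mult: "0 \<le> K ==> E (ennreal K * u) \<le> ennreal (K + 1) * E u"
proof (cases u)
  case (real t)
  assume K: "0 \<le> K"
  have "E (ennreal K * u) = ennreal (\<Phi> (K * t))" using real K by (simp add: extend_real flip: ennreal_mult)
  also have "... \<le> ennreal ((K + 1) * \<Phi> t)" using K real by (intro ennreal_leI Phi_mult) auto
  also have "... = ennreal (K + 1) * E u" using real K by (simp add: extend_real Phi_nonneg ennreal_mult)
  finally show ?thesis .
next
  case top
  assume "0 \<le> K"
  then have "ennreal (K + 1) * E u = top" using top by (simp add: extend_Phi_def ennreal_mult_top)
  then show ?thesis by simp
qed

lemma extend_measurable: "E \<in> borel_measurable borel"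
proof -
  define \<Psi> where "\<Psi> t = (if t \<le> 0 then 0 else \<Phi> t)" for t
  have "mono \<Psi>" unfolding mono_def \<Psi>_def using Phi_mono Phi_nonneg by auto
  then have m: "\<Psi> \<in> borel_measurable borel" by (rule borel_measurable_mono)
  have eq: "E u = (if u = top then top else ennreal (\<Psi> (enn2real u)))" for u
  proof -
    have "\<Psi> (enn2real u) = \<Phi> (enn2real u)"
      unfolding \<Psi>_def using Phi_zero enn2real_nonneg[of u] by (smt (verit))
    then show ?thesis by (simp only: extend_Phi_def)
  qed
  have "(\<lambda>u. if u = top then top else ennreal (\<Psi> (enn2real u))) \<in> borel_measurable borel"
    using m by measurable
  then show ?thesis unfolding eq[abs_def] .
qed

text \<open>Continuity from the left, in a form that also covers infinite suprema: there it rests on the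
unboundedness of the Orlicz function.\<close>

lemma extend_Sup_le:
  assumes "\<And>a. a \<in> X ==> E a \<le> m"
  shows "E (Sup X) \<le> m"
proof (cases m)
  case m: (real r)
  show ?thesis
  proof (cases "Sup X")
    case s: (real s)
    show ?thesis
    proof (cases "s = 0")
      case False
      then have s0: "0 < s" using s by simp
      have le: "\<Phi> t \<le> r" if "0 < t" "t < s" for t
      proof -
        have "ennreal t < Sup X" using that s by (simp add: ennreal_less_iff)
        then obtain a where a: "a \<in> X" "ennreal t < a" unfolding less_Sup_iff by blast
        have "ennreal (\<Phi> t) \<le> E a" using extend_mono[of "ennreal t" a] a that by (simp add: extend_real)
        also have "... \<le> ennreal r" using assms[OF a(1)] m by simp
        finally show ?thesis using m by simp
      qed
      have "isCont \<Phi> s"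
        using A s0 by (intro continuous_on_interior[of "{0<..}"]) (auto simp: assumption_A_def interior_open)
      then have "(\<Phi> \<longlongrightarrow> \<Phi> s) (at_left s)"
        by (simp add: isCont_def filterlim_at_split)
      moreover have "\<forall>\<^sub>F t in at_left s. \<Phi> t \<le> r"
        using eventually_at_left_real[OF s0] by (rule eventually_mono) (auto intro: le)
      ultimately have "\<Phi> s \<le> r" by (rule tendsto_upperbound) simp
      then show ?thesis using s m by (simp add: extend_real ennreal_leI)
    qed (use s extend_zero in simp)
  next
    case top
    obtain t where t: "0 < t" "r < \<Phi> t" using Phi_unbounded[of r] .
    have "ennreal t < Sup X" by (simp only: top ennreal_less_top)
    then obtain a where a: "a \<in> X" "ennreal t < a" unfolding less_Sup_iff by blast
    have "ennreal (\<Phi> t) \<le> E a" using extend_mono[of "ennreal t" a] a t by (simp add: extend_real)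
    also have "... \<le> ennreal r" using assms[OF a(1)] m by simp
    finally show ?thesis using m t by simp
  qed
qed simp

end

section \<open>The grand maximal function tests against bumps of every scale\<close>

abbreviation support_radius :: "'n itself => real" where
  "support_radius TYPE('n) \<equiv> 2 ^ (3 * (10 + CARD('n)))"

lemma supp_subset: "closed S ==> (\<And>x. \<phi> x \<noteq> 0 ==> x \<in> S) ==> supp \<phi> \<subseteq> S"
  unfolding supp_def by (rule closure_minimal) auto

lemma supp_memI: "\<phi> x \<noteq> 0 ==> x \<in> supp \<phi>"
  unfolding supp_def by (rule closure_subset[THEN subsetD]) simp

lemma supp_mono:
  assumes "\<And>x. \<psi> x = 0 ==> \<phi> x = 0"
  shows "supp \<phi> \<subseteq> supp \<psi>" unfolding supp_def
proof (intro closure_mono subsetI CollectI notI)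
  fix x assume "x \<in> {x. \<phi> x \<noteq> 0}" "\<psi> x = 0"
  then show False using assms[of x] by simp
qed

lemma distribution_cmult:
  assumes "f \<in> distributions" "h \<in> test_functions"
  shows "f (\<lambda>x. c * h x) = c * f h"
proof -
  have "\<forall>\<phi>\<in>test_functions. \<forall>c. f (\<lambda>x. c * \<phi> x) = c * f \<phi>"
    using assms(1) unfolding distributions_def by simp
  from this[rule_format, OF assms(2)] show ?thesis .
qed

lemma distribution_add:
  assumes "f \<in> distributions" "g \<in> test_functions" "h \<in> test_functions"
  shows "f (\<lambda>x. g x + h x) = f g + f h"
proof -
  have "\<forall>\<phi>\<in>test_functions. \<forall>\<psi>\<in>test_functions. f (\<lambda>x. \<phi> x + \<psi> x) = f \<phi> + f \<psi>"
    using assms(1) unfolding distributions_def by simp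
  from this[rule_format, OF assms(2,3)] show ?thesis .
qed

lemma distribution_zero: "f \<in> distributions ==> f (\<lambda>x. 0) = 0"
  using distribution_cmult[of f "\<lambda>x. 0" 0] test_zero by simp

text \<open>Up to the factor \<open>s\<^sup>n M\<close> a function concentrated at scale \<open>s\<close> near \<open>z\<close> is itself, after rescaling,
an admissible kernel at the point \<open>z\<close>; reflection turns evaluation into convolution.\<close>

lemma grand_maximal_bound:
  fixes f :: "(real^'n => complex) => complex"
  assumes f: "f \<in> distributions" and h: "h \<in> test_functions"
    and supp: "supp h \<subseteq> ball z (support_radius TYPE('n) * s)" and s: "0 < s" "s < 1"
    and jet: "\<And>x. jet_le N s M h x"
  shows "ennreal (norm (f h)) \<le> ennreal (s ^ CARD('n) * M) * grand_maximal N f z"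
proof (cases "M = 0")
  case True
  then have "h x = 0" for x using jet_le_norm[OF jet[of x]] by simp
  then have "h = (\<lambda>x. 0)" by auto
  then show ?thesis using distribution_zero[OF f] by simp
next
  case False
  then have M: "0 < M" using jet_le_nonneg[OF jet] by (simp add: less_le)
  define \<psi> where "\<psi> w = complex_of_real (1 / M) * h (z + (- s) *\<^sub>R w)" for w
  have \<psi>: "\<psi> \<in> test_functions"
    unfolding \<psi>_def using s h by (intro test_cmult test_affine) auto
  have "\<psi> \<in> grand_test_functions N" unfolding grand_test_functions_def
  proof (intro CollectI conjI \<psi>)
    have "supp \<psi> \<subseteq> (\<lambda>w. z + (- s) *\<^sub>R w) -` supp h"
    proof (rule supp_subset)
      show "closed ((\<lambda>w. z + (- s) *\<^sub>R w) -` supp h)"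
        by (intro continuous_closed_vimage continuous_intros) (simp add: supp_def)
      show "w \<in> (\<lambda>w. z + (- s) *\<^sub>R w) -` supp h" if "\<psi> w \<noteq> 0" for w
        using that supp_memI[of h "z + (- s) *\<^sub>R w"] by (auto simp: \<psi>_def)
    qed
    also have "... \<subseteq> ball 0 (support_radius TYPE('n))"
    proof
      fix w assume "w \<in> (\<lambda>w. z + (- s) *\<^sub>R w) -` supp h"
      then have "z + (- s) *\<^sub>R w \<in> ball z (support_radius TYPE('n) * s)" using supp by auto
      then have "s * norm w < support_radius TYPE('n) * s" using s by (simp add: dist_norm)
      then show "w \<in> ball 0 (support_radius TYPE('n))" using s by simp
    qed
    finally show "supp \<psi> \<subseteq> ball 0 (2 ^ (3 * (10 + CARD('n))))" .
    show "Ck_norm N \<psi> \<le> 1" unfolding Ck_norm_def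
    proof (intro SUP_least)
      fix x and ds :: "'n list" assume ds: "ds \<in> {ds. length ds \<le> N}"
      have sm: "smooth (\<lambda>w. h (z + (- s) *\<^sub>R w))" by (rule smooth_affine[OF test_smooth[OF h]])
      have "partial_derivs ds \<psi> x = complex_of_real (1 / M) * (complex_of_real (- s) ^ length ds * partial_derivs ds h (z + (- s) *\<^sub>R x))"
        unfolding \<psi>_def partial_derivs_cmult[OF sm] partial_derivs_affine[OF test_smooth[OF h]] ..
      then have "norm (partial_derivs ds \<psi> x) = 1 / M * (s ^ length ds * norm (partial_derivs ds h (z + (- s) *\<^sub>R x)))"
        using M s by (simp add: norm_mult norm_divide norm_power)
      also have "... \<le> 1 / M * M" using M ds by (intro mult_left_mono jet_leD[OF jet]) auto
      finally show "ennreal (norm (partial_derivs ds \<psi> x)) \<le> 1" using M by simp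
    qed
  qed
  then have "ennreal (norm (convolve (dilate s \<psi>) f z)) \<le> grand_maximal N f z"
    unfolding grand_maximal_def using s by (intro SUP_upper2[of s] SUP_upper2[of \<psi>]) auto
  also have "convolve (dilate s \<psi>) f z = complex_of_real (1 / (s ^ CARD('n) * M)) * f h"
  proof -
    have "(\<lambda>y. dilate s \<psi> (z - y)) = (\<lambda>y. complex_of_real (1 / (s ^ CARD('n) * M)) * h y)"
    proof
      fix y
      have "z + (- s) *\<^sub>R ((1 / s) *\<^sub>R (z - y)) = y" using s by simp
      then show "dilate s \<psi> (z - y) = complex_of_real (1 / (s ^ CARD('n) * M)) * h y"
        by (simp add: dilate_def \<psi>_def scaleR_conv_of_real)
    qed
    then show ?thesis unfolding convolve_def by (simp only: distribution_cmult[OF f h])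
  qed
  finally have le: "ennreal (1 / (s ^ CARD('n) * M) * norm (f h)) \<le> grand_maximal N f z"
    using s M by (simp add: norm_mult norm_divide norm_power)
  have "ennreal (norm (f h)) = ennreal (s ^ CARD('n) * M) * ennreal (1 / (s ^ CARD('n) * M) * norm (f h))"
    using s M by (simp flip: ennreal_mult)
  also have "... \<le> ennreal (s ^ CARD('n) * M) * grand_maximal N f z" by (intro mult_left_mono le) auto
  finally show ?thesis .
qed

lemma grand_test_kernel:
  fixes \<psi> :: "real^'n => complex"
  fixes x :: "real^'n"
  assumes \<psi>: "\<psi> \<in> grand_test_functions N" and t: "0 < t"
  defines "h \<equiv> \<lambda>y. dilate t \<psi> (x - y)"
  shows "h \<in> test_functions" "supp h \<subseteq> ball x (support_radius TYPE('n) * t)"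
    "\<And>y. jet_le N t (1 / t ^ CARD('n)) h y"
    "(LINT y|lebesgue. norm (h y)) \<le> (2 * support_radius TYPE('n)) ^ CARD('n)"
proof -
  have \<psi>t: "\<psi> \<in> test_functions" and sup: "supp \<psi> \<subseteq> ball 0 (support_radius TYPE('n))" and ck: "Ck_norm N \<psi> \<le> 1"
    using \<psi> by (auto simp: grand_test_functions_def)
  have heq: "h = (\<lambda>y. complex_of_real (1 / t ^ CARD('n)) * \<psi> ((1 / t) *\<^sub>R x + (- 1 / t) *\<^sub>R y))"
    by (auto simp: h_def dilate_def scaleR_conv_of_real fun_eq_iff algebra_simps scaleR_right_diff_distrib)
  show h: "h \<in> test_functions" unfolding heq using t \<psi>t by (intro test_cmult test_affine) auto
  have arg: "norm (x - y) < support_radius TYPE('n) * t" if "(1 / t) *\<^sub>R x + (- 1 / t) *\<^sub>R y \<in> supp \<psi>" for y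
  proof -
    have "(1 / t) *\<^sub>R x + (- 1 / t) *\<^sub>R y = (1 / t) *\<^sub>R (x - y)" by (simp add: scaleR_right_diff_distrib)
    then have "(1 / t) *\<^sub>R (x - y) \<in> ball 0 (support_radius TYPE('n))" using that sup by auto
    then have "norm (x - y) / t < support_radius TYPE('n)" using t by (simp only: mem_ball_0 norm_scaleR) simp
    then show ?thesis using t by (simp add: pos_divide_less_eq)
  qed
  show sh: "supp h \<subseteq> ball x (support_radius TYPE('n) * t)"
  proof -
    have "supp h \<subseteq> (\<lambda>y. (1 / t) *\<^sub>R x + (- 1 / t) *\<^sub>R y) -` supp \<psi>"
    proof (rule supp_subset)
      show "closed ((\<lambda>y. (1 / t) *\<^sub>R x + (- 1 / t) *\<^sub>R y) -` supp \<psi>)"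
        by (intro continuous_closed_vimage continuous_intros) (simp add: supp_def)
      show "y \<in> (\<lambda>y. (1 / t) *\<^sub>R x + (- 1 / t) *\<^sub>R y) -` supp \<psi>" if "h y \<noteq> 0" for y
        using that supp_memI[of \<psi> "(1 / t) *\<^sub>R x + (- 1 / t) *\<^sub>R y"] by (auto simp: heq)
    qed
    then show ?thesis using arg by (auto simp: dist_norm)
  qed
  have j\<psi>: "jet_le N 1 1 \<psi> w" for w unfolding jet_le_def
  proof (intro allI impI)
    fix ds :: "'n list" assume ds: "length ds \<le> N"
    have "ennreal (norm (partial_derivs ds \<psi> w)) \<le> Ck_norm N \<psi>"
      unfolding Ck_norm_def using ds by (intro SUP_upper2[of w] SUP_upper2[of ds]) auto
    also have "... \<le> ennreal 1" using ck by simp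
    finally have "norm (partial_derivs ds \<psi> w) \<le> 1" by (subst (asm) ennreal_le_iff) auto
    then show "1 ^ length ds * norm (partial_derivs ds \<psi> w) \<le> 1" by simp
  qed
  show jet: "jet_le N t (1 / t ^ CARD('n)) h y" for y
  proof -
    have "jet_le N t (norm (complex_of_real (1 / t ^ CARD('n))) * 1) h y" unfolding heq
      by (intro jet_le_cmult smooth_affine test_smooth[OF \<psi>t] jet_le_affine[OF test_smooth[OF \<psi>t] j\<psi>]) (use t in auto)
    then show ?thesis using t by (simp add: norm_divide norm_power)
  qed
  have "(LINT y|lebesgue. norm (h y)) \<le> (LINT y|lebesgue. (1 / t ^ CARD('n)) * indicator (cball x (support_radius TYPE('n) * t)) y)"
  proof (rule integral_mono)
    show "integrable lebesgue (\<lambda>y. norm (h y))" using test_integrable[OF h] by simp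
    show "integrable lebesgue (\<lambda>y. (1 / t ^ CARD('n)) * indicator (cball x (support_radius TYPE('n) * t)) y :: real)"
      using lmeasurable_cball[of x "support_radius TYPE('n) * t"] by (simp add: lmeasurable_iff_integrable)
    fix y
    show "norm (h y) \<le> (1 / t ^ CARD('n)) * indicator (cball x (support_radius TYPE('n) * t)) y"
      using jet_le_norm[OF jet[of y]] sh supp_memI[of h y] by (cases "h y = 0") (auto simp: indicator_def less_imp_le t)
  qed
  also have "... = (1 / t ^ CARD('n)) * measure lebesgue (cball x (support_radius TYPE('n) * t))" by simp
  also have "... \<le> (1 / t ^ CARD('n)) * (2 * (support_radius TYPE('n) * t)) ^ CARD('n)"
    using t by (intro mult_left_mono measure_cball_le) auto
  also have "... = (2 * support_radius TYPE('n)) ^ CARD('n)" using t by (simp add: power_mult_distrib)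
  finally show "(LINT y|lebesgue. norm (h y)) \<le> (2 * support_radius TYPE('n)) ^ CARD('n)" .
qed

section \<open>Smoothed indicator functions\<close>

definition sm :: "real => (real^'n) set => real^'n => complex" where
  "sm a S = cv (moll a) (indicator S)"

lemma integrable_indicator_complex:
  "S \<in> lmeasurable ==> integrable lebesgue (indicator S :: real^'n => complex)"
proof -
  assume "S \<in> lmeasurable"
  then have "integrable lebesgue (\<lambda>x. complex_of_real (indicator S x))"
    by (intro integrable_of_real) (simp add: lmeasurable_iff_integrable)
  moreover have "(\<lambda>x. complex_of_real (indicator S x)) = indicator S" by (auto simp: indicator_def)
  ultimately show ?thesis by simp
qed

lemma smooth_sm: "0 < a ==> S \<in> lmeasurable ==> smooth (sm a S)"
  unfolding sm_def by (intro smooth_cv moll_test integrable_indicator_complex)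

lemma test_sm:
  assumes "0 < a" "S \<in> lmeasurable" "S \<subseteq> cball 0 r"
  shows "sm a S \<in> test_functions" unfolding sm_def
  by (rule test_cv_integrable[OF moll_test[OF assms(1)] integrable_indicator_complex[OF assms(2)], of r])
     (use assms(3) in \<open>auto simp: indicator_def\<close>)

text \<open>The constant serves all sets and all scales at once, by scaling.\<close>

lemma sm_jet:
  obtains C where "1 \<le> C"
    "\<And>a (S :: (real^'n) set) x. 0 < a ==> S \<in> lmeasurable ==> jet_le N a C (sm a S) x"
    "\<And>a (S :: (real^'n) set) x. 0 < a ==> S \<in> lmeasurable ==> cball x a \<inter> S = {} ==> jet_le N a 0 (sm a S) x"
proof -
  obtain C where C: "1 \<le> C"
    "\<And>a (h :: real^'n => complex) x. 0 < a ==> integrable lebesgue h ==>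
      jet_le N a (C / a ^ CARD('n) * (LINT y|lebesgue. indicator (cball x a) y * norm (h y))) (cv (moll a) h) x"
    by (rule jet_le_cv_moll) blast
  have 1: "jet_le N a (C * 2 ^ CARD('n)) (sm a S) x" if a: "0 < a" and S: "S \<in> lmeasurable" for a and S :: "(real^'n) set" and x
  proof -
    have ci: "integrable lebesgue (indicator (cball x a) :: real^'n => real)"
      using lmeasurable_cball[of x a] by (simp add: lmeasurable_iff_integrable)
    have "(LINT y|lebesgue. indicator (cball x a) y * norm (indicator S y :: complex)) \<le> (LINT y|lebesgue. indicator (cball x a) y)"
    proof (rule integral_mono')
      show "indicator (cball x a) y * norm (indicator S y :: complex) \<le> indicator (cball x a) y" for y
        by (auto simp: indicator_def)
    qed (use ci in auto)
    also have "... \<le> (2 * a) ^ CARD('n)" using measure_cball_le[of a x] a by simp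
    finally have "C / a ^ CARD('n) * (LINT y|lebesgue. indicator (cball x a) y * norm (indicator S y :: complex)) \<le> C / a ^ CARD('n) * (2 * a) ^ CARD('n)"
      using C(1) a by (intro mult_left_mono) auto
    also have "... = C * 2 ^ CARD('n)" using a by (simp add: power_mult_distrib)
    finally show ?thesis
      unfolding sm_def using a by (intro jet_le_mono[OF C(2)[OF a integrable_indicator_complex[OF S]]]) auto
  qed
  have 2: "jet_le N a 0 (sm a S) x" if a: "0 < a" and S: "S \<in> lmeasurable" and e: "cball x a \<inter> S = {}" for a and S :: "(real^'n) set" and x
  proof -
    have "(\<lambda>y. indicator (cball x a) y * norm (indicator S y :: complex)) = (\<lambda>y. 0)"
      using e by (auto simp: indicator_def fun_eq_iff)
    then show ?thesis unfolding sm_def using C(2)[OF a integrable_indicator_complex[OF S], of x] by simp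
  qed
  have "1 \<le> C * 2 ^ CARD('n)" using C(1) mult_mono[of 1 C 1 "2 ^ CARD('n)"] by simp
  then show ?thesis using that[OF _ 1 2] by blast
qed

lemma sm_zero:
  assumes "0 < a" "S \<in> lmeasurable" "cball x a \<inter> S = {}"
  shows "sm a S x = 0"
proof -
  have "norm (cv (moll a) (indicator S) x - 0) \<le> 0"
  proof (rule cv_moll_approx[OF assms(1) integrable_indicator_complex[OF assms(2)]])
    fix y assume "y \<in> cball x a"
    then have "y \<notin> S" using assms(3) by blast
    then show "norm (indicator S y - 0 :: complex) \<le> 0" by simp
  qed
  then show ?thesis by (simp add: sm_def)
qed

lemma sm_one:
  assumes "0 < a" "S \<in> lmeasurable" "cball x a \<subseteq> S"
  shows "sm a S x = 1"
proof -
  have "norm (cv (moll a) (indicator S) x - 1) \<le> 0"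
  proof (rule cv_moll_approx[OF assms(1) integrable_indicator_complex[OF assms(2)]])
    fix y assume "y \<in> cball x a"
    then have "y \<in> S" using assms(3) by blast
    then show "norm (indicator S y - 1 :: complex) \<le> 0" by simp
  qed
  then show ?thesis by (simp add: sm_def)
qed

lemma sm_sum:
  assumes "0 < a" "finite I" "\<And>i. i \<in> I ==> S i \<in> lmeasurable" "disjoint_family_on S I"
  shows "(\<Sum>i\<in>I. sm a (S i) x) = sm a (\<Union>i\<in>I. S i) x"
proof -
  have ind: "(indicator (\<Union>i\<in>I. S i) y :: complex) = (\<Sum>i\<in>I. indicator (S i) y)" for y
    using indicator_UN_disjoint[OF assms(2,4), of y] by simp
  have int: "integrable lebesgue (\<lambda>y. moll a (x - y) * indicator (S i) y)" if "i \<in> I" for i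
    by (rule cv_integrable[OF moll_test[OF assms(1)] integrable_indicator_complex[OF assms(3)[OF that]]])
  have "sm a (\<Union>i\<in>I. S i) x = (LINT y|lebesgue. (\<Sum>i\<in>I. moll a (x - y) * indicator (S i) y))"
    by (simp add: sm_def cv_def ind sum_distrib_left)
  also have "... = (\<Sum>i\<in>I. sm a (S i) x)" using int by (simp add: sm_def cv_def)
  finally show ?thesis ..
qed

section \<open>Whitney layers around a closed level set\<close>

lemma infdist_lipschitz: "infdist x F \<le> infdist y F + norm (x - y)"
  using infdist_triangle[of x F y] by (simp add: dist_norm)

lemma infdist_lessD:
  assumes "F \<noteq> {}" "infdist x F < r"
  obtains z where "z \<in> F" "dist x z < r"
  using cInf_lessD[of "dist x ` F" r] assms by (auto simp: infdist_notempty)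

definition lattice_point :: "real => ('n => int) => real^'n" where
  "lattice_point l i = (\<chi> j. l * real_of_int (i j))"

definition lattice_bump :: "real => ('n => int) => real^'n => complex" where
  "lattice_bump l i = sm l (hcube (lattice_point l i) l)"

lemma hcube_lmeasurable: "0 \<le> l ==> hcube x l \<in> lmeasurable"
  by (rule fmeasurableI) (simp, simp only: emeasure_hcube ennreal_less_top infinity_ennreal_def)

lemma cube_norm_le:
  fixes x :: "real^'n"
  assumes "y \<in> cube x l" shows "norm (y - x) \<le> real CARD('n) * l"
proof -
  have "norm (y - x) \<le> (\<Sum>i\<in>UNIV. \<bar>(y - x) $ i\<bar>)" by (rule norm_le_l1_cart)
  also have "... \<le> (\<Sum>i\<in>(UNIV :: 'n set). l)"
  proof (rule sum_mono)
    fix i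
    have "x $ i \<le> y $ i" "y $ i \<le> x $ i + l" using assms by (auto simp: mem_cube)
    then show "\<bar>(y - x) $ i\<bar> \<le> l" by simp
  qed
  finally show ?thesis by simp
qed

lemma hcube_norm_le: "y \<in> hcube (x :: real^'n) l ==> norm (y - x) \<le> real CARD('n) * l"
  using cube_norm_le hcube_subset_cube by blast

lemma lattice_bump_support:
  fixes i :: "'n::finite => int"
  assumes l: "0 < l" and x: "(real CARD('n) + 1) * l < norm (x - lattice_point l i)"
  shows "cball x l \<inter> hcube (lattice_point l i) l = {}"
proof (rule ccontr)
  assume "\<not> ?thesis"
  then obtain y where y: "y \<in> cball x l" "y \<in> hcube (lattice_point l i) l" by blast
  have "norm (x - lattice_point l i) \<le> norm (x - y) + norm (y - lattice_point l i)"
    using norm_triangle_ineq[of "x - y" "y - lattice_point l i"] by simp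
  also have "... \<le> l + real CARD('n) * l"
    using hcube_norm_le[OF y(2)] y(1) by (intro add_mono) (auto simp: dist_norm)
  finally show False using x by (simp add: algebra_simps)
qed

lemma lattice_bump_zero:
  fixes i :: "'n::finite => int"
  assumes "0 < l" "(real CARD('n) + 1) * l < norm (x - lattice_point l i)"
  shows "lattice_bump l i x = 0" unfolding lattice_bump_def
  by (rule sm_zero[OF assms(1) hcube_lmeasurable lattice_bump_support[OF assms]]) (use assms in simp)

lemma lattice_bump_test: "0 < l ==> lattice_bump l (i :: 'n::finite => int) \<in> test_functions"
  unfolding lattice_bump_def
proof (rule test_sm[of _ _ "norm (lattice_point l i) + real CARD('n) * l"])
  show "hcube (lattice_point l i) l \<subseteq> cball 0 (norm (lattice_point l i) + real CARD('n) * l)"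
  proof
    fix y assume "y \<in> hcube (lattice_point l i) l"
    then show "y \<in> cball 0 (norm (lattice_point l i) + real CARD('n) * l)"
      using hcube_norm_le[of y "lattice_point l i" l] norm_triangle_ineq[of "lattice_point l i" "y - lattice_point l i"]
      by simp
  qed
qed (auto simp: hcube_lmeasurable)

lemma lattice_points_finite: "finite {i :: 'n::finite => int. \<forall>j. \<bar>i j\<bar> \<le> m}"
  and lattice_points_card: "0 \<le> m ==> card {i :: 'n::finite => int. \<forall>j. \<bar>i j\<bar> \<le> m} = nat (2 * m + 1) ^ CARD('n)"
proof -
  have eq: "{i :: 'n::finite => int. \<forall>j. \<bar>i j\<bar> \<le> m} = (\<Pi>\<^sub>E j\<in>UNIV. {-m..m})"
  proof -
    have "\<bar>i j\<bar> \<le> m \<longleftrightarrow> i j \<in> {-m..m}" for i :: "'n => int" and j by auto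
    then show ?thesis by (auto simp: PiE_UNIV_domain Pi_iff simp del: atLeastAtMost_iff)
  qed
  show "finite {i :: 'n::finite => int. \<forall>j. \<bar>i j\<bar> \<le> m}" unfolding eq by (intro finite_PiE) auto
  show "card {i :: 'n::finite => int. \<forall>j. \<bar>i j\<bar> \<le> m} = nat (2 * m + 1) ^ CARD('n)" if "0 \<le> m"
    unfolding eq by (subst card_PiE) (auto simp: prod_constant)
qed

lemma lattice_overlap:
  fixes y :: "real^'n"
  assumes l: "0 < l" and a: "0 \<le> a" and J: "finite J"
  shows "(\<Sum>i\<in>J. indicator (cball (lattice_point l i) (a * l)) y :: real) \<le> (2 * a + 2) ^ CARD('n)"
proof -
  let ?lo = "\<lambda>j. \<lceil>y $ j / l - a\<rceil>" and ?hi = "\<lambda>j. \<lfloor>y $ j / l + a\<rfloor>"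
  have sub: "{i\<in>J. y \<in> cball (lattice_point l i) (a * l)} \<subseteq> (\<Pi>\<^sub>E j\<in>UNIV. {?lo j..?hi j})"
  proof
    fix i assume "i \<in> {i\<in>J. y \<in> cball (lattice_point l i) (a * l)}"
    then have n: "norm (lattice_point l i - y) \<le> a * l" by (simp add: dist_norm)
    have "i j \<in> {?lo j..?hi j}" for j
    proof -
      have "\<bar>l * real_of_int (i j) - y $ j\<bar> \<le> a * l"
        using component_le_norm_cart[of "lattice_point l i - y" j] n by (simp add: lattice_point_def)
      then have "y $ j - a * l \<le> l * real_of_int (i j)" "l * real_of_int (i j) \<le> y $ j + a * l"
        by (auto simp: abs_le_iff)
      then have "y $ j / l - a \<le> real_of_int (i j)" "real_of_int (i j) \<le> y $ j / l + a"
        using l by (auto simp: field_simps)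
      then show ?thesis by (simp add: ceiling_le_iff le_floor_iff)
    qed
    then show "i \<in> (\<Pi>\<^sub>E j\<in>UNIV. {?lo j..?hi j})" by auto
  qed
  have "(\<Sum>i\<in>J. indicator (cball (lattice_point l i) (a * l)) y :: real) =
      (\<Sum>i\<in>J. if y \<in> cball (lattice_point l i) (a * l) then 1 else 0)"
    by (intro sum.cong) (simp_all only: indicator_def of_bool_def)
  also have "... = (\<Sum>i\<in>{i\<in>J. y \<in> cball (lattice_point l i) (a * l)}. 1)"
    by (rule sum.inter_filter[OF J, symmetric])
  also have "... = real (card {i\<in>J. y \<in> cball (lattice_point l i) (a * l)})" by simp
  also have "... \<le> real (card (\<Pi>\<^sub>E j\<in>(UNIV :: 'n set). {?lo j..?hi j}))"
    using sub by (intro of_nat_mono card_mono finite_PiE) auto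
  also have "... = (\<Prod>j\<in>(UNIV :: 'n set). real (card {?lo j..?hi j}))" by (simp add: card_PiE)
  also have "... \<le> (\<Prod>j\<in>(UNIV :: 'n set). 2 * a + 2)"
  proof (intro prod_mono conjI)
    fix j
    have "real_of_int (?hi j - ?lo j + 1) \<le> 2 * a + 2" by linarith
    then show "real (card {?lo j..?hi j}) \<le> 2 * a + 2" using a by simp
  qed auto
  finally show ?thesis by simp
qed

lemma jet_le_one: "jet_le N s 1 (\<lambda>x. 1) (x :: real^'n)" unfolding jet_le_def
proof (intro allI impI)
  fix ds :: "'n list"
  show "s ^ length ds * norm (partial_derivs ds (\<lambda>x. 1) x) \<le> 1"
  proof (cases ds rule: rev_cases)
    case (snoc es j)
    then show ?thesis by (simp add: partial_derivs_append partial_derivs_Cons partial_deriv_const partial_derivs_zero)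
  qed simp
qed

text \<open>The functional \<open>f\<close> is a distribution cut off to a ball; of its relation to \<open>\<Gamma>\<close> only the scale
estimate is kept. The constants \<open>Cs\<close> and \<open>Ct\<close> are parameters in order that constants built from them
visibly do not depend on \<open>f\<close>, \<open>\<kappa>\<close> or \<open>F\<close>.\<close>

locale whitney =
  fixes N :: nat and f :: "(real^'n => complex) => complex" and \<Gamma> :: "real^'n => ennreal"
    and \<rho> \<kappa> :: real and F :: "(real^'n) set" and Cs Ct :: real
  assumes N: "1 \<le> N" and \<rho>: "0 < \<rho>" and \<kappa>: "0 < \<kappa>"
    and f_add: "g \<in> test_functions ==> h \<in> test_functions ==> f (\<lambda>x. g x + h x) = f g + f h"
    and f_cmult: "h \<in> test_functions ==> f (\<lambda>x. c * h x) = c * f h"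
    and f_scale: "h \<in> test_functions ==> supp h \<subseteq> ball z (support_radius TYPE('n) * s) ==> 0 < s ==> s < 1 ==>
      (\<And>x. jet_le N s M h x) ==> ennreal (norm (f h)) \<le> ennreal (s ^ CARD('n) * M) * \<Gamma> z"
    and f_local: "h \<in> test_functions ==> (\<And>x. x \<in> ball 0 \<rho> ==> h x = 0) ==> f h = 0"
    and F: "F \<noteq> {}" "z \<in> F ==> \<Gamma> z \<le> ennreal \<kappa>"
    and near_F: "x \<in> ball 0 \<rho> ==> infdist x F < 1"
    and Cs: "1 \<le> Cs" "0 < a ==> S \<in> lmeasurable ==> jet_le N a Cs (sm a S) (x :: real^'n)"
      "0 < a ==> S \<in> lmeasurable ==> cball x a \<inter> S = {} ==> jet_le N a 0 (sm a S) (x :: real^'n)"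
    and Ct: "1 \<le> Ct" "0 < l ==> h \<in> test_functions ==> jet_le N l
      (Ct / l ^ CARD('n) * (LINT y|lebesgue. indicator (cball x l) y * norm (h y)))
      (\<lambda>x. h x - (resid (l / real (N + 1)) ^^ N) h x) (x :: real^'n)"
begin

abbreviation d :: "real^'n => real" where "d x \<equiv> infdist x F"

lemma f_zero: "f (\<lambda>x. 0) = 0" using f_local[OF test_zero] by simp

lemma f_diff:
  assumes "g \<in> test_functions" "h \<in> test_functions"
  shows "f (\<lambda>x. g x - h x) = f g - f h"
  using f_add[OF assms(1) test_cmult[OF assms(2), of "-1"]] f_cmult[OF assms(2), of "-1"] by simp

lemma f_sum:
  assumes "finite I" "\<And>i. i \<in> I ==> h i \<in> test_functions"
  shows "f (\<lambda>x. \<Sum>i\<in>I. h i x) = (\<Sum>i\<in>I. f (h i))" using assms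
proof (induction I rule: finite_induct)
  case (insert a I)
  then show ?case using f_add[of "h a" "\<lambda>x. \<Sum>i\<in>I. h i x"] test_sum[of I h] by simp
qed (simp add: f_zero)

lemma f_cong:
  assumes "g \<in> test_functions" "h \<in> test_functions" "\<And>x. x \<in> ball 0 \<rho> ==> g x = h x"
  shows "f g = f h" using f_diff[OF assms(1,2)] f_local[OF test_diff[OF assms(1,2)]] assms(3) by simp

definition lattice_index :: "real => ('n => int) set" where
  "lattice_index l = {i. \<forall>j. \<bar>i j\<bar> \<le> \<lceil>(\<rho> + 1) / l\<rceil> + 1}"

lemma finite_lattice_index: "finite (lattice_index l)"
  unfolding lattice_index_def by (rule lattice_points_finite)

lemma card_lattice_index:
  assumes "0 < l" "l \<le> 1" shows "real (card (lattice_index l)) \<le> ((2 * \<rho> + 9) / l) ^ CARD('n)"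
proof -
  let ?m = "\<lceil>(\<rho> + 1) / l\<rceil> + 1"
  have m0: "0 \<le> (\<rho> + 1) / l" using \<rho> assms by simp
  then have m: "0 \<le> ?m" by linarith
  have "real (card (lattice_index l)) = real_of_int (2 * ?m + 1) ^ CARD('n)"
    unfolding lattice_index_def lattice_points_card[OF m] using m by simp
  also have "... \<le> ((2 * \<rho> + 9) / l) ^ CARD('n)"
  proof (intro power_mono)
    have "real_of_int (2 * ?m + 1) \<le> 2 * ((\<rho> + 1) / l) + 7"
    proof -
      have "real_of_int (2 * (\<lceil>r\<rceil> + 1) + 1) \<le> 2 * r + 7" for r :: real
      proof -
        define c where "c = real_of_int \<lceil>r\<rceil>"
        have "c \<le> r + 1" unfolding c_def by (rule of_int_ceiling_le_add_one)
        then have "2 * (c + 1) + 1 \<le> 2 * r + 7" by (simp add: algebra_simps)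
        then show ?thesis by (simp only: c_def of_int_add of_int_mult of_int_numeral of_int_1)
      qed
      then show ?thesis .
    qed
    also have "... = (2 * \<rho> + 2 + 7 * l) / l" using assms by (simp add: field_simps)
    also have "... \<le> (2 * \<rho> + 9) / l" using assms by (intro divide_right_mono) auto
    finally show "real_of_int (2 * ?m + 1) \<le> (2 * \<rho> + 9) / l" .
    show "0 \<le> real_of_int (2 * ?m + 1)" using m by simp
  qed
  finally show ?thesis .
qed

lemma lattice_bump_sum:
  assumes l: "0 < l" "l \<le> 1" and x: "x \<in> ball 0 \<rho>"
  shows "(\<Sum>i\<in>lattice_index l. lattice_bump l i x) = 1"
proof -
  have disj: "disjoint_family_on (\<lambda>i. hcube (lattice_point l i) l :: (real^'n) set) (lattice_index l)"
    unfolding disjoint_family_on_def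
  proof (intro ballI impI, rule ccontr)
    fix i i' :: "'n => int" assume ne: "i \<noteq> i'" and "hcube (lattice_point l i) l \<inter> hcube (lattice_point l i') l \<noteq> {}"
    then obtain y where y: "y \<in> hcube (lattice_point l i) l" "y \<in> hcube (lattice_point l i') l" by blast
    have key: "k j = \<lfloor>y $ j / l\<rfloor>" if "y \<in> hcube (lattice_point l k) l" for k j
    proof -
      have "l * real_of_int (k j) \<le> y $ j" "y $ j < l * real_of_int (k j) + l"
        using that by (auto simp: hcube_def lattice_point_def)
      then have "real_of_int (k j) \<le> y $ j / l" "y $ j / l < real_of_int (k j) + 1"
        using l by (auto simp: field_simps)
      then show ?thesis by linarith
    qed
    have "i = i'" using key[OF y(1)] key[OF y(2)] by auto
    then show False using ne by simp
  qed
  have "(\<Sum>i\<in>lattice_index l. lattice_bump l i x) = sm l (\<Union>i\<in>lattice_index l. hcube (lattice_point l i) l) x"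
    unfolding lattice_bump_def using l by (intro sm_sum finite_lattice_index disj hcube_lmeasurable) auto
  also have "... = 1"
  proof (rule sm_one)
    show "(\<Union>i\<in>lattice_index l. hcube (lattice_point l i) l) \<in> lmeasurable"
      using l by (intro fmeasurable.finite_UN finite_lattice_index) (auto simp: hcube_lmeasurable)
    show "cball x l \<subseteq> (\<Union>i\<in>lattice_index l. hcube (lattice_point l i) l)"
    proof
      fix y assume "y \<in> cball x l"
      then have "norm y \<le> \<rho> + 1"
        using x l norm_triangle_ineq[of x "y - x"] by (simp add: dist_norm norm_minus_commute)
      define i where "i j = \<lfloor>y $ j / l\<rfloor>" for j
      have "\<bar>i j\<bar> \<le> \<lceil>(\<rho> + 1) / l\<rceil> + 1" for j
      proof -
        have "\<bar>y $ j\<bar> \<le> \<rho> + 1" using component_le_norm_cart[of y j] \<open>norm y \<le> \<rho> + 1\<close> by linarith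
        then have "\<bar>y $ j / l\<bar> \<le> (\<rho> + 1) / l" using l by (simp add: abs_divide divide_right_mono)
        then show ?thesis unfolding i_def by linarith
      qed
      then have "i \<in> lattice_index l" by (simp add: lattice_index_def)
      moreover have "y \<in> hcube (lattice_point l i) l"
      proof -
        have "l * real_of_int (i j) \<le> y $ j \<and> y $ j < l * real_of_int (i j) + l" for j
        proof -
          have "real_of_int (i j) \<le> y $ j / l" "y $ j / l < real_of_int (i j) + 1" unfolding i_def by linarith+
          then show ?thesis using l by (auto simp: field_simps)
        qed
        then show ?thesis by (simp add: hcube_def lattice_point_def)
      qed
      ultimately show "y \<in> (\<Union>i\<in>lattice_index l. hcube (lattice_point l i) l)" by blast
    qed
  qed (use l in simp)
  finally show ?thesis .
qed

text \<open>The layer \<open>e\<close> of scale \<open>l\<close> lives, inside the ball that carries \<open>f\<close>, at distance comparable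
  to \<open>l\<close> from \<open>F\<close> or closer; its active cells are those that meet it.\<close>

definition layer :: "(real^'n => complex) => real => bool" where
  "layer e l \<longleftrightarrow> smooth e \<and> (\<forall>x. jet_le N l (2 * Cs) e x) \<and>
     (\<forall>x\<in>ball 0 \<rho>. e x \<noteq> 0 --> d x \<le> (4 * real CARD('n) + 14) * l)"

definition active :: "(real^'n => complex) => real => ('n => int) set" where
  "active e l = {i\<in>lattice_index l. \<exists>x\<in>ball 0 \<rho>. e x \<noteq> 0 \<and> lattice_bump l i x \<noteq> 0}"

definition piece_const :: real where
  "piece_const = 4 ^ N * (2 * Cs) * Cs"

lemma piece_const_nonneg: "0 \<le> piece_const" using Cs(1) by (simp add: piece_const_def)

lemma finite_active: "finite (active e l)" unfolding active_def using finite_lattice_index by simp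

lemma radius_bound: "6 * real CARD('n) + 17 < support_radius TYPE('n)"
proof -
  have "CARD('n) < 2 ^ CARD('n)" by (rule less_exp)
  then have "6 * CARD('n) + 17 < 1073741824 * 2 ^ CARD('n)" by linarith
  also have "(1073741824 :: nat) * 2 ^ CARD('n) = 2 ^ 30 * 2 ^ CARD('n)" by simp
  also have "... \<le> 2 ^ (3 * (10 + CARD('n)))"
    by (simp only: power_add[symmetric]) (rule power_increasing, auto)
  finally have "real (6 * CARD('n) + 17) < real (2 ^ (3 * (10 + CARD('n))))" by (rule of_nat_less_iff[THEN iffD2])
  then show ?thesis by simp
qed

text \<open>An active cell of scale \<open>l\<close> comes within a bounded multiple of \<open>l\<close> of a point \<open>z\<close> of \<open>F\<close>. So the
piece is a bump of scale \<open>l\<close> seen from \<open>z\<close>, where \<open>\<Gamma>\<close> is at most \<open>\<kappa>\<close>; the admissible radius of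
kernels is large enough for this.\<close>

lemma piece_bound:
  assumes l: "0 < l" "l < 1" and e: "layer e l" and H: "H \<in> test_functions" and i: "i \<in> active e l"
    and B: "\<And>x. norm (x - lattice_point l i) \<le> (real CARD('n) + 1) * l ==> jet_le N l B H x"
  shows "norm (f (\<lambda>x. e x * (lattice_bump l i x * H x))) \<le> \<kappa> * (l ^ CARD('n) * (piece_const * B))"
proof -
  let ?n = "real CARD('n)" and ?p = "lattice_point l i"
  define h where "h x = e x * (lattice_bump l i x * H x)" for x
  have sb: "smooth (lattice_bump l i)" by (rule test_smooth[OF lattice_bump_test[OF l(1)]])
  have se: "smooth e" and je: "\<And>x. jet_le N l (2 * Cs) e x" using e by (auto simp: layer_def)
  have h: "h \<in> test_functions" unfolding h_def by (intro test_mult se sb H)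
  obtain y where y: "y \<in> ball 0 \<rho>" "e y \<noteq> 0" "lattice_bump l i y \<noteq> 0" using i by (auto simp: active_def)
  have yi: "norm (y - ?p) \<le> (?n + 1) * l" using lattice_bump_zero[of l y i] l y(3) by (meson not_le)
  have B0: "0 \<le> B" using jet_le_nonneg[OF B[OF yi]] .
  have "d y < (4 * ?n + 15) * l" using e y l by (fastforce simp: layer_def algebra_simps)
  then obtain z where z: "z \<in> F" "norm (y - z) < (4 * ?n + 15) * l"
    using infdist_lessD[OF F(1)] by (auto simp: dist_norm)
  have sup: "supp h \<subseteq> ball z (support_radius TYPE('n) * l)"
  proof -
    have "supp h \<subseteq> cball z ((6 * ?n + 17) * l)"
    proof (rule supp_subset)
      fix x assume "h x \<noteq> 0"
      then have "lattice_bump l i x \<noteq> 0" by (auto simp: h_def)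
      then have "norm (x - ?p) \<le> (?n + 1) * l" using lattice_bump_zero[of l x i] l by (meson not_le)
      moreover have "norm (x - z) \<le> norm (x - ?p) + norm (y - ?p) + norm (y - z)"
        using norm_triangle_ineq[of "x - ?p" "?p - y"] norm_triangle_ineq[of "x - y" "y - z"]
        by (simp add: norm_minus_commute)
      ultimately have "norm (x - z) \<le> (6 * ?n + 17) * l" using yi z(2) by (simp add: algebra_simps)
      then show "x \<in> cball z ((6 * ?n + 17) * l)" by (simp add: dist_norm norm_minus_commute)
    qed simp
    also have "... \<subseteq> ball z (support_radius TYPE('n) * l)"
      using mult_strict_right_mono[OF radius_bound l(1)] by auto
    finally show ?thesis .
  qed
  have jet: "jet_le N l (piece_const * B) h x" for x
  proof (cases "norm (x - ?p) \<le> (?n + 1) * l")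
    case True
    have "jet_le N l (2 ^ N * (2 * Cs) * (2 ^ N * Cs * B)) h x" unfolding h_def lattice_bump_def using l
      by (intro jet_le_mult je se smooth_mult test_smooth[OF H] B[OF True] Cs(2) smooth_sm hcube_lmeasurable) auto
    then show ?thesis by (simp add: piece_const_def mult_ac power_mult_distrib[symmetric])
  next
    case False
    obtain M where M: "\<And>x. jet_le N 1 M H x" by (rule test_jet_bounded[OF H]) blast
    have "jet_le N l M H x" using jet_le_mono[OF M[of x], of l M] l by simp
    then have "jet_le N l (2 ^ N * (2 * Cs) * (2 ^ N * 0 * M)) h x"
      unfolding h_def lattice_bump_def using l False
      by (intro jet_le_mult je se smooth_mult test_smooth[OF H] Cs(3) smooth_sm hcube_lmeasurable lattice_bump_support) auto
    then have j0: "jet_le N l 0 h x" by simp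
    show ?thesis by (rule jet_le_mono[OF j0]) (use l B0 piece_const_nonneg in auto)
  qed
  have "ennreal (norm (f h)) \<le> ennreal (l ^ CARD('n) * (piece_const * B)) * \<Gamma> z"
    by (rule f_scale[OF h sup l jet])
  also have "... \<le> ennreal (l ^ CARD('n) * (piece_const * B)) * ennreal \<kappa>"
    by (intro mult_left_mono F z) auto
  also have "... = ennreal (\<kappa> * (l ^ CARD('n) * (piece_const * B)))"
    using l B0 piece_const_nonneg \<kappa> by (simp flip: ennreal_mult add: mult_ac)
  finally show ?thesis
    using l B0 piece_const_nonneg \<kappa> unfolding h_def by (subst (asm) ennreal_le_iff) auto
qed

lemma layer_pieces:
  assumes l: "0 < l" "l \<le> 1" and e: "smooth e" and H: "H \<in> test_functions"
  shows "f (\<lambda>x. e x * H x) = (\<Sum>i\<in>active e l. f (\<lambda>x. e x * (lattice_bump l i x * H x)))"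
proof -
  have t: "(\<lambda>x. e x * (lattice_bump l i x * H x)) \<in> test_functions" for i
    using l by (intro test_mult e H test_smooth[OF lattice_bump_test]) auto
  have "f (\<lambda>x. e x * H x) = f (\<lambda>x. \<Sum>i\<in>lattice_index l. e x * (lattice_bump l i x * H x))"
  proof (rule f_cong[OF test_mult[OF e H] test_sum[OF t]])
    fix x :: "real^'n" assume "x \<in> ball 0 \<rho>"
    then show "e x * H x = (\<Sum>i\<in>lattice_index l. e x * (lattice_bump l i x * H x))"
      using lattice_bump_sum[OF l] by (simp flip: sum_distrib_left sum_distrib_right)
  qed
  also have "... = (\<Sum>i\<in>lattice_index l. f (\<lambda>x. e x * (lattice_bump l i x * H x)))"
    by (intro f_sum finite_lattice_index t)
  also have "... = (\<Sum>i\<in>active e l. f (\<lambda>x. e x * (lattice_bump l i x * H x)))"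
  proof (rule sum.mono_neutral_right[OF finite_lattice_index])
    show "\<forall>i\<in>lattice_index l - active e l. f (\<lambda>x. e x * (lattice_bump l i x * H x)) = 0"
    proof
      fix i assume "i \<in> lattice_index l - active e l"
      then have "e x * (lattice_bump l i x * H x) = 0" if "x \<in> ball 0 \<rho>" for x
        using that by (auto simp: active_def)
      then show "f (\<lambda>x. e x * (lattice_bump l i x * H x)) = 0" by (intro f_local t) auto
    qed
  qed (auto simp: active_def)
  finally show ?thesis .
qed

lemma active_near:
  assumes "i \<in> active e l" "0 < l"
  obtains y where "y \<in> ball 0 \<rho>" "e y \<noteq> 0" "norm (y - lattice_point l i) \<le> (real CARD('n) + 1) * l"
proof -
  obtain y where y: "y \<in> ball 0 \<rho>" "e y \<noteq> 0" "lattice_bump l i y \<noteq> 0" using assms(1) by (auto simp: active_def)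
  have "norm (y - lattice_point l i) \<le> (real CARD('n) + 1) * l"
  proof (rule ccontr)
    assume "\<not> ?thesis"
    then have "lattice_bump l i y = 0" using assms(2) by (intro lattice_bump_zero) auto
    then show False using y(3) by simp
  qed
  then show ?thesis by (rule that[OF y(1,2)])
qed

text \<open>The cut-off \<open>cut k\<close> removes the points closer to \<open>F\<close> than about \<open>2\<^sup>-\<^sup>k\<close>; its differences are
  the layers, and \<open>rest k\<close> is what is left near \<open>F\<close>.\<close>

definition scale :: "nat => real" where "scale k = (1 / 2) ^ Suc k"

definition cut :: "nat => real^'n => complex" where
  "cut k = sm ((1 / 2) ^ k) {x \<in> ball 0 (\<rho> + 2). (2 * real CARD('n) + 6) * (1 / 2) ^ k < d x}"

definition ring_layer :: "nat => real^'n => complex" where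
  "ring_layer k x = cut (Suc k) x - cut k x"

definition rest :: "nat => real^'n => complex" where
  "rest k x = 1 - cut (Suc k) x"

lemma scale: "0 < scale k" "scale k < 1"
proof -
  show "0 < scale k" by (simp add: scale_def)
  have "(1 / 2 :: real) ^ Suc k < 1" by (rule power_Suc_less_one) auto
  then show "scale k < 1" unfolding scale_def .
qed

lemma cut_set: "{x \<in> ball 0 (\<rho> + 2). c < d x} \<in> lmeasurable"
proof (rule bounded_set_imp_lmeasurable)
  show "bounded {x \<in> ball 0 (\<rho> + 2). c < d x}" by (rule bounded_subset[OF bounded_ball[of 0 "\<rho> + 2"]]) auto
  have "open {x. c < d x}" by (intro open_Collect_less continuous_intros)
  then have "open (ball 0 (\<rho> + 2) \<inter> {x. c < d x})" by (intro open_Int) auto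
  moreover have "ball 0 (\<rho> + 2) \<inter> {x. c < d x} = {x \<in> ball 0 (\<rho> + 2). c < d x}" by auto
  ultimately show "{x \<in> ball 0 (\<rho> + 2). c < d x} \<in> sets lebesgue"
    by (intro sets_completionI_sets) (simp add: borel_open)
qed

lemma cut_test: "cut k \<in> test_functions"
  unfolding cut_def by (rule test_sm[where r = "\<rho> + 2"], simp, rule cut_set, auto)

lemma cut_jet: "jet_le N ((1 / 2) ^ k) Cs (cut k) x" unfolding cut_def by (rule Cs(2)[OF _ cut_set]) simp

lemma cut_nonzero:
  assumes "cut k x \<noteq> 0" shows "(2 * real CARD('n) + 5) * (1 / 2) ^ k < d x"
proof (rule ccontr)
  assume n: "\<not> ?thesis"
  have "cut k x = 0" unfolding cut_def
  proof (rule sm_zero[OF _ cut_set])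
    have "d y \<le> (2 * real CARD('n) + 6) * (1 / 2) ^ k" if "y \<in> cball x ((1 / 2) ^ k)" for y
    proof -
      have "d y \<le> d x + norm (y - x)" by (rule infdist_lipschitz)
      also have "... \<le> (2 * real CARD('n) + 5) * (1 / 2) ^ k + (1 / 2) ^ k"
        using n that by (intro add_mono) (auto simp: dist_norm norm_minus_commute)
      finally show ?thesis by (simp add: algebra_simps)
    qed
    then show "cball x ((1 / 2) ^ k) \<inter> {x \<in> ball 0 (\<rho> + 2). (2 * real CARD('n) + 6) * (1 / 2) ^ k < d x} = {}"
      by (auto simp: not_le[symmetric])
  qed simp
  then show False using assms by simp
qed

lemma cut_eq_1:
  assumes "x \<in> ball 0 \<rho>" "(2 * real CARD('n) + 7) * (1 / 2) ^ k < d x" shows "cut k x = 1"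
  unfolding cut_def
proof (rule sm_one[OF _ cut_set])
  show "cball x ((1 / 2) ^ k) \<subseteq> {x \<in> ball 0 (\<rho> + 2). (2 * real CARD('n) + 6) * (1 / 2) ^ k < d x}"
  proof
    fix y assume y: "y \<in> cball x ((1 / 2) ^ k)"
    have "(1 / 2 :: real) ^ k \<le> 1" by (intro power_le_one) auto
    then have "norm y < \<rho> + 2"
      using y assms(1) norm_triangle_ineq[of x "y - x"] by (simp add: dist_norm norm_minus_commute)
    moreover have "(2 * real CARD('n) + 6) * (1 / 2) ^ k < d y"
      using infdist_lipschitz[of x F y] y assms(2) by (simp add: dist_norm algebra_simps)
    ultimately show "y \<in> {x \<in> ball 0 (\<rho> + 2). (2 * real CARD('n) + 6) * (1 / 2) ^ k < d x}" by simp
  qed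
qed simp

lemma cut_0: "x \<in> ball 0 \<rho> ==> cut 0 x = 0"
proof (rule ccontr)
  assume x: "x \<in> ball 0 \<rho>" "cut 0 x \<noteq> 0"
  then have "2 * real CARD('n) + 5 < d x" using cut_nonzero[of 0 x] by simp
  moreover have "0 \<le> real CARD('n)" by simp
  ultimately show False using near_F[OF x(1)] by linarith
qed

lemma ring_layer_far: "ring_layer k x \<noteq> 0 ==> (2 * real CARD('n) + 5) * scale k < d x"
proof -
  assume "ring_layer k x \<noteq> 0"
  then have "cut (Suc k) x \<noteq> 0 \<or> cut k x \<noteq> 0" by (cases "cut k x = 0") (simp_all add: ring_layer_def)
  then consider "cut (Suc k) x \<noteq> 0" | "cut k x \<noteq> 0" by blast
  then show ?thesis
  proof cases
    case 1 then show ?thesis using cut_nonzero[of "Suc k" x] by (simp add: scale_def)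
  next
    case 2
    have "scale k \<le> (1 / 2) ^ k" by (simp add: scale_def)
    then have "(2 * real CARD('n) + 5) * scale k \<le> (2 * real CARD('n) + 5) * (1 / 2) ^ k" by (intro mult_left_mono) auto
    then show ?thesis using cut_nonzero[OF 2] by linarith
  qed
qed

lemma smooth_cut: "smooth (cut k)" by (rule test_smooth[OF cut_test])

lemma layer_ring: "layer (ring_layer k) (scale k)" unfolding layer_def
proof (intro conjI allI ballI impI)
  have eq: "ring_layer k = (\<lambda>x. cut (Suc k) x - cut k x)" by (simp add: ring_layer_def fun_eq_iff)
  show "smooth (ring_layer k)" unfolding eq by (intro smooth_diff smooth_cut)
  show "jet_le N (scale k) (2 * Cs) (ring_layer k) x" for x
  proof -
    have "jet_le N (scale k) Cs (cut k) x" by (rule jet_le_mono[OF cut_jet]) (auto simp: scale_def)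
    moreover have "jet_le N (scale k) Cs (cut (Suc k)) x" unfolding scale_def by (rule cut_jet)
    ultimately have "jet_le N (scale k) (Cs + Cs) (ring_layer k) x"
      unfolding eq using scale(1)[of k] by (intro jet_le_diff smooth_cut) auto
    then show ?thesis by simp
  qed
  fix x assume x: "x \<in> ball 0 \<rho>" "ring_layer k x \<noteq> 0"
  show "d x \<le> (4 * real CARD('n) + 14) * scale k"
  proof (rule ccontr)
    assume "\<not> ?thesis"
    then have a: "(2 * real CARD('n) + 7) * (1 / 2) ^ k < d x" by (simp add: scale_def algebra_simps)
    have "(2 * real CARD('n) + 7) * (1 / 2) ^ Suc k \<le> (2 * real CARD('n) + 7) * (1 / 2) ^ k"
      by (intro mult_left_mono) auto
    then have b: "(2 * real CARD('n) + 7) * (1 / 2) ^ Suc k < d x" using a by linarith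
    show False using cut_eq_1[OF x(1) a] cut_eq_1[OF x(1) b] x(2) by (simp add: ring_layer_def)
  qed
qed

lemma layer_rest: "layer (rest k) (scale k)" unfolding layer_def
proof (intro conjI allI ballI impI)
  have eq: "rest k = (\<lambda>x. 1 - cut (Suc k) x)" by (simp add: rest_def fun_eq_iff)
  show "smooth (rest k)" unfolding eq by (intro smooth_diff smooth_cut smooth_const)
  show "jet_le N (scale k) (2 * Cs) (rest k) x" for x
  proof -
    have "jet_le N (scale k) 1 (\<lambda>x. 1) x" by (rule jet_le_one)
    moreover have "jet_le N (scale k) Cs (cut (Suc k)) x" unfolding scale_def by (rule cut_jet)
    ultimately have j: "jet_le N (scale k) (1 + Cs) (rest k) x"
      unfolding eq using scale(1)[of k] by (intro jet_le_diff smooth_cut smooth_const) auto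
    show ?thesis by (rule jet_le_mono[OF j]) (use Cs(1) scale(1)[of k] in auto)
  qed
  fix x assume x: "x \<in> ball 0 \<rho>" "rest k x \<noteq> 0"
  show "d x \<le> (4 * real CARD('n) + 14) * scale k"
  proof (rule ccontr)
    assume "\<not> ?thesis"
    moreover have "(2 * real CARD('n) + 7) * scale k \<le> (4 * real CARD('n) + 14) * scale k"
      using scale(1)[of k] by (intro mult_right_mono) auto
    ultimately have b: "(2 * real CARD('n) + 7) * (1 / 2) ^ Suc k < d x" unfolding scale_def by linarith
    show False using cut_eq_1[OF x(1) b] x(2) by (simp add: rest_def)
  qed
qed

abbreviation cells :: "nat => ('n => int) set" where
  "cells k \<equiv> active (ring_layer k) (scale k)"

lemma ring_layer_sum: "(\<Sum>k<K. ring_layer k x) = cut K x - cut 0 x"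
  unfolding ring_layer_def by (rule sum_lessThan_telescope)

end

context whitney
begin

section \<open>Removing the oscillating part of every layer\<close>

text \<open>The step of the mollification is a fraction of the scale so that \<open>N\<close> iterations do not leave the
cell and its neighbours.\<close>

definition fine_part :: "nat => (real^'n => complex) => real^'n => complex" where
  "fine_part k h = (resid (scale k / real (N + 1)) ^^ N) h"

definition coarse_part :: "nat => (real^'n => complex) => real^'n => complex" where
  "coarse_part k h x = h x - fine_part k h x"

definition correction :: "nat => (real^'n => complex) => complex" where
  "correction k h = f (\<lambda>x. ring_layer k x * fine_part k h x)"

lemma step: "0 < scale k / real (N + 1)" "scale k / real (N + 1) \<le> scale k" "real N * (scale k / real (N + 1)) \<le> scale k"
proof -
  show "0 < scale k / real (N + 1)" using scale(1)[of k] by simp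
  have s: "0 \<le> scale k" using scale(1)[of k] by simp
  show "scale k / real (N + 1) \<le> scale k" using s by (simp add: divide_le_eq mult_left_mono algebra_simps)
  have "real N * scale k \<le> scale k * real (N + 1)" using s by (simp add: algebra_simps)
  then show "real N * (scale k / real (N + 1)) \<le> scale k" by (simp add: divide_le_eq)
qed

lemma fine_test: "h \<in> test_functions ==> fine_part k h \<in> test_functions"
  unfolding fine_part_def by (rule test_resid_pow[OF step(1)])

lemma coarse_eq: "coarse_part k h = (\<lambda>x. h x - fine_part k h x)" by (rule ext) (rule coarse_part_def)

lemma coarse_test: "h \<in> test_functions ==> coarse_part k h \<in> test_functions"
  unfolding coarse_eq by (intro test_diff fine_test)

lemma fine_zero:
  assumes h: "h \<in> test_functions" and z: "\<And>y. y \<in> cball x (scale k) ==> h y = 0"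
  shows "fine_part k h x = 0"
proof -
  have "norm ((resid (scale k / real (N + 1)) ^^ N) h x) \<le> 2 ^ N * 0"
  proof (rule resid_pow_local[OF step(1) h])
    fix y assume "y \<in> cball x (real N * (scale k / real (N + 1)))"
    then have "y \<in> cball x (scale k)" using step(3)[of k] by (simp del: of_nat_add of_nat_Suc)
    then show "norm (h y) \<le> 0" using z by simp
  qed
  then show ?thesis by (simp add: fine_part_def)
qed

lemma fine_jet:
  assumes h: "h \<in> test_functions" and M: "\<And>ds x. length ds = N ==> norm (partial_derivs ds h x) \<le> M"
  shows "jet_le N (scale k) ((2 * real CARD('n)) ^ N * scale k ^ N * M) (fine_part k h) x"
  unfolding fine_part_def by (rule resid_pow_jet[OF step(1) h M step(2)])

lemma coarse_jet:
  assumes "h \<in> test_functions"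
  shows "jet_le N (scale k) (Ct / scale k ^ CARD('n) * (LINT y|lebesgue. indicator (cball x (scale k)) y * norm (h y)))
    (coarse_part k h) x" unfolding coarse_eq fine_part_def by (rule Ct(2)[OF scale(1) assms])

lemma test_cball_integrable:
  assumes "h \<in> test_functions"
  shows "integrable lebesgue (\<lambda>y. indicator (cball (x :: real^'n) r) y * norm (h y))"
proof (rule Bochner_Integration.integrable_bound[OF integrable_norm[OF test_integrable[OF assms]]])
  show "(\<lambda>y. indicator (cball x r) y * norm (h y)) \<in> borel_measurable lebesgue"
    using test_lebesgue_measurable[OF assms]
    by (intro borel_measurable_times borel_measurable_norm borel_measurable_indicator) auto
qed (auto simp: indicator_def)

text \<open>There are about \<open>l\<^sup>-\<^sup>n\<close> cells, each contributes \<open>l\<^sup>n l\<^sup>N\<close>: for a fixed test function the layers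
sum up geometrically.\<close>

lemma layer_fine_bound:
  assumes e: "layer e (scale k)" and h: "h \<in> test_functions"
    and M: "\<And>ds x. length ds = N ==> norm (partial_derivs ds h x) \<le> M"
  shows "norm (f (\<lambda>x. e x * fine_part k h x)) \<le>
    \<kappa> * piece_const * (2 * real CARD('n)) ^ N * (2 * \<rho> + 9) ^ CARD('n) * M * scale k ^ N"
proof -
  let ?l = "scale k" and ?n = "CARD('n)"
  have M0: "0 \<le> M" by (rule order_trans[OF norm_ge_zero M[of "replicate N undefined" 0]]) simp
  define b where "b = \<kappa> * (?l ^ ?n * (piece_const * ((2 * real ?n) ^ N * ?l ^ N * M)))"
  have b0: "0 \<le> b"
    unfolding b_def using \<kappa> M0 piece_const_nonneg scale(1)[of k] by (intro mult_nonneg_nonneg) auto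
  have e': "smooth e" using e by (simp add: layer_def)
  have "norm (f (\<lambda>x. e x * fine_part k h x)) \<le>
      (\<Sum>i\<in>active e ?l. norm (f (\<lambda>x. e x * (lattice_bump ?l i x * fine_part k h x))))"
    unfolding layer_pieces[OF scale(1)[of k] less_imp_le[OF scale(2)] e' fine_test[OF h]] by (rule norm_sum)
  also have "... \<le> (\<Sum>i\<in>active e ?l. b)" unfolding b_def
    by (intro sum_mono piece_bound[OF scale e fine_test[OF h]] fine_jet[OF h M]) auto
  also have "... = real (card (active e ?l)) * b" by simp
  also have "... \<le> real (card (lattice_index ?l)) * b"
    using b0 by (intro mult_right_mono of_nat_mono card_mono finite_lattice_index) (auto simp: active_def)
  also have "... \<le> ((2 * \<rho> + 9) / ?l) ^ ?n * b"
    by (intro mult_right_mono card_lattice_index scale(1) less_imp_le[OF scale(2)] b0)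
  also have "... = \<kappa> * piece_const * (2 * real ?n) ^ N * (2 * \<rho> + 9) ^ ?n * M * ?l ^ N"
    using scale(1)[of k] by (simp add: b_def power_divide)
  finally show ?thesis .
qed

lemma cell_norm_le:
  assumes i: "i \<in> active e l" and l: "0 < l" "l \<le> 1"
    and x: "x \<in> cball (lattice_point l i) ((real CARD('n) + 2) * l)"
  shows "norm x \<le> \<rho> + 2 * real CARD('n) + 3"
proof -
  obtain y where y: "y \<in> ball 0 \<rho>" "norm (y - lattice_point l i) \<le> (real CARD('n) + 1) * l"
    by (rule active_near[OF i l(1)]) blast
  have "norm x \<le> norm y + norm (y - lattice_point l i) + norm (lattice_point l i - x)"
    using norm_triangle_ineq[of y "x - y"] norm_triangle_ineq[of "x - lattice_point l i" "lattice_point l i - y"]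
    by (simp add: norm_minus_commute)
  also have "... \<le> \<rho> + (real CARD('n) + 1) * l + (real CARD('n) + 2) * l"
    using x y by (intro add_mono) (auto simp: dist_norm)
  also have "... \<le> \<rho> + (real CARD('n) + 1) * 1 + (real CARD('n) + 2) * 1"
    using l by (intro add_mono mult_left_mono) auto
  finally show ?thesis by simp
qed

lemma ring_cell_dist:
  assumes i: "i \<in> cells k"
    and x: "x \<in> cball (lattice_point (scale k) i) ((real CARD('n) + 2) * scale k)"
  shows "2 * scale k < d x" "d x \<le> (6 * real CARD('n) + 17) * scale k"
proof -
  let ?l = "scale k" and ?n = "real CARD('n)" and ?p = "lattice_point (scale k) i"
  obtain y where y: "y \<in> ball 0 \<rho>" "ring_layer k y \<noteq> 0" "norm (y - ?p) \<le> (?n + 1) * ?l"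
    by (rule active_near[OF i scale(1)]) blast
  have "norm (x - y) \<le> norm (x - ?p) + norm (y - ?p)"
    using norm_triangle_ineq[of "x - ?p" "?p - y"] by (simp add: norm_minus_commute)
  also have "... \<le> (?n + 2) * ?l + (?n + 1) * ?l"
    using x y by (intro add_mono) (auto simp: dist_norm norm_minus_commute)
  finally have xy: "norm (x - y) \<le> (2 * ?n + 3) * ?l" by (simp add: algebra_simps)
  have "(2 * ?n + 5) * ?l < d y" by (rule ring_layer_far[OF y(2)])
  then show "2 * ?l < d x" using infdist_lipschitz[of y F x] xy by (simp add: norm_minus_commute algebra_simps)
  have "d y \<le> (4 * ?n + 14) * ?l" using layer_ring[of k] y(1,2) by (auto simp: layer_def)
  then show "d x \<le> (6 * ?n + 17) * ?l" using infdist_lipschitz[of x F y] xy by (simp add: algebra_simps)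
qed

text \<open>At a given point only the layers whose scale is comparable to the distance from \<open>F\<close> are seen.\<close>

lemma ring_overlap:
  "(\<Sum>k<K. \<Sum>i\<in>cells k. indicator (cball (lattice_point (scale k) i) ((real CARD('n) + 2) * scale k)) y)
    \<le> (6 * real CARD('n) + 17) * (2 * (real CARD('n) + 2) + 2) ^ CARD('n)"
proof -
  let ?n = "real CARD('n)"
  let ?s = "\<lambda>k. \<Sum>i\<in>cells k. indicator (cball (lattice_point (scale k) i) ((?n + 2) * scale k)) y :: real"
  let ?v = "(2 * (?n + 2) + 2) ^ CARD('n)"
  define S where "S = {k. k < K \<and> 2 * scale k < d y \<and> d y \<le> (6 * ?n + 17) * scale k}"
  have fS: "finite S" by (rule finite_subset[of _ "{..<K}"]) (auto simp: S_def)
  have cS: "card S \<le> 6 * CARD('n) + 17"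
  proof (cases "S = {}")
    case False
    define m where "m = Min S"
    have m: "m \<in> S" "\<And>k. k \<in> S ==> m \<le> k" using fS False by (auto simp: m_def)
    have "S \<subseteq> {m..<m + (6 * CARD('n) + 17)}"
    proof
      fix k assume k: "k \<in> S"
      obtain j where j: "k = m + j" using m(2)[OF k] le_Suc_ex by blast
      have "2 * scale m < (6 * ?n + 17) * scale k" using m(1) k by (auto simp: S_def)
      also have "scale k = scale m / 2 ^ j" by (simp add: j scale_def power_add power_divide)
      finally have "scale m * (2 ^ j * 2) < scale m * (6 * ?n + 17)" by (simp add: field_simps)
      then have "2 ^ j * 2 < 6 * ?n + 17" by (simp only: mult_less_cancel_left_pos[OF scale(1)])
      then have "real (2 ^ j) < real (6 * CARD('n) + 17)" by simp
      then have "2 ^ j < 6 * CARD('n) + 17" by (simp only: of_nat_less_iff)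
      then have "j < 6 * CARD('n) + 17" using less_exp[of j] by linarith
      then show "k \<in> {m..<m + (6 * CARD('n) + 17)}" using j by simp
    qed
    then have "card S \<le> card {m..<m + (6 * CARD('n) + 17)}" by (intro card_mono) auto
    then show ?thesis by simp
  qed simp
  have "(\<Sum>k<K. ?s k) = (\<Sum>k\<in>S. ?s k)"
  proof (rule sum.mono_neutral_right)
    show "\<forall>k\<in>{..<K} - S. ?s k = 0"
    proof (intro ballI sum.neutral)
      fix k i assume "k \<in> {..<K} - S" and i: "i \<in> cells k"
      then have "y \<notin> cball (lattice_point (scale k) i) ((?n + 2) * scale k)"
        using ring_cell_dist[OF i, of y] by (auto simp: S_def)
      then show "indicator (cball (lattice_point (scale k) i) ((?n + 2) * scale k)) y = (0::real)"
        by (simp only: indicator_def of_bool_eq if_False)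
    qed
  qed (auto simp: S_def)
  also have "... \<le> (\<Sum>k\<in>S. ?v)" by (intro sum_mono lattice_overlap finite_active scale) auto
  also have "... = real (card S) * ?v" by simp
  also have "... \<le> real (6 * CARD('n) + 17) * ?v" using cS by (intro mult_right_mono of_nat_mono) auto
  finally show ?thesis by simp
qed

text \<open>The volume factor \<open>l\<^sup>n\<close> of a piece cancels the normalisation of the mean over the cell, so that the
cells add up to an integral of \<open>|h|\<close>.\<close>

lemma layer_coarse_bound:
  assumes e: "layer e (scale k)" and h: "h \<in> test_functions"
  shows "norm (f (\<lambda>x. e x * coarse_part k h x)) \<le> \<kappa> * piece_const * Ct *
    (\<Sum>i\<in>active e (scale k). LINT y|lebesgue. indicator (cball (lattice_point (scale k) i) ((real CARD('n) + 2) * scale k)) y * norm (h y))"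
proof -
  let ?l = "scale k" and ?n = "real CARD('n)"
  let ?I = "\<lambda>i. LINT y|lebesgue. indicator (cball (lattice_point ?l i) ((?n + 2) * ?l)) y * norm (h y)"
  have e': "smooth e" using e by (simp add: layer_def)
  have one: "norm (f (\<lambda>x. e x * (lattice_bump ?l i x * coarse_part k h x))) \<le> \<kappa> * piece_const * Ct * ?I i"
    if i: "i \<in> active e ?l" for i
  proof -
    have "norm (f (\<lambda>x. e x * (lattice_bump ?l i x * coarse_part k h x))) \<le>
        \<kappa> * (?l ^ CARD('n) * (piece_const * (Ct / ?l ^ CARD('n) * ?I i)))"
    proof (rule piece_bound[OF scale e coarse_test[OF h] i])
      fix x assume x: "norm (x - lattice_point ?l i) \<le> (?n + 1) * ?l"
      have "(LINT y|lebesgue. indicator (cball x ?l) y * norm (h y)) \<le> ?I i"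
      proof (rule integral_mono[OF test_cball_integrable[OF h] test_cball_integrable[OF h]])
        fix y
        have "y \<in> cball (lattice_point ?l i) ((?n + 2) * ?l)" if y: "y \<in> cball x ?l"
        proof -
          have "norm (y - lattice_point ?l i) \<le> norm (x - y) + norm (x - lattice_point ?l i)"
            using norm_triangle_ineq[of "y - x" "x - lattice_point ?l i"] by (simp add: norm_minus_commute)
          also have "... \<le> ?l + (?n + 1) * ?l" using x y by (intro add_mono) (auto simp: dist_norm)
          finally show ?thesis by (simp add: dist_norm norm_minus_commute algebra_simps)
        qed
        then show "indicator (cball x ?l) y * norm (h y) \<le>
            indicator (cball (lattice_point ?l i) ((?n + 2) * ?l)) y * norm (h y)"
          by (intro mult_right_mono) (auto simp: indicator_def)
      qed
      then have "Ct / ?l ^ CARD('n) * (LINT y|lebesgue. indicator (cball x ?l) y * norm (h y)) \<le> Ct / ?l ^ CARD('n) * ?I i"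
        using Ct(1) scale(1)[of k] by (intro mult_left_mono) auto
      then show "jet_le N ?l (Ct / ?l ^ CARD('n) * ?I i) (coarse_part k h) x"
        using scale(1)[of k] by (intro jet_le_mono[OF coarse_jet[OF h]]) auto
    qed
    also have "... = \<kappa> * piece_const * Ct * ?I i" using scale(1)[of k] by simp
    finally show ?thesis .
  qed
  have "norm (f (\<lambda>x. e x * coarse_part k h x)) \<le>
      (\<Sum>i\<in>active e ?l. norm (f (\<lambda>x. e x * (lattice_bump ?l i x * coarse_part k h x))))"
    unfolding layer_pieces[OF scale(1)[of k] less_imp_le[OF scale(2)] e' coarse_test[OF h]] by (rule norm_sum)
  also have "... \<le> (\<Sum>i\<in>active e ?l. \<kappa> * piece_const * Ct * ?I i)" by (intro sum_mono one)
  finally show ?thesis by (simp only: sum_distrib_left)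
qed

lemma layer_split:
  assumes "smooth e" "h \<in> test_functions"
  shows "f (\<lambda>x. e x * h x) = f (\<lambda>x. e x * coarse_part k h x) + f (\<lambda>x. e x * fine_part k h x)"
proof -
  have "(\<lambda>x. e x * h x) = (\<lambda>x. e x * coarse_part k h x + e x * fine_part k h x)"
    by (simp add: coarse_part_def fun_eq_iff algebra_simps)
  then show ?thesis
    by (simp only: f_add[OF test_mult[OF assms(1) coarse_test[OF assms(2)]] test_mult[OF assms(1) fine_test[OF assms(2)]]])
qed

lemma smooth_ring: "smooth (ring_layer k)" and smooth_rest: "smooth (rest k)"
  using layer_ring[of k] layer_rest[of k] by (simp_all add: layer_def)

lemma ring_layers_cut:
  assumes h: "h \<in> test_functions"
  shows "(\<Sum>k<K. f (\<lambda>x. ring_layer k x * h x)) = f (\<lambda>x. cut K x * h x)"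
proof -
  have "(\<Sum>k<K. f (\<lambda>x. ring_layer k x * h x)) = f (\<lambda>x. \<Sum>k<K. ring_layer k x * h x)"
    by (intro f_sum[symmetric] test_mult smooth_ring h) auto
  also have "... = f (\<lambda>x. cut K x * h x)"
  proof (rule f_cong)
    show "(\<lambda>x. \<Sum>k<K. ring_layer k x * h x) \<in> test_functions" by (intro test_sum test_mult smooth_ring h)
    show "(\<lambda>x. cut K x * h x) \<in> test_functions" by (intro test_mult smooth_cut h)
    fix x :: "real^'n" assume x: "x \<in> ball 0 \<rho>"
    have "(\<Sum>k<K. ring_layer k x * h x) = (\<Sum>k<K. ring_layer k x) * h x" by (rule sum_distrib_right[symmetric])
    also have "... = cut K x * h x" by (simp only: ring_layer_sum cut_0[OF x] diff_zero)
    finally show "(\<Sum>k<K. ring_layer k x * h x) = cut K x * h x" .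
  qed
  finally show ?thesis .
qed

lemma f_minus_corrections:
  assumes h: "h \<in> test_functions"
  shows "f h - (\<Sum>k<Suc K. correction k h) =
    (\<Sum>k<Suc K. f (\<lambda>x. ring_layer k x * coarse_part k h x)) + f (\<lambda>x. rest K x * coarse_part K h x)
    + f (\<lambda>x. rest K x * fine_part K h x)"
proof -
  have "h = (\<lambda>x. cut (Suc K) x * h x + rest K x * h x)" by (simp add: rest_def fun_eq_iff algebra_simps)
  then have "f h = f (\<lambda>x. cut (Suc K) x * h x + rest K x * h x)" by simp
  also have "... = f (\<lambda>x. cut (Suc K) x * h x) + f (\<lambda>x. rest K x * h x)"
    by (intro f_add test_mult smooth_cut smooth_rest h)
  also have "f (\<lambda>x. cut (Suc K) x * h x) = (\<Sum>k<Suc K. f (\<lambda>x. ring_layer k x * h x))"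
    by (rule ring_layers_cut[OF h, symmetric])
  also have "... = (\<Sum>k<Suc K. f (\<lambda>x. ring_layer k x * coarse_part k h x) + correction k h)"
    unfolding correction_def by (intro sum.cong refl layer_split smooth_ring h)
  also have "f (\<lambda>x. rest K x * h x) = f (\<lambda>x. rest K x * coarse_part K h x) + f (\<lambda>x. rest K x * fine_part K h x)"
    by (rule layer_split[OF smooth_rest h])
  finally show ?thesis by (simp only: sum.distrib) simp
qed

definition good_const :: real where
  "good_const = piece_const * Ct * ((6 * real CARD('n) + 18) * (2 * (real CARD('n) + 2) + 2) ^ CARD('n))"

lemma good_partial_bound:
  assumes h: "h \<in> test_functions"
  shows "norm (f h - (\<Sum>k<Suc K. correction k h) - f (\<lambda>x. rest K x * fine_part K h x)) \<le>
    \<kappa> * good_const * (LINT y|lebesgue. indicator (cball 0 (\<rho> + 2 * real CARD('n) + 3)) y * norm (h y))"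
proof -
  let ?n = "real CARD('n)"
  let ?c = "\<lambda>k i. cball (lattice_point (scale k) i) ((?n + 2) * scale k)"
  let ?B = "cball (0 :: real^'n) (\<rho> + 2 * ?n + 3)"
  let ?v = "(2 * (?n + 2) + 2) ^ CARD('n)"
  define I where "I k i = (LINT y|lebesgue. indicator (?c k i) y * norm (h y))" for k and i :: "'n => int"
  define w where "w y = (\<Sum>k<Suc K. \<Sum>i\<in>cells k. indicator (?c k i) y) +
      (\<Sum>i\<in>active (rest K) (scale K). indicator (?c K i) y :: real)" for y
  define C where "C = \<kappa> * piece_const * Ct"
  have C0: "0 \<le> C" unfolding C_def using \<kappa> piece_const_nonneg Ct(1) by (intro mult_nonneg_nonneg) auto
  have w0: "w y = 0" if "y \<notin> ?B" for y
  proof -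
    have "y \<notin> ?c k i" if "i \<in> active e (scale k)" for e k i
      using cell_norm_le[OF that scale(1) less_imp_le[OF scale(2)], of y] \<open>y \<notin> ?B\<close> by auto
    then have "indicator (?c k i) y = (0::real)" if "i \<in> active e (scale k)" for e k i
      using that by (simp only: indicator_def of_bool_eq if_False)
    then show ?thesis unfolding w_def by (simp add: sum.neutral)
  qed
  have w1: "w y \<le> (6 * ?n + 18) * ?v" for y
  proof -
    have "w y \<le> (6 * ?n + 17) * ?v + ?v"
      unfolding w_def by (intro add_mono ring_overlap lattice_overlap finite_active scale) auto
    then show ?thesis by (simp only: distrib_right)
  qed
  have eq: "f h - (\<Sum>k<Suc K. correction k h) - f (\<lambda>x. rest K x * fine_part K h x) =
      (\<Sum>k<Suc K. f (\<lambda>x. ring_layer k x * coarse_part k h x)) + f (\<lambda>x. rest K x * coarse_part K h x)"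
    unfolding f_minus_corrections[OF h] by simp
  have "norm (f h - (\<Sum>k<Suc K. correction k h) - f (\<lambda>x. rest K x * fine_part K h x)) \<le>
      (\<Sum>k<Suc K. norm (f (\<lambda>x. ring_layer k x * coarse_part k h x))) + norm (f (\<lambda>x. rest K x * coarse_part K h x))"
    unfolding eq by (intro norm_triangle_le add_mono norm_sum order_refl)
  also have "... \<le> (\<Sum>k<Suc K. C * (\<Sum>i\<in>cells k. I k i)) + C * (\<Sum>i\<in>active (rest K) (scale K). I K i)"
    unfolding C_def I_def by (intro add_mono sum_mono layer_coarse_bound layer_ring layer_rest h)
  also have "... = C * ((\<Sum>k<Suc K. \<Sum>i\<in>cells k. I k i) + (\<Sum>i\<in>active (rest K) (scale K). I K i))"
    by (simp only: sum_distrib_left distrib_left)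
  also have "(\<Sum>k<Suc K. \<Sum>i\<in>cells k. I k i) + (\<Sum>i\<in>active (rest K) (scale K). I K i) =
      (LINT y|lebesgue. w y * norm (h y))"
  proof -
    have int: "integrable lebesgue (\<lambda>y. indicator (?c k i) y * norm (h y))" for k i
      by (rule test_cball_integrable[OF h])
    have int2: "integrable lebesgue (\<lambda>y. \<Sum>i\<in>J. indicator (?c k i) y * norm (h y))" for k J
      by (intro Bochner_Integration.integrable_sum int)
    have int3: "integrable lebesgue (\<lambda>y. \<Sum>k<Suc K. \<Sum>i\<in>cells k. indicator (?c k i) y * norm (h y))"
      by (intro Bochner_Integration.integrable_sum int)
    have s1: "(\<Sum>i\<in>J. I k i) = (LINT y|lebesgue. (\<Sum>i\<in>J. indicator (?c k i) y * norm (h y)))" for k J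
      unfolding I_def by (rule Bochner_Integration.integral_sum[OF int, symmetric])
    have s2: "(\<Sum>k<Suc K. \<Sum>i\<in>cells k. I k i) =
        (LINT y|lebesgue. (\<Sum>k<Suc K. \<Sum>i\<in>cells k. indicator (?c k i) y * norm (h y)))"
      unfolding s1 by (rule Bochner_Integration.integral_sum[OF int2, symmetric])
    show ?thesis unfolding s2 unfolding s1 Bochner_Integration.integral_add[OF int3 int2, symmetric] w_def
      by (simp only: sum_distrib_right distrib_right)
  qed
  also have "C * (LINT y|lebesgue. w y * norm (h y)) \<le> C * (LINT y|lebesgue. ((6 * ?n + 18) * ?v) * (indicator ?B y * norm (h y)))"
  proof (intro mult_left_mono C0 integral_mono')
    show "integrable lebesgue (\<lambda>y. ((6 * ?n + 18) * ?v) * (indicator ?B y * norm (h y)))"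
      by (intro integrable_mult_right test_cball_integrable h)
    show "w y * norm (h y) \<le> ((6 * ?n + 18) * ?v) * (indicator ?B y * norm (h y))" for y
    proof (cases "y \<in> ?B")
      case True
      then show ?thesis using mult_right_mono[OF w1[of y], of "norm (h y)"] by (simp only: indicator_simps mult_1) simp
    next
      case False
      then show ?thesis using w0[OF False] by (simp only: indicator_simps) simp
    qed
    show "0 \<le> ((6 * ?n + 18) * ?v) * (indicator ?B y * norm (h y))" for y by (intro mult_nonneg_nonneg) auto
  qed
  also have "... = \<kappa> * good_const * (LINT y|lebesgue. indicator ?B y * norm (h y))"
    unfolding integral_mult_right_zero good_const_def C_def by (simp only: mult_ac)
  finally show ?thesis .
qed

lemma test_deriv_bound:
  assumes "h \<in> test_functions"
  obtains M where "\<And>ds (x :: real^'n). length ds = N ==> norm (partial_derivs ds h x) \<le> M"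
proof -
  obtain M where M: "\<And>x. jet_le N 1 M h x" by (rule test_jet_bounded[OF assms]) blast
  show ?thesis
  proof (rule that)
    fix ds :: "'n list" and x :: "real^'n" assume "length ds = N"
    then show "norm (partial_derivs ds h x) \<le> M" using jet_leD[OF M[of x], of ds] by simp
  qed
qed

lemma summable_scale_N: "summable (\<lambda>k. scale k ^ N)"
proof (rule summable_comparison_test)
  show "\<exists>M. \<forall>k\<ge>M. norm (scale k ^ N) \<le> (1 / 2) * (1 / 2) ^ k"
  proof (intro exI allI impI)
    fix k
    have "scale k ^ N \<le> scale k ^ 1" using scale[of k] N by (intro power_decreasing) auto
    then show "norm (scale k ^ N) \<le> (1 / 2) * (1 / 2) ^ k" using scale(1)[of k] by (simp add: scale_def)
  qed
  show "summable (\<lambda>k. (1 / 2) * (1 / 2) ^ k :: real)" by (intro summable_mult summable_geometric) simp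
qed

lemma correction_summable:
  assumes h: "h \<in> test_functions"
  shows "summable (\<lambda>k. correction k h)"
proof -
  obtain M where M: "\<And>ds (x :: real^'n). length ds = N ==> norm (partial_derivs ds h x) \<le> M"
    by (rule test_deriv_bound[OF h]) blast
  let ?c = "\<kappa> * piece_const * (2 * real CARD('n)) ^ N * (2 * \<rho> + 9) ^ CARD('n) * M"
  have "norm (correction k h) \<le> ?c * scale k ^ N" for k
    unfolding correction_def by (rule layer_fine_bound[OF layer_ring h M])
  then show ?thesis by (intro summable_comparison_test[OF _ summable_mult[OF summable_scale_N, of ?c]]) auto
qed

lemma rest_fine_tendsto_0:
  assumes h: "h \<in> test_functions"
  shows "(\<lambda>K. f (\<lambda>x. rest K x * fine_part K h x)) \<longlonglongrightarrow> 0"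
proof -
  obtain M where M: "\<And>ds (x :: real^'n). length ds = N ==> norm (partial_derivs ds h x) \<le> M"
    by (rule test_deriv_bound[OF h]) blast
  let ?c = "\<kappa> * piece_const * (2 * real CARD('n)) ^ N * (2 * \<rho> + 9) ^ CARD('n) * M"
  have le: "norm (f (\<lambda>x. rest K x * fine_part K h x)) \<le> ?c * scale K ^ N" for K
    by (rule layer_fine_bound[OF layer_rest h M])
  have "(\<lambda>K. ?c * scale K ^ N) \<longlonglongrightarrow> ?c * 0"
    by (intro tendsto_mult_left summable_LIMSEQ_zero summable_scale_N)
  then have "(\<lambda>K. ?c * scale K ^ N) \<longlonglongrightarrow> 0" by simp
  then show ?thesis by (rule Lim_null_comparison[OF always_eventually[OF allI[OF le]]])
qed

definition good :: "(real^'n => complex) => complex" where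
  "good h = f h - (\<Sum>k. correction k h)"

lemma fine_add:
  assumes "g \<in> test_functions" "h \<in> test_functions"
  shows "fine_part k (\<lambda>x. g x + h x) = (\<lambda>x. fine_part k g x + fine_part k h x)"
  unfolding fine_part_def by (rule resid_pow_add[OF step(1) assms])

lemma fine_cmult: "fine_part k (\<lambda>x. c * h x) = (\<lambda>x. c * fine_part k h x)"
  unfolding fine_part_def by (rule resid_pow_cmult[OF step(1)])

lemma good_add:
  assumes g: "g \<in> test_functions" and h: "h \<in> test_functions"
  shows "good (\<lambda>x. g x + h x) = good g + good h"
proof -
  have "correction k (\<lambda>x. g x + h x) = correction k g + correction k h" for k
    unfolding correction_def fine_add[OF g h] distrib_left by (intro f_add test_mult smooth_ring fine_test g h)
  then have "(\<Sum>k. correction k (\<lambda>x. g x + h x)) = (\<Sum>k. correction k g + correction k h)" by simp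
  also have "... = (\<Sum>k. correction k g) + (\<Sum>k. correction k h)"
    by (intro suminf_add[symmetric] correction_summable g h)
  finally show ?thesis unfolding good_def f_add[OF g h] by simp
qed

lemma good_cmult:
  assumes h: "h \<in> test_functions"
  shows "good (\<lambda>x. c * h x) = c * good h"
proof -
  have "correction k (\<lambda>x. c * h x) = c * correction k h" for k
    unfolding correction_def fine_cmult mult.left_commute[of _ c]
    by (intro f_cmult test_mult smooth_ring fine_test h)
  then have "(\<Sum>k. correction k (\<lambda>x. c * h x)) = (\<Sum>k. c * correction k h)" by simp
  also have "... = c * (\<Sum>k. correction k h)" by (intro suminf_mult correction_summable h)
  finally show ?thesis unfolding good_def f_cmult[OF h] by (simp add: right_diff_distrib)
qed

text \<open>The partial sums of the corrections differ from \<open>f\<close> by coarse parts, whose cells overlap boundedly,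
and by the fine part of the innermost rest, which tends to zero.\<close>

lemma good_bound:
  assumes h: "h \<in> test_functions"
  shows "norm (good h) \<le> (\<kappa> * good_const) * (LINT y|lebesgue. indicator (cball 0 (\<rho> + 2 * real CARD('n) + 3)) y * norm (h y))"
proof -
  have "(\<lambda>K. f h - (\<Sum>k<Suc K. correction k h) - f (\<lambda>x. rest K x * fine_part K h x)) \<longlonglongrightarrow> f h - (\<Sum>k. correction k h) - 0"
    by (intro tendsto_diff tendsto_const rest_fine_tendsto_0[OF h] LIMSEQ_Suc[OF summable_LIMSEQ[OF correction_summable[OF h]]])
  then have "(\<lambda>K. norm (f h - (\<Sum>k<Suc K. correction k h) - f (\<lambda>x. rest K x * fine_part K h x))) \<longlonglongrightarrow> norm (good h)"
    unfolding good_def diff_zero by (rule tendsto_norm)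
  then show ?thesis by (rule LIMSEQ_le_const2) (use good_partial_bound[OF h] in blast)
qed

end

context whitney
begin

section \<open>The corrections have a small grand maximal function\<close>

definition tail_kernel :: "nat => ('n => int) => real^'n => real" where
  "tail_kernel k i x =
    (if norm (x - lattice_point (scale k) i) \<le> support_radius TYPE('n) + real CARD('n) + 3
     then (scale k / (scale k + norm (x - lattice_point (scale k) i))) ^ (CARD('n) + N) else 0)"

lemma tail_kernel_nonneg: "0 \<le> tail_kernel k i x" using scale(1)[of k] by (simp add: tail_kernel_def)

definition dist_const :: real where
  "dist_const = (support_radius TYPE('n) + real CARD('n) + 3) ^ (CARD('n) + N)"

lemma dist_const: "1 \<le> dist_const"
proof -
  have "(1 :: real) \<le> support_radius TYPE('n) + real CARD('n) + 3"
    by (intro order_trans[OF _ add_increasing[of "support_radius TYPE('n) + real CARD('n)" 3]]) auto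
  then show ?thesis unfolding dist_const_def by (rule one_le_power)
qed

lemma tail_kernel_near:
  assumes t: "0 < t" "t < 1"
    and near: "norm (x - lattice_point (scale k) i) \<le> support_radius TYPE('n) * t + (real CARD('n) + 2) * scale k"
  shows "(scale k / max t (scale k)) ^ (CARD('n) + N) \<le> dist_const * tail_kernel k i x"
proof -
  define R where "R = support_radius TYPE('n)"
  note near = near[folded R_def]
  let ?l = "scale k" and ?n = "real CARD('n)"
  let ?r = "norm (x - lattice_point ?l i)"
  define m where "m = max t ?l"
  have m: "0 < m" "t \<le> m" "?l \<le> m" "m \<le> 1" using t scale[of k] by (auto simp: m_def)
  have R0: "0 \<le> R" by (simp add: R_def)
  have "?r \<le> R * m + (?n + 2) * m"
    using near mult_left_mono[OF m(2) R0] mult_left_mono[OF m(3), of "?n + 2"] by linarith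
  then have r: "?r \<le> (R + ?n + 2) * m" by (simp only: distrib_right)
  have q: "0 \<le> R + ?n + 2" using R0 by linarith
  have "(R + ?n + 2) * m \<le> (R + ?n + 2) * 1" using m(4) q by (rule mult_left_mono)
  then have "?r \<le> (R + ?n + 2) * 1" by (rule order_trans[OF r])
  also have "... \<le> R + ?n + 3" by simp
  finally have c: "?r \<le> R + ?n + 3" .
  have lr: "?l + ?r \<le> (R + ?n + 3) * m"
  proof -
    have "(R + ?n + 3) * m = (R + ?n + 2) * m + m" by (simp add: distrib_right)
    then show ?thesis using add_mono[OF m(3) r] by (simp only: add.commute)
  qed
  have pos: "0 < ?l + ?r" using scale(1)[of k] norm_ge_zero by (rule add_pos_nonneg)
  have le: "?l / m \<le> (R + ?n + 3) * (?l / (?l + ?r))"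
  proof -
    have "?l * (?l + ?r) \<le> ?l * ((R + ?n + 3) * m)" using lr scale(1)[of k] by (intro mult_left_mono) auto
    then have "?l \<le> (?l * ((R + ?n + 3) * m)) / (?l + ?r)" using pos by (simp only: pos_le_divide_eq)
    also have "... = ((R + ?n + 3) * (?l / (?l + ?r))) * m" by (simp only: times_divide_eq_right times_divide_eq_left mult_ac)
    finally show ?thesis using m(1) by (simp only: pos_divide_le_eq)
  qed
  have "(?l / m) ^ (CARD('n) + N) \<le> ((R + ?n + 3) * (?l / (?l + ?r))) ^ (CARD('n) + N)"
    using le scale(1)[of k] m(1) by (intro power_mono) auto
  also have "... = dist_const * tail_kernel k i x"
    unfolding tail_kernel_def dist_const_def R_def[symmetric] using c by (simp only: power_mult_distrib if_True)
  finally show ?thesis unfolding m_def .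
qed

definition remainder_const :: real where
  "remainder_const = piece_const * ((2 * real CARD('n)) ^ N + Ct * (2 * support_radius TYPE('n)) ^ CARD('n)) * dist_const"

lemma remainder_const_nonneg: "0 \<le> remainder_const"
  unfolding remainder_const_def using piece_const_nonneg Ct(1) dist_const
  by (intro mult_nonneg_nonneg add_nonneg_nonneg) auto

definition tail_const :: real where
  "tail_const = remainder_const + 2 ^ N * Cs * dist_const"

text \<open>A kernel of scale \<open>t\<close> meets a layer of smaller scale \<open>l\<close> through its oscillating part, which
  gains \<open>(l / t)\<^sup>N\<close>; from a coarser layer its oscillating part differs by the harmless coarse part.\<close>

context
  fixes h :: "real^'n => complex" and x\<^sub>0 :: "real^'n" and t :: real
  assumes h: "h \<in> test_functions" and hs: "supp h \<subseteq> ball x\<^sub>0 (support_radius TYPE('n) * t)"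
    and hj: "\<And>y. jet_le N t (1 / t ^ CARD('n)) h y"
    and hi: "(LINT y|lebesgue. norm (h y)) \<le> (2 * support_radius TYPE('n)) ^ CARD('n)"
    and t: "0 < t" "t < 1"
begin

lemma kernel_far:
  assumes far: "support_radius TYPE('n) * t + (real CARD('n) + 2) * scale k < norm (x\<^sub>0 - lattice_point (scale k) i)"
    and b: "lattice_bump (scale k) i y \<noteq> 0"
  shows "h y = 0" "fine_part k h y = 0"
proof -
  let ?l = "scale k" and ?p = "lattice_point (scale k) i"
  have yp: "norm (y - ?p) \<le> (real CARD('n) + 1) * ?l"
  proof (rule ccontr)
    assume "\<not> ?thesis"
    then have "lattice_bump ?l i y = 0" using scale(1)[of k] by (intro lattice_bump_zero) auto
    then show False using b by simp
  qed
  have z: "h w = 0" if w: "w \<in> cball y ?l" for w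
  proof (rule ccontr)
    assume "h w \<noteq> 0"
    then have "w \<in> ball x\<^sub>0 (support_radius TYPE('n) * t)" using hs supp_memI by blast
    then have "norm (x\<^sub>0 - w) < support_radius TYPE('n) * t" by (simp add: dist_norm)
    moreover have "norm (y - w) \<le> ?l" using w by (simp add: dist_norm)
    moreover have "norm (x\<^sub>0 - ?p) \<le> norm (x\<^sub>0 - w) + norm (y - w) + norm (y - ?p)"
      using norm_triangle_ineq[of "x\<^sub>0 - w" "w - ?p"] norm_triangle_ineq[of "w - y" "y - ?p"]
      by (simp add: norm_minus_commute)
    ultimately show False using far yp by (simp add: algebra_simps)
  qed
  show "h y = 0" using z scale(1)[of k] by simp
  show "fine_part k h y = 0" by (rule fine_zero[OF h z])
qed

lemma fine_piece_bound:
  assumes i: "i \<in> cells k" and lt: "scale k \<le> t"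
  shows "norm (f (\<lambda>y. ring_layer k y * (lattice_bump (scale k) i y * fine_part k h y))) \<le>
    \<kappa> * (piece_const * (2 * real CARD('n)) ^ N * dist_const) * tail_kernel k i x\<^sub>0"
proof (cases "norm (x\<^sub>0 - lattice_point (scale k) i) \<le> support_radius TYPE('n) * t + (real CARD('n) + 2) * scale k")
  case True
  let ?l = "scale k" and ?n = "CARD('n)"
  have M: "norm (partial_derivs ds h y) \<le> 1 / t ^ (?n + N)" if "length ds = N" for ds y
    using jet_leD[OF hj[of y], of ds] that t by (simp add: field_simps power_add)
  have "norm (f (\<lambda>y. ring_layer k y * (lattice_bump ?l i y * fine_part k h y))) \<le>
      \<kappa> * (?l ^ ?n * (piece_const * ((2 * real ?n) ^ N * ?l ^ N * (1 / t ^ (?n + N)))))"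
    by (intro piece_bound[OF scale layer_ring fine_test[OF h] i] fine_jet[OF h M])
  also have "... = \<kappa> * (piece_const * (2 * real ?n) ^ N) * (?l / t) ^ (?n + N)"
    by (simp add: power_divide power_add)
  also have "... \<le> \<kappa> * (piece_const * (2 * real ?n) ^ N) * (dist_const * tail_kernel k i x\<^sub>0)"
  proof (rule mult_left_mono)
    have "max t ?l = t" using lt by simp
    then show "(?l / t) ^ (?n + N) \<le> dist_const * tail_kernel k i x\<^sub>0"
      using tail_kernel_near[OF t True] by (simp only:)
    show "0 \<le> \<kappa> * (piece_const * (2 * real ?n) ^ N)"
      using \<kappa> piece_const_nonneg by (intro mult_nonneg_nonneg) auto
  qed
  finally show ?thesis by (simp only: mult_ac)
next
  case False
  have "ring_layer k y * (lattice_bump (scale k) i y * fine_part k h y) = 0" for y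
    using kernel_far(2)[of k i y] False by (cases "lattice_bump (scale k) i y = 0") (auto simp: not_le)
  then have "(\<lambda>y. ring_layer k y * (lattice_bump (scale k) i y * fine_part k h y)) = (\<lambda>y. 0)" by (rule ext)
  moreover have "0 \<le> \<kappa> * (piece_const * (2 * real CARD('n)) ^ N * dist_const) * tail_kernel k i x\<^sub>0"
    using \<kappa> piece_const_nonneg dist_const tail_kernel_nonneg by (intro mult_nonneg_nonneg) auto
  ultimately show ?thesis by (simp only: f_zero norm_zero)
qed

lemma coarse_piece_bound:
  assumes i: "i \<in> cells k" and lt: "t < scale k"
  shows "norm (f (\<lambda>y. ring_layer k y * (lattice_bump (scale k) i y * coarse_part k h y))) \<le>
    \<kappa> * (piece_const * (Ct * (2 * support_radius TYPE('n)) ^ CARD('n)) * dist_const) * tail_kernel k i x\<^sub>0"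
proof (cases "norm (x\<^sub>0 - lattice_point (scale k) i) \<le> support_radius TYPE('n) * t + (real CARD('n) + 2) * scale k")
  case True
  let ?l = "scale k" and ?n = "CARD('n)" and ?J = "(2 * support_radius TYPE('n)) ^ CARD('n)"
  have jet: "jet_le N ?l (Ct / ?l ^ ?n * ?J) (coarse_part k h) y" for y
  proof (rule jet_le_mono[OF coarse_jet[OF h]])
    have "(LINT w|lebesgue. indicator (cball y ?l) w * norm (h w)) \<le> (LINT w|lebesgue. norm (h w))"
      by (intro integral_mono[OF test_cball_integrable[OF h] integrable_norm[OF test_integrable[OF h]]])
         (simp add: indicator_def)
    also have "... \<le> ?J" by (rule hi)
    finally show "Ct / ?l ^ ?n * (LINT w|lebesgue. indicator (cball y ?l) w * norm (h w)) \<le> Ct / ?l ^ ?n * ?J"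
      using Ct(1) scale(1)[of k] by (intro mult_left_mono) auto
  qed (use scale(1)[of k] in auto)
  have "norm (f (\<lambda>y. ring_layer k y * (lattice_bump ?l i y * coarse_part k h y))) \<le>
      \<kappa> * (?l ^ ?n * (piece_const * (Ct / ?l ^ ?n * ?J)))"
    by (intro piece_bound[OF scale layer_ring coarse_test[OF h] i] jet)
  also have "... = \<kappa> * (piece_const * (Ct * ?J)) * 1" using scale(1)[of k] by simp
  also have "... \<le> \<kappa> * (piece_const * (Ct * ?J)) * (dist_const * tail_kernel k i x\<^sub>0)"
  proof (rule mult_left_mono)
    have "max t ?l = ?l" using lt by simp
    then have "(?l / ?l) ^ (?n + N) \<le> dist_const * tail_kernel k i x\<^sub>0"
      using tail_kernel_near[OF t True] by (simp only:)
    then show "1 \<le> dist_const * tail_kernel k i x\<^sub>0" using scale(1)[of k] by simp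
    show "0 \<le> \<kappa> * (piece_const * (Ct * ?J))"
      using \<kappa> piece_const_nonneg Ct(1) by (intro mult_nonneg_nonneg) auto
  qed
  finally show ?thesis by (simp only: mult_ac)
next
  case False
  have "ring_layer k y * (lattice_bump (scale k) i y * coarse_part k h y) = 0" for y
    using kernel_far[of k i y] False
    by (cases "lattice_bump (scale k) i y = 0") (auto simp: not_le coarse_part_def)
  then have "(\<lambda>y. ring_layer k y * (lattice_bump (scale k) i y * coarse_part k h y)) = (\<lambda>y. 0)" by (rule ext)
  moreover have "0 \<le> \<kappa> * (piece_const * (Ct * (2 * support_radius TYPE('n)) ^ CARD('n)) * dist_const) * tail_kernel k i x\<^sub>0"
    using \<kappa> piece_const_nonneg dist_const tail_kernel_nonneg Ct(1) by (intro mult_nonneg_nonneg) auto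
  ultimately show ?thesis by (simp only: f_zero norm_zero)
qed

lemma correction_remainder:
  "norm (correction k h - (if t < scale k then f (\<lambda>y. ring_layer k y * h y) else 0)) \<le>
    \<kappa> * remainder_const * (\<Sum>i\<in>cells k. tail_kernel k i x\<^sub>0)"
proof -
  let ?a = "piece_const * (2 * real CARD('n)) ^ N * dist_const"
  let ?b = "piece_const * (Ct * (2 * support_radius TYPE('n)) ^ CARD('n)) * dist_const"
  let ?S = "\<Sum>i\<in>cells k. tail_kernel k i x\<^sub>0"
  have ab: "0 \<le> ?a" "0 \<le> ?b" using piece_const_nonneg dist_const Ct(1) by (auto intro!: mult_nonneg_nonneg)
  have sum: "remainder_const = ?a + ?b" unfolding remainder_const_def by (simp add: algebra_simps)
  have S0: "0 \<le> ?S" by (intro sum_nonneg tail_kernel_nonneg)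
  note pieces = layer_pieces[OF scale(1)[of k] less_imp_le[OF scale(2)] smooth_ring]
  show ?thesis
  proof (cases "t < scale k")
    case True
    have "norm (correction k h - f (\<lambda>y. ring_layer k y * h y)) = norm (f (\<lambda>y. ring_layer k y * coarse_part k h y))"
      unfolding layer_split[OF smooth_ring h, of k k] correction_def by (simp add: norm_minus_commute)
    also have "... \<le> (\<Sum>i\<in>cells k.
        norm (f (\<lambda>y. ring_layer k y * (lattice_bump (scale k) i y * coarse_part k h y))))"
      unfolding pieces[OF coarse_test[OF h]] by (rule norm_sum)
    also have "... \<le> (\<Sum>i\<in>cells k. \<kappa> * ?b * tail_kernel k i x\<^sub>0)"
      by (intro sum_mono coarse_piece_bound True)
    also have "... = \<kappa> * ?b * ?S" by (rule sum_distrib_left[symmetric])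
    also have "... \<le> \<kappa> * remainder_const * ?S"
      unfolding sum using ab S0 \<kappa> by (intro mult_right_mono mult_left_mono) auto
    finally show ?thesis using True by simp
  next
    case False
    have "norm (correction k h) \<le> (\<Sum>i\<in>cells k.
        norm (f (\<lambda>y. ring_layer k y * (lattice_bump (scale k) i y * fine_part k h y))))"
      unfolding correction_def pieces[OF fine_test[OF h]] by (rule norm_sum)
    also have "... \<le> (\<Sum>i\<in>cells k. \<kappa> * ?a * tail_kernel k i x\<^sub>0)"
      using False by (intro sum_mono fine_piece_bound) auto
    also have "... = \<kappa> * ?a * ?S" by (rule sum_distrib_left[symmetric])
    also have "... \<le> \<kappa> * remainder_const * ?S"
      unfolding sum using ab S0 \<kappa> by (intro mult_right_mono mult_left_mono) auto
    finally show ?thesis using False by simp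
  qed
qed

text \<open>The layers coarser than the kernel add up to a single cut-off, so that together they cost one
  application of the scale estimate instead of one per layer.\<close>

lemma coarse_layers:
  obtains K' where "K' \<le> K" "\<And>k. k < K' ==> t < scale k"
    "(\<Sum>k<K. if t < scale k then f (\<lambda>y. ring_layer k y * h y) else 0) = (\<Sum>k<K'. f (\<lambda>y. ring_layer k y * h y))"
proof -
  have "\<exists>K'\<le>K. (\<forall>k<K'. t < scale k) \<and>
      (\<Sum>k<K. if t < scale k then f (\<lambda>y. ring_layer k y * h y) else 0) = (\<Sum>k<K'. f (\<lambda>y. ring_layer k y * h y))"
  proof (induction K)
    case (Suc K)
    show ?case
    proof (cases "t < scale K")
      case True
      have "t < scale k" if "k < Suc K" for k
      proof -
        have "scale K \<le> scale k" unfolding scale_def using that by (intro power_decreasing) auto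
        then show ?thesis using True by linarith
      qed
      then show ?thesis by (intro exI[of _ "Suc K"]) simp
    next
      case False
      obtain K' where K': "K' \<le> K" "\<forall>k<K'. t < scale k"
        "(\<Sum>k<K. if t < scale k then f (\<lambda>y. ring_layer k y * h y) else 0) = (\<Sum>k<K'. f (\<lambda>y. ring_layer k y * h y))"
        using Suc.IH by (elim exE conjE)
      show ?thesis by (intro exI[of _ K'] conjI K'(2)) (use K'(1) in simp, use False K'(3) in simp)
    qed
  qed simp
  then show ?thesis using that by (elim exE conjE) simp
qed

lemma cut_bound:
  assumes z: "supp h \<subseteq> ball z (support_radius TYPE('n) * t)" and K: "t \<le> (1 / 2) ^ K"
  shows "ennreal (norm (f (\<lambda>y. cut K y * h y))) \<le> ennreal (2 ^ N * Cs) * \<Gamma> z"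
proof -
  have "ennreal (norm (f (\<lambda>y. cut K y * h y))) \<le> ennreal (t ^ CARD('n) * (2 ^ N * Cs * (1 / t ^ CARD('n)))) * \<Gamma> z"
  proof (rule f_scale[OF test_mult[OF smooth_cut h] _ t])
    show "supp (\<lambda>y. cut K y * h y) \<subseteq> ball z (support_radius TYPE('n) * t)"
      by (rule order_trans[OF supp_mono z]) simp
    show "jet_le N t (2 ^ N * Cs * (1 / t ^ CARD('n))) (\<lambda>y. cut K y * h y) y" for y
      by (intro jet_le_mult smooth_cut test_smooth[OF h] jet_le_mono[OF cut_jet] hj) (use t K in auto)
  qed
  also have "t ^ CARD('n) * (2 ^ N * Cs * (1 / t ^ CARD('n))) = 2 ^ N * Cs" using t by simp
  finally show ?thesis .
qed

lemma near_point:
  assumes "d x\<^sub>0 = 0"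
  obtains z where "z \<in> F" "supp h \<subseteq> ball z (support_radius TYPE('n) * t)"
proof (cases "supp h = {}")
  case True
  obtain z where "z \<in> F" using F(1) by blast
  then show ?thesis using True that by simp
next
  case False
  have "compact (supp h)" using h by (simp add: test_functions_def)
  then obtain y where y: "y \<in> supp h" "\<And>w. w \<in> supp h ==> dist x\<^sub>0 w \<le> dist x\<^sub>0 y"
    using distance_attains_sup[OF _ False, of x\<^sub>0] by blast
  have "dist x\<^sub>0 y < support_radius TYPE('n) * t" using y(1) hs by auto
  then have "d x\<^sub>0 < support_radius TYPE('n) * t - dist x\<^sub>0 y" using assms by simp
  then obtain z where z: "z \<in> F" "dist x\<^sub>0 z < support_radius TYPE('n) * t - dist x\<^sub>0 y"
    by (rule infdist_lessD[OF F(1)]) blast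
  have "supp h \<subseteq> ball z (support_radius TYPE('n) * t)"
  proof
    fix w assume "w \<in> supp h"
    then have "dist x\<^sub>0 w \<le> dist x\<^sub>0 y" by (rule y(2))
    then have "dist z w < support_radius TYPE('n) * t"
      using z(2) dist_triangle[of z w x\<^sub>0] by (simp add: dist_commute)
    then show "w \<in> ball z (support_radius TYPE('n) * t)" by simp
  qed
  then show ?thesis using z(1) that by blast
qed

text \<open>If \<open>x\<^sub>0\<close> has distance zero from \<open>F\<close>, the scale estimate of the joint cut-off is applied at a point
of \<open>F\<close> so close to \<open>x\<^sub>0\<close> that the support of the kernel still fits. The value \<open>\<kappa>\<close> obtained there is
absorbed into the tail of a single cell: if the joint term does not vanish, some active cell meets the
kernel at a scale larger than \<open>t\<close>.\<close>

lemma corrections_kernel_bound: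
  "ennreal (norm (\<Sum>k<K. correction k h)) \<le>
    ennreal (2 ^ N * Cs) * (if d x\<^sub>0 = 0 then 0 else \<Gamma> x\<^sub>0) +
    ennreal (\<kappa> * tail_const * (\<Sum>k<K. \<Sum>i\<in>cells k. tail_kernel k i x\<^sub>0))"
proof -
  let ?S = "\<lambda>k. \<Sum>i\<in>cells k. tail_kernel k i x\<^sub>0"
  let ?T = "\<Sum>k<K. ?S k"
  have S0: "0 \<le> ?S k" for k by (intro sum_nonneg tail_kernel_nonneg)
  have T0: "0 \<le> ?T" by (intro sum_nonneg S0)
  define c where "c k = (if t < scale k then f (\<lambda>y. ring_layer k y * h y) else 0)" for k
  obtain K' where K': "K' \<le> K" "\<And>k. k < K' ==> t < scale k" "(\<Sum>k<K. c k) = (\<Sum>k<K'. f (\<lambda>y. ring_layer k y * h y))"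
    unfolding c_def by (rule coarse_layers[of K]) blast
  define w where "w = f (\<lambda>y. cut K' y * h y)"
  have cw: "(\<Sum>k<K. c k) = w" unfolding w_def K'(3) by (rule ring_layers_cut[OF h])
  have rem: "norm (\<Sum>k<K. correction k h - c k) \<le> \<kappa> * remainder_const * ?T"
  proof -
    have "norm (\<Sum>k<K. correction k h - c k) \<le> (\<Sum>k<K. \<kappa> * remainder_const * ?S k)"
      unfolding c_def by (intro sum_norm_le correction_remainder)
    then show ?thesis by (simp only: sum_distrib_left)
  qed
  have wb: "ennreal (norm w) \<le> ennreal (2 ^ N * Cs) * (if d x\<^sub>0 = 0 then 0 else \<Gamma> x\<^sub>0) + ennreal (\<kappa> * (2 ^ N * Cs * dist_const) * ?T)"
  proof (cases "w = 0")
    case False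
    have K0: "K' \<noteq> 0"
    proof
      assume "K' = 0"
      then have "(\<Sum>k<K'. f (\<lambda>y. ring_layer k y * h y)) = 0" by simp
      then show False using False cw K'(3) by simp
    qed
    then have tK: "t \<le> (1 / 2) ^ K'" using K'(2)[of "K' - 1"] by (simp add: scale_def less_imp_le)
    show ?thesis
    proof (cases "d x\<^sub>0 = 0")
      case True
      obtain z where z: "z \<in> F" "supp h \<subseteq> ball z (support_radius TYPE('n) * t)" by (rule near_point[OF True]) blast
      have "\<exists>k. k < K' \<and> f (\<lambda>y. ring_layer k y * h y) \<noteq> 0"
      proof (rule ccontr)
        assume "\<not> ?thesis"
        then have "(\<Sum>k<K'. f (\<lambda>y. ring_layer k y * h y)) = 0" by simp
        then show False using False cw K'(3) by simp
      qed
      then obtain k where k: "k < K'" "f (\<lambda>y. ring_layer k y * h y) \<noteq> 0" by (elim exE conjE)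
      have "\<exists>i. i \<in> cells k \<and> f (\<lambda>y. ring_layer k y * (lattice_bump (scale k) i y * h y)) \<noteq> 0"
      proof (rule ccontr)
        assume "\<not> ?thesis"
        then have "(\<Sum>i\<in>cells k. f (\<lambda>y. ring_layer k y * (lattice_bump (scale k) i y * h y))) = 0"
          by simp
        then show False
          using k(2) unfolding layer_pieces[OF scale(1)[of k] less_imp_le[OF scale(2)] smooth_ring h] by (rule notE[rotated])
      qed
      then obtain i where i: "i \<in> cells k"
        "f (\<lambda>y. ring_layer k y * (lattice_bump (scale k) i y * h y)) \<noteq> 0" by (elim exE conjE)
      have near: "norm (x\<^sub>0 - lattice_point (scale k) i) \<le> support_radius TYPE('n) * t + (real CARD('n) + 2) * scale k"
      proof (rule ccontr)
        assume far: "\<not> ?thesis"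
        have "ring_layer k y * (lattice_bump (scale k) i y * h y) = 0" for y
          using kernel_far(1)[of k i y] far by (cases "lattice_bump (scale k) i y = 0") (auto simp: not_le)
        then have "(\<lambda>y. ring_layer k y * (lattice_bump (scale k) i y * h y)) = (\<lambda>y. 0)" by (rule ext)
        then show False using i(2) by (simp only: f_zero)
      qed
      have "max t (scale k) = scale k" using K'(2)[OF k(1)] by simp
      then have "(scale k / scale k) ^ (CARD('n) + N) \<le> dist_const * tail_kernel k i x\<^sub>0"
        using tail_kernel_near[OF t near] by (simp only:)
      then have "1 \<le> dist_const * tail_kernel k i x\<^sub>0" using scale(1)[of k] by simp
      also have "tail_kernel k i x\<^sub>0 \<le> ?S k"
        by (intro member_le_sum i(1) tail_kernel_nonneg finite_active)
      also have "?S k \<le> ?T" by (intro member_le_sum[of k "{..<K}" ?S] S0) (use k(1) K'(1) in auto)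
      finally have "1 \<le> dist_const * ?T" using dist_const by simp
      then have one: "\<kappa> * (2 ^ N * Cs) * 1 \<le> \<kappa> * (2 ^ N * Cs) * (dist_const * ?T)"
        using \<kappa> Cs(1) by (intro mult_left_mono) auto
      have "ennreal (norm w) \<le> ennreal (2 ^ N * Cs) * \<Gamma> z" unfolding w_def by (rule cut_bound[OF z(2) tK])
      also have "... \<le> ennreal (2 ^ N * Cs) * ennreal \<kappa>" by (intro mult_left_mono F(2) z(1)) auto
      also have "... = ennreal (\<kappa> * (2 ^ N * Cs) * 1)" using \<kappa> Cs(1) by (simp add: mult.commute flip: ennreal_mult)
      also have "... \<le> ennreal (\<kappa> * (2 ^ N * Cs * dist_const) * ?T)"
        using one by (intro ennreal_leI) (simp only: mult_ac)
      finally show ?thesis using True by simp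
    next
      case False
      have "ennreal (norm w) \<le> ennreal (2 ^ N * Cs) * \<Gamma> x\<^sub>0" unfolding w_def by (rule cut_bound[OF hs tK])
      then show ?thesis using False by (simp add: add_increasing2)
    qed
  qed simp
  have "norm (\<Sum>k<K. correction k h) \<le> norm w + \<kappa> * remainder_const * ?T"
  proof -
    have "(\<Sum>k<K. correction k h) = w + (\<Sum>k<K. correction k h - c k)" by (simp add: sum_subtractf cw)
    then have "norm (\<Sum>k<K. correction k h) \<le> norm w + norm (\<Sum>k<K. correction k h - c k)"
      by (simp only: norm_triangle_ineq)
    then show ?thesis using rem by linarith
  qed
  then have "ennreal (norm (\<Sum>k<K. correction k h)) \<le> ennreal (norm w + \<kappa> * remainder_const * ?T)"
    by (rule ennreal_leI)
  also have "... = ennreal (norm w) + ennreal (\<kappa> * remainder_const * ?T)"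
    using \<kappa> remainder_const_nonneg T0 by (intro ennreal_plus) (auto intro!: mult_nonneg_nonneg)
  also have "... \<le> (ennreal (2 ^ N * Cs) * (if d x\<^sub>0 = 0 then 0 else \<Gamma> x\<^sub>0) + ennreal (\<kappa> * (2 ^ N * Cs * dist_const) * ?T)) +
      ennreal (\<kappa> * remainder_const * ?T)" by (intro add_right_mono wb)
  also have "... = ennreal (2 ^ N * Cs) * (if d x\<^sub>0 = 0 then 0 else \<Gamma> x\<^sub>0) +
      ennreal (\<kappa> * (2 ^ N * Cs * dist_const) * ?T + \<kappa> * remainder_const * ?T)"
    unfolding add.assoc using \<kappa> remainder_const_nonneg T0 Cs(1) dist_const
    by (subst ennreal_plus) (auto intro!: mult_nonneg_nonneg)
  also have "\<kappa> * (2 ^ N * Cs * dist_const) * ?T + \<kappa> * remainder_const * ?T = \<kappa> * tail_const * ?T"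
    unfolding tail_const_def by (simp only: distrib_left distrib_right add.commute)
  finally show ?thesis .
qed

end

lemma tail_const_nonneg: "0 \<le> tail_const"
  unfolding tail_const_def using remainder_const_nonneg Cs(1) dist_const by simp

definition tail :: "real^'n => ennreal" where
  "tail x = (\<Sum>k. \<Sum>i\<in>cells k. ennreal (tail_kernel k i x))"

text \<open>Hence the maximal function of what was removed is controlled by \<open>\<Gamma>\<close> off \<open>F\<close> and by tails of
  the cells, each of size the level \<open>\<kappa>\<close>.\<close>

theorem grand_maximal_bad:
  "grand_maximal N (\<lambda>h. if h \<in> test_functions then f h - good h else 0) x \<le>
    ennreal (2 ^ N * Cs) * (if d x = 0 then 0 else \<Gamma> x) + ennreal (\<kappa> * tail_const) * tail x"
  unfolding grand_maximal_def
proof (intro SUP_least)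
  fix t :: real and \<psi> :: "real^'n => complex"
  assume tt: "t \<in> {0<..<1}" and \<psi>: "\<psi> \<in> grand_test_functions N"
  then have t: "0 < t" "t < 1" by auto
  let ?rhs = "ennreal (2 ^ N * Cs) * (if d x = 0 then 0 else \<Gamma> x) + ennreal (\<kappa> * tail_const) * tail x"
  define h where "h y = dilate t \<psi> (x - y)" for y
  have h: "h \<in> test_functions" and hs: "supp h \<subseteq> ball x (support_radius TYPE('n) * t)"
    and hj: "\<And>y. jet_le N t (1 / t ^ CARD('n)) h y"
    and hi: "(LINT y|lebesgue. norm (h y)) \<le> (2 * support_radius TYPE('n)) ^ CARD('n)"
    unfolding h_def by (rule grand_test_kernel[OF \<psi> t(1)])+
  have lim: "(\<lambda>K. ennreal (norm (\<Sum>k<K. correction k h))) \<longlonglongrightarrow> ennreal (norm (\<Sum>k. correction k h))"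
    by (intro tendsto_ennrealI tendsto_norm summable_LIMSEQ correction_summable h)
  have le: "ennreal (norm (\<Sum>k<K. correction k h)) \<le> ?rhs" for K
  proof -
    let ?S = "\<lambda>k. \<Sum>i\<in>cells k. tail_kernel k i x"
    have S0: "0 \<le> ?S k" for k by (intro sum_nonneg tail_kernel_nonneg)
    have "ennreal (\<Sum>k<K. ?S k) = (\<Sum>k<K. \<Sum>i\<in>cells k. ennreal (tail_kernel k i x))"
      by (simp add: sum_ennreal S0 tail_kernel_nonneg)
    also have "... \<le> tail x" unfolding tail_def by (intro sum_le_suminf) auto
    finally have le: "ennreal (\<Sum>k<K. ?S k) \<le> tail x" .
    have "ennreal (\<kappa> * tail_const * (\<Sum>k<K. ?S k)) = ennreal (\<kappa> * tail_const) * ennreal (\<Sum>k<K. ?S k)"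
      using \<kappa> tail_const_nonneg by (intro ennreal_mult sum_nonneg S0 mult_nonneg_nonneg) auto
    also have "... \<le> ennreal (\<kappa> * tail_const) * tail x" by (intro mult_left_mono le) auto
    finally have "ennreal (\<kappa> * tail_const * (\<Sum>k<K. ?S k)) \<le> ennreal (\<kappa> * tail_const) * tail x" .
    then show ?thesis by (rule order_trans[OF corrections_kernel_bound[OF h hs hj hi t] add_left_mono])
  qed
  have "ennreal (norm (\<Sum>k. correction k h)) \<le> ?rhs"
    by (intro LIMSEQ_le_const2[OF lim] exI[of _ 0] allI impI le)
  moreover have "convolve (dilate t \<psi>) (\<lambda>h. if h \<in> test_functions then f h - good h else 0) x = (\<Sum>k. correction k h)"
    using h unfolding convolve_def h_def[abs_def, symmetric] by (simp add: good_def)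
  ultimately show "ennreal (norm (convolve (dilate t \<psi>) (\<lambda>h. if h \<in> test_functions then f h - good h else 0) x)) \<le> ?rhs"
    by simp
qed

end

section \<open>Integrating the tails against the weight\<close>

lemma wmeas_integral:
  fixes \<omega> :: "real^'n => real"
  assumes "\<omega> \<in> weights" "u \<in> borel_measurable lebesgue"
  shows "(\<integral>\<^sup>+x. u x \<partial>wmeas \<omega>) = (\<integral>\<^sup>+x. u x * ennreal (\<omega> x) \<partial>lebesgue)"
  unfolding wmeas_def using assms(2) weight_measurable[OF assms(1)]
  by (subst nn_integral_density) (auto simp: mult.commute)

lemma wmeas_measurable: "borel_measurable (wmeas \<omega>) = borel_measurable lebesgue"
  by (rule measurable_cong_sets) auto

lemma modular_le:
  fixes \<omega> :: "real^'n => real"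
  assumes w: "\<omega> \<in> weights" and u: "u \<in> borel_measurable lebesgue" and le: "\<And>x. extend_Phi \<Phi> (g x) \<le> u x"
  shows "modular \<Phi> \<omega> g \<le> (\<integral>\<^sup>+x. u x \<partial>wmeas \<omega>)"
  unfolding modular_def wmeas_integral[OF w u] by (intro nn_integral_mono mult_right_mono le) auto

lemma extend_suminf:
  assumes A: "assumption_A \<Phi>"
  shows "extend_Phi \<Phi> (\<Sum>k. u k) \<le> (\<Sum>k. extend_Phi \<Phi> (u k))"
proof -
  have "extend_Phi \<Phi> (SUP n. \<Sum>k<n. u k) \<le> (\<Sum>k. extend_Phi \<Phi> (u k))"
  proof (rule extend_Sup_le[OF A])
    fix a assume "a \<in> range (\<lambda>n. \<Sum>k<n. u k)"
    then obtain n where "a = (\<Sum>k<n. u k)" by blast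
    then have "extend_Phi \<Phi> a \<le> (\<Sum>k<n. extend_Phi \<Phi> (u k))" using extend_sum[OF A, of u "{..<n}"] by simp
    also have "... \<le> (\<Sum>k. extend_Phi \<Phi> (u k))" by (intro sum_le_suminf) auto
    finally show "extend_Phi \<Phi> a \<le> (\<Sum>k. extend_Phi \<Phi> (u k))" .
  qed
  then show ?thesis by (simp only: suminf_eq_SUP)
qed

lemma superlevel_sets:
  fixes u :: "real^'n => ennreal"
  assumes "u \<in> borel_measurable lebesgue" shows "{x. a < u x} \<in> sets lebesgue"
proof -
  have "u -` {a<..} \<inter> space lebesgue \<in> sets lebesgue" by (rule measurable_sets[OF assms]) simp
  then show ?thesis by (simp add: vimage_def greaterThan_def)
qed

text \<open>The tail of a cell decays like the \<open>m\<close>-th power of the inverse distance, and the weight of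
  the dyadic annuli grows at most like the power \<open>n p\<^sub>1\<close>; the lower type of the Orlicz function
  turns the former into the power \<open>m p\<close>, so that the annuli contribute a geometric series.\<close>

lemma cell_tail:
  fixes \<omega> :: "real^'n => real"
  assumes A: "assumption_A \<Phi>" and w: "\<omega> \<in> weights" and pos: "\<And>x l. 0 < l ==> 0 < measure (wmeas \<omega>) (cube x l)"
    and pb: "part_bound \<omega> p\<^sub>1 C" and p1: "0 \<le> p\<^sub>1" and p: "p \<in> lower_type_exponents \<Phi>"
    and gap: "real CARD('n) * p\<^sub>1 < real m * p" and B: "bounded B"
  obtains K where "0 < K" "\<And>y l \<kappa>. y \<in> B ==> 0 < l ==> l \<le> 1 ==> 0 < \<kappa> ==>
    (\<integral>\<^sup>+x. extend_Phi \<Phi> (ennreal (\<kappa> * (if norm (x - y) \<le> r then (l / (l + norm (x - y))) ^ m else 0))) \<partial>wmeas \<omega>)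
      \<le> ennreal (K * \<Phi> \<kappa> * measure (wmeas \<omega>) (cube y l))"
proof -
  let ?W = "measure (wmeas \<omega>)" and ?E = "extend_Phi \<Phi>"
  let ?e = "real CARD('n) * p\<^sub>1"
  obtain b where b: "\<And>x. x \<in> B ==> norm x \<le> b" using B by (auto simp: bounded_iff)
  define B' where "B' = cball (0 :: real^'n) (b + r)"
  obtain K0 where K0: "0 < K0" "\<And>x l j. x \<in> B ==> 0 < l ==> l \<le> 1 ==>
    ?W (ball x (2 ^ j * 2 * l) \<inter> B') \<le> K0 * (2 ^ j) powr ?e * ?W (cube x l)"
    by (rule local_doubling[OF w pos pb B _ _ p1, of B']) (auto simp: B'_def)
  define q where "q = (2::real) powr (?e - real m * p)"
  have q: "0 < q" "q < 1" unfolding q_def using gap powr_less_mono[of "?e - real m * p" 0 2] by simp_all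
  define c where "c j = ((1 / 2 ^ j) ^ m :: real) powr p" for j :: nat
  have cq: "c j * (2 ^ j) powr ?e = q ^ j" for j
  proof -
    have "(2::real) powr (- real (j * m)) = inverse (2 powr real (j * m))" by (rule powr_minus)
    also have "... = inverse (2 ^ (j * m))" by (subst powr_realpow) simp_all
    also have "... = (1 / 2 ^ j) ^ m" by (simp add: power_mult power_one_over inverse_eq_divide)
    finally have "c j = 2 powr (- real (j * m) * p)" unfolding c_def by (simp only: powr_powr[symmetric])
    moreover have "((2::real) ^ j) powr ?e = 2 powr (real j * ?e)"
      by (subst powr_realpow[symmetric], simp, simp only: powr_powr)
    moreover have "q ^ j = 2 powr ((?e - real m * p) * real j)"
      by (subst powr_realpow[OF q(1), symmetric]) (simp only: q_def powr_powr)
    moreover have "- real (j * m) * p + real j * ?e = (?e - real m * p) * real j" by (simp add: algebra_simps)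
    ultimately show ?thesis by (simp only: powr_add[symmetric])
  qed
  have main: "(\<integral>\<^sup>+x. ?E (ennreal (\<kappa> * (if norm (x - y) \<le> r then (l / (l + norm (x - y))) ^ m else 0))) \<partial>wmeas \<omega>)
      \<le> ennreal (K0 / (1 - q) * \<Phi> \<kappa> * ?W (cube y l))"
    if y: "y \<in> B" and l: "0 < l" "l \<le> 1" and \<kappa>: "0 < \<kappa>" for y l \<kappa>
  proof -
    define S where "S j = ball y (2 ^ j * 2 * l) \<inter> B'" for j :: nat
    have S: "S j \<in> sets lebesgue" "bounded (S j)" for j unfolding S_def B'_def by (auto intro: bounded_Int)
    have \<Phi>0: "0 \<le> \<Phi> \<kappa>" by (rule Phi_nonneg[OF A]) (use \<kappa> in simp)
    have c0: "0 \<le> c j" for j by (simp add: c_def)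
    have pt: "?E (ennreal (\<kappa> * (if norm (x - y) \<le> r then (l / (l + norm (x - y))) ^ m else 0)))
        \<le> (\<Sum>j. ennreal (c j * \<Phi> \<kappa>) * indicator (S j) x)" for x
    proof (cases "norm (x - y) \<le> r")
      case True
      let ?s = "l + norm (x - y)"
      have s: "l \<le> ?s" "0 < ?s" using l by (auto intro: add_pos_nonneg)
      obtain k where "?s / l < 2 ^ k" using real_arch_pow[of 2 "?s / l"] by auto
      then have ex: "?s < 2 ^ Suc k * l" using l s by (simp add: field_simps)
      define j where "j = (LEAST j. ?s < 2 ^ Suc j * l)"
      have j1: "?s < 2 ^ Suc j * l" unfolding j_def by (rule LeastI[of _ k]) (rule ex)
      have j2: "2 ^ j * l \<le> ?s"
      proof (cases j)
        case 0
        then show ?thesis using s by simp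
      next
        case (Suc i)
        then have "\<not> ?s < 2 ^ Suc i * l" using not_less_Least[of i "\<lambda>j. ?s < 2 ^ Suc j * l"] by (simp add: j_def)
        then show ?thesis using Suc by simp
      qed
      have "norm (x - y) < 2 ^ j * 2 * l" using j1 l by (simp add: mult_ac)
      moreover have "norm x \<le> b + r" using True b[OF y] norm_triangle_ineq[of y "x - y"] by simp
      ultimately have xS: "x \<in> S j" by (simp add: S_def B'_def dist_norm norm_minus_commute)
      have "l / ?s \<le> 1 / 2 ^ j" using j2 l s by (simp add: field_simps)
      then have "(l / ?s) ^ m \<le> (1 / 2 ^ j) ^ m" using l s by (intro power_mono) auto
      then have "\<Phi> (\<kappa> * (l / ?s) ^ m) \<le> \<Phi> (\<kappa> * (1 / 2 ^ j) ^ m)"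
        using \<kappa> l s by (intro Phi_mono[OF A] mult_left_mono) auto
      also have "... \<le> c j * \<Phi> \<kappa>"
        unfolding c_def using \<kappa> by (intro Phi_lower_type[OF A p]) (auto intro: power_le_one)
      finally have "?E (ennreal (\<kappa> * (l / ?s) ^ m)) \<le> ennreal (c j * \<Phi> \<kappa>)"
        using \<kappa> l s by (subst extend_real[OF A]) (auto intro: ennreal_leI)
      also have "... = ennreal (c j * \<Phi> \<kappa>) * indicator (S j) x" using xS by simp
      also have "... \<le> (\<Sum>j. ennreal (c j * \<Phi> \<kappa>) * indicator (S j) x)"
      proof -
        define v where "v i = ennreal (c i * \<Phi> \<kappa>) * indicator (S i) x" for i
        have "sum v {j} \<le> suminf v" by (intro sum_le_suminf) auto
        then have "v j \<le> suminf v" by simp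
        then show ?thesis unfolding v_def .
      qed
      finally show ?thesis using True by simp
    qed (simp add: extend_zero[OF A])
    have "(\<integral>\<^sup>+x. ?E (ennreal (\<kappa> * (if norm (x - y) \<le> r then (l / (l + norm (x - y))) ^ m else 0))) \<partial>wmeas \<omega>)
        \<le> (\<integral>\<^sup>+x. (\<Sum>j. ennreal (c j * \<Phi> \<kappa>) * indicator (S j) x) \<partial>wmeas \<omega>)"
      by (intro nn_integral_mono pt)
    also have "... = (\<Sum>j. \<integral>\<^sup>+x. ennreal (c j * \<Phi> \<kappa>) * indicator (S j) x \<partial>wmeas \<omega>)"
      by (intro nn_integral_suminf borel_measurable_times_ennreal borel_measurable_indicator) (auto simp: S)
    also have "... = (\<Sum>j. ennreal (c j * \<Phi> \<kappa>) * emeasure (wmeas \<omega>) (S j))"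
      by (intro suminf_cong nn_integral_cmult_indicator) (auto simp: S)
    also have "... \<le> (\<Sum>j. ennreal (K0 * \<Phi> \<kappa> * ?W (cube y l) * q ^ j))"
    proof (rule suminf_le)
      fix j
      have "ennreal (c j * \<Phi> \<kappa>) * emeasure (wmeas \<omega>) (S j) = ennreal (c j * \<Phi> \<kappa> * ?W (S j))"
        unfolding wmeas_measure[OF w S(2)] using c0 \<Phi>0 by (simp add: ennreal_mult)
      also have "c j * \<Phi> \<kappa> * ?W (S j) \<le> c j * \<Phi> \<kappa> * (K0 * (2 ^ j) powr ?e * ?W (cube y l))"
        unfolding S_def using c0 \<Phi>0 by (intro mult_left_mono K0(2) y l mult_nonneg_nonneg)
      also have "... = K0 * \<Phi> \<kappa> * ?W (cube y l) * (c j * (2 ^ j) powr ?e)" by (simp only: mult_ac)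
      also have "... = K0 * \<Phi> \<kappa> * ?W (cube y l) * q ^ j" by (simp only: cq)
      finally show "ennreal (c j * \<Phi> \<kappa>) * emeasure (wmeas \<omega>) (S j) \<le> ennreal (K0 * \<Phi> \<kappa> * ?W (cube y l) * q ^ j)"
        using ennreal_leI by simp
    qed auto
    also have "... = ennreal (K0 * \<Phi> \<kappa> * ?W (cube y l) * (1 / (1 - q)))"
      using K0(1) \<Phi>0 q by (intro suminf_ennreal_eq sums_mult geometric_sums) auto
    also have "K0 * \<Phi> \<kappa> * ?W (cube y l) * (1 / (1 - q)) = K0 / (1 - q) * \<Phi> \<kappa> * ?W (cube y l)" by simp
    finally show ?thesis .
  qed
  show ?thesis by (rule that[of "K0 / (1 - q)"]) (use K0(1) q main in auto)
qed

context whitney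
begin

definition overlap_const :: real where
  "overlap_const = (6 * real CARD('n) + 17) * (2 * (real CARD('n) + 2) + 2) ^ CARD('n)"

definition off_F :: "(real^'n) set" where
  "off_F = cball 0 (\<rho> + 2 * real CARD('n) + 3) \<inter> {x. 0 < d x}"

lemma off_F_sets: "off_F \<in> sets lebesgue"
proof -
  have "open {x. 0 < d x}" by (intro open_Collect_less continuous_intros)
  then have "off_F \<in> sets borel" unfolding off_F_def by (intro sets.Int borel_closed borel_open) auto
  then show ?thesis by (intro sets_completionI_sets) simp
qed

lemma cell_cover:
  "(\<Sum>k. \<Sum>i\<in>cells k. indicator (cube (lattice_point (scale k) i) (scale k)) y)
    \<le> ennreal overlap_const * indicator off_F y"
proof (rule suminf_le_const)
  fix K
  let ?c = "\<lambda>k i. cball (lattice_point (scale k) i) ((real CARD('n) + 2) * scale k)"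
  have sub: "cube (lattice_point (scale k) i) (scale k) \<subseteq> ?c k i" for k and i :: "'n => int"
  proof
    fix z assume "z \<in> cube (lattice_point (scale k) i) (scale k)"
    then have "norm (z - lattice_point (scale k) i) \<le> real CARD('n) * scale k" by (rule cube_norm_le)
    also have "... \<le> (real CARD('n) + 2) * scale k" using scale(1)[of k] by (intro mult_right_mono) auto
    finally show "z \<in> ?c k i" by (simp add: dist_norm norm_minus_commute)
  qed
  show "(\<Sum>k<K. \<Sum>i\<in>cells k. indicator (cube (lattice_point (scale k) i) (scale k)) y)
      \<le> ennreal overlap_const * indicator off_F y"
  proof (cases "y \<in> off_F")
    case True
    have "(\<Sum>k<K. \<Sum>i\<in>cells k. indicator (cube (lattice_point (scale k) i) (scale k)) y)
        \<le> (\<Sum>k<K. \<Sum>i\<in>cells k. ennreal (indicator (?c k i) y))"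
    proof (intro sum_mono)
      fix k and i :: "'n => int"
      show "indicator (cube (lattice_point (scale k) i) (scale k)) y \<le> ennreal (indicator (?c k i) y)"
        using subsetD[OF sub[of k i], of y] by (auto simp: indicator_def)
    qed
    also have "... = ennreal (\<Sum>k<K. \<Sum>i\<in>cells k. indicator (?c k i) y)"
      by (simp add: sum_ennreal sum_nonneg)
    also have "... \<le> ennreal overlap_const" unfolding overlap_const_def by (intro ennreal_leI ring_overlap)
    finally show ?thesis using True by simp
  next
    case False
    have "indicator (cube (lattice_point (scale k) i) (scale k)) y = (0::ennreal)"
      if i: "i \<in> cells k" for k i
    proof (rule ccontr)
      assume "\<not> ?thesis"
      then have "y \<in> cube (lattice_point (scale k) i) (scale k)" by (auto simp: indicator_def split: if_splits)
      then have "y \<in> ?c k i" using sub by blast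
      then have "y \<in> off_F"
        using cell_norm_le[OF i scale(1) less_imp_le[OF scale(2)]] ring_cell_dist(1)[OF i, of y] scale(1)[of k]
        by (simp add: off_F_def)
      then show False using False by simp
    qed
    then show ?thesis by simp
  qed
qed auto

lemma tail_kernel_measurable: "(\<lambda>x. tail_kernel k i x) \<in> borel_measurable lebesgue"
  unfolding tail_kernel_def by (rule borel_measurable_lebesgueI) measurable

lemma extend_tail_measurable:
  assumes A: "assumption_A \<Phi>"
  shows "(\<lambda>x. extend_Phi \<Phi> (ennreal (\<kappa> * tail_kernel k i x))) \<in> borel_measurable lebesgue"
proof -
  have "(\<lambda>x. \<kappa> * tail_kernel k i x) \<in> borel_measurable lebesgue"
    by (intro borel_measurable_times borel_measurable_const tail_kernel_measurable)
  from measurable_compose[OF measurable_compose[OF this measurable_ennreal] extend_measurable[OF A]]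
  show ?thesis .
qed

definition tail_bound :: "(real => real) => real^'n => ennreal" where
  "tail_bound \<Phi> x = (\<Sum>k. \<Sum>i\<in>cells k. extend_Phi \<Phi> (ennreal (\<kappa> * tail_kernel k i x)))"

lemma tail_bound_measurable: "assumption_A \<Phi> ==> tail_bound \<Phi> \<in> borel_measurable lebesgue"
  unfolding tail_bound_def[abs_def]
  by (intro borel_measurable_suminf_order borel_measurable_sum extend_tail_measurable)

lemma extend_tail:
  assumes A: "assumption_A \<Phi>"
  shows "extend_Phi \<Phi> (ennreal \<kappa> * tail x) \<le> tail_bound \<Phi> x"
proof -
  have "ennreal \<kappa> * tail x = (\<Sum>k. \<Sum>i\<in>cells k. ennreal (\<kappa> * tail_kernel k i x))"
    unfolding tail_def ennreal_suminf_cmult[symmetric]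
    by (simp only: sum_distrib_left ennreal_mult[OF less_imp_le[OF \<kappa>] tail_kernel_nonneg])
  then have "extend_Phi \<Phi> (ennreal \<kappa> * tail x) \<le>
      (\<Sum>k. extend_Phi \<Phi> (\<Sum>i\<in>cells k. ennreal (\<kappa> * tail_kernel k i x)))"
    using extend_suminf[OF A] by simp
  also have "... \<le> tail_bound \<Phi> x" unfolding tail_bound_def by (intro suminf_le extend_sum[OF A]) auto
  finally show ?thesis .
qed

lemma tail_bound_integral:
  assumes A: "assumption_A \<Phi>" and w: "\<omega> \<in> weights" and K: "0 \<le> K"
    and cell: "\<And>k i. i \<in> cells k ==>
      (\<integral>\<^sup>+x. extend_Phi \<Phi> (ennreal (\<kappa> * tail_kernel k i x)) \<partial>wmeas \<omega>)
        \<le> ennreal (K * \<Phi> \<kappa> * measure (wmeas \<omega>) (cube (lattice_point (scale k) i) (scale k)))"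
  shows "(\<integral>\<^sup>+x. tail_bound \<Phi> x \<partial>wmeas \<omega>) \<le> ennreal (K * overlap_const) * (ennreal (\<Phi> \<kappa>) * emeasure (wmeas \<omega>) off_F)"
proof -
  let ?q = "\<lambda>k i. cube (lattice_point (scale k) i) (scale k)"
  let ?a = "\<lambda>k. cells k"
  have \<Phi>0: "0 \<le> \<Phi> \<kappa>" by (rule Phi_nonneg[OF A]) (use \<kappa> in simp)
  have o0: "0 \<le> overlap_const" by (simp add: overlap_const_def)
  have m: "(\<lambda>x. extend_Phi \<Phi> (ennreal (\<kappa> * tail_kernel k i x))) \<in> borel_measurable (wmeas \<omega>)" for k i
    unfolding wmeas_measurable by (rule extend_tail_measurable[OF A])
  have q: "?q k i \<in> sets (wmeas \<omega>)" for k i by simp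
  have qm: "(indicator (?q k i) :: _ => ennreal) \<in> borel_measurable (wmeas \<omega>)" for k i
    by (intro borel_measurable_indicator q)
  have qi: "(\<integral>\<^sup>+x. indicator (?q k i) x \<partial>wmeas \<omega>) = emeasure (wmeas \<omega>) (?q k i)" for k i
    by (rule nn_integral_indicator[OF q])
  have "(\<integral>\<^sup>+x. tail_bound \<Phi> x \<partial>wmeas \<omega>) = (\<Sum>k. \<Sum>i\<in>?a k. \<integral>\<^sup>+x. extend_Phi \<Phi> (ennreal (\<kappa> * tail_kernel k i x)) \<partial>wmeas \<omega>)"
    unfolding tail_bound_def using m
    by (subst nn_integral_suminf) (auto intro!: borel_measurable_sum suminf_cong nn_integral_sum)
  also have "... \<le> (\<Sum>k. \<Sum>i\<in>?a k. ennreal (K * \<Phi> \<kappa>) * emeasure (wmeas \<omega>) (?q k i))"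
  proof (intro suminf_le sum_mono)
    fix k i assume "i \<in> ?a k"
    from cell[OF this] show "(\<integral>\<^sup>+x. extend_Phi \<Phi> (ennreal (\<kappa> * tail_kernel k i x)) \<partial>wmeas \<omega>) \<le> ennreal (K * \<Phi> \<kappa>) * emeasure (wmeas \<omega>) (?q k i)"
      unfolding wmeas_measure[OF w cube_bounded] using K \<Phi>0 by (simp add: ennreal_mult)
  qed auto
  also have "... = ennreal (K * \<Phi> \<kappa>) * (\<Sum>k. \<Sum>i\<in>?a k. emeasure (wmeas \<omega>) (?q k i))"
    by (simp only: sum_distrib_left[symmetric] ennreal_suminf_cmult)
  also have "(\<Sum>k. \<Sum>i\<in>?a k. emeasure (wmeas \<omega>) (?q k i)) = (\<integral>\<^sup>+x. (\<Sum>k. \<Sum>i\<in>?a k. indicator (?q k i) x) \<partial>wmeas \<omega>)"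
  proof -
    have "(\<Sum>i\<in>?a k. emeasure (wmeas \<omega>) (?q k i)) = (\<integral>\<^sup>+x. (\<Sum>i\<in>?a k. indicator (?q k i) x) \<partial>wmeas \<omega>)" for k
      unfolding qi[symmetric] by (rule nn_integral_sum[OF qm, symmetric])
    then show ?thesis by (simp only: nn_integral_suminf[OF borel_measurable_sum[OF qm], symmetric])
  qed
  also have "... \<le> (\<integral>\<^sup>+x. ennreal overlap_const * indicator off_F x \<partial>wmeas \<omega>)"
    by (intro nn_integral_mono cell_cover)
  also have "... = ennreal overlap_const * emeasure (wmeas \<omega>) off_F"
    by (rule nn_integral_cmult_indicator) (simp add: off_F_sets)
  finally have "(\<integral>\<^sup>+x. tail_bound \<Phi> x \<partial>wmeas \<omega>) \<le> ennreal (K * \<Phi> \<kappa>) * (ennreal overlap_const * emeasure (wmeas \<omega>) off_F)"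
    by (simp add: mult_left_mono)
  also have "... = ennreal (K * overlap_const) * (ennreal (\<Phi> \<kappa>) * emeasure (wmeas \<omega>) off_F)"
    using K \<Phi>0 o0 by (simp add: ennreal_mult mult_ac)
  finally show ?thesis .
qed

definition bad_bound :: "(real => real) => real^'n => ennreal" where
  "bad_bound \<Phi> x = ennreal (2 ^ N * Cs + 1) * (extend_Phi \<Phi> (\<Gamma> x) * indicator {x. ennreal \<kappa> < \<Gamma> x} x) +
     ennreal (tail_const + 1) * tail_bound \<Phi> x"

lemma extend_bad:
  assumes A: "assumption_A \<Phi>" and Feq: "F = {x. \<Gamma> x \<le> ennreal \<kappa>}"
  shows "extend_Phi \<Phi> (grand_maximal N (\<lambda>h. if h \<in> test_functions then f h - good h else 0) x) \<le> bad_bound \<Phi> x"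
proof -
  let ?E = "extend_Phi \<Phi>"
  have "?E (grand_maximal N (\<lambda>h. if h \<in> test_functions then f h - good h else 0) x) \<le>
      ?E (ennreal (2 ^ N * Cs) * (if d x = 0 then 0 else \<Gamma> x) + ennreal (\<kappa> * tail_const) * tail x)"
    by (intro extend_mono[OF A] grand_maximal_bad)
  also have "... \<le> ?E (ennreal (2 ^ N * Cs) * (if d x = 0 then 0 else \<Gamma> x)) + ?E (ennreal tail_const * (ennreal \<kappa> * tail x))"
    using extend_add[OF A] \<kappa> tail_const_nonneg by (simp add: ennreal_mult mult_ac)
  also have "... \<le> ennreal (2 ^ N * Cs + 1) * ?E (if d x = 0 then 0 else \<Gamma> x) + ennreal (tail_const + 1) * ?E (ennreal \<kappa> * tail x)"
    using Cs(1) tail_const_nonneg by (intro add_mono extend_mult[OF A]) auto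
  also have "... \<le> bad_bound \<Phi> x" unfolding bad_bound_def
  proof (intro add_mono mult_left_mono extend_tail[OF A])
    show "?E (if d x = 0 then 0 else \<Gamma> x) \<le> ?E (\<Gamma> x) * indicator {x. ennreal \<kappa> < \<Gamma> x} x"
    proof (cases "d x = 0")
      case False
      then have "x \<notin> F" by auto
      then have "ennreal \<kappa> < \<Gamma> x" using Feq by (simp add: not_le)
      then show ?thesis using False by simp
    qed (simp add: extend_zero[OF A])
  qed auto
  finally show ?thesis .
qed

lemma bad_bound_measurable:
  assumes A: "assumption_A \<Phi>" and \<Gamma>: "\<Gamma> \<in> borel_measurable lebesgue"
  shows "bad_bound \<Phi> \<in> borel_measurable lebesgue"
proof -
  have s: "{x. ennreal \<kappa> < \<Gamma> x} \<in> sets lebesgue" by (rule superlevel_sets[OF \<Gamma>])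
  have e: "(\<lambda>x. extend_Phi \<Phi> (\<Gamma> x)) \<in> borel_measurable lebesgue"
    by (rule measurable_compose[OF \<Gamma> extend_measurable[OF A]])
  show ?thesis unfolding bad_bound_def[abs_def]
    by (intro borel_measurable_add borel_measurable_times_ennreal borel_measurable_const borel_measurable_indicator s e
        tail_bound_measurable[OF A])
qed

text \<open>Off \<open>F\<close> the function \<open>\<Gamma>\<close> exceeds the level, so the cells, which lie off \<open>F\<close> and overlap
  boundedly, are paid for by the part of the modular where \<open>\<Gamma>\<close> is large.\<close>

lemma bad_bound_integral:
  assumes A: "assumption_A \<Phi>" and w: "\<omega> \<in> weights" and K: "0 \<le> K" and \<Gamma>: "\<Gamma> \<in> borel_measurable lebesgue"
    and Feq: "F = {x. \<Gamma> x \<le> ennreal \<kappa>}"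
    and cell: "\<And>k i. i \<in> cells k ==>
      (\<integral>\<^sup>+x. extend_Phi \<Phi> (ennreal (\<kappa> * tail_kernel k i x)) \<partial>wmeas \<omega>)
        \<le> ennreal (K * \<Phi> \<kappa> * measure (wmeas \<omega>) (cube (lattice_point (scale k) i) (scale k)))"
  shows "(\<integral>\<^sup>+x. bad_bound \<Phi> x \<partial>wmeas \<omega>) \<le>
    (ennreal (2 ^ N * Cs + 1) + ennreal (tail_const + 1) * ennreal (K * overlap_const)) *
    (\<integral>\<^sup>+x. extend_Phi \<Phi> (\<Gamma> x) * indicator {x. ennreal \<kappa> < \<Gamma> x} x \<partial>wmeas \<omega>)"
proof -
  let ?E = "extend_Phi \<Phi>" and ?G = "{x. ennreal \<kappa> < \<Gamma> x}"
  let ?I = "\<integral>\<^sup>+x. ?E (\<Gamma> x) * indicator ?G x \<partial>wmeas \<omega>"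
  have s: "?G \<in> sets lebesgue" by (rule superlevel_sets[OF \<Gamma>])
  have e: "(\<lambda>x. ?E (\<Gamma> x)) \<in> borel_measurable lebesgue"
    by (rule measurable_compose[OF \<Gamma> extend_measurable[OF A]])
  have m1: "(\<lambda>x. ?E (\<Gamma> x) * indicator ?G x) \<in> borel_measurable (wmeas \<omega>)"
    unfolding wmeas_measurable by (intro borel_measurable_times_ennreal borel_measurable_indicator s e)
  have m2: "tail_bound \<Phi> \<in> borel_measurable (wmeas \<omega>)"
    unfolding wmeas_measurable by (rule tail_bound_measurable[OF A])
  have "ennreal (\<Phi> \<kappa>) * emeasure (wmeas \<omega>) off_F = (\<integral>\<^sup>+x. ennreal (\<Phi> \<kappa>) * indicator off_F x \<partial>wmeas \<omega>)"
    by (rule nn_integral_cmult_indicator[symmetric]) (simp add: off_F_sets)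
  also have "... \<le> ?I"
  proof (rule nn_integral_mono)
    fix x
    show "ennreal (\<Phi> \<kappa>) * indicator off_F x \<le> ?E (\<Gamma> x) * indicator ?G x"
    proof (cases "x \<in> off_F")
      case True
      then have "0 < d x" by (simp add: off_F_def)
      then have "x \<notin> F" by auto
      then have g: "ennreal \<kappa> < \<Gamma> x" using Feq by (simp add: not_le)
      have "ennreal (\<Phi> \<kappa>) = ?E (ennreal \<kappa>)" using \<kappa> by (intro extend_real[OF A, symmetric]) simp
      also have "... \<le> ?E (\<Gamma> x)" by (rule extend_mono[OF A less_imp_le[OF g]])
      finally show ?thesis using True g by simp
    qed simp
  qed
  finally have off: "ennreal (\<Phi> \<kappa>) * emeasure (wmeas \<omega>) off_F \<le> ?I" .
  have "(\<integral>\<^sup>+x. bad_bound \<Phi> x \<partial>wmeas \<omega>) = ennreal (2 ^ N * Cs + 1) * ?I + ennreal (tail_const + 1) * (\<integral>\<^sup>+x. tail_bound \<Phi> x \<partial>wmeas \<omega>)"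
    unfolding bad_bound_def
    by (simp only: nn_integral_add[OF borel_measurable_times_ennreal[OF borel_measurable_const m1]
          borel_measurable_times_ennreal[OF borel_measurable_const m2]] nn_integral_cmult[OF m1] nn_integral_cmult[OF m2])
  also have "... \<le> ennreal (2 ^ N * Cs + 1) * ?I + ennreal (tail_const + 1) * (ennreal (K * overlap_const) * ?I)"
    by (intro add_left_mono mult_left_mono order_trans[OF tail_bound_integral[OF A w K cell]] off) auto
  also have "... = (ennreal (2 ^ N * Cs + 1) + ennreal (tail_const + 1) * ennreal (K * overlap_const)) * ?I"
    by (simp only: distrib_right mult.assoc)
  finally show ?thesis .
qed

end

section \<open>Bounded functions with bounded support\<close>

text \<open>The error need not be known to be measurable: a measurable majorant of its image under the Orlicz
function is enough.\<close>

lemma LPhi_norm_less: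
  fixes \<omega> :: "real^'n => real"
  assumes A: "assumption_A \<Phi>" and w: "\<omega> \<in> weights" and e: "0 < e"
    and u: "u \<in> borel_measurable lebesgue" "\<And>x. extend_Phi \<Phi> (g x) \<le> u x"
    and small: "(\<integral>\<^sup>+x. u x \<partial>wmeas \<omega>) \<le> ennreal (1 / (2 / e + 1))"
  shows "LPhi_norm \<Phi> \<omega> g < ennreal e"
proof -
  define c where "c = e / 2"
  have c: "0 < c" "c < e" using e by (auto simp: c_def)
  have m: "(\<lambda>x. ennreal (1 / c + 1) * u x) \<in> borel_measurable lebesgue"
    by (intro borel_measurable_times_ennreal borel_measurable_const u(1))
  have "extend_Phi \<Phi> (g x / ennreal c) \<le> ennreal (1 / c + 1) * u x" for x
  proof -
    have "g x / ennreal c = ennreal (1 / c) * g x"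
      using c by (simp add: divide_ennreal_def inverse_ennreal inverse_eq_divide mult.commute)
    then have "extend_Phi \<Phi> (g x / ennreal c) \<le> ennreal (1 / c + 1) * extend_Phi \<Phi> (g x)"
      using extend_mult[OF A, of "1 / c" "g x"] c by simp
    also have "... \<le> ennreal (1 / c + 1) * u x" by (intro mult_left_mono u(2)) auto
    finally show ?thesis .
  qed
  then have "modular \<Phi> \<omega> (\<lambda>x. g x / ennreal c) \<le> (\<integral>\<^sup>+x. ennreal (1 / c + 1) * u x \<partial>wmeas \<omega>)"
    by (rule modular_le[OF w m])
  also have "... = ennreal (1 / c + 1) * (\<integral>\<^sup>+x. u x \<partial>wmeas \<omega>)"
    by (rule nn_integral_cmult) (simp add: wmeas_measurable u(1))
  also have "... \<le> ennreal (1 / c + 1) * ennreal (1 / (2 / e + 1))" by (intro mult_left_mono small) auto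
  also have "... = ennreal ((1 / c + 1) * (1 / (2 / e + 1)))" using c e by (intro ennreal_mult[symmetric]) auto
  also have "(1 / c + 1) * (1 / (2 / e + 1)) = 1"
  proof -
    have "1 / c + 1 = 2 / e + 1" by (simp add: c_def)
    moreover have "0 < 2 / e + 1" using e by (simp add: add_pos_pos)
    ultimately show ?thesis by simp
  qed
  finally have "modular \<Phi> \<omega> (\<lambda>x. g x / ennreal c) \<le> 1" by simp
  then have "LPhi_norm \<Phi> \<omega> g \<le> ennreal c"
    unfolding LPhi_norm_def using c by (intro Inf_lower) auto
  also have "... < ennreal e" using c by (simp add: ennreal_less_iff)
  finally show ?thesis .
qed

lemma grand_maximal_add: "grand_maximal N (\<lambda>\<phi>. a \<phi> + b \<phi>) x \<le> grand_maximal N a x + grand_maximal N b x"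
proof -
  have "ennreal (norm (convolve (dilate t \<psi>) (\<lambda>\<phi>. a \<phi> + b \<phi>) x)) \<le> grand_maximal N a x + grand_maximal N b x"
    if t: "t \<in> {0<..<1}" and \<psi>: "\<psi> \<in> grand_test_functions N" for t \<psi>
  proof -
    have "ennreal (norm (convolve (dilate t \<psi>) (\<lambda>\<phi>. a \<phi> + b \<phi>) x)) \<le>
        ennreal (norm (convolve (dilate t \<psi>) a x) + norm (convolve (dilate t \<psi>) b x))"
      unfolding convolve_def by (intro ennreal_leI norm_triangle_ineq)
    also have "... = ennreal (norm (convolve (dilate t \<psi>) a x)) + ennreal (norm (convolve (dilate t \<psi>) b x))"
      by (intro ennreal_plus) auto
    also have "... \<le> grand_maximal N a x + grand_maximal N b x" unfolding grand_maximal_def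
      by (intro add_mono; intro SUP_upper2[OF t] SUP_upper2[OF \<psi>] order_refl)
    finally show ?thesis .
  qed
  then show ?thesis unfolding grand_maximal_def[of N "\<lambda>\<phi>. a \<phi> + b \<phi>"] by (intro SUP_least)
qed

context
  fixes v :: "real^'n => complex" and M r :: real
  assumes vm: "v \<in> borel_measurable lebesgue" and vb: "\<And>x. norm (v x) \<le> M"
    and vs: "\<And>x. x \<notin> cball 0 r ==> v x = 0"
begin

lemma M_nonneg: "0 \<le> M" by (rule order_trans[OF norm_ge_zero vb])

lemma cball_integrable: "integrable lebesgue (\<lambda>x. M * indicator (cball (0 :: real^'n) r) x)"
  by (intro integrable_mult_right) (use lmeasurable_cball[of "0 :: real^'n" r] in \<open>simp add: lmeasurable_iff_integrable\<close>)

lemma bounded_le_indicator: "norm (v x) \<le> M * indicator (cball 0 r) x"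
  using vb[of x] vs[of x] by (cases "x \<in> cball 0 r") (auto simp del: mem_cball_0)

lemma bounded_integrable: "integrable lebesgue v"
proof (rule Bochner_Integration.integrable_bound[OF cball_integrable vm])
  show "AE x in lebesgue. norm (v x) \<le> norm (M * indicator (cball 0 r) x)"
    using bounded_le_indicator by (intro AE_I2) (simp add: order_trans[OF _ abs_ge_self])
qed

lemma bounded_mult_integrable: "h \<in> test_functions ==> integrable lebesgue (\<lambda>x. v x * h x)"
  using integrable_test_mult[OF _ bounded_integrable, of h] by (simp add: mult.commute)

lemma bounded_locally_integrable: "locally_integrable v" unfolding locally_integrable_def set_integrable_def
proof (intro conjI vm allI impI)
  fix K :: "(real^'n) set" assume "compact K"
  then have "K \<in> sets lebesgue" by (intro sets_completionI_sets) (simp add: borel_compact)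
  then show "integrable lebesgue (\<lambda>x. indicator K x *\<^sub>R v x)"
    by (rule integrable_mult_indicator[OF _ bounded_integrable])
qed

lemma bounded_distribution: "distribution_of v \<in> distributions" unfolding distributions_def mem_Collect_eq
proof (intro conjI allI ballI impI)
  show "distribution_of v \<phi> = 0" if "\<phi> \<notin> test_functions" for \<phi> using that by (simp add: distribution_of_def)
  show "distribution_of v (\<lambda>x. \<phi> x + \<psi> x) = distribution_of v \<phi> + distribution_of v \<psi>"
    if "\<phi> \<in> test_functions" "\<psi> \<in> test_functions" for \<phi> \<psi>
    using that test_add[OF that] Bochner_Integration.integral_add[OF bounded_mult_integrable[OF that(1)] bounded_mult_integrable[OF that(2)]]
    by (simp add: distribution_of_def distrib_left)
  show "distribution_of v (\<lambda>x. c * \<phi> x) = c * distribution_of v \<phi>" if "\<phi> \<in> test_functions" for \<phi> c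
    using that test_cmult[OF that, of c] integral_mult_right_zero[of lebesgue c "\<lambda>x. v x * \<phi> x"]
    by (simp add: distribution_of_def mult.left_commute)
  fix K :: "(real^'n) set"
  define V where "V = (LINT x|lebesgue. M * indicator (cball (0 :: real^'n) r) x)"
  have V0: "0 \<le> V" unfolding V_def using M_nonneg by (intro Bochner_Integration.integral_nonneg) simp
  show "\<exists>(C::real) k. \<forall>\<phi>\<in>test_functions. supp \<phi> \<subseteq> K --> ennreal (norm (distribution_of v \<phi>)) \<le> ennreal C * Ck_norm k \<phi>"
  proof (intro exI[of _ "V + 1"] exI[of _ 0] ballI impI)
    fix \<phi> :: "real^'n => complex" assume \<phi>: "\<phi> \<in> test_functions"
    have sup: "ennreal (norm (\<phi> x)) \<le> Ck_norm 0 \<phi>" for x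
      unfolding Ck_norm_def by (intro SUP_upper2[of x] SUP_upper2[of "[]"]) auto
    show "ennreal (norm (distribution_of v \<phi>)) \<le> ennreal (V + 1) * Ck_norm 0 \<phi>"
    proof (cases "Ck_norm 0 \<phi>")
      case (real b)
      have b: "norm (\<phi> x) \<le> b" for x using sup[of x] real by simp
      have "norm (LINT x|lebesgue. v x * \<phi> x) \<le> (LINT x|lebesgue. norm (v x * \<phi> x))" by (rule integral_norm_bound)
      also have "... \<le> (LINT x|lebesgue. b * (M * indicator (cball (0 :: real^'n) r) x))"
      proof (rule integral_mono[OF integrable_norm[OF bounded_mult_integrable[OF \<phi>]] integrable_mult_right[OF cball_integrable]])
        fix x :: "real^'n"
        show "norm (v x * \<phi> x) \<le> b * (M * indicator (cball 0 r) x)"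
          unfolding norm_mult using mult_mono[OF b[of x] bounded_le_indicator[of x]] real by (simp add: mult.commute)
      qed
      also have "... = b * V" unfolding V_def by (rule integral_mult_right_zero)
      also have "... \<le> (V + 1) * b" using real by (simp add: algebra_simps)
      finally have "norm (distribution_of v \<phi>) \<le> (V + 1) * b" using \<phi> by (simp add: distribution_of_def)
      then have "ennreal (norm (distribution_of v \<phi>)) \<le> ennreal ((V + 1) * b)" by (rule ennreal_leI)
      also have "... = ennreal (V + 1) * ennreal b" using real V0 by (intro ennreal_mult) auto
      finally show ?thesis using real by (simp only:)
    next
      case top
      have "ennreal (V + 1) \<noteq> 0" using V0 by (simp only: ennreal_eq_0_iff)
      then show ?thesis using top by (simp add: ennreal_mult_top del: ennreal_plus)
    qed
  qed
qed

lemma bounded_convolve: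
  assumes \<psi>: "\<psi> \<in> grand_test_functions N" and t: "0 < t"
  shows "convolve (dilate t \<psi>) (distribution_of v) x = cv (dilate t \<psi>) v x" "dilate t \<psi> \<in> test_functions"
proof -
  have k: "(\<lambda>y. dilate t \<psi> (x - y)) \<in> test_functions" for x :: "real^'n" by (rule grand_test_kernel(1)[OF \<psi> t])
  show "convolve (dilate t \<psi>) (distribution_of v) x = cv (dilate t \<psi>) v x"
    using k by (simp add: convolve_def distribution_of_def cv_def mult.commute)
  have "(\<lambda>y. (\<lambda>y. dilate t \<psi> (0 - y)) (0 + (-1) *\<^sub>R y)) \<in> test_functions" by (rule test_affine[OF k]) simp
  then show "dilate t \<psi> \<in> test_functions" by simp
qed

lemma bounded_grand_maximal_measurable: "grand_maximal N (distribution_of v) \<in> borel_measurable lebesgue"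
proof (rule borel_measurable_lebesgueI, rule borel_measurableI_greater)
  fix a :: ennreal
  let ?c = "\<lambda>t \<psi> x. ennreal (norm (convolve (dilate t \<psi>) (distribution_of v) x))"
  have "{x. a < grand_maximal N (distribution_of v) x} = (\<Union>t\<in>{0<..<1}. \<Union>\<psi>\<in>grand_test_functions N. {x. a < ?c t \<psi> x})"
    unfolding grand_maximal_def less_SUP_iff by auto
  also have "open ..."
  proof (intro open_UN ballI)
    fix t :: real and \<psi> :: "real^'n => complex" assume t: "t \<in> {0<..<1}" and \<psi>: "\<psi> \<in> grand_test_functions N"
    then have t0: "0 < t" by simp
    have eq: "?c t \<psi> = (\<lambda>x. ennreal (norm (cv (dilate t \<psi>) v x)))"
      by (simp only: bounded_convolve(1)[OF \<psi> t0])
    have "continuous_on UNIV (cv (dilate t \<psi>) v)"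
      by (intro smooth_continuous_on smooth_cv bounded_convolve(2)[OF \<psi> t0] bounded_integrable)
    then have "continuous_on UNIV (?c t \<psi>)" unfolding eq by (intro continuous_on_ennreal continuous_on_norm)
    then show "open {x. a < ?c t \<psi> x}" by (intro open_Collect_less continuous_on_const)
  qed
  finally show "{x \<in> space borel. a < grand_maximal N (distribution_of v) x} \<in> sets borel" by (simp add: borel_open)
qed

lemma bounded_grand_maximal_le:
  "grand_maximal N (distribution_of v) x \<le>
    ennreal (M * (2 * support_radius TYPE('n)) ^ CARD('n)) * indicator (cball 0 (r + support_radius TYPE('n))) x"
  unfolding grand_maximal_def
proof (intro SUP_least)
  fix t :: real and \<psi> :: "real^'n => complex" assume t: "t \<in> {0<..<1}" and \<psi>: "\<psi> \<in> grand_test_functions N"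
  then have t0: "0 < t" "t < 1" by auto
  let ?R = "support_radius TYPE('n)"
  define h where "h y = dilate t \<psi> (x - y)" for y
  have h: "h \<in> test_functions" "supp h \<subseteq> ball x (?R * t)" "(LINT y|lebesgue. norm (h y)) \<le> (2 * ?R) ^ CARD('n)"
    unfolding h_def by (rule grand_test_kernel[OF \<psi> t0(1)])+
  have eq: "convolve (dilate t \<psi>) (distribution_of v) x = (LINT y|lebesgue. v y * h y)"
    using h(1) unfolding convolve_def h_def[abs_def, symmetric] by (simp add: distribution_of_def)
  show "ennreal (norm (convolve (dilate t \<psi>) (distribution_of v) x)) \<le>
      ennreal (M * (2 * ?R) ^ CARD('n)) * indicator (cball 0 (r + ?R)) x"
  proof (cases "x \<in> cball 0 (r + ?R)")
    case True
    have "norm (LINT y|lebesgue. v y * h y) \<le> (LINT y|lebesgue. norm (v y * h y))" by (rule integral_norm_bound)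
    also have "... \<le> (LINT y|lebesgue. M * norm (h y))"
      using vb by (intro integral_mono integrable_norm bounded_mult_integrable h(1) integrable_mult_right test_integrable)
        (auto simp: norm_mult intro: mult_right_mono)
    also have "... = M * (LINT y|lebesgue. norm (h y))" by (rule integral_mult_right_zero)
    also have "... \<le> M * (2 * ?R) ^ CARD('n)" by (intro mult_left_mono h(3) M_nonneg)
    finally show ?thesis unfolding eq using True by (simp add: ennreal_leI del: mem_cball_0)
  next
    case False
    have "v y * h y = 0" for y
    proof (rule ccontr)
      assume ne: "v y * h y \<noteq> 0"
      then have "y \<in> supp h" by (intro supp_memI) auto
      then have "y \<in> ball x (?R * t)" using h(2) by (rule set_rev_mp)
      then have "norm (x - y) < ?R * t" by (simp add: dist_norm)
      also have "... \<le> ?R * 1" using t0 by (intro mult_left_mono) auto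
      finally have "norm (x - y) < ?R" by (simp only: mult_1_right)
      moreover have "norm y \<le> r" using ne vs[of y] by fastforce
      moreover have "norm x \<le> norm y + norm (x - y)" using norm_triangle_ineq[of y "x - y"] by simp
      ultimately have "norm x \<le> r + ?R" by linarith
      then show False using False by simp
    qed
    then have "(\<lambda>y. v y * h y) = (\<lambda>y. 0)" by (rule ext)
    then have "(LINT y|lebesgue. v y * h y) = 0" by (simp only: integral_zero)
    then show ?thesis unfolding eq by simp
  qed
qed

text \<open>The grand maximal function is lower semicontinuous as a supremum of continuous functions, bounded
since kernels have bounded integrals, and supported in a ball since kernels are.\<close>

lemma bounded_in_hardy_Lq:
  fixes \<omega> :: "real^'n => real"
  assumes A: "assumption_A \<Phi>" and w: "\<omega> \<in> weights" and q: "0 < q"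
  shows "distribution_of v \<in> hardy \<Phi> \<omega> N \<inter> Lq_distributions q \<omega>"
proof
  let ?B = "cball (0 :: real^'n) (r + support_radius TYPE('n))"
  define b where "b = M * (2 * support_radius TYPE('n)) ^ CARD('n)"
  have b0: "0 \<le> b" unfolding b_def using M_nonneg by (intro mult_nonneg_nonneg) auto
  have "modular \<Phi> \<omega> (grand_maximal N (distribution_of v)) \<le> (\<integral>\<^sup>+x. ennreal (\<Phi> b) * indicator ?B x \<partial>wmeas \<omega>)"
  proof (rule modular_le[OF w])
    show "(\<lambda>x. ennreal (\<Phi> b) * indicator ?B x) \<in> borel_measurable lebesgue"
      by (intro borel_measurable_times_ennreal borel_measurable_const borel_measurable_indicator) auto
    fix x
    have "extend_Phi \<Phi> (grand_maximal N (distribution_of v) x) \<le> extend_Phi \<Phi> (ennreal b * indicator ?B x)"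
      unfolding b_def by (intro extend_mono[OF A] bounded_grand_maximal_le)
    also have "... = ennreal (\<Phi> b) * indicator ?B x"
      by (cases "x \<in> ?B") (simp_all add: extend_real[OF A b0] extend_zero[OF A] del: mem_cball_0)
    finally show "extend_Phi \<Phi> (grand_maximal N (distribution_of v) x) \<le> ennreal (\<Phi> b) * indicator ?B x" .
  qed
  also have "... = ennreal (\<Phi> b) * emeasure (wmeas \<omega>) ?B" by (rule nn_integral_cmult_indicator) simp
  also have "... < top" using wmeas_finite[OF w, of ?B] by (simp add: ennreal_mult_less_top)
  finally show "distribution_of v \<in> hardy \<Phi> \<omega> N"
    by (simp add: hardy_def LPhi_def bounded_distribution bounded_grand_maximal_measurable)
  have "(\<integral>\<^sup>+x. ennreal (norm (v x) powr q * \<omega> x) \<partial>lebesgue) \<le> (\<integral>\<^sup>+x. (ennreal (M powr q) * indicator (cball 0 r) x) * ennreal (\<omega> x) \<partial>lebesgue)"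
  proof (rule nn_integral_mono)
    fix x
    show "ennreal (norm (v x) powr q * \<omega> x) \<le> (ennreal (M powr q) * indicator (cball 0 r) x) * ennreal (\<omega> x)"
    proof (cases "x \<in> cball 0 r")
      case True
      have "norm (v x) powr q * \<omega> x \<le> M powr q * \<omega> x"
        using vb[of x] q weight_nonneg[OF w, of x] by (intro mult_right_mono powr_mono2) auto
      then show ?thesis using True weight_nonneg[OF w, of x] by (simp add: ennreal_leI del: mem_cball_0 flip: ennreal_mult)
    next
      case False
      then show ?thesis using vs[OF False] q by simp
    qed
  qed
  also have "... = (\<integral>\<^sup>+x. ennreal (M powr q) * indicator (cball 0 r) x \<partial>wmeas \<omega>)"
    by (rule wmeas_integral[OF w, symmetric])
       (intro borel_measurable_times_ennreal borel_measurable_const borel_measurable_indicator, auto)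
  also have "... = ennreal (M powr q) * emeasure (wmeas \<omega>) (cball 0 r)" by (rule nn_integral_cmult_indicator) simp
  also have "... < top" using wmeas_finite[OF w, of "cball 0 r"] by (simp add: ennreal_mult_less_top)
  finally have "v \<in> Lq_weighted q \<omega>" by (simp add: Lq_weighted_def vm)
  then show "distribution_of v \<in> Lq_distributions q \<omega>"
    unfolding Lq_distributions_def using bounded_locally_integrable by (intro CollectI exI[of _ v]) simp
qed

end

section \<open>Cutting off at infinity\<close>

lemma vanishing_tail:
  fixes u :: "'a => ennreal"
  assumes u: "u \<in> borel_measurable M" "(\<integral>\<^sup>+x. u x \<partial>M) < top" and S: "\<And>k. S k \<in> sets M"
    and van: "AE x in M. \<exists>k\<^sub>0. \<forall>k\<ge>k\<^sub>0. x \<notin> S k" and e: "0 < e"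
  obtains k :: nat where "(\<integral>\<^sup>+x. u x * indicator (S k) x \<partial>M) < e"
proof -
  have "(\<lambda>k. \<integral>\<^sup>+x. u x * indicator (S k) x \<partial>M) \<longlonglongrightarrow> (\<integral>\<^sup>+x. 0 \<partial>M)"
  proof (rule nn_integral_dominated_convergence[where w = u])
    show "(\<lambda>x. u x * indicator (S k) x) \<in> borel_measurable M" for k
      by (intro borel_measurable_times_ennreal borel_measurable_indicator u S)
    show "AE x in M. u x * indicator (S k) x \<le> u x" for k by (intro AE_I2) (auto simp: indicator_def)
    show "AE x in M. (\<lambda>k. u x * indicator (S k) x) \<longlonglongrightarrow> 0" using van
    proof (rule AE_mp, intro AE_I2 impI)
      fix x assume "\<exists>k\<^sub>0. \<forall>k\<ge>k\<^sub>0. x \<notin> S k"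
      then have "\<forall>\<^sub>F k in sequentially. u x * indicator (S k) x = 0"
        unfolding eventually_sequentially by (auto simp: indicator_def)
      then show "(\<lambda>k. u x * indicator (S k) x) \<longlonglongrightarrow> 0" by (rule tendsto_eventually)
    qed
  qed (use u in auto)
  then have "(\<lambda>k. \<integral>\<^sup>+x. u x * indicator (S k) x \<partial>M) \<longlonglongrightarrow> 0" by simp
  then have "\<forall>\<^sub>F k in sequentially. (\<integral>\<^sup>+x. u x * indicator (S k) x \<partial>M) < e"
    by (rule order_tendstoD) (rule e)
  then obtain k where "(\<integral>\<^sup>+x. u x * indicator (S k) x \<partial>M) < e"
    unfolding eventually_sequentially by blast
  then show ?thesis by (rule that)
qed

lemma cutoff_error:
  fixes f :: "(real^'n => complex) => complex"
  assumes f: "f \<in> distributions" and \<chi>c: "1 \<le> Cs" "\<And>x. jet_le N 1 Cs c x" "smooth c"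
    and one: "\<And>x. norm x \<le> r ==> c x = 1"
  shows "grand_maximal N (\<lambda>\<phi>. if \<phi> \<in> test_functions then f \<phi> - f (\<lambda>y. c y * \<phi> y) else 0) x \<le>
    ennreal (2 ^ N * (1 + Cs)) * (grand_maximal N f x * indicator {x. r - support_radius TYPE('n) \<le> norm x} x)"
  unfolding grand_maximal_def[of N "\<lambda>\<phi>. if \<phi> \<in> test_functions then f \<phi> - f (\<lambda>y. c y * \<phi> y) else 0"]
proof (intro SUP_least)
  fix t :: real and \<psi> :: "real^'n => complex" assume t: "t \<in> {0<..<1}" and \<psi>: "\<psi> \<in> grand_test_functions N"
  then have t0: "0 < t" "t < 1" by auto
  let ?R = "support_radius TYPE('n)"
  define h where "h y = dilate t \<psi> (x - y)" for y
  have h: "h \<in> test_functions" "supp h \<subseteq> ball x (?R * t)" and hj: "\<And>y. jet_le N t (1 / t ^ CARD('n)) h y"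
    unfolding h_def by (rule grand_test_kernel[OF \<psi> t0(1)])+
  have s1: "smooth (\<lambda>y. 1 - c y)" by (intro smooth_diff smooth_const \<chi>c(3))
  define H where "H y = (1 - c y) * h y" for y
  have H: "H \<in> test_functions" unfolding H_def by (intro test_mult s1 h(1))
  have "f h = f (\<lambda>y. c y * h y + H y)" by (simp add: H_def algebra_simps)
  also have "... = f (\<lambda>y. c y * h y) + f H" by (intro distribution_add f test_mult \<chi>c(3) h(1) H)
  finally have split: "f h = f (\<lambda>y. c y * h y) + f H" .
  have conv: "convolve (dilate t \<psi>) F x = F h" for F unfolding convolve_def h_def[abs_def] by (rule refl)
  have eq: "convolve (dilate t \<psi>) (\<lambda>\<phi>. if \<phi> \<in> test_functions then f \<phi> - f (\<lambda>y. c y * \<phi> y) else 0) x = f H"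
    unfolding conv using h(1) split by simp
  show "ennreal (norm (convolve (dilate t \<psi>) (\<lambda>\<phi>. if \<phi> \<in> test_functions then f \<phi> - f (\<lambda>y. c y * \<phi> y) else 0) x)) \<le>
      ennreal (2 ^ N * (1 + Cs)) * (grand_maximal N f x * indicator {x. r - ?R \<le> norm x} x)"
  proof (cases "r - ?R \<le> norm x")
    case True
    have "ennreal (norm (f H)) \<le> ennreal (t ^ CARD('n) * (2 ^ N * (1 + Cs) * (1 / t ^ CARD('n)))) * grand_maximal N f x"
    proof (rule grand_maximal_bound[OF f H _ t0])
      show "supp H \<subseteq> ball x (?R * t)" by (rule order_trans[OF supp_mono h(2)]) (simp add: H_def)
      fix y
      have "jet_le N t Cs c y" by (rule jet_le_mono[OF \<chi>c(2)]) (use t0 in auto)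
      then show "jet_le N t (2 ^ N * (1 + Cs) * (1 / t ^ CARD('n))) H y" unfolding H_def using t0
        by (intro jet_le_mult s1 test_smooth[OF h(1)] hj jet_le_diff smooth_const \<chi>c(3) jet_le_one) auto
    qed
    also have "t ^ CARD('n) * (2 ^ N * (1 + Cs) * (1 / t ^ CARD('n))) = 2 ^ N * (1 + Cs)" using t0 by simp
    finally show ?thesis unfolding eq using True by simp
  next
    case False
    have "H y = 0" for y
    proof (cases "h y = 0")
      case nz: False
      have "y \<in> ball x (?R * t)" by (rule subsetD[OF h(2) supp_memI[of h, OF nz]])
      then have "norm (y - x) < ?R * t" by (simp add: dist_norm norm_minus_commute)
      also have "... \<le> ?R * 1" using t0 by (intro mult_left_mono) auto
      finally have "norm (y - x) < ?R" by (simp only: mult_1_right)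
      moreover have "norm y \<le> norm x + norm (y - x)" using norm_triangle_ineq[of x "y - x"] by simp
      ultimately have "norm y \<le> r" using False by linarith
      then show ?thesis using one by (simp add: H_def)
    qed (simp add: H_def)
    then have "H = (\<lambda>y. 0)" by (rule ext)
    then have "f H = 0" using distribution_zero[OF f] by simp
    then show ?thesis unfolding eq by simp
  qed
qed

section \<open>Density\<close>

text \<open>The floor in the definition of the order gives \<open>n q\<^sub>\<omega> < (n + N) p\<^sub>\<Phi>\<close>; this strict inequality
survives a small change of both indices to exponents that are attained.\<close>

lemma exponents_gap:
  fixes \<omega> :: "real^'n => real"
  assumes A: "assumption_A \<Phi>" and \<omega>: "\<omega> \<in> Ainfty_loc" and N: "N_tilde \<Phi> \<omega> \<le> int N"
  obtains p\<^sub>1 p where "1 \<le> p\<^sub>1" "\<omega> \<in> Ap_loc p\<^sub>1" "p \<in> lower_type_exponents \<Phi>"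
    "real CARD('n) * p\<^sub>1 < real (CARD('n) + N) * p" "1 \<le> N" "1 \<le> critical_index \<omega>"
proof -
  let ?n = "real CARD('n)"
  let ?Q = "{p. 1 \<le> p \<and> \<omega> \<in> Ap_loc p}"
  obtain p\<^sub>2 where "1 < p\<^sub>2" "\<omega> \<in> Ap_loc p\<^sub>2" using Ainfty_in_some_Ap[OF \<omega>] by (elim exE conjE)
  then have "p\<^sub>2 \<in> ?Q" by simp
  then have ne: "?Q \<noteq> {}" by blast
  have q1: "1 \<le> critical_index \<omega>" unfolding critical_index_def by (rule cInf_greatest[OF ne]) simp
  define s where "s = lower_type_index \<Phi>"
  have s: "0 < s" "s \<le> 1" using A by (auto simp: assumption_A_def s_def)
  have n: "1 \<le> ?n" by (simp add: Suc_le_eq)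
  have nN: "0 < ?n + real N" using n by (intro add_pos_nonneg) auto
  define X where "X = ?n * (critical_index \<omega> / s - 1)"
  have X0: "0 \<le> X"
  proof -
    have "1 \<le> critical_index \<omega> / s" using s q1 by (simp add: field_simps)
    then show ?thesis unfolding X_def by simp
  qed
  have "\<lfloor>X\<rfloor> + 2 \<le> int N" using N by (simp add: N_tilde_def X_def s_def)
  then have "X < real N" and "1 \<le> N" using X0 by linarith+
  then have "?n * (critical_index \<omega> / s) < ?n + real N" by (simp add: X_def algebra_simps)
  then have "?n * critical_index \<omega> < (?n + real N) * s" using s by (simp add: field_simps)
  then have "?n * critical_index \<omega> / (?n + real N) < s" by (simp only: pos_divide_less_eq[OF nN] mult.commute)
  moreover have "lower_type_exponents \<Phi> \<noteq> {}" using A by (simp add: assumption_A_def)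
  ultimately obtain p where p: "p \<in> lower_type_exponents \<Phi>" "?n * critical_index \<omega> / (?n + real N) < p"
    unfolding s_def lower_type_index_def using less_cSupE by metis
  have "?n * critical_index \<omega> < p * (?n + real N)" using p(2) by (simp only: pos_divide_less_eq[OF nN])
  then have "critical_index \<omega> < p * (?n + real N) / ?n" using n by (simp add: pos_less_divide_eq mult.commute)
  then have "\<exists>p\<^sub>1\<in>?Q. p\<^sub>1 < p * (?n + real N) / ?n"
    unfolding critical_index_def by (rule cInf_lessD[OF ne])
  then obtain p\<^sub>1 where p1: "p\<^sub>1 \<in> ?Q" "p\<^sub>1 < p * (?n + real N) / ?n" by (elim bexE)
  have "?n * p\<^sub>1 < real (CARD('n) + N) * p" using p1(2) n by (simp add: pos_less_divide_eq mult.commute)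
  then show ?thesis using that p1(1) p(1) \<open>1 \<le> N\<close> q1 by blast
qed

lemma approximate_in_hardy:
  fixes \<omega> :: "real^'n => real"
  assumes A: "assumption_A \<Phi>" and w: "\<omega> \<in> weights" and pos: "\<And>x l. 0 < l ==> 0 < measure (wmeas \<omega>) (cube x l)"
    and pb: "part_bound \<omega> p\<^sub>1 C\<^sub>1" and p1: "0 \<le> p\<^sub>1" and p: "p \<in> lower_type_exponents \<Phi>"
    and gap: "real CARD('n) * p\<^sub>1 < real (CARD('n) + N) * p" and N: "1 \<le> N"
    and f: "f \<in> hardy \<Phi> \<omega> N" and e: "0 < e" and q: "0 < q"
  shows "\<exists>g\<in>hardy \<Phi> \<omega> N \<inter> Lq_distributions q \<omega>. hardy_norm \<Phi> \<omega> N (\<lambda>\<phi>. f \<phi> - g \<phi>) < ennreal e"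
proof -
  let ?E = "extend_Phi \<Phi>" and ?G = "grand_maximal N f" and ?R = "support_radius TYPE('n)" and ?n = "real CARD('n)"
  have fd: "f \<in> distributions" and Gm: "?G \<in> borel_measurable lebesgue" and Gf: "modular \<Phi> \<omega> ?G < top"
    using f by (auto simp: hardy_def LPhi_def)
  obtain Cs where Cs: "1 \<le> Cs"
    "\<And>a (S :: (real^'n) set) x. 0 < a ==> S \<in> lmeasurable ==> jet_le N a Cs (sm a S) x"
    "\<And>a (S :: (real^'n) set) x. 0 < a ==> S \<in> lmeasurable ==> cball x a \<inter> S = {} ==> jet_le N a 0 (sm a S) x"
    by (rule sm_jet[where 'n = 'n and N = N]) blast
  obtain Ct where Ct: "1 \<le> Ct"
    "\<And>l h (x :: real^'n). 0 < l ==> h \<in> test_functions ==> jet_le N l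
      (Ct / l ^ CARD('n) * (LINT y|lebesgue. indicator (cball x l) y * norm (h y)))
      (\<lambda>x. h x - (resid (l / real (N + 1)) ^^ N) h x) x"
    by (rule smoothing_jet[where 'n = 'n and N = N]) blast
  define \<delta> where "\<delta> = 1 / (2 / e + 1) / 2"
  have \<delta>: "0 < \<delta>" unfolding \<delta>_def using e by (simp add: add_pos_pos)

  have EGm: "(\<lambda>x. ?E (?G x)) \<in> borel_measurable lebesgue" by (rule measurable_compose[OF Gm extend_measurable[OF A]])
  have EGf: "(\<integral>\<^sup>+x. ?E (?G x) \<partial>wmeas \<omega>) < top" using Gf unfolding wmeas_integral[OF w EGm] modular_def .
  define c\<^sub>1 where "c\<^sub>1 = 2 ^ N * (1 + Cs) + 1"
  have c1: "0 < c\<^sub>1" using Cs(1) by (simp add: c\<^sub>1_def add_pos_pos)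

  \<comment> \<open>A cut-off far out costs little, since it is felt only where the maximal function has little mass.\<close>
  define A\<^sub>k where "A\<^sub>k k = {x :: real^'n. real k - ?R \<le> norm x}" for k :: nat
  have Ak: "A\<^sub>k k \<in> sets lebesgue" for k
  proof -
    have "closed (A\<^sub>k k)" unfolding A\<^sub>k_def by (intro closed_Collect_le continuous_intros)
    then show ?thesis by (intro sets_completionI_sets) (simp add: borel_closed)
  qed
  have vanA: "AE x in wmeas \<omega>. \<exists>k\<^sub>0. \<forall>k\<ge>k\<^sub>0. x \<notin> A\<^sub>k k"
  proof (rule AE_I2)
    fix x :: "real^'n"
    obtain k\<^sub>0 :: nat where "norm x + ?R < real k\<^sub>0" using reals_Archimedean2 by blast
    then have "\<forall>k\<ge>k\<^sub>0. x \<notin> A\<^sub>k k" by (auto simp: A\<^sub>k_def)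
    then show "\<exists>k\<^sub>0. \<forall>k\<ge>k\<^sub>0. x \<notin> A\<^sub>k k" by blast
  qed
  obtain k where k: "(\<integral>\<^sup>+x. ?E (?G x) * indicator (A\<^sub>k k) x \<partial>wmeas \<omega>) < ennreal (\<delta> / c\<^sub>1)"
    by (rule vanishing_tail[of "\<lambda>x. ?E (?G x)" "wmeas \<omega>" A\<^sub>k "ennreal (\<delta> / c\<^sub>1)"])
       (use EGm EGf vanA Ak \<delta> c1 in \<open>simp_all add: wmeas_measurable\<close>)
  define c where "c = sm 1 (ball (0 :: real^'n) (real k + 2))"
  define \<rho> where "\<rho> = real k + 3"
  have bm: "ball (0 :: real^'n) (real k + 2) \<in> lmeasurable" by (rule lmeasurable_ball)
  have cs: "smooth c" unfolding c_def by (rule smooth_sm[OF _ bm]) simp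
  have cj: "jet_le N 1 Cs c x" for x unfolding c_def by (rule Cs(2)[OF _ bm]) simp
  have c_one: "c x = 1" if "norm x \<le> real k" for x unfolding c_def
  proof (rule sm_one[OF _ bm])
    show "cball x 1 \<subseteq> ball 0 (real k + 2)"
    proof
      fix y assume "y \<in> cball x 1"
      then show "y \<in> ball 0 (real k + 2)"
        using that norm_triangle_ineq[of x "y - x"] by (simp add: dist_norm norm_minus_commute)
    qed
  qed simp
  have c_zero: "c x = 0" if "x \<notin> ball 0 \<rho>" for x unfolding c_def
  proof (rule sm_zero[OF _ bm])
    show "cball x 1 \<inter> ball 0 (real k + 2) = {}"
    proof (rule ccontr)
      assume "\<not> ?thesis"
      then obtain y where "y \<in> cball x 1" "y \<in> ball 0 (real k + 2)" by blast
      then show False using that norm_triangle_ineq[of y "x - y"] by (simp add: dist_norm \<rho>_def)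
    qed
  qed simp
  define f\<^sub>1 where "f\<^sub>1 h = f (\<lambda>x. c x * h x)" for h
  define \<Gamma> where "\<Gamma> x = ennreal (2 ^ N * Cs) * ?G x" for x
  have \<Gamma>m: "\<Gamma> \<in> borel_measurable lebesgue"
    unfolding \<Gamma>_def[abs_def] by (intro borel_measurable_times_ennreal borel_measurable_const Gm)
  have E\<Gamma>m: "(\<lambda>x. ?E (\<Gamma> x)) \<in> borel_measurable lebesgue" by (rule measurable_compose[OF \<Gamma>m extend_measurable[OF A]])
  have E\<Gamma>f: "(\<integral>\<^sup>+x. ?E (\<Gamma> x) \<partial>wmeas \<omega>) < top"
  proof -
    have "(\<integral>\<^sup>+x. ?E (\<Gamma> x) \<partial>wmeas \<omega>) \<le> (\<integral>\<^sup>+x. ennreal (2 ^ N * Cs + 1) * ?E (?G x) \<partial>wmeas \<omega>)"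
      unfolding \<Gamma>_def using Cs(1) by (intro nn_integral_mono extend_mult[OF A]) auto
    also have "... = ennreal (2 ^ N * Cs + 1) * (\<integral>\<^sup>+x. ?E (?G x) \<partial>wmeas \<omega>)"
      by (rule nn_integral_cmult) (simp add: wmeas_measurable EGm)
    also have "... < top" using EGf by (simp add: ennreal_mult_less_top)
    finally show ?thesis .
  qed

  obtain c\<^sub>0 where c0: "0 < c\<^sub>0" "\<And>x. x \<in> ball 0 \<rho> ==> c\<^sub>0 \<le> measure (wmeas \<omega>) (cube x (1 / (2 * ?n)))"
    by (rule cube_mass_lower_bound[OF w pos, of "ball 0 \<rho>" "1 / (2 * ?n)"]) auto
  obtain K where K: "0 < K" "\<And>y l \<kappa>. y \<in> cball (0 :: real^'n) (\<rho> + ?n + 1) ==> 0 < l ==> l \<le> 1 ==> 0 < \<kappa> ==>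
    (\<integral>\<^sup>+x. ?E (ennreal (\<kappa> * (if norm (x - y) \<le> ?R + ?n + 3 then (l / (l + norm (x - y))) ^ (CARD('n) + N) else 0))) \<partial>wmeas \<omega>)
      \<le> ennreal (K * \<Phi> \<kappa> * measure (wmeas \<omega>) (cube y l))"
    by (rule cell_tail[OF A w pos pb p1 p gap, of "cball 0 (\<rho> + ?n + 1)" "?R + ?n + 3"]) auto
  define C where "C = ennreal (2 ^ N * Cs + 1) +
    ennreal (whitney.tail_const TYPE('n) N Cs Ct + 1) * ennreal (K * whitney.overlap_const TYPE('n))"
  have C: "C \<noteq> top" "C \<noteq> 0"
  proof -
    show "C \<noteq> top" unfolding C_def by (simp add: ennreal_mult_eq_top_iff)
    have "0 < 2 ^ N * Cs + 1" using Cs(1) by (simp add: add_pos_pos)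
    then have "0 < ennreal (2 ^ N * Cs + 1)" by (simp only: ennreal_less_zero_iff)
    then have "ennreal (2 ^ N * Cs + 1) \<noteq> 0" by (rule less_imp_neq[symmetric])
    then show "C \<noteq> 0" unfolding C_def by (simp only: add_eq_0_iff_both_eq_0 simp_thms)
  qed
  define \<eta> where "\<eta> = min (ennreal \<delta> / C) (ennreal (\<Phi> 1 * c\<^sub>0))"
  have \<eta>: "0 < \<eta>"
  proof -
    have "0 < \<Phi> 1 * c\<^sub>0" using Phi_pos[OF A, of 1] c0(1) by simp
    then have "0 < ennreal (\<Phi> 1 * c\<^sub>0)" by (simp only: ennreal_less_zero_iff)
    moreover have "0 < ennreal \<delta> / C"
    proof (rule ccontr)
      assume "\<not> ?thesis"
      then have "ennreal \<delta> / C = 0" by simp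
      then have "C * (ennreal \<delta> / C) = 0" by simp
      then have "ennreal \<delta> = 0" using C(1,2) by (simp add: ennreal_times_divide mult.commute[of C] ennreal_mult_divide_eq)
      then show False using \<delta> by simp
    qed
    ultimately show ?thesis unfolding \<eta>_def by simp
  qed

  \<comment> \<open>The level is chosen so high that little of the modular lies above it; as a cube of fixed size
    has at least a fixed mass, the set below the level then comes close to every point.\<close>
  define S where "S j = {x. ennreal (real j + 1) < \<Gamma> x}" for j :: nat
  have Ssets: "S j \<in> sets lebesgue" for j unfolding S_def by (rule superlevel_sets[OF \<Gamma>m])
  have vanS: "AE x in wmeas \<omega>. \<exists>k\<^sub>0. \<forall>k\<ge>k\<^sub>0. x \<notin> S k"
  proof -
    have "AE x in wmeas \<omega>. ?E (\<Gamma> x) \<noteq> \<infinity>"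
      using E\<Gamma>m E\<Gamma>f by (intro nn_integral_PInf_AE) (auto simp: wmeas_measurable)
    then show ?thesis
    proof (rule AE_mp, intro AE_I2 impI)
      fix x assume "?E (\<Gamma> x) \<noteq> \<infinity>"
      then have "\<Gamma> x \<noteq> top" by (auto simp: extend_Phi_def)
      then obtain r where r: "\<Gamma> x = ennreal r" "0 \<le> r" by (cases "\<Gamma> x") auto
      obtain k\<^sub>0 :: nat where k0: "r < real k\<^sub>0" using reals_Archimedean2 by blast
      have "x \<notin> S k" if "k \<ge> k\<^sub>0" for k
      proof -
        have "ennreal r \<le> ennreal (real k + 1)" using k0 that by (intro ennreal_leI) simp
        then show ?thesis unfolding S_def using r by (simp add: not_less del: ennreal_plus)
      qed
      then show "\<exists>k\<^sub>0. \<forall>k\<ge>k\<^sub>0. x \<notin> S k" by blast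
    qed
  qed
  obtain j where j: "(\<integral>\<^sup>+x. ?E (\<Gamma> x) * indicator (S j) x \<partial>wmeas \<omega>) < \<eta>"
    by (rule vanishing_tail[of "\<lambda>x. ?E (\<Gamma> x)" "wmeas \<omega>" S \<eta>])
       (use E\<Gamma>m E\<Gamma>f vanS Ssets \<eta> in \<open>simp_all add: wmeas_measurable\<close>)
  define \<kappa> where "\<kappa> = real j + 1"
  have \<kappa>: "1 \<le> \<kappa>" by (simp add: \<kappa>_def)
  define F where "F = {x. \<Gamma> x \<le> ennreal \<kappa>}"
  have near: "\<exists>z\<in>F. dist x z < 1" if x: "x \<in> ball 0 \<rho>" for x
  proof (rule ccontr)
    assume none: "\<not> ?thesis"
    let ?q = "cube x (1 / (2 * ?n))"
    have qS: "?q \<subseteq> S j"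
    proof
      fix z assume z: "z \<in> ?q"
      have "norm (z - x) \<le> ?n * (1 / (2 * ?n))" by (rule cube_norm_le[OF z])
      then have "dist x z < 1" by (simp add: dist_norm norm_minus_commute)
      then have "z \<notin> F" using none by blast
      then show "z \<in> S j" by (simp add: F_def S_def \<kappa>_def not_le del: ennreal_plus)
    qed
    have "ennreal (\<Phi> 1 * c\<^sub>0) \<le> ennreal (\<Phi> 1) * emeasure (wmeas \<omega>) ?q"
      unfolding wmeas_measure[OF w cube_bounded] using c0(2)[OF x] Phi_pos[OF A, of 1]
      by (subst ennreal_mult[symmetric]) (auto intro!: ennreal_leI mult_left_mono)
    also have "... = (\<integral>\<^sup>+z. ennreal (\<Phi> 1) * indicator ?q z \<partial>wmeas \<omega>)"
      by (rule nn_integral_cmult_indicator[symmetric]) simp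
    also have "... \<le> (\<integral>\<^sup>+z. ?E (\<Gamma> z) * indicator (S j) z \<partial>wmeas \<omega>)"
    proof (rule nn_integral_mono)
      fix z
      show "ennreal (\<Phi> 1) * indicator ?q z \<le> ?E (\<Gamma> z) * indicator (S j) z"
      proof (cases "z \<in> ?q")
        case True
        then have zS: "z \<in> S j" using qS by blast
        have "ennreal 1 \<le> ennreal (real j + 1)" by (intro ennreal_leI) simp
        also have "... < \<Gamma> z" using zS by (simp only: S_def mem_Collect_eq)
        finally have "?E (ennreal 1) \<le> ?E (\<Gamma> z)" by (intro extend_mono[OF A] less_imp_le)
        then show ?thesis using True zS extend_real[OF A, of 1] by simp
      qed simp
    qed
    also have "... < \<eta>" by (rule j)
    also have "... \<le> ennreal (\<Phi> 1 * c\<^sub>0)" unfolding \<eta>_def by simp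
    finally show False by simp
  qed
  interpret W: whitney N f\<^sub>1 \<Gamma> \<rho> \<kappa> F Cs Ct
  proof
    show "1 \<le> N" by (rule N)
    show "0 < \<rho>" by (simp add: \<rho>_def)
    show "0 < \<kappa>" using \<kappa> by simp
    show "f\<^sub>1 (\<lambda>x. g x + h x) = f\<^sub>1 g + f\<^sub>1 h" if "g \<in> test_functions" "h \<in> test_functions" for g h
      unfolding f\<^sub>1_def distrib_left by (intro distribution_add[OF fd] test_mult cs that)
    show "f\<^sub>1 (\<lambda>x. b * h x) = b * f\<^sub>1 h" if "h \<in> test_functions" for h b
      unfolding f\<^sub>1_def mult.left_commute[of _ b] by (intro distribution_cmult[OF fd] test_mult cs that)
    show "ennreal (norm (f\<^sub>1 h)) \<le> ennreal (s ^ CARD('n) * M) * \<Gamma> z"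
      if h: "h \<in> test_functions" "supp h \<subseteq> ball z (?R * s)" and s: "0 < s" "s < 1" and hj: "\<And>x. jet_le N s M h x" for h z s M
    proof -
      have M0: "0 \<le> M" by (rule jet_le_nonneg[OF hj])
      have "ennreal (norm (f\<^sub>1 h)) \<le> ennreal (s ^ CARD('n) * (2 ^ N * Cs * M)) * ?G z"
        unfolding f\<^sub>1_def
      proof (rule grand_maximal_bound[OF fd test_mult[OF cs h(1)] _ s])
        show "supp (\<lambda>x. c x * h x) \<subseteq> ball z (?R * s)" by (rule order_trans[OF supp_mono h(2)]) simp
        fix x
        have "jet_le N s Cs c x" by (rule jet_le_mono[OF cj]) (use s in auto)
        then show "jet_le N s (2 ^ N * Cs * M) (\<lambda>x. c x * h x) x"
          using s by (intro jet_le_mult cs test_smooth[OF h(1)] hj) auto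
      qed
      also have "s ^ CARD('n) * (2 ^ N * Cs * M) = (s ^ CARD('n) * M) * (2 ^ N * Cs)" by simp
      also have "ennreal ((s ^ CARD('n) * M) * (2 ^ N * Cs)) = ennreal (s ^ CARD('n) * M) * ennreal (2 ^ N * Cs)"
        using s M0 Cs(1) by (intro ennreal_mult) auto
      finally show ?thesis unfolding \<Gamma>_def by (simp only: mult.assoc)
    qed
    show "f\<^sub>1 h = 0" if "h \<in> test_functions" "\<And>x. x \<in> ball 0 \<rho> ==> h x = 0" for h
    proof -
      have "c x * h x = 0" for x using that(2)[of x] c_zero[of x] by (cases "x \<in> ball 0 \<rho>") auto
      then have "(\<lambda>x. c x * h x) = (\<lambda>x. 0)" by (rule ext)
      then show ?thesis unfolding f\<^sub>1_def using distribution_zero[OF fd] by (simp only:)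
    qed
    show "F \<noteq> {}" using near[of 0] by (auto simp: \<rho>_def)
    show "\<Gamma> z \<le> ennreal \<kappa>" if "z \<in> F" for z using that by (simp add: F_def)
    show "infdist x F < 1" if x: "x \<in> ball 0 \<rho>" for x
    proof -
      obtain z where "z \<in> F" "dist x z < 1" using near[OF x] by blast
      then show ?thesis using infdist_le[of z F x] by simp
    qed
  qed (use Cs Ct in auto)

  have M0: "0 \<le> \<kappa> * W.good_const"
    unfolding W.good_const_def using \<kappa> W.piece_const_nonneg Ct(1) by (intro mult_nonneg_nonneg) auto
  obtain v where v: "v \<in> borel_measurable lebesgue" "\<And>x. norm (v x) \<le> \<kappa> * W.good_const"
    "\<And>x. x \<notin> cball 0 (\<rho> + 2 * ?n + 3) ==> v x = 0"
    "\<And>h. h \<in> test_functions ==> W.good h = (LINT x|lebesgue. v x * h x)"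
  proof (rule bounded_functional_representation[OF W.good_add W.good_cmult W.good_bound M0])
    fix v assume a: "v \<in> borel_measurable lebesgue" "\<And>x. norm (v x) \<le> \<kappa> * W.good_const"
      "\<And>x. x \<notin> cball 0 (\<rho> + 2 * ?n + 3) ==> v x = 0"
      "\<And>h. h \<in> test_functions ==> W.good h = (LINT x|lebesgue. v x * h x)"
    show thesis by (rule that[OF a])
  qed
  define g where "g = distribution_of v"
  have g: "g \<in> hardy \<Phi> \<omega> N \<inter> Lq_distributions q \<omega>"
    unfolding g_def by (rule bounded_in_hardy_Lq[OF v(1-3) A w q])
  define D where "D \<phi> = (if \<phi> \<in> test_functions then f \<phi> - f (\<lambda>x. c x * \<phi> x) else 0)" for \<phi>
  define B where "B \<phi> = (if \<phi> \<in> test_functions then f\<^sub>1 \<phi> - W.good \<phi> else 0)" for \<phi>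
  have fg: "(\<lambda>\<phi>. f \<phi> - g \<phi>) = (\<lambda>\<phi>. D \<phi> + B \<phi>)"
  proof
    fix \<phi> :: "real^'n => complex"
    show "f \<phi> - g \<phi> = D \<phi> + B \<phi>"
    proof (cases "\<phi> \<in> test_functions")
      case True
      then show ?thesis by (simp add: D_def B_def f\<^sub>1_def g_def distribution_of_def v(4))
    next
      case False
      then have "f \<phi> = 0" using fd by (simp add: distributions_def)
      then show ?thesis using False by (simp add: D_def B_def g_def distribution_of_def)
    qed
  qed
  define u where "u x = ennreal c\<^sub>1 * (?E (?G x) * indicator (A\<^sub>k k) x) + W.bad_bound \<Phi> x" for x
  have m1: "(\<lambda>x. ?E (?G x) * indicator (A\<^sub>k k) x) \<in> borel_measurable lebesgue"
    by (intro borel_measurable_times_ennreal EGm borel_measurable_indicator Ak)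
  have m2: "W.bad_bound \<Phi> \<in> borel_measurable lebesgue" by (rule W.bad_bound_measurable[OF A \<Gamma>m])
  have m3: "(\<lambda>x. ennreal c\<^sub>1 * (?E (?G x) * indicator (A\<^sub>k k) x)) \<in> borel_measurable lebesgue"
    by (intro borel_measurable_times_ennreal borel_measurable_const m1)
  have um: "u \<in> borel_measurable lebesgue" unfolding u_def[abs_def] by (intro borel_measurable_add m3 m2)
  have le: "?E (grand_maximal N (\<lambda>\<phi>. f \<phi> - g \<phi>) x) \<le> u x" for x
  proof -
    have "grand_maximal N D x \<le> ennreal (2 ^ N * (1 + Cs)) * (?G x * indicator (A\<^sub>k k) x)"
      unfolding D_def[abs_def] A\<^sub>k_def by (rule cutoff_error[OF fd Cs(1) cj cs c_one])
    then have "?E (grand_maximal N D x) \<le> ?E (ennreal (2 ^ N * (1 + Cs)) * (?G x * indicator (A\<^sub>k k) x))"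
      by (rule extend_mono[OF A])
    also have "... \<le> ennreal c\<^sub>1 * ?E (?G x * indicator (A\<^sub>k k) x)"
      unfolding c\<^sub>1_def using Cs(1) by (intro extend_mult[OF A]) auto
    also have "?E (?G x * indicator (A\<^sub>k k) x) = ?E (?G x) * indicator (A\<^sub>k k) x"
      by (cases "x \<in> A\<^sub>k k") (simp_all add: extend_zero[OF A])
    finally have d: "?E (grand_maximal N D x) \<le> ennreal c\<^sub>1 * (?E (?G x) * indicator (A\<^sub>k k) x)" .
    have b: "?E (grand_maximal N B x) \<le> W.bad_bound \<Phi> x"
      unfolding B_def[abs_def] by (rule W.extend_bad[OF A F_def])
    have "?E (grand_maximal N (\<lambda>\<phi>. f \<phi> - g \<phi>) x) \<le> ?E (grand_maximal N D x + grand_maximal N B x)"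
      unfolding fg by (intro extend_mono[OF A] grand_maximal_add)
    also have "... \<le> ?E (grand_maximal N D x) + ?E (grand_maximal N B x)" by (rule extend_add[OF A])
    also have "... \<le> u x" unfolding u_def by (rule add_mono[OF d b])
    finally show ?thesis .
  qed
  have cell: "(\<integral>\<^sup>+x. ?E (ennreal (\<kappa> * W.tail_kernel k i x)) \<partial>wmeas \<omega>)
      \<le> ennreal (K * \<Phi> \<kappa> * measure (wmeas \<omega>) (cube (lattice_point (W.scale k) i) (W.scale k)))"
    if i: "i \<in> W.active (W.ring_layer k) (W.scale k)" for k i unfolding W.tail_kernel_def
  proof (rule K(2))
    obtain y where y: "y \<in> ball 0 \<rho>" "norm (y - lattice_point (W.scale k) i) \<le> (?n + 1) * W.scale k"
      by (rule W.active_near[OF i W.scale(1)]) blast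
    have s: "(?n + 1) * W.scale k \<le> (?n + 1) * 1" using W.scale[of k] by (intro mult_left_mono) auto
    have "norm y \<le> \<rho>" using y(1) by simp
    then have "norm y + norm (y - lattice_point (W.scale k) i) \<le> \<rho> + (?n + 1) * 1"
      by (rule add_mono[OF _ order_trans[OF y(2) s]])
    then show "lattice_point (W.scale k) i \<in> cball 0 (\<rho> + ?n + 1)"
      using norm_triangle_ineq[of y "lattice_point (W.scale k) i - y"] by (simp add: norm_minus_commute)
  qed (use W.scale[of k] \<kappa> in auto)
  have bad: "(\<integral>\<^sup>+x. W.bad_bound \<Phi> x \<partial>wmeas \<omega>) \<le> ennreal \<delta>"
  proof -
    have "(\<integral>\<^sup>+x. W.bad_bound \<Phi> x \<partial>wmeas \<omega>) \<le>
        C * (\<integral>\<^sup>+x. ?E (\<Gamma> x) * indicator {x. ennreal \<kappa> < \<Gamma> x} x \<partial>wmeas \<omega>)"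
      unfolding C_def by (rule W.bad_bound_integral[OF A w less_imp_le[OF K(1)] \<Gamma>m F_def cell])
    also have "... \<le> C * (ennreal \<delta> / C)"
      using less_imp_le[OF j] unfolding S_def \<kappa>_def[symmetric] \<eta>_def by (intro mult_left_mono) auto
    also have "... = ennreal \<delta>" using C by (simp add: ennreal_times_divide mult.commute[of C] ennreal_mult_divide_eq)
    finally show ?thesis .
  qed
  have "(\<integral>\<^sup>+x. u x \<partial>wmeas \<omega>) = ennreal c\<^sub>1 * (\<integral>\<^sup>+x. ?E (?G x) * indicator (A\<^sub>k k) x \<partial>wmeas \<omega>) + (\<integral>\<^sup>+x. W.bad_bound \<Phi> x \<partial>wmeas \<omega>)"
    unfolding u_def using m1 m2 m3 by (simp add: nn_integral_add nn_integral_cmult wmeas_measurable)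
  also have "... \<le> ennreal c\<^sub>1 * ennreal (\<delta> / c\<^sub>1) + ennreal \<delta>"
    by (intro add_mono mult_left_mono less_imp_le[OF k] bad) auto
  also have "... = ennreal (c\<^sub>1 * (\<delta> / c\<^sub>1) + \<delta>)" using c1 \<delta> by (simp flip: ennreal_mult ennreal_plus)
  also have "c\<^sub>1 * (\<delta> / c\<^sub>1) + \<delta> = \<delta> + \<delta>" using c1 by simp
  also have "... = 1 / (2 / e + 1)" unfolding \<delta>_def by (rule field_sum_of_halves)
  finally have small: "(\<integral>\<^sup>+x. u x \<partial>wmeas \<omega>) \<le> ennreal (1 / (2 / e + 1))" .
  show ?thesis unfolding hardy_norm_def by (intro bexI[OF _ g] LPhi_norm_less[OF A w e um le small])
qed

theorem corollary4p8:
  fixes \<Phi> :: "real \<Rightarrow> real"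
    and \<omega> :: "real^'n \<Rightarrow> real"
    and \<psi>\<^sub>0 :: "real^'n \<Rightarrow> complex"
    and A\<^sub>0 q :: real
    and N :: nat
  assumes "assumption_A \<Phi>"
    and "\<omega> \<in> Ainfty_loc"
    and "critical_index \<omega> < q"
    and "\<psi>\<^sub>0 \<in> test_functions" and "(LINT x|lebesgue. \<psi>\<^sub>0 x) \<noteq> 0"
    and "admissible_A0 (supp \<psi>\<^sub>0) A\<^sub>0"
    and "N_crit \<Phi> \<omega> A\<^sub>0 \<le> int N"
  shows "dense_in_hardy \<Phi> \<omega> N (hardy \<Phi> \<omega> N \<inter> Lq_distributions q \<omega>)"
proof -
  note A = assms(1)
  have w: "\<omega> \<in> weights" using assms(2) by (simp add: Ainfty_loc_def)
  have "N_tilde \<Phi> \<omega> \<le> int N" using assms(7) by (simp add: N_crit_def)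
  then obtain p\<^sub>1 p where p1: "1 \<le> p\<^sub>1" "\<omega> \<in> Ap_loc p\<^sub>1" and p: "p \<in> lower_type_exponents \<Phi>"
    and gap: "real CARD('n) * p\<^sub>1 < real (CARD('n) + N) * p" and N: "1 \<le> N" and q1: "1 \<le> critical_index \<omega>"
    by (rule exponents_gap[OF A assms(2)]) blast
  have q: "0 < q" using q1 assms(3) by simp
  obtain C where pb: "part_bound \<omega> p\<^sub>1 C" using Ap_loc_part_bound[OF p1(2)] by (elim exE)
  have zero: "measure (wmeas \<omega>) (cube y l) \<le> 0"
    if "0 < k" "0 < l" "l \<le> 1" "cube x k \<subseteq> cube y l" "measure (wmeas \<omega>) (cube x k) = 0" for x k y l
    using part_bound_cubes[OF w pb that(1-4)] that(5) by simp
  show ?thesis unfolding dense_in_hardy_def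
  proof (intro conjI ballI allI impI Int_lower1)
    fix f and e :: real assume f: "f \<in> hardy \<Phi> \<omega> N" and e: "0 < e"
    show "\<exists>g\<in>hardy \<Phi> \<omega> N \<inter> Lq_distributions q \<omega>. hardy_norm \<Phi> \<omega> N (\<lambda>\<phi>. f \<phi> - g \<phi>) < ennreal e"
    proof (cases "AE x in lebesgue. \<omega> x = 0")
      case True
      let ?g = "distribution_of (\<lambda>x :: real^'n. 0)"
      have g: "?g \<in> hardy \<Phi> \<omega> N \<inter> Lq_distributions q \<omega>"
        by (rule bounded_in_hardy_Lq[of _ 0 0, OF _ _ _ A w q]) auto
      have fg: "(\<lambda>\<phi>. f \<phi> - ?g \<phi>) = f" by (simp add: distribution_of_def fun_eq_iff)
      have Gm: "grand_maximal N f \<in> borel_measurable lebesgue" using f by (simp add: hardy_def LPhi_def)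
      have um: "(\<lambda>x. extend_Phi \<Phi> (grand_maximal N f x)) \<in> borel_measurable lebesgue"
        by (rule measurable_compose[OF Gm extend_measurable[OF A]])
      have "(\<integral>\<^sup>+x. extend_Phi \<Phi> (grand_maximal N f x) * ennreal (\<omega> x) \<partial>lebesgue) = (\<integral>\<^sup>+x. 0 \<partial>(lebesgue :: (real^'n) measure))"
        using True by (intro nn_integral_cong_AE) auto
      then have "(\<integral>\<^sup>+x. extend_Phi \<Phi> (grand_maximal N f x) \<partial>wmeas \<omega>) \<le> ennreal (1 / (2 / e + 1))"
        by (simp add: wmeas_integral[OF w um])
      then show ?thesis
        unfolding hardy_norm_def by (intro bexI[OF _ g]) (simp only: fg LPhi_norm_less[OF A w e um order_refl])
    next
      case False
      have "(AE x in lebesgue. \<omega> x = 0) \<or> (\<forall>x l. 0 < l \<longrightarrow> 0 < measure (wmeas \<omega>) (cube x l))"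
        by (rule weight_zero_or_positive[OF w]) (rule zero)
      then have pos: "0 < measure (wmeas \<omega>) (cube x l)" if "0 < l" for x l using False that by simp
      show ?thesis by (rule approximate_in_hardy[OF A w pos pb _ p gap N f e q]) (use p1 in simp_all)
    qed
  qed
qed

end
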